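(* Let $(Y,\lambda)$ be a closed contact $3$-manifold with an anticontact involution $N$, and let $\beta$ be a nondegenerate brake orbit of period $\tau$. Then $\beta$ belongs to exactly one of the following five cases, and in each case the stated formulae hold for all integers $k\ge 1$. (1) $\beta$ is elliptic: $\Psi_\beta(\tau)$ is conjugate to a rotation $R(2\pi\theta)=\begin{pmatrix}\cos 2\pi\theta&-\sin 2\pi\theta\\ \sin 2\pi\theta&\cos 2\pi\theta\end{pmatrix}$, where $\theta\in\mathbf R\setminus\mathbf Q$ is a rotation number of $\beta$ (as a real number it depends on the trivialization), and $$\mu_1(\beta^k)=[k\theta]+\tfrac12,\qquad \mu_{CZ}(\beta^k)=2[k\theta]+1 .$$ (2) $\beta$ is negative hyperbolic of type one: $\mu_1(\beta^2)-\mu_2(\beta^2)=1$, $\mu_{CZ}(\beta)=2\mu_1(\beta)$, and $$\mu_1(\beta^k)=\begin{cases}k\mu_1(\beta),&k\text{ odd}\\ k\mu_1(\beta)+\frac12,&k\text{ even}\end{cases},\qquad \mu_{CZ}(\beta^k)=k\mu_{CZ}(\beta)=2k\mu_1(\beta).$$ (3) $\beta$ is negative hyperbolic of type two: $\mu_1(\beta^2)-\mu_2(\beta^2)=-1$, $\mu_{CZ}(\beta)=2\mu_1(\beta)$, and $$\mu_1(\beta^k)=\begin{cases}k\mu_1(\beta),&k\text{ odd}\\ k\mu_1(\beta)-\frac12,&k\text{ even}\end{cases},\qquad \mu_{CZ}(\beta^k)=k\mu_{CZ}(\beta)=2k\mu_1(\beta).$$ (4) $\beta$ is positive hyperbolic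 of type one: $\mu_1(\beta^2)-\mu_2(\beta^2)=1$, $\mu_{CZ}(\beta)=2\mu_1(\beta)-1$, and $$\mu_1(\beta^k)=k\mu_1(\beta)+\tfrac{1-k}{2},\qquad \mu_{CZ}(\beta^k)=k\mu_{CZ}(\beta)=2k\mu_1(\beta)-k.$$ (5) $\beta$ is positive hyperbolic of type two: $\mu_1(\beta^2)-\mu_2(\beta^2)=-1$, $\mu_{CZ}(\beta)=2\mu_1(\beta)+1$, and $$\mu_1(\beta^k)=k\mu_1(\beta)+\tfrac{k-1}{2},\qquad \mu_{CZ}(\beta^k)=k\mu_{CZ}(\beta)=2k\mu_1(\beta)+k.$$
   Context: $(Y,\lambda)$ is a closed contact $3$-manifold, $\xi=\ker\lambda$, $R$ the Reeb vector field. An anticontact involution is a diffeomorphism $N:Y\to Y$ with $N^2=\mathrm{Id}$, $N^*\lambda=-\lambda$. $J$ is a $d\lambda$-compatible almost complex structure on $\xi$ with $J\circ dN=-dN\circ J$. A brake orbit of period $\tau$ is a map $\beta:\mathbf R\to Y$ with $\beta'(t)=R(\beta(t))$, $\beta(t+\tau)=\beta(t)$, $\beta(-t)=N\beta(t)$. Its $k$-th iterate $\beta^k$ is the same map regarded as a brake orbit of period $k\tau$. Along $\beta$ we use a $\tau$-periodic trivialization of $\xi$ in which $J$ is the matrix $J_0=\begin{pmatrix}0&-1\\1&0\end{pmatrix}$ and $dN:\xi_{\beta(t)}\to\xi_{\beta(-t)}$ is the matrix $N_0=\begin{pmatrix}-1&0\\0&1\end{pmatrix}$; iterates use the induced trivialization.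 The linearized Reeb flow on $\xi$ then becomes a path $\Psi_\beta(t)\in \mathrm{Sp}(2)$ with $\Psi_\beta(0)=I$. A periodic orbit of period $\tau$ is nondegenerate if its linearized return map $\Psi(\tau)$ does not have eigenvalue $1$; standing assumption: all periodic Reeb orbits, including all iterates, are nondegenerate. Let $L_0=\{0\}\times\mathbf R$, $L_1=\mathbf R\times\{0\}$, let $W\subset\mathbf R^4$ be the diagonal and $Gr(M)=\{(x,Mx)\}$. With $\mu^{RS}$ the Robbin–Salamon index of a pair of Lagrangian paths, $\mu_{CZ}(\beta^k)=\mu^{RS}(W,Gr(\Psi_\beta([0,k\tau])))$, $\mu_1(\beta^k)=\mu^{RS}(L_0,\Psi_\beta([0,\tfrac{k\tau}2])L_0)$, $\mu_2(\beta^k)=\mu^{RS}(L_1,\Psi_\beta([0,\tfrac{k\tau}2])L_1)$, with signs normalized so that counterclockwise rotation counts positively (e.g. the path $R(2\pi\theta t)$, $t\in[0,1]$, $0<\theta<1$, has $\mu_{CZ}=1$). $[x]$ denotes the integer part (floor). $\beta$ is elliptic if the eigenvalues of $\Psi_\beta(\tau)$ lie on the unit circle, and positive (negative) hyperbolic if they are positive (negative) real numbers. A hyperbolic brake orbit is of type one if $\mu_1(\beta^2)-\mu_2(\beta^2)>0$ and of type two if $\mu_1(\beta^2)-\mu_2(\beta^2)<0$. *)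

theory Defs
  imports "HOL-Analysis.Analysis"
begin

section \<open>Smooth maps between open subsets of normed spaces\<close>

text \<open>The set \<open>U\<close> is meant to be open. In finite dimensions the recursion over directional
  derivatives gives the usual notion of class \<open>C^n\<close>.\<close>

primrec Ck_on :: "nat \<Rightarrow> 'a::real_normed_vector set \<Rightarrow> ('a \<Rightarrow> 'b::real_normed_vector) \<Rightarrow> bool" where
  "Ck_on 0 U f = continuous_on U f"
| "Ck_on (Suc n) U f =
     ((\<forall>x\<in>U. f differentiable (at x)) \<and> (\<forall>v. Ck_on n U (\<lambda>x. frechet_derivative f (at x) v)))"

definition smooth_on :: "'a::real_normed_vector set \<Rightarrow> ('a \<Rightarrow> 'b::real_normed_vector) \<Rightarrow> bool" where
  "smooth_on U f \<longleftrightarrow> (\<forall>n. Ck_on n U f)"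

section \<open>Closed 3-manifolds\<close>

text \<open>The manifold is the whole type \<open>'y\<close>; a chart is a domain together with a coordinate map, whose
  values outside the domain are irrelevant.\<close>

type_synonym 'y chart = "'y set \<times> ('y \<Rightarrow> real^3)"

definition chart_dom :: "'y chart \<Rightarrow> 'y set" where "chart_dom c = fst c"

definition chart_map :: "'y chart \<Rightarrow> 'y \<Rightarrow> real^3" where "chart_map c = snd c"

definition chart_inv :: "'y chart \<Rightarrow> real^3 \<Rightarrow> 'y" where
  "chart_inv c = inv_into (chart_dom c) (chart_map c)"

definition chart_img :: "'y chart \<Rightarrow> (real^3) set" where
  "chart_img c = chart_map c ` chart_dom c"

definition smooth_atlas :: "'y::topological_space chart set \<Rightarrow> bool" where
  "smooth_atlas A \<longleftrightarrow>
     (\<forall>c\<in>A. open (chart_dom c) \<and> open (chart_img c) \<and>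
            homeomorphism (chart_dom c) (chart_img c) (chart_map c) (chart_inv c)) \<and>
     (\<Union>c\<in>A. chart_dom c) = UNIV \<and>
     (\<forall>c\<in>A. \<forall>d\<in>A. smooth_on (chart_map c ` (chart_dom c \<inter> chart_dom d)) (chart_map d \<circ> chart_inv c))"

text \<open>Second countability is automatic, by compactness.\<close>

definition closed_3_manifold :: "'y::t2_space chart set \<Rightarrow> bool" where
  "closed_3_manifold A \<longleftrightarrow> smooth_atlas A \<and> compact (UNIV :: 'y set)"

definition smooth_self_map :: "'y::topological_space chart set \<Rightarrow> ('y \<Rightarrow> 'y) \<Rightarrow> bool" where
  "smooth_self_map A F \<longleftrightarrow> continuous_on UNIV F \<and>
     (\<forall>c\<in>A. \<forall>d\<in>A. smooth_on (chart_map c ` (chart_dom c \<inter> F -` chart_dom d))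
                                (chart_map d \<circ> F \<circ> chart_inv c))"

definition chart_at :: "'y chart set \<Rightarrow> 'y \<Rightarrow> 'y chart" where
  "chart_at A p = (SOME c. c \<in> A \<and> p \<in> chart_dom c)"

text \<open>A tangent vector at \<open>p\<close> is the family of its coordinate vectors in all charts around \<open>p\<close>,
  subject to the transformation law; it is extended by \<open>0\<close> to all other index values, so that equality
  of tangent vectors is equality of functions.\<close>

type_synonym 'y tvec = "'y chart \<Rightarrow> real^3"

definition tangent_space :: "'y chart set \<Rightarrow> 'y \<Rightarrow> 'y tvec set" where
  "tangent_space A p = {v.
     (\<forall>c\<in>A. \<forall>d\<in>A. p \<in> chart_dom c \<longrightarrow> p \<in> chart_dom d \<longrightarrow>
        v d = frechet_derivative (chart_map d \<circ> chart_inv c) (at (chart_map c p)) (v c)) \<and>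
     (\<forall>c. \<not> (c \<in> A \<and> p \<in> chart_dom c) \<longrightarrow> v c = 0)}"

text \<open>The linear combination \<open>a u + b v\<close> of tangent vectors.\<close>

definition tcomb :: "real \<Rightarrow> 'y tvec \<Rightarrow> real \<Rightarrow> 'y tvec \<Rightarrow> 'y tvec" where
  "tcomb a u b v = (\<lambda>c. a *\<^sub>R u c + b *\<^sub>R v c)"

definition tzero :: "'y tvec" where "tzero = (\<lambda>c. 0)"

text \<open>The tangent vector at \<open>p\<close> with coordinate vector \<open>w\<close> in the chart \<open>c\<close>.\<close>

definition tvec_of :: "'y chart set \<Rightarrow> 'y chart \<Rightarrow> 'y \<Rightarrow> real^3 \<Rightarrow> 'y tvec" where
  "tvec_of A c p w = (\<lambda>d. if d \<in> A \<and> p \<in> chart_dom d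
     then frechet_derivative (chart_map d \<circ> chart_inv c) (at (chart_map c p)) w else 0)"

definition tangent_map :: "'y chart set \<Rightarrow> ('y \<Rightarrow> 'y) \<Rightarrow> 'y \<Rightarrow> 'y tvec \<Rightarrow> 'y tvec" where
  "tangent_map A F p v = (\<lambda>d. if d \<in> A \<and> F p \<in> chart_dom d
     then (let c = chart_at A p in
       frechet_derivative (chart_map d \<circ> F \<circ> chart_inv c) (at (chart_map c p)) (v c)) else 0)"

definition has_velocity ::
    "'y::topological_space chart set \<Rightarrow> (real \<Rightarrow> 'y) \<Rightarrow> 'y tvec \<Rightarrow> real \<Rightarrow> bool" where
  "has_velocity A \<gamma> v t \<longleftrightarrow> isCont \<gamma> t \<and> v \<in> tangent_space A (\<gamma> t) \<and>
     (\<forall>c\<in>A. \<gamma> t \<in> chart_dom c \<longrightarrow> ((chart_map c \<circ> \<gamma>) has_vector_derivative v c) (at t))"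

section \<open>Contact geometry\<close>

type_synonym 'y one_form = "'y \<Rightarrow> 'y tvec \<Rightarrow> real"

text \<open>The coordinate expression of a 1-form: at the coordinate point \<open>x\<close>, on the constant
  coordinate field \<open>w\<close>.\<close>

definition form_coord :: "'y chart set \<Rightarrow> 'y one_form \<Rightarrow> 'y chart \<Rightarrow> real^3 \<Rightarrow> real^3 \<Rightarrow> real" where
  "form_coord A \<alpha> c w x = \<alpha> (chart_inv c x) (tvec_of A c (chart_inv c x) w)"

definition smooth_one_form :: "'y chart set \<Rightarrow> 'y one_form \<Rightarrow> bool" where
  "smooth_one_form A \<alpha> \<longleftrightarrow>
     (\<forall>p. \<forall>u\<in>tangent_space A p. \<forall>v\<in>tangent_space A p. \<forall>a b.
        \<alpha> p (tcomb a u b v) = a * \<alpha> p u + b * \<alpha> p v) \<and>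
     (\<forall>c\<in>A. \<forall>w. smooth_on (chart_img c) (form_coord A \<alpha> c w))"

text \<open>\<open>d\<alpha>(U,V) = U(\<alpha>(V)) - V(\<alpha>(U)) - \<alpha>([U,V])\<close>, where \<open>U\<close> and \<open>V\<close> are the (commuting) coordinate
  fields with constant coefficients in a chart around \<open>p\<close>; the result does not depend on the chart.\<close>

definition ext_deriv :: "'y chart set \<Rightarrow> 'y one_form \<Rightarrow> 'y \<Rightarrow> 'y tvec \<Rightarrow> 'y tvec \<Rightarrow> real" where
  "ext_deriv A \<alpha> p u v = (let c = chart_at A p; x = chart_map c p in
     frechet_derivative (form_coord A \<alpha> c (v c)) (at x) (u c) -
     frechet_derivative (form_coord A \<alpha> c (u c)) (at x) (v c))"

text \<open>The last clause says that the 3-form \<open>\<alpha> \<and> d\<alpha>\<close> vanishes nowhere.\<close>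

definition contact_form :: "'y chart set \<Rightarrow> 'y one_form \<Rightarrow> bool" where
  "contact_form A \<alpha> \<longleftrightarrow> smooth_one_form A \<alpha> \<and>
     (\<forall>p. \<exists>u\<in>tangent_space A p. \<exists>v\<in>tangent_space A p. \<exists>w\<in>tangent_space A p.
        \<alpha> p u * ext_deriv A \<alpha> p v w + \<alpha> p v * ext_deriv A \<alpha> p w u +
        \<alpha> p w * ext_deriv A \<alpha> p u v \<noteq> 0)"

definition contact_plane :: "'y chart set \<Rightarrow> 'y one_form \<Rightarrow> 'y \<Rightarrow> 'y tvec set" where
  "contact_plane A \<alpha> p = {v \<in> tangent_space A p. \<alpha> p v = 0}"

definition reeb_field :: "'y chart set \<Rightarrow> 'y one_form \<Rightarrow> ('y \<Rightarrow> 'y tvec) \<Rightarrow> bool" where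
  "reeb_field A \<alpha> R \<longleftrightarrow>
     (\<forall>p. R p \<in> tangent_space A p \<and> \<alpha> p (R p) = 1 \<and>
          (\<forall>v\<in>tangent_space A p. ext_deriv A \<alpha> p (R p) v = 0))"

text \<open>The flow of a vector field as a smooth action of the reals. For a smooth field on a closed
  manifold it exists and is unique.\<close>

definition flow_of ::
    "'y::topological_space chart set \<Rightarrow> ('y \<Rightarrow> 'y tvec) \<Rightarrow> (real \<Rightarrow> 'y \<Rightarrow> 'y) \<Rightarrow> bool" where
  "flow_of A X \<phi> \<longleftrightarrow>
     continuous_on UNIV (\<lambda>(t, p). \<phi> t p) \<and>
     (\<forall>c\<in>A. \<forall>d\<in>A. smooth_on {(t, x). x \<in> chart_img c \<and> \<phi> t (chart_inv c x) \<in> chart_dom d}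
                                (\<lambda>(t, x). chart_map d (\<phi> t (chart_inv c x)))) \<and>
     (\<forall>p. \<phi> 0 p = p) \<and>
     (\<forall>s t p. \<phi> (s + t) p = \<phi> s (\<phi> t p)) \<and>
     (\<forall>p t. has_velocity A (\<lambda>s. \<phi> s p) (X (\<phi> t p)) t)"

definition anticontact_involution ::
    "'y::topological_space chart set \<Rightarrow> 'y one_form \<Rightarrow> ('y \<Rightarrow> 'y) \<Rightarrow> bool" where
  "anticontact_involution A \<alpha> N \<longleftrightarrow> smooth_self_map A N \<and> (\<forall>p. N (N p) = p) \<and>
     (\<forall>p. \<forall>v\<in>tangent_space A p. \<alpha> (N p) (tangent_map A N p v) = - \<alpha> p v)"

text \<open>Only the restriction of \<open>J\<close> to the contact planes is relevant. Its smoothness is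
  expressed through the endomorphism \<open>v \<mapsto> J (v - \<alpha>(v) R)\<close> of the tangent bundle.\<close>

definition compatible_acs ::
    "'y chart set \<Rightarrow> 'y one_form \<Rightarrow> ('y \<Rightarrow> 'y tvec) \<Rightarrow> ('y \<Rightarrow> 'y tvec \<Rightarrow> 'y tvec) \<Rightarrow> bool" where
  "compatible_acs A \<alpha> R J \<longleftrightarrow>
     (\<forall>p. \<forall>u\<in>contact_plane A \<alpha> p. \<forall>v\<in>contact_plane A \<alpha> p.
        J p u \<in> contact_plane A \<alpha> p \<and>
        (\<forall>a b. J p (tcomb a u b v) = tcomb a (J p u) b (J p v)) \<and>
        J p (J p u) = tcomb (-1) u 0 u \<and>
        ext_deriv A \<alpha> p (J p u) (J p v) = ext_deriv A \<alpha> p u v \<and>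
        (u \<noteq> tzero \<longrightarrow> ext_deriv A \<alpha> p u (J p u) > 0)) \<and>
     (\<forall>c\<in>A. \<forall>w. smooth_on (chart_img c)
        (\<lambda>x. let p = chart_inv c x in
             J p (tcomb 1 (tvec_of A c p w) (- form_coord A \<alpha> c w x) (R p)) c))"

definition anticommutes_with_involution ::
    "'y chart set \<Rightarrow> 'y one_form \<Rightarrow> ('y \<Rightarrow> 'y) \<Rightarrow> ('y \<Rightarrow> 'y tvec \<Rightarrow> 'y tvec) \<Rightarrow> bool" where
  "anticommutes_with_involution A \<alpha> N J \<longleftrightarrow>
     (\<forall>p. \<forall>v\<in>contact_plane A \<alpha> p.
        J (N p) (tangent_map A N p v) = tcomb (-1) (tangent_map A N p (J p v)) 0 tzero)"

text \<open>Here, and for brake orbits, \<open>T\<close> is a period and need not be the minimal one.\<close>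

definition periodic_orbit ::
    "'y::topological_space chart set \<Rightarrow> ('y \<Rightarrow> 'y tvec) \<Rightarrow> (real \<Rightarrow> 'y) \<Rightarrow> real \<Rightarrow> bool" where
  "periodic_orbit A R \<gamma> T \<longleftrightarrow> T > 0 \<and>
     (\<forall>t. has_velocity A \<gamma> (R (\<gamma> t)) t) \<and> (\<forall>t. \<gamma> (t + T) = \<gamma> t)"

text \<open>The linearized return map on the contact plane does not have the eigenvalue \<open>1\<close>.\<close>

definition nondegenerate_orbit ::
    "'y chart set \<Rightarrow> 'y one_form \<Rightarrow> (real \<Rightarrow> 'y \<Rightarrow> 'y) \<Rightarrow> (real \<Rightarrow> 'y) \<Rightarrow> real \<Rightarrow> bool" where
  "nondegenerate_orbit A \<alpha> \<phi> \<gamma> T \<longleftrightarrow>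
     (\<forall>v\<in>contact_plane A \<alpha> (\<gamma> 0). tangent_map A (\<phi> T) (\<gamma> 0) v = v \<longrightarrow> v = tzero)"

definition brake_orbit ::
    "'y::topological_space chart set \<Rightarrow> ('y \<Rightarrow> 'y tvec) \<Rightarrow> ('y \<Rightarrow> 'y) \<Rightarrow> (real \<Rightarrow> 'y) \<Rightarrow> real \<Rightarrow> bool" where
  "brake_orbit A R N \<beta> \<tau> \<longleftrightarrow> periodic_orbit A R \<beta> \<tau> \<and> (\<forall>t. \<beta> (- t) = N (\<beta> t))"

text \<open>A continuous \<open>\<tau>\<close>-periodic symplectic frame \<open>(e1, e2)\<close> of the contact planes along \<open>\<beta>\<close>, in which
  \<open>J\<close> has the matrix \<open>(0 -1; 1 0)\<close> and \<open>dN\<close> has the matrix \<open>(-1 0; 0 1)\<close>.\<close>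

definition brake_trivialization ::
    "'y chart set \<Rightarrow> 'y one_form \<Rightarrow> ('y \<Rightarrow> 'y) \<Rightarrow> ('y \<Rightarrow> 'y tvec \<Rightarrow> 'y tvec) \<Rightarrow>
     (real \<Rightarrow> 'y) \<Rightarrow> real \<Rightarrow> (real \<Rightarrow> 'y tvec) \<Rightarrow> (real \<Rightarrow> 'y tvec) \<Rightarrow> bool" where
  "brake_trivialization A \<alpha> N J \<beta> \<tau> e1 e2 \<longleftrightarrow>
     (\<forall>t. e1 t \<in> contact_plane A \<alpha> (\<beta> t) \<and> e2 t \<in> contact_plane A \<alpha> (\<beta> t) \<and>
          ext_deriv A \<alpha> (\<beta> t) (e1 t) (e2 t) = 1 \<and>
          e1 (t + \<tau>) = e1 t \<and> e2 (t + \<tau>) = e2 t \<and>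
          J (\<beta> t) (e1 t) = e2 t \<and> J (\<beta> t) (e2 t) = tcomb (-1) (e1 t) 0 (e2 t) \<and>
          tangent_map A N (\<beta> t) (e1 t) = tcomb (-1) (e1 (- t)) 0 (e2 (- t)) \<and>
          tangent_map A N (\<beta> t) (e2 t) = e2 (- t)) \<and>
     (\<forall>c\<in>A. continuous_on {t. \<beta> t \<in> chart_dom c} (\<lambda>t. e1 t c) \<and>
            continuous_on {t. \<beta> t \<in> chart_dom c} (\<lambda>t. e2 t c))"

text \<open>The matrix of \<open>d\<phi>\<^sub>t\<close> from the contact plane at \<open>\<beta>(0)\<close> to the one at \<open>\<beta>(t)\<close> in the frame.\<close>

definition linearized_flow ::
    "'y chart set \<Rightarrow> (real \<Rightarrow> 'y \<Rightarrow> 'y) \<Rightarrow> (real \<Rightarrow> 'y) \<Rightarrow> (real \<Rightarrow> 'y tvec) \<Rightarrow> (real \<Rightarrow> 'y tvec) \<Rightarrow>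
     real \<Rightarrow> real^2^2" where
  "linearized_flow A \<phi> \<beta> e1 e2 t = (THE M.
     tangent_map A (\<phi> t) (\<beta> 0) (e1 0) = tcomb (M$1$1) (e1 t) (M$2$1) (e2 t) \<and>
     tangent_map A (\<phi> t) (\<beta> 0) (e2 0) = tcomb (M$1$2) (e1 t) (M$2$2) (e2 t))"

section \<open>The Robbin-Salamon index\<close>

definition lagrangian :: "('v::euclidean_space \<Rightarrow> 'v \<Rightarrow> real) \<Rightarrow> 'v set \<Rightarrow> bool" where
  "lagrangian \<omega> L \<longleftrightarrow> subspace L \<and> (\<forall>u\<in>L. \<forall>v\<in>L. \<omega> u v = 0) \<and> 2 * dim L = DIM('v)"

text \<open>The Grassmannian is topologized by identifying a subspace with its orthogonal projection.\<close>

definition orth_proj :: "'v::euclidean_space set \<Rightarrow> 'v \<Rightarrow>\<^sub>L 'v" where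
  "orth_proj L = Blinfun (closest_point L)"

definition lag_grass :: "('v::euclidean_space \<Rightarrow> 'v \<Rightarrow> real) \<Rightarrow> ('v \<Rightarrow>\<^sub>L 'v) set" where
  "lag_grass \<omega> = orth_proj ` {L. lagrangian \<omega> L}"

text \<open>For \<open>v \<in> \<Lambda>(t)\<close> the crossing form is \<open>d/ds \<omega>(v, w(s))\<close> at \<open>s = t\<close>, where \<open>W\<close> is a Lagrangian complement of
  \<open>\<Lambda>(t)\<close> and \<open>w(s) \<in> W\<close> is defined by \<open>v + w(s) \<in> \<Lambda>(s)\<close>; the value does not depend on \<open>W\<close>.\<close>

definition crossing_form ::
    "('v::euclidean_space \<Rightarrow> 'v \<Rightarrow> real) \<Rightarrow> (real \<Rightarrow> 'v set) \<Rightarrow> real \<Rightarrow> 'v \<Rightarrow> real" where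
  "crossing_form \<omega> \<Lambda> t v = (THE q. \<exists>W w.
     lagrangian \<omega> W \<and> W \<inter> \<Lambda> t = {0} \<and> w t = 0 \<and>
     (\<forall>\<^sub>F s in at t within {0..1}. w s \<in> W \<and> v + w s \<in> \<Lambda> s) \<and>
     ((\<lambda>s. \<omega> v (w s)) has_real_derivative q) (at t within {0..1}))"

definition nondegenerate_form :: "'v::euclidean_space set \<Rightarrow> ('v \<Rightarrow> real) \<Rightarrow> bool" where
  "nondegenerate_form K Q \<longleftrightarrow> (\<forall>u\<in>K. (\<forall>v\<in>K. Q (u + v) - Q u - Q v = 0) \<longrightarrow> u = 0)"

definition positive_index :: "'v::euclidean_space set \<Rightarrow> ('v \<Rightarrow> real) \<Rightarrow> nat" where
  "positive_index K Q = Max {dim S | S. subspace S \<and> S \<subseteq> K \<and> (\<forall>v\<in>S - {0}. Q v > 0)}"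

definition form_signature :: "'v::euclidean_space set \<Rightarrow> ('v \<Rightarrow> real) \<Rightarrow> real" where
  "form_signature K Q = real (positive_index K Q) - real (positive_index K (\<lambda>v. - Q v))"

definition C1_subspace_path :: "(real \<Rightarrow> 'v::euclidean_space set) \<Rightarrow> bool" where
  "C1_subspace_path \<Lambda> \<longleftrightarrow> (\<exists>D. continuous_on {0..1} D \<and>
     (\<forall>t\<in>{0..1}. ((orth_proj \<circ> \<Lambda>) has_vector_derivative D t) (at t within {0..1})))"

definition crossings :: "'v::euclidean_space set \<Rightarrow> (real \<Rightarrow> 'v set) \<Rightarrow> real set" where
  "crossings V \<Lambda> = {t \<in> {0..1}. \<Lambda> t \<inter> V \<noteq> {0}}"

text \<open>Regular crossings are isolated, so the finiteness clause follows from the others.\<close>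

definition regular_path ::
    "('v::euclidean_space \<Rightarrow> 'v \<Rightarrow> real) \<Rightarrow> 'v set \<Rightarrow> (real \<Rightarrow> 'v set) \<Rightarrow> bool" where
  "regular_path \<omega> V \<Lambda> \<longleftrightarrow> (\<forall>t\<in>{0..1}. lagrangian \<omega> (\<Lambda> t)) \<and> C1_subspace_path \<Lambda> \<and>
     finite (crossings V \<Lambda>) \<and>
     (\<forall>t\<in>crossings V \<Lambda>. nondegenerate_form (\<Lambda> t \<inter> V) (crossing_form \<omega> \<Lambda> t))"

definition crossing_signature ::
    "('v::euclidean_space \<Rightarrow> 'v \<Rightarrow> real) \<Rightarrow> 'v set \<Rightarrow> (real \<Rightarrow> 'v set) \<Rightarrow> real \<Rightarrow> real" where
  "crossing_signature \<omega> V \<Lambda> t = form_signature (\<Lambda> t \<inter> V) (crossing_form \<omega> \<Lambda> t)"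

definition regular_index ::
    "('v::euclidean_space \<Rightarrow> 'v \<Rightarrow> real) \<Rightarrow> 'v set \<Rightarrow> (real \<Rightarrow> 'v set) \<Rightarrow> real" where
  "regular_index \<omega> V \<Lambda> = crossing_signature \<omega> V \<Lambda> 0 / 2
     + (\<Sum>t\<in>crossings V \<Lambda> \<inter> {0<..<1}. crossing_signature \<omega> V \<Lambda> t)
     + crossing_signature \<omega> V \<Lambda> 1 / 2"

text \<open>The index of a continuous path \<open>\<Lambda>\<close> of Lagrangians, parametrized by \<open>[0,1]\<close>, relative to the constant
  Lagrangian \<open>V\<close>: the common value of \<open>regular_index\<close> on the regular paths that are homotopic to \<open>\<Lambda>\<close>
  with fixed endpoints.\<close>

definition mu_RS ::
    "('v::euclidean_space \<Rightarrow> 'v \<Rightarrow> real) \<Rightarrow> 'v set \<Rightarrow> (real \<Rightarrow> 'v set) \<Rightarrow> real" where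
  "mu_RS \<omega> V \<Lambda> = (THE r. \<exists>\<Lambda>'. regular_path \<omega> V \<Lambda>' \<and>
     homotopic_paths (lag_grass \<omega>) (orth_proj \<circ> \<Lambda>) (orth_proj \<circ> \<Lambda>') \<and>
     r = regular_index \<omega> V \<Lambda>')"

section \<open>Indices of brake orbits\<close>

definition omega2 :: "real^2 \<Rightarrow> real^2 \<Rightarrow> real" where
  "omega2 u v = u$1 * v$2 - u$2 * v$1"

text \<open>The form \<open>(-\<omega>) \<oplus> \<omega>\<close>, for which graphs of symplectic maps are Lagrangian. With these two forms and
  the sign of \<open>crossing_form\<close>, counterclockwise rotation counts positively.\<close>

definition omega4 :: "(real^2) \<times> (real^2) \<Rightarrow> (real^2) \<times> (real^2) \<Rightarrow> real" where
  "omega4 u v = omega2 (snd u) (snd v) - omega2 (fst u) (fst v)"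

definition Sp2 :: "(real^2^2) set" where
  "Sp2 = {M. \<forall>u v. omega2 (M *v u) (M *v v) = omega2 u v}"

definition L0 :: "(real^2) set" where "L0 = {v. v$1 = 0}"

definition L1 :: "(real^2) set" where "L1 = {v. v$2 = 0}"

definition diagonal4 :: "((real^2) \<times> (real^2)) set" where "diagonal4 = {(x, x) | x. True}"

definition Gr :: "real^2^2 \<Rightarrow> ((real^2) \<times> (real^2)) set" where "Gr M = {(x, M *v x) | x. True}"

text \<open>In the following three definitions \<open>T\<close> is the period, \<open>k\<tau>\<close> for the \<open>k\<close>-th iterate.\<close>

definition mu_CZ :: "(real \<Rightarrow> real^2^2) \<Rightarrow> real \<Rightarrow> real" where
  "mu_CZ \<Psi> T = mu_RS omega4 diagonal4 (\<lambda>s. Gr (\<Psi> (T * s)))"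

definition mu_1 :: "(real \<Rightarrow> real^2^2) \<Rightarrow> real \<Rightarrow> real" where
  "mu_1 \<Psi> T = mu_RS omega2 L0 (\<lambda>s. (\<lambda>v. \<Psi> (T / 2 * s) *v v) ` L0)"

definition mu_2 :: "(real \<Rightarrow> real^2^2) \<Rightarrow> real \<Rightarrow> real" where
  "mu_2 \<Psi> T = mu_RS omega2 L1 (\<lambda>s. (\<lambda>v. \<Psi> (T / 2 * s) *v v) ` L1)"

definition complex_eigenvalues :: "real^2^2 \<Rightarrow> complex set" where
  "complex_eigenvalues M =
     {z. \<exists>v::complex^2. v \<noteq> 0 \<and> (\<chi> i j. complex_of_real (M$i$j)) *v v = z *s v}"

definition elliptic :: "real^2^2 \<Rightarrow> bool" where
  "elliptic M \<longleftrightarrow> (\<forall>z\<in>complex_eigenvalues M. cmod z = 1)"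

definition positive_hyperbolic :: "real^2^2 \<Rightarrow> bool" where
  "positive_hyperbolic M \<longleftrightarrow> (\<forall>z\<in>complex_eigenvalues M. z \<in> \<real> \<and> Re z > 0)"

definition negative_hyperbolic :: "real^2^2 \<Rightarrow> bool" where
  "negative_hyperbolic M \<longleftrightarrow> (\<forall>z\<in>complex_eigenvalues M. z \<in> \<real> \<and> Re z < 0)"

definition type_one :: "(real \<Rightarrow> real^2^2) \<Rightarrow> real \<Rightarrow> bool" where
  "type_one \<Psi> \<tau> \<longleftrightarrow> mu_1 \<Psi> (2 * \<tau>) - mu_2 \<Psi> (2 * \<tau>) > 0"

definition type_two :: "(real \<Rightarrow> real^2^2) \<Rightarrow> real \<Rightarrow> bool" where
  "type_two \<Psi> \<tau> \<longleftrightarrow> mu_1 \<Psi> (2 * \<tau>) - mu_2 \<Psi> (2 * \<tau>) < 0"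

definition rot :: "real \<Rightarrow> real^2^2" where
  "rot a = vector [vector [cos a, - sin a], vector [sin a, cos a]]"

text \<open>Up to homotopy with fixed endpoints in \<open>Sp(2)\<close> and conjugation, the path is the rotation
  through the angle \<open>2\<pi>\<theta>\<close>. This determines \<open>\<theta>\<close> as a real number, not just modulo integers.\<close>

definition rotation_number :: "(real \<Rightarrow> real^2^2) \<Rightarrow> real \<Rightarrow> real \<Rightarrow> bool" where
  "rotation_number \<Psi> \<tau> \<theta> \<longleftrightarrow> (\<exists>P\<in>Sp2.
     homotopic_paths Sp2 (\<lambda>s. \<Psi> (\<tau> * s)) (\<lambda>s. P ** rot (2 * pi * \<theta> * s) ** matrix_inv P))"

end

theory Submission
  imports Defs
begin

text \<open>Write \<open>\<omega> = d\<alpha>\<close>. Since \<open>N\<close> and the Reeb flow multiply \<open>\<alpha>\<close>, hence \<open>\<omega>\<close>, by \<open>-1\<close> and \<open>1\<close>, and the Reeb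
  field is the only field with \<open>\<alpha>(R) = 1\<close> and \<open>\<omega>(R, -) = 0\<close>, we get \<open>dN R = -R\<close> and
  \<open>N \<phi>\<^sub>t = \<phi>\<^sub>-\<^sub>t N\<close>. In the frame the linearized flow is therefore a continuous path in \<open>Sp(2)\<close> with
  \<open>\<Psi>(t + \<tau>) = \<Psi>(t) \<Psi>(\<tau>)\<close> and \<open>\<Psi>(-t) = N\<^sub>0 \<Psi>(t) N\<^sub>0\<close>.

  The Lagrangians in question correspond to symmetric unitary matrices \<open>W\<close>, and the crossings with a fixed
  Lagrangian to the eigenvalue \<open>1\<close> of \<open>W\<close>. A regular index is a difference of counts that depend only on
  the endpoints and on a continuous argument of \<open>det W\<close>, so that it is a homotopy invariant. With \<open>\<rho>\<close>
  a continuous argument of \<open>tr M + \<i> (M\<^sub>2\<^sub>1 - M\<^sub>1\<^sub>2)\<close> along \<open>\<Psi>\<close>, this expresses \<open>\<mu>\<^sub>C\<^sub>Z\<close> through \<open>\<rho>\<close> and the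
  sign of \<open>2 - tr\<close>, and \<open>\<mu>\<^sub>1\<close> through the lift \<open>f\<^sub>t\<close> to the real line of the action of \<open>\<Psi>(t)\<close> on directions:
  \<open>\<mu>\<^sub>1(\<beta>\<^sup>k) = [f\<^sub>k\<^sub>\<tau>\<^sub>/\<^sub>2(0) / \<pi>] + 1/2\<close>.

  The lifts satisfy \<open>f\<^sub>t\<^sub>+\<^sub>\<tau> = f\<^sub>t f\<^sub>\<tau>\<close> and \<open>f\<^sub>-\<^sub>t(-x) = -f\<^sub>t(x)\<close>. In the hyperbolic case the eigendirections
  are \<open>\<plusminus>x\<^sub>0\<close>, so that \<open>f\<^sub>\<tau>(\<plusminus>x\<^sub>0) = \<plusminus>x\<^sub>0 + n \<pi>\<close>, and the symmetry determines \<open>f\<^sub>\<tau>\<^sub>/\<^sub>2\<close> on the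
  eigendirections up to the alternative between the two types. In the elliptic case \<open>\<Psi>(\<tau>)\<close> is conjugate to a rotation by a
  diagonal matrix \<open>P\<close>, and the lift \<open>g\<close> of \<open>P\<close>, an odd function, conjugates \<open>f\<^sub>\<tau>\<close> to a translation.\<close>

section \<open>Orthogonal projections, signatures and logarithms along homotopies\<close>

text \<open>\<open>mu_RS\<close> is a \<open>THE\<close> over regular paths and
  \<open>crossing_form\<close> a \<open>THE\<close> over complements, so every index needs an
  explicit regular representative as well as a proof that all representatives agree. Orthogonal
  projections serve both ends: they carry the topology of the Grassmannian, their derivative gives
  the crossing form, and the reflection \<open>2 P - 1\<close> is antilinear for a compatible
  complex structure, which is where the symmetric unitary W comes from. At a crossing the counts
  take the mean of their one-sided values, to match the half weights at the ends; this matters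
  because every path begins on its reference Lagrangian, for the Conley-Zehnder index even with a
  double crossing at the identity. The number whose argument is \<rho> is twice the complex-linear
  part of M and has no zero on Sp(2). The square of its phase is det W of the graph, and \<rho> also
  approximates the lifts of directions up to an error below pi/2, so one angle serves both kinds of
  index. The type of a hyperbolic orbit is the side to which one period moves \<open>L0\<close>,
  once n half turns are removed.\<close>

lemma orth_proj_apply:
  fixes L :: "'v::euclidean_space set"
  assumes "subspace L" "\<And>v. f v \<in> L" "\<And>v y. y \<in> L \<Longrightarrow> inner (v - f v) y = 0"
  shows "blinfun_apply (orth_proj L) = f"
proof -
  have uniq: "p = q" if "p \<in> L" "q \<in> L" "\<And>y. y \<in> L \<Longrightarrow> inner (v - p) y = 0"
      "\<And>y. y \<in> L \<Longrightarrow> inner (v - q) y = 0" for p q v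
  proof -
    have "p - q \<in> L" using that assms(1) by (simp add: subspace_diff)
    then have "inner (v - p) (p - q) = 0" "inner (v - q) (p - q) = 0" using that by auto
    then have "inner ((v - q) - (v - p)) (p - q) = 0" by (simp only: inner_diff_left)
    then show ?thesis by simp
  qed
  have cp: "closest_point L v = f v" for v
  proof (rule closest_point_unique[symmetric])
    show "convex L" "closed L" using assms(1) by (auto simp: subspace_imp_convex closed_subspace)
    show "f v \<in> L" by fact
    show "\<forall>z\<in>L. dist v (f v) \<le> dist v z"
    proof
      fix z assume "z \<in> L"
      then have "inner (v - f v) (f v - z) = 0"
        using assms by (simp add: subspace_diff)
      then have "norm ((v - f v) + (f v - z))^2 = norm (v - f v)^2 + norm (f v - z)^2"
        by (intro norm_add_Pythagorean) (simp add: orthogonal_def)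
      then have "norm (v - z)^2 \<ge> norm (v - f v)^2" by simp
      then show "dist v (f v) \<le> dist v z" by (simp add: dist_norm power2_le_iff_abs_le)
    qed
  qed
  \<comment> \<open>\<open>Blinfun\<close> returns its argument only if that is bounded linear;
    linearity follows from the uniqueness of the point with the orthogonality property.\<close>
  have lin: "linear f"
  proof (rule linearI)
    fix a b show "f (a + b) = f a + f b"
    proof (rule uniq[of _ _ "a+b"])
      show "f a + f b \<in> L" using assms by (simp add: subspace_add)
      show "inner (a + b - (f a + f b)) y = 0" if "y \<in> L" for y
        using assms(3)[OF that, of a] assms(3)[OF that, of b] by (simp add: inner_diff_left inner_add_left)
    qed (use assms in auto)
  next
    fix r a show "f (r *\<^sub>R a) = r *\<^sub>R f a"
    proof (rule uniq[of _ _ "r *\<^sub>R a"])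
      show "r *\<^sub>R f a \<in> L" using assms by (simp add: subspace_scale)
      show "inner (r *\<^sub>R a - r *\<^sub>R f a) y = 0" if "y \<in> L" for y
        using assms(3)[OF that, of a] by (simp add: inner_diff_left)
    qed (use assms in auto)
  qed
  have "closest_point L = f" using cp by auto
  then show ?thesis unfolding orth_proj_def
    using lin by (simp add: bounded_linear_Blinfun_apply linear_conv_bounded_linear)
qed

lemma orth_proj_props:
  fixes L :: "'v::euclidean_space set"
  assumes "subspace L"
  shows orth_proj_in: "blinfun_apply (orth_proj L) v \<in> L"
    and orth_proj_orthogonal: "y \<in> L \<Longrightarrow> inner (v - blinfun_apply (orth_proj L) v) y = 0"
    and orth_proj_fixes: "v \<in> L \<Longrightarrow> blinfun_apply (orth_proj L) v = v"
    and orth_proj_fixed_iff: "blinfun_apply (orth_proj L) v = v \<longleftrightarrow> v \<in> L"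
proof -
  have "\<exists>p. p \<in> L \<and> (\<forall>y\<in>L. inner (v - p) y = 0)" for v
  proof -
    obtain y z where "y \<in> span L" "\<And>w. w \<in> span L \<Longrightarrow> orthogonal z w" "v = y + z"
      using orthogonal_subspace_decomp_exists by blast
    then show ?thesis using assms
      by (intro exI[of _ y]) (auto simp: orthogonal_def span_eq_iff[THEN iffD2, OF assms] inner_commute)
  qed
  then obtain f where f: "\<And>v. f v \<in> L" "\<And>v y. y \<in> L \<Longrightarrow> inner (v - f v) y = 0" by metis
  have eq: "blinfun_apply (orth_proj L) = f" by (rule orth_proj_apply[OF assms f])
  show 1: "blinfun_apply (orth_proj L) v \<in> L" for v using f eq by auto
  show 2: "y \<in> L \<Longrightarrow> inner (v - blinfun_apply (orth_proj L) v) y = 0" for v y using f eq by auto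
  show 3: "v \<in> L \<Longrightarrow> blinfun_apply (orth_proj L) v = v" for v
  proof -
    assume "v \<in> L"
    then have "v - orth_proj L v \<in> L" using 1 assms by (simp add: subspace_diff)
    then have "inner (v - orth_proj L v) (v - orth_proj L v) = 0" using 2 by blast
    then show ?thesis by simp
  qed
  show "blinfun_apply (orth_proj L) v = v \<longleftrightarrow> v \<in> L" using 1 3 by metis
qed

lemma orth_proj_selfadjoint:
  assumes "subspace L"
  shows "inner (blinfun_apply (orth_proj L) u) v = inner u (blinfun_apply (orth_proj L) v)"
proof -
  have "inner (v - orth_proj L v) (orth_proj L u) = 0" "inner (u - orth_proj L u) (orth_proj L v) = 0"
    using orth_proj_props[OF assms] by blast+
  then show ?thesis using inner_commute[of v] inner_commute[of "orth_proj L v" "orth_proj L u"] inner_commute[of "orth_proj L v" "u"]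
    by (simp add: inner_diff_left)
qed

text \<open>Reduces convergence and differentiation in operator norm to the finitely many matrix
  entries of an operator.\<close>

lemma blinfun_matrix_sum: "f = (\<Sum>i\<in>Basis. \<Sum>j\<in>Basis. (inner (blinfun_apply f i) j) *\<^sub>R
   Blinfun (\<lambda>v. (inner v i) *\<^sub>R j))"
  for f :: "'a::euclidean_space \<Rightarrow>\<^sub>L 'b::euclidean_space"
proof (rule blinfun_euclidean_eqI)
  fix b :: 'a assume b: "b \<in> Basis"
  have bl: "blinfun_apply (Blinfun (\<lambda>v. (inner v i) *\<^sub>R j)) = (\<lambda>v. (inner v i) *\<^sub>R j)" for i :: 'a and j :: 'b
    by (intro bounded_linear_Blinfun_apply bounded_linear_intros)
  have "(\<Sum>i\<in>Basis. \<Sum>j\<in>Basis. (inner (blinfun_apply f i) j) *\<^sub>R Blinfun (\<lambda>v. (inner v i) *\<^sub>R j)) b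
     = (\<Sum>i\<in>Basis. (inner b i) *\<^sub>R (\<Sum>j\<in>Basis. (inner (blinfun_apply f i) j) *\<^sub>R j))"
    by (simp add: blinfun.sum_left blinfun.scaleR_left bl scaleR_sum_right mult.commute)
  also have "\<dots> = (\<Sum>i\<in>Basis. (inner b i) *\<^sub>R blinfun_apply f i)"
    by (simp add: euclidean_representation)
  also have "\<dots> = blinfun_apply f b"
    by (metis (no_types, lifting) blinfun.scaleR_right blinfun.sum_right euclidean_representation sum.cong)
  finally show "blinfun_apply f b = blinfun_apply (\<Sum>i\<in>Basis. \<Sum>j\<in>Basis. (inner (blinfun_apply f i) j) *\<^sub>R
   Blinfun (\<lambda>v. (inner v i) *\<^sub>R j)) b" by simp
qed

lemma has_vector_derivative_blinfun:
  fixes P :: "real \<Rightarrow> 'a::euclidean_space \<Rightarrow>\<^sub>L 'b::euclidean_space"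
  assumes "\<And>i. i \<in> Basis \<Longrightarrow> ((\<lambda>t. blinfun_apply (P t) i) has_vector_derivative blinfun_apply D i) (at t within S)"
  shows "(P has_vector_derivative D) (at t within S)"
proof -
  let ?E = "\<lambda>i j. Blinfun (\<lambda>v::'a. (inner v i) *\<^sub>R (j::'b))"
  have "((\<lambda>t. \<Sum>i\<in>Basis. \<Sum>j\<in>Basis. (inner (blinfun_apply (P t) i) j) *\<^sub>R ?E i j) has_vector_derivative
     (\<Sum>i\<in>Basis. \<Sum>j\<in>Basis. (inner (blinfun_apply D i) j) *\<^sub>R ?E i j)) (at t within S)"
  proof (intro has_vector_derivative_sum)
    fix i :: 'a and j :: 'b assume "i \<in> Basis"
    from assms[OF this] have "((\<lambda>t. inner (P t i) j) has_vector_derivative (inner (D i) j)) (at t within S)"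
      by (rule bounded_linear.has_vector_derivative[OF bounded_linear_inner_left])
    then show "((\<lambda>t. inner (P t i) j *\<^sub>R ?E i j) has_vector_derivative inner (D i) j *\<^sub>R ?E i j) (at t within S)"
      by (rule bounded_linear.has_vector_derivative[OF bounded_linear_scaleR_left])
  qed
  then show ?thesis by (simp flip: blinfun_matrix_sum)
qed

lemma continuous_on_blinfunI:
  fixes P :: "'c::topological_space \<Rightarrow> 'a::euclidean_space \<Rightarrow>\<^sub>L 'b::euclidean_space"
  assumes "\<And>i. i \<in> Basis \<Longrightarrow> continuous_on S (\<lambda>t. blinfun_apply (P t) i)"
  shows "continuous_on S P"
proof -
  let ?E = "\<lambda>i j. Blinfun (\<lambda>v::'a. (inner v i) *\<^sub>R (j::'b))"
  have "continuous_on S (\<lambda>t. \<Sum>i\<in>Basis. \<Sum>j\<in>Basis. (inner (blinfun_apply (P t) i) j) *\<^sub>R ?E i j)"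
    by (intro continuous_intros assms)
  then show ?thesis by (simp flip: blinfun_matrix_sum)
qed

text \<open>Give full weight to the crossings before t and half weight to t itself: minus this sum,
  \<open>n\<close> is locally constant, hence constant. The half weights at 0 and 1 are the
  one-sided jumps there.\<close>

lemma local_sum_jumps:
  fixes n \<sigma> :: "real \<Rightarrow> real"
  assumes fin: "finite C" and C: "C \<subseteq> {0..1}"
    and off: "\<And>t. t \<in> {0..1} \<Longrightarrow> t \<notin> C \<Longrightarrow> \<sigma> t = 0"
    and R: "\<And>t. t \<in> {0..1} \<Longrightarrow> \<forall>\<^sub>F s in at t within {0..1}. s > t \<longrightarrow> n s = n t + \<sigma> t / 2"
    and L: "\<And>t. t \<in> {0..1} \<Longrightarrow> \<forall>\<^sub>F s in at t within {0..1}. s < t \<longrightarrow> n s = n t - \<sigma> t / 2"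
  shows "n 1 - n 0 = \<sigma> 0 / 2 + (\<Sum>t\<in>C \<inter> {0<..<1}. \<sigma> t) + \<sigma> 1 / 2"
proof -
  define H where "H t = (\<Sum>u\<in>C \<inter> {..<t}. \<sigma> u) + \<sigma> t / 2" for t
  define g where "g t = n t - H t" for t
  have "\<forall>\<^sub>F s in at t within {0..1}. g t = g s" if t: "t \<in> {0..1}" for t
  proof -
    have cl: "closed (C - {t})" using fin by (simp add: finite_imp_closed)
    obtain e where e: "e > 0" "\<And>s. dist s t < e \<Longrightarrow> s \<notin> C - {t}"
      using cl[unfolded closed_def open_dist, rule_format, of t] by (auto simp: Ball_def)
    have "\<forall>\<^sub>F s in at t within {0..1}. dist s t < e"
      using e(1) by (simp add: eventually_at) blast
    moreover have "\<forall>\<^sub>F s in at t within {0..1}. s \<in> {0..1} \<and> s \<noteq> t" by (simp add: eventually_at) (use zero_less_one in blast)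
    ultimately show ?thesis using R[OF t] L[OF t]
    proof eventually_elim
      case (elim s)
      have ns: "u \<notin> C" if "u \<noteq> t" "\<bar>u - t\<bar> \<le> \<bar>s - t\<bar>" for u
        using e(2)[of u] that elim(1) by (auto simp: dist_real_def)
      have s0: "\<sigma> s = 0" using off[of s] ns[of s] elim by auto
      show ?case
      proof (cases "s > t")
        case True
        have "(\<Sum>u\<in>C \<inter> {..<s}. \<sigma> u) = (\<Sum>u\<in>C \<inter> {..<t}. \<sigma> u) + \<sigma> t"
        proof (cases "t \<in> C")
          case inC: True
          have "C \<inter> {..<s} = insert t (C \<inter> {..<t})"
          proof -
            have "u < t" if "u \<in> C" "u < s" "u \<noteq> t" for u
              using ns[of u] that True by force
            then show ?thesis using inC True by auto
          qed
          then show ?thesis using fin by simp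
        next
          case False
          have "C \<inter> {..<s} = C \<inter> {..<t}"
          proof -
            have "u < t" if "u \<in> C" "u < s" for u
              using ns[of u] that True False by force
            then show ?thesis using True by auto
          qed
          then show ?thesis using off[OF t False] by simp
        qed
        then show ?thesis using elim True s0 by (simp add: g_def H_def)
      next
        case False
        then have st: "s < t" using elim by auto
        have "C \<inter> {..<s} = C \<inter> {..<t}"
        proof -
          have "u < s" if "u \<in> C" "u < t" for u
            using ns[of u] that st by force
          then show ?thesis using st by auto
        qed
        then show ?thesis using elim st s0 by (simp add: g_def H_def)
      qed
    qed
  qed
  then have "(g has_derivative (\<lambda>_. 0)) (at t within {0..1})" if "t \<in> {0..1}" for t
    using that
    by (intro has_derivative_transform_eventually[OF has_derivative_const[of "g t"]])
      auto
  then have "\<exists>c. \<forall>x\<in>{0..1}. g x = c"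
    by (intro has_derivative_zero_constant) auto
  then have "g 1 = g 0" by auto
  moreover have "H 0 = \<sigma> 0 / 2"
  proof -
    have "C \<inter> {..<0} = {}" using C by auto
    then show ?thesis by (simp add: H_def)
  qed
  moreover have "(\<Sum>u\<in>C \<inter> {..<1}. \<sigma> u) = \<sigma> 0 + (\<Sum>t\<in>C \<inter> {0<..<1}. \<sigma> t)"
  proof (cases "0 \<in> C")
    case True
    then have "C \<inter> {..<1} = insert 0 (C \<inter> {0<..<1})" using C by force
    then show ?thesis using fin by simp
  next
    case False
    then have "x \<in> C \<Longrightarrow> 0 < x" for x using C by (metis atLeastAtMost_iff less_le subset_iff)
    then have "C \<inter> {..<1} = C \<inter> {0<..<1}" by auto
    then show ?thesis using off False by simp
  qed
  ultimately show ?thesis by (simp add: g_def H_def)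
qed

text \<open>The whole homotopy has a logarithm because the square is contractible. On the two sides
  where the endpoints stay fixed it is constant, since logarithms of one number are 2 pi apart, and
  two logarithms of one path differ by a constant.\<close>

lemma logs_of_homotopic_paths:
  fixes p q :: "real \<Rightarrow> complex"
  assumes hom: "homotopic_paths (- {0}) p q"
    and a: "continuous_on {0..1} a" "\<And>t. t \<in> {0..1} \<Longrightarrow> p t = exp (a t)"
    and b: "continuous_on {0..1} b" "\<And>t. t \<in> {0..1} \<Longrightarrow> q t = exp (b t)"
  shows "a 1 - a 0 = b 1 - b 0"
proof -
  obtain h :: "real \<times> real \<Rightarrow> complex" where
      h: "continuous_on ({0..1} \<times> {0..1}) h" "h ` ({0..1} \<times> {0..1}) \<subseteq> - {0}"
        "\<forall>x\<in>{0..1}. h (0, x) = p x" "\<forall>x\<in>{0..1}. h (1, x) = q x"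
        "\<forall>t\<in>{0..1}. pathstart (h \<circ> Pair t) = pathstart p \<and> pathfinish (h \<circ> Pair t) = pathfinish p"
    using hom unfolding homotopic_paths image_subset_iff_funcset[symmetric] by (elim exE conjE) (rule that)
  have "contractible ({0..1::real} \<times> {0..1::real})"
    by (intro convex_imp_contractible convex_Times) auto
  then obtain g where g: "continuous_on ({0..1} \<times> {0..1}) g"
      "\<And>x. x \<in> {0..1} \<times> {0..1} \<Longrightarrow> h x = exp (g x)"
    using continuous_logarithm_on_contractible[of "{0..1} \<times> {0..1}" h] h(1,2) by (metis (no_types, lifting) ComplD image_subset_iff singletonI)
  have const: "f u = f v" if "continuous_on {0..1} f" "\<And>s. s \<in> {0..1} \<Longrightarrow> exp (f s) = c" "u \<in> {0..1}" "v \<in> {0..1}"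
    for f :: "real \<Rightarrow> complex" and c u v
  proof -
    have "f constant_on {0..1}"
    proof (rule continuous_discrete_range_constant)
      show "connected {0..1::real}" by simp
      show "\<exists>e>0. \<forall>y. y \<in> {0..1} \<and> f y \<noteq> f x \<longrightarrow> e \<le> norm (f y - f x)" if "x \<in> {0..1}" for x
      proof (intro exI[of _ "2*pi"] conjI allI impI)
        fix y assume y: "y \<in> {0..1} \<and> f y \<noteq> f x"
        then have "exp (f y) = exp (f x)" using \<open>\<And>s. s \<in> {0..1} \<Longrightarrow> exp (f s) = c\<close> that by simp
        then obtain n :: int where n: "f y = f x + of_real (of_int (2 * n) * pi) * \<i>" using exp_eq by blast
        with y have "n \<noteq> 0" by auto
        then have "1 \<le> \<bar>real_of_int n\<bar>" by linarith
        then show "2 * pi \<le> norm (f y - f x)" using n by (simp add: norm_mult)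
      qed simp
    qed fact
    then show ?thesis using that unfolding constant_on_def by auto
  qed
  have slice: "continuous_on {0..1} (\<lambda>u. g (u, c))" "continuous_on {0..1} (\<lambda>u. g (c, u))" if "c \<in> {0..1}" for c
    using that by (auto intro!: continuous_on_compose2[OF g(1)] continuous_intros)
  have 1: "g (1, c) = g (0, c)" if "c \<in> {0, 1}" for c
    using h(5) that
    by (intro const[of "\<lambda>u. g (u, c)" "if c = 0 then pathstart p else pathfinish p"] slice)
      (auto simp flip: g(2) simp: pathstart_def pathfinish_def)
  have diff: "x 1 - y 1 = x 0 - y 0" if "continuous_on {0..1} x" "continuous_on {0..1} y"
      "\<And>t. t \<in> {0..1} \<Longrightarrow> exp (x t) = exp (y t)" for x y :: "real \<Rightarrow> complex"
    using that by (intro const[of "\<lambda>t. x t - y t" 1]) (auto intro: continuous_intros simp: exp_diff)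
  have A: "a 1 - g (0, 1) = a 0 - g (0, 0)"
    using h(3) by (intro diff[of a "\<lambda>t. g (0, t)"] a(1) slice) (auto simp flip: a(2) g(2))
  have B: "b 1 - g (1, 1) = b 0 - g (1, 0)"
    using h(4) by (intro diff[of b "\<lambda>t. g (1, t)"] b(1) slice) (auto simp flip: b(2) g(2))
  have "a 1 - a 0 = g (0, 1) - g (0, 0)" using A by (simp add: algebra_simps)
  moreover have "b 1 - b 0 = g (1, 1) - g (1, 0)" using B by (simp add: algebra_simps)
  ultimately show ?thesis using 1[of 0] 1[of 1] by simp
qed

lemma has_vector_derivative_quotient:
  assumes "(f has_vector_derivative d) (at x within S)"
  shows "((\<lambda>y. (f y - f x) /\<^sub>R (y - x)) \<longlongrightarrow> d) (at x within S)"
proof -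
  have "((\<lambda>y. norm ((f y - f x) - (y - x) *\<^sub>R d) / norm (y - x)) \<longlongrightarrow> 0) (at x within S)"
    using assms unfolding has_vector_derivative_def has_derivative_iff_norm by blast
  moreover have "\<forall>\<^sub>F y in at x within S. norm ((f y - f x) - (y - x) *\<^sub>R d) / norm (y - x)
      = norm ((f y - f x) /\<^sub>R (y - x) - d)"
  proof -
    have "\<forall>\<^sub>F y in at x within S. y \<noteq> x" by (simp add: eventually_at) (use zero_less_one in blast)
    then show ?thesis
    proof eventually_elim
      case (elim y)
      have "(f y - f x) /\<^sub>R (y - x) - d = ((f y - f x) - (y - x) *\<^sub>R d) /\<^sub>R (y - x)"
        using elim by (simp add: scaleR_diff_right)
      then show ?case by (simp add: divide_inverse)
    qed
  qed
  ultimately have "((\<lambda>y. norm ((f y - f x) /\<^sub>R (y - x) - d)) \<longlongrightarrow> 0) (at x within S)"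
    by (rule Lim_transform_eventually)
  then show ?thesis by (rule LIM_zero_cancel[OF tendsto_norm_zero_cancel])
qed

text \<open>Treats the plane and four dimensions together. With \<open>I\<close> an isometric
  complex structure behind \<omega>, a subspace is Lagrangian when \<open>I\<close> exchanges it
  with its orthogonal complement, so symplectic questions become questions about orthogonal
  projections.\<close>

locale compatible_form =
  fixes \<omega> :: "'v::euclidean_space \<Rightarrow> 'v \<Rightarrow> real" and I :: "'v \<Rightarrow> 'v"
  assumes I_linear: "linear I" and I_square: "I (I u) = - u"
    and I_isometry: "inner (I u) (I v) = inner u v" and \<omega>_eq: "\<omega> u v = inner (I u) v"
begin

lemma bounded_linear_I: "bounded_linear I"
  using I_linear by (simp add: linear_conv_bounded_linear)

lemma I_skew: "inner (I u) v = - inner u (I v)"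
  using I_isometry[of "I u" v] by (simp add: I_square)

lemma bilinear_\<omega>: "bounded_bilinear \<omega>"
proof -
  have "bounded_bilinear (\<lambda>u v. inner (I u) v)"
    by (rule bounded_bilinear.comp1[OF bounded_bilinear_inner bounded_linear_I])
  then show ?thesis by (simp add: \<omega>_eq[abs_def])
qed

lemma \<omega>_skew: "\<omega> u v = - \<omega> v u"
  using I_skew[of u v] by (simp add: \<omega>_eq inner_commute)

text \<open>Isotropy places the image of L under \<open>I\<close> inside the orthogonal complement
  of L, and the dimensions agree.\<close>

lemma lagrangian_I_orthogonal:
  assumes "lagrangian \<omega> L"
  shows "I v \<in> L \<longleftrightarrow> (\<forall>y\<in>L. inner v y = 0)"
proof -
  let ?LC = "{y. \<forall>x\<in>L. orthogonal x y}"
  have sub: "subspace L" and iso: "\<And>u v. u \<in> L \<Longrightarrow> v \<in> L \<Longrightarrow> \<omega> u v = 0" and dim: "2 * dim L = DIM('v)"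
    using assms by (auto simp: lagrangian_def)
  have inj: "inj I" by (rule inj_on_inverseI[of _ "\<lambda>x. - I x"]) (simp add: I_square)
  have "subspace (I ` L)" using I_linear sub by (simp add: linear_subspace_image)
  moreover have "dim (I ` L) = dim L"
    using I_linear inj by (intro dim_image_eq) (auto intro: inj_on_subset)
  moreover have "subspace ?LC" by (simp add: subspace_orthogonal_to_vectors)
  moreover have "dim ?LC + dim L = DIM('v)"
    using dim_subspace_orthogonal_to_vectors[OF sub subspace_UNIV] by simp
  moreover have "I ` L \<subseteq> ?LC"
    using iso by (auto simp: orthogonal_def \<omega>_eq inner_commute)
  ultimately have eq: "I ` L = ?LC"
    using dim by (intro subspace_dim_equal) auto
  have "I v \<in> L \<longleftrightarrow> v \<in> I ` L"
  proof
    assume "I v \<in> L"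
    moreover have "v = I (- I v)" using I_linear by (simp add: linear_neg I_square)
    ultimately show "v \<in> I ` L" using sub by (metis image_eqI subspace_neg)
  next
    assume "v \<in> I ` L" then show "I v \<in> L" using sub by (auto simp: I_square subspace_neg)
  qed
  also have "\<dots> \<longleftrightarrow> (\<forall>y\<in>L. inner v y = 0)" unfolding eq by (auto simp: orthogonal_def inner_commute)
  finally show ?thesis .
qed

text \<open>\<open>I\<close> swaps L with its orthogonal complement, so the reflection
  \<open>2 P - 1\<close> anticommutes with \<open>I\<close>. The symmetry of the matrix W rests on
  this.\<close>

lemma orth_proj_I:
  assumes "lagrangian \<omega> L"
  shows "orth_proj L (I v) = I v - I (orth_proj L v)"
proof -
  have sub: "subspace L" using assms by (simp add: lagrangian_def)
  have 1: "I (v - orth_proj L v) \<in> L"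
    using lagrangian_I_orthogonal[OF assms] orth_proj_orthogonal[OF sub] by blast
  have 2: "orth_proj L (I (orth_proj L v)) = 0"
  proof -
    have "inner (I (orth_proj L v)) y = 0" if "y \<in> L" for y
      using assms that orth_proj_in[OF sub, of v] by (simp add: lagrangian_def \<omega>_eq)
    then have "inner (orth_proj L (I (orth_proj L v))) (orth_proj L (I (orth_proj L v))) = 0"
      using orth_proj_in[OF sub] orth_proj_selfadjoint[OF sub] by (metis)
    then show ?thesis by simp
  qed
  have "orth_proj L (I v) = orth_proj L (I (v - orth_proj L v) + I (orth_proj L v))"
    using I_linear by (simp add: linear_diff)
  also have "\<dots> = I (v - orth_proj L v)"
    using orth_proj_fixes[OF sub 1] 2 by (simp add: blinfun.add_right)
  finally show ?thesis using I_linear by (simp add: linear_diff)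
qed

lemma lagrangian_complement:
  assumes "lagrangian \<omega> L"
  shows "lagrangian \<omega> (I ` L)" "I ` L \<inter> L = {0}"
proof -
  have sub: "subspace L" and iso: "\<And>u v. u \<in> L \<Longrightarrow> v \<in> L \<Longrightarrow> \<omega> u v = 0" and dim: "2 * dim L = DIM('v)"
    using assms by (auto simp: lagrangian_def)
  have inj: "inj I" by (rule inj_on_inverseI[of _ "\<lambda>x. - I x"]) (simp add: I_square)
  have "dim (I ` L) = dim L"
    using I_linear inj by (intro dim_image_eq) (auto intro: inj_on_subset)
  then show "lagrangian \<omega> (I ` L)"
    using I_linear sub dim iso by (auto simp: lagrangian_def linear_subspace_image \<omega>_eq I_isometry)
  have "x = 0" if "x \<in> L" "I x \<in> L" for x
    using lagrangian_I_orthogonal[OF assms, of x] that by auto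
  moreover have "0 \<in> I ` L \<inter> L" using sub I_linear by (metis IntI imageI linear_0 subspace_0)
  moreover have "y = 0" if y: "y \<in> L" "y = I x" "x \<in> L" for x y
    using that calculation(1)[of x] I_linear by (simp add: linear_0)
  ultimately show "I ` L \<inter> L = {0}" by blast
qed

lemma dim_lagrangian_eq: "lagrangian \<omega> L \<Longrightarrow> lagrangian \<omega> L' \<Longrightarrow> dim L = dim L'"
  by (auto simp: lagrangian_def)

text \<open>The crossing form is \<open>d/ds \<omega>(v, P(s) v)\<close>, with \<open>P(s)\<close> the orthogonal projection onto \<open>\<Lambda>(s)\<close>:
  both \<open>v + w(s)\<close> and \<open>P(s) v\<close> lie in \<open>\<Lambda>(s)\<close>, so \<open>\<omega>(v, w(s)) = \<omega>(v, P(s) v) + \<omega>(w(s), P(s) v - v)\<close>,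
  and the last term is of second order.\<close>

lemma has_crossing_derivative:
  assumes lag: "\<And>s. s \<in> {0..1} \<Longrightarrow> lagrangian \<omega> (\<Lambda> s)"
    and D: "((\<lambda>s. orth_proj (\<Lambda> s)) has_vector_derivative D) (at t within {0..1})"
    and t: "t \<in> {0..1}" and v: "v \<in> \<Lambda> t"
    and W: "subspace W" "W \<inter> \<Lambda> t = {0}" and w: "w t = 0"
      "\<forall>\<^sub>F s in at t within {0..1}. w s \<in> W \<and> v + w s \<in> \<Lambda> s"
  shows "((\<lambda>s. \<omega> v (w s)) has_real_derivative \<omega> v (D v)) (at t within {0..1})"
proof -
  interpret \<omega>: bounded_bilinear \<omega> by (rule bilinear_\<omega>)
  let ?F = "at t within {0..1::real}"
  let ?P = "\<lambda>s. orth_proj (\<Lambda> s)"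
  have sub: "subspace (\<Lambda> s)" if "s \<in> {0..1}" for s using lag[OF that] by (simp add: lagrangian_def)
  have in01: "\<forall>\<^sub>F s in ?F. s \<in> {0..1} \<and> s \<noteq> t" by (simp add: eventually_at) (use zero_less_one in blast)
  have Pc: "(?P \<longlongrightarrow> ?P t) ?F"
    using has_vector_derivative_continuous[OF D] by (simp add: continuous_within)
  have Pv: "((\<lambda>s. ?P s v) has_vector_derivative D v) ?F"
    using bounded_linear.has_vector_derivative[OF blinfun.bounded_linear_left D] by simp
  define T where "T = (\<lambda>x. x - ?P t x)"
  have linT: "linear T" unfolding T_def by (intro linear_compose_sub linear_ident bounded_linear.linear[OF blinfun.bounded_linear_right])
  have "inj_on T W"
  proof (rule linear_injective_on_subspace_0[OF linT W(1), THEN iffD2], intro ballI impI)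
    fix x assume "x \<in> W" "T x = 0"
    then have "?P t x = x" by (simp add: T_def)
    then have "x \<in> \<Lambda> t" using orth_proj_fixed_iff[OF sub[OF t]] by blast
    then show "x = 0" using \<open>x \<in> W\<close> W by auto
  qed
  then obtain B where B: "B > 0" "\<And>x. x \<in> W \<Longrightarrow> B * norm x \<le> norm (T x)"
    using injective_imp_isometric[OF closed_subspace[OF W(1)] W(1), of T] linT W(1)
    by (metis (no_types, lifting) linear_conv_bounded_linear linear_injective_on_subspace_0 mult.commute)
  \<comment> \<open>The component orthogonal to \<open>\<Lambda> t\<close> is bounded below by B on
    W. Hence \<open>w s\<close> is controlled by the displacement of v under the projection, tends
    to 0, and makes the mixed term second order.\<close>
  have wbound: "\<forall>\<^sub>F s in ?F. norm (w s) \<le> 2 / B * norm (v - ?P s v)"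
  proof -
    have "\<forall>\<^sub>F s in ?F. norm (?P s - ?P t) < B / 2"
      using tendstoD[OF Pc, of "B/2"] B(1) by (simp add: dist_norm)
    then show ?thesis using w(2) in01
    proof eventually_elim
      case (elim s)
      then have "?P s (v + w s) = v + w s" using orth_proj_fixes[OF sub] by blast
      then have eq: "v - ?P s v = ?P s (w s) - w s" by (simp add: blinfun.add_right algebra_simps)
      have "B * norm (w s) \<le> norm (w s - ?P t (w s))" using B(2)[of "w s"] elim by (simp add: T_def)
      also have "w s - ?P t (w s) = - (v - ?P s v) + (?P s - ?P t) (w s)"
        by (simp add: eq blinfun.diff_left)
      also have "norm \<dots> \<le> norm (v - ?P s v) + norm ((?P s - ?P t) (w s))"
        by (metis norm_minus_cancel norm_triangle_ineq)
      also have "norm ((?P s - ?P t) (w s)) \<le> norm (?P s - ?P t) * norm (w s)" by (rule norm_blinfun)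
      also have "\<dots> \<le> B / 2 * norm (w s)" using elim by (intro mult_right_mono) auto
      finally show ?case using B(1) by (simp add: field_simps)
    qed
  qed
  have Ptv: "?P t v = v" using orth_proj_fixes[OF sub[OF t] v] .
  have wlim: "(w \<longlongrightarrow> 0) ?F"
  proof (rule Lim_null_comparison[OF wbound])
    have "((\<lambda>s. ?P s v) \<longlongrightarrow> v) ?F"
      using has_vector_derivative_continuous[OF Pv] Ptv by (simp add: continuous_within)
    then have "((\<lambda>s. 2 / B * norm (v - ?P s v)) \<longlongrightarrow> 2 / B * norm (v - v)) ?F"
      by (intro tendsto_intros)
    then show "((\<lambda>s. 2 / B * norm (v - ?P s v)) \<longlongrightarrow> 0) ?F" by simp
  qed
  have quot: "((\<lambda>s. (?P s v - v) /\<^sub>R (s - t)) \<longlongrightarrow> D v) ?F"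
    using has_vector_derivative_quotient[OF Pv] by (simp add: Ptv)
  have "((\<lambda>s. \<omega> v ((?P s v - v) /\<^sub>R (s - t)) + \<omega> (w s) ((?P s v - v) /\<^sub>R (s - t))) \<longlongrightarrow> \<omega> v (D v) + \<omega> 0 (D v)) ?F"
    by (intro tendsto_add \<omega>.tendsto wlim quot tendsto_const)
  moreover have "\<forall>\<^sub>F s in ?F. \<omega> v ((?P s v - v) /\<^sub>R (s - t)) + \<omega> (w s) ((?P s v - v) /\<^sub>R (s - t))
      = (\<omega> v (w s) - \<omega> v (w t)) / (s - t)"
    using w(2) in01
  proof eventually_elim
    case (elim s)
    have "\<omega> (v + w s) (?P s v) = 0"
      using elim lag[of s] orth_proj_in[OF sub, of s] by (simp add: lagrangian_def)
    moreover have "\<omega> v v = 0" "\<omega> v (w s) = - \<omega> (w s) v" using \<omega>_skew[of v v] \<omega>_skew[of v "w s"] by auto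
    ultimately have "\<omega> v (?P s v - v) + \<omega> (w s) (?P s v - v) = \<omega> v (w s)"
      by (simp add: \<omega>.diff_right \<omega>.add_left)
    then have "\<omega> v ((?P s v - v) /\<^sub>R (s - t)) + \<omega> (w s) ((?P s v - v) /\<^sub>R (s - t)) = inverse (s - t) * \<omega> v (w s)"
      by (simp only: \<omega>.scaleR_right real_scaleR_def flip: distrib_left)
    then show ?case using w(1) by (simp add: \<omega>.zero_right divide_inverse mult.commute)
  qed
  ultimately have "((\<lambda>s. (\<omega> v (w s) - \<omega> v (w t)) / (s - t)) \<longlongrightarrow> \<omega> v (D v) + \<omega> 0 (D v)) ?F"
    by (rule Lim_transform_eventually)
  then have "((\<lambda>s. (\<omega> v (w s) - \<omega> v (w t)) / (s - t)) \<longlongrightarrow> \<omega> v (D v)) ?F"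
    by (simp add: \<omega>.zero_left)
  then show ?thesis by (simp add: has_field_derivative_iff)
qed

text \<open>All admissible complements yield the same derivative by
  \<open>has_crossing_derivative\<close>. For existence take the orthogonal complement of
  \<open>\<Lambda> t\<close>: for s near t the projection onto \<open>\<Lambda> t\<close> is
  injective on \<open>\<Lambda> s\<close>, hence onto by dimension, and a preimage of v differs from
  v by an element of that complement.\<close>

lemma crossing_form_eq:
  assumes lag: "\<And>s. s \<in> {0..1} \<Longrightarrow> lagrangian \<omega> (\<Lambda> s)"
    and D: "((\<lambda>s. orth_proj (\<Lambda> s)) has_vector_derivative D) (at t within {0..1})"
    and t: "t \<in> {0..1}" and v: "v \<in> \<Lambda> t"
  shows "crossing_form \<omega> \<Lambda> t v = \<omega> v (D v)"
proof -
  let ?F = "at t within {0..1::real}"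
  let ?P = "\<lambda>s. orth_proj (\<Lambda> s)"
  have sub: "subspace (\<Lambda> s)" if "s \<in> {0..1}" for s using lag[OF that] by (simp add: lagrangian_def)
  define W where "W = I ` \<Lambda> t"
  have Wl: "lagrangian \<omega> W" "W \<inter> \<Lambda> t = {0}" unfolding W_def using lagrangian_complement[OF lag[OF t]] by auto
  have in01: "\<forall>\<^sub>F s in ?F. s \<in> {0..1}" by (simp add: eventually_at) (use zero_less_one in blast)
  have Pc: "(?P \<longlongrightarrow> ?P t) ?F"
    using has_vector_derivative_continuous[OF D] by (simp add: continuous_within)
  have ex: "\<forall>\<^sub>F s in ?F. \<exists>x. x \<in> W \<and> v + x \<in> \<Lambda> s"
  proof -
    have "\<forall>\<^sub>F s in ?F. norm (?P s - ?P t) < 1"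
      using tendstoD[OF Pc, of 1] by (simp add: dist_norm)
    then show ?thesis using in01
    proof eventually_elim
      case (elim s)
      have lin: "linear (blinfun_apply (?P t))" by (rule bounded_linear.linear[OF blinfun.bounded_linear_right])
      have "inj_on (blinfun_apply (?P t)) (\<Lambda> s)"
      proof (rule linear_injective_on_subspace_0[OF lin sub[OF elim(2)], THEN iffD2], intro ballI impI)
        fix x assume x: "x \<in> \<Lambda> s" "?P t x = 0"
        then have "x = (?P s - ?P t) x" using orth_proj_fixes[OF sub[OF elim(2)]] by (simp add: blinfun.diff_left)
        then have "norm x \<le> norm (?P s - ?P t) * norm x" by (metis norm_blinfun)
        moreover have "norm x > 0 \<Longrightarrow> norm (?P s - ?P t) * norm x < 1 * norm x"
          using elim(1) by (intro mult_strict_right_mono) auto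
        ultimately show "x = 0" by fastforce
      qed
      then have "dim (blinfun_apply (?P t) ` \<Lambda> s) = dim (\<Lambda> s)"
        using lin sub[OF elim(2)] by (intro dim_image_eq) (auto simp: span_eq_iff[THEN iffD2])
      also have "\<dots> = dim (\<Lambda> t)" using dim_lagrangian_eq lag t elim by blast
      finally have "blinfun_apply (?P t) ` \<Lambda> s = \<Lambda> t"
        using lin sub[OF elim(2)] sub[OF t] orth_proj_in[OF sub[OF t]]
        by (intro subspace_dim_equal) (auto simp: linear_subspace_image)
      then obtain u where u: "u \<in> \<Lambda> s" "?P t u = v" using v by (metis imageE)
      have "\<And>y. y \<in> \<Lambda> t \<Longrightarrow> inner (u - v) y = 0" using orth_proj_orthogonal[OF sub[OF t], of _ u] u by auto
      then have "I (u - v) \<in> \<Lambda> t" using lagrangian_I_orthogonal[OF lag[OF t]] by blast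
      then have "I (- I (u - v)) \<in> W" unfolding W_def using sub[OF t] by (intro imageI subspace_neg)
      then have "u - v \<in> W" using I_linear by (simp add: linear_neg I_square)
      then show ?case using u by (intro exI[of _ "u - v"]) auto
    qed
  qed
  define w where "w s = (if s = t then 0 else SOME x. x \<in> W \<and> v + x \<in> \<Lambda> s)" for s
  have w: "w t = 0" "\<forall>\<^sub>F s in ?F. w s \<in> W \<and> v + w s \<in> \<Lambda> s"
  proof -
    have "\<forall>\<^sub>F s in ?F. s \<noteq> t" by (simp add: eventually_at) (use zero_less_one in blast)
    with ex show "\<forall>\<^sub>F s in ?F. w s \<in> W \<and> v + w s \<in> \<Lambda> s"
    proof eventually_elim
      case (elim s)
      then show ?case unfolding w_def using someI_ex[of "\<lambda>x. x \<in> W \<and> v + x \<in> \<Lambda> s"] by auto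
    qed
  qed (simp add: w_def)
  have nontriv: "?F \<noteq> bot"
    using t by (auto simp: trivial_limit_within islimpt_Icc)
  show ?thesis unfolding crossing_form_def
  proof (rule the_equality)
    show "\<exists>W w. lagrangian \<omega> W \<and> W \<inter> \<Lambda> t = {0} \<and> w t = 0 \<and>
       (\<forall>\<^sub>F s in ?F. w s \<in> W \<and> v + w s \<in> \<Lambda> s) \<and> ((\<lambda>s. \<omega> v (w s)) has_real_derivative \<omega> v (D v)) ?F"
      using Wl w has_crossing_derivative[OF lag D t v _ Wl(2) w] by (auto simp: lagrangian_def)
  next
    fix q assume "\<exists>W w. lagrangian \<omega> W \<and> W \<inter> \<Lambda> t = {0} \<and> w t = 0 \<and>
       (\<forall>\<^sub>F s in ?F. w s \<in> W \<and> v + w s \<in> \<Lambda> s) \<and> ((\<lambda>s. \<omega> v (w s)) has_real_derivative q) ?F"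
    then obtain W w where *: "lagrangian \<omega> W" "W \<inter> \<Lambda> t = {0}" "w t = 0"
       "\<forall>\<^sub>F s in ?F. w s \<in> W \<and> v + w s \<in> \<Lambda> s" "((\<lambda>s. \<omega> v (w s)) has_real_derivative q) ?F" by blast
    have "((\<lambda>s. \<omega> v (w s)) has_real_derivative \<omega> v (D v)) ?F"
      using * by (intro has_crossing_derivative[OF lag D t v, of W]) (auto simp: lagrangian_def)
    then show "q = \<omega> v (D v)" using *(5) unfolding has_field_derivative_iff
      by (rule tendsto_unique[OF nontriv, rotated])
  qed
qed

text \<open>Differentiating \<open>P \<gamma> = \<gamma>\<close> gives
  \<open>\<gamma>' = P \<gamma>' + D \<gamma>\<close>, and the first summand pairs to zero with
  \<gamma>. Explicit paths can then be treated through moving vectors.\<close>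

lemma crossing_form_section:
  assumes lag: "\<And>s. s \<in> {0..1} \<Longrightarrow> lagrangian \<omega> (\<Lambda> s)"
    and D: "((\<lambda>s. orth_proj (\<Lambda> s)) has_vector_derivative D) (at t within {0..1})"
    and t: "t \<in> {0..1}"
    and \<gamma>: "\<And>s. s \<in> {0..1} \<Longrightarrow> \<gamma> s \<in> \<Lambda> s" "(\<gamma> has_vector_derivative \<gamma>') (at t within {0..1})"
  shows "crossing_form \<omega> \<Lambda> t (\<gamma> t) = \<omega> (\<gamma> t) \<gamma>'"
proof -
  interpret \<omega>: bounded_bilinear \<omega> by (rule bilinear_\<omega>)
  let ?F = "at t within {0..1::real}"
  let ?P = "\<lambda>s. orth_proj (\<Lambda> s)"
  have sub: "subspace (\<Lambda> s)" if "s \<in> {0..1}" for s using lag[OF that] by (simp add: lagrangian_def)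
  have "((\<lambda>s. ?P s (\<gamma> s)) has_vector_derivative (?P t \<gamma>' + D (\<gamma> t))) ?F"
    by (rule bounded_bilinear.has_vector_derivative[OF bounded_bilinear_blinfun_apply D \<gamma>(2)])
  then have "(\<gamma> has_vector_derivative (?P t \<gamma>' + D (\<gamma> t))) ?F"
    by (rule has_vector_derivative_transform[OF t, rotated]) (simp add: orth_proj_fixes sub \<gamma>)
  moreover have "?F \<noteq> bot" using t by (auto simp: trivial_limit_within islimpt_Icc)
  ultimately have "\<gamma>' = ?P t \<gamma>' + D (\<gamma> t)"
    using vector_derivative_unique_within[OF _ \<gamma>(2)] by blast
  then have "\<omega> (\<gamma> t) \<gamma>' = \<omega> (\<gamma> t) (?P t \<gamma>') + \<omega> (\<gamma> t) (D (\<gamma> t))" by (metis \<omega>.add_right)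
  also have "\<omega> (\<gamma> t) (?P t \<gamma>') = 0"
    using lag[OF t] \<gamma>(1)[OF t] orth_proj_in[OF sub[OF t]] by (simp add: lagrangian_def)
  finally show ?thesis using crossing_form_eq[OF lag D t \<gamma>(1)[OF t]] by simp
qed

end

section \<open>Lines in the plane\<close>

definition J2 :: "real^2 \<Rightarrow> real^2" where "J2 u = vector [- u$2, u$1]"

lemma vec2_eq_iff: "(u::'a^2) = v \<longleftrightarrow> u$1 = v$1 \<and> u$2 = v$2"
  by (simp add: vec_eq_iff forall_2)

lemma inner_real2: "inner (u::real^2) v = u$1 * v$1 + u$2 * v$2"
  by (simp add: inner_vec_def sum_2)

lemma J2_nth [simp]: "J2 u $ 1 = - u$2" "J2 u $ 2 = u$1"
  by (simp_all add: J2_def)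

interpretation form2: compatible_form omega2 J2
proof (rule compatible_form.intro)
  show "linear J2" by (rule linearI) (auto simp: vec2_eq_iff)
qed (auto simp: vec2_eq_iff inner_real2 omega2_def)

text \<open>Directions are measured counterclockwise from the second coordinate axis, so that
  \<open>L0\<close> is the line at angle \<open>0\<close>.\<close>

definition dir :: "real \<Rightarrow> real^2" where "dir x = vector [- sin x, cos x]"

definition line :: "real \<Rightarrow> (real^2) set" where "line x = range (\<lambda>r. r *\<^sub>R dir x)"

lemma dir_nth [simp]: "dir x $ 1 = - sin x" "dir x $ 2 = cos x"
  by (simp_all add: dir_def)

lemma dir_inner: "inner (dir x) (dir y) = cos (x - y)"
  by (simp add: inner_real2 cos_diff algebra_simps)

lemma dir_ne_0 [simp]: "dir x \<noteq> 0"
  using dir_inner[of x x] by auto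

lemma omega2_dir: "omega2 (dir x) (dir y) = sin (y - x)"
  by (simp add: omega2_def sin_diff algebra_simps)

lemma J2_dir: "J2 (dir x) = dir (x + pi / 2)"
  by (simp add: vec2_eq_iff sin_add cos_add)

lemma continuous_on_dir [continuous_intros]:
  "continuous_on S f \<Longrightarrow> continuous_on S (\<lambda>s. dir (f s))"
proof -
  assume f: "continuous_on S f"
  have "dir x = (- sin x) *\<^sub>R axis 1 1 + cos x *\<^sub>R axis 2 1" for x by (simp add: vec2_eq_iff axis_def)
  moreover have "continuous_on S (\<lambda>s. (- sin (f s)) *\<^sub>R axis 1 1 + cos (f s) *\<^sub>R axis 2 1 :: real^2)"
    by (intro continuous_intros continuous_on_compose2[OF continuous_on_sin[OF continuous_on_id] f]
        continuous_on_compose2[OF continuous_on_cos[OF continuous_on_id] f]) auto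
  ultimately show ?thesis by simp
qed

lemma dir_has_vector_derivative:
  assumes "(f has_real_derivative c) (at t within S)"
  shows "((\<lambda>s. dir (f s)) has_vector_derivative c *\<^sub>R J2 (dir (f t))) (at t within S)"
proof -
  have "dir x = (- sin x) *\<^sub>R axis 1 1 + cos x *\<^sub>R axis 2 1" for x by (simp add: vec2_eq_iff axis_def)
  moreover have "((\<lambda>s. (- sin (f s)) *\<^sub>R axis 1 1 + cos (f s) *\<^sub>R axis 2 1 :: real^2) has_vector_derivative
      c *\<^sub>R J2 (dir (f t))) (at t within S)"
    using assms by (auto intro!: derivative_eq_intros simp: vec2_eq_iff axis_def)
  ultimately show ?thesis by simp
qed

lemma subspace_line: "subspace (line x)"
proof -
  have "line x = span {dir x}" by (simp add: line_def span_singleton)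
  then show ?thesis by simp
qed

lemma dim_line: "dim (line x) = 1"
proof -
  have "line x = span {dir x}" by (simp add: line_def span_singleton)
  then show ?thesis by (simp add: dim_insert)
qed

lemma lagrangian_line: "lagrangian omega2 (line x)"
  unfolding lagrangian_def using subspace_line dim_line
  by (auto simp: line_def omega2_def)

lemma L0_eq_line: "L0 = line 0" and L1_eq_line: "L1 = line (- (pi / 2))"
  by (auto simp: L0_def L1_def line_def vec2_eq_iff image_iff)

lemma orth_proj_line: "blinfun_apply (orth_proj (line x)) = (\<lambda>v. inner v (dir x) *\<^sub>R dir x)"
  by (rule orth_proj_apply[OF subspace_line])
    (auto simp: line_def inner_diff_left dir_inner)

lemma continuous_on_orth_proj_line: "continuous_on S (\<lambda>x. orth_proj (line x))"
  by (rule continuous_on_blinfunI) (auto simp: orth_proj_line intro!: continuous_intros)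

lemma eventually_deriv_sign:
  assumes "(g has_real_derivative d) (at t within S)" "g t = 0" "d \<noteq> 0"
  shows "\<forall>\<^sub>F s in at t within S. d * ((s - t) * g s) > 0"
proof -
  have "((\<lambda>s. d * ((g s - g t) / (s - t))) \<longlongrightarrow> d * d) (at t within S)"
    using assms(1) unfolding has_field_derivative_iff by (intro tendsto_intros)
  moreover have "d * d > 0" using assms(3) by (metis not_real_square_gt_zero)
  ultimately have "\<forall>\<^sub>F s in at t within S. d * ((g s - g t) / (s - t)) > 0"
    by (rule order_tendstoD)
  moreover have "\<forall>\<^sub>F s in at t within S. s \<noteq> t" by (simp add: eventually_at) (use zero_less_one in blast)
  ultimately show ?thesis
  proof eventually_elim
    case (elim s)
    have "d * ((s - t) * g s) = (d * ((g s - g t) / (s - t))) * (s - t)^2"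
      using elim assms(2) by (simp add: power2_eq_square)
    also have "\<dots> > 0" using elim by (simp only: zero_less_mult_iff) simp
    finally show ?case .
  qed
qed

section \<open>Positive index and signature of quadratic forms\<close>

lemma finite_dims: "finite {dim S | S. P S}" for P :: "'v::euclidean_space set \<Rightarrow> bool"
  by (rule finite_subset[of _ "{..DIM('v)}"]) (auto simp: dim_subset_UNIV)

lemma positive_index_eqI:
  fixes S :: "'v::euclidean_space set"
  assumes "subspace S" "S \<subseteq> K" "\<And>v. v \<in> S \<Longrightarrow> v \<noteq> 0 \<Longrightarrow> Q v > 0" "dim S = n"
    and "\<And>S. subspace S \<Longrightarrow> S \<subseteq> K \<Longrightarrow> (\<And>v. v \<in> S \<Longrightarrow> v \<noteq> 0 \<Longrightarrow> Q v > 0) \<Longrightarrow> dim S \<le> n"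
  shows "positive_index K Q = n"
  unfolding positive_index_def
proof (rule Max_eqI[OF finite_dims])
  fix y assume "y \<in> {dim S |S. subspace S \<and> S \<subseteq> K \<and> (\<forall>v\<in>S - {0}. 0 < Q v)}"
  then obtain S where "y = dim S" "subspace S" "S \<subseteq> K" "\<forall>v\<in>S - {0}. 0 < Q v" by blast
  then show "y \<le> n" using assms(5)[of S] by auto
next
  show "n \<in> {dim S |S. subspace S \<and> S \<subseteq> K \<and> (\<forall>v\<in>S - {0}. 0 < Q v)}"
    using assms(1-4) by blast
qed

lemma positive_index_0: "positive_index {0} Q = 0"
  by (rule positive_index_eqI[of "{0}"]) auto

lemma positive_index_nonpos:
  assumes "0 \<in> K" "\<And>v. v \<in> K \<Longrightarrow> Q v \<le> 0"
  shows "positive_index K Q = 0"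
proof (rule positive_index_eqI[of "{0}"])
  fix S :: "'a set" assume S: "subspace S" "S \<subseteq> K" "\<And>v. v \<in> S \<Longrightarrow> v \<noteq> 0 \<Longrightarrow> 0 < Q v"
  have "S \<subseteq> {0}"
  proof
    fix v assume "v \<in> S"
    then show "v \<in> {0}" using S(2) S(3)[of v] assms(2)[of v] by force
  qed
  then show "dim S \<le> 0" by simp
qed (use assms in auto)

lemma positive_index_pos:
  assumes "subspace K" "\<And>v. v \<in> K \<Longrightarrow> v \<noteq> 0 \<Longrightarrow> Q v > 0"
  shows "positive_index K Q = dim K"
  using assms by (intro positive_index_eqI[of K]) (auto simp: dim_subset)

lemma form_signature_span:
  assumes "v \<noteq> 0" "\<And>r. Q (r *\<^sub>R v) = r^2 * q"
  shows "form_signature (span {v}) Q = sgn q"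
proof -
  have d: "dim (span {v}) = 1" using assms(1) by (simp add: dim_insert)
  have inspan: "\<exists>r. u = r *\<^sub>R v" if "u \<in> span {v}" for u using that by (auto simp: span_singleton)
  consider "q > 0" | "q = 0" | "q < 0" by linarith
  then show ?thesis
  proof cases
    case 1
    then have "positive_index (span {v}) Q = 1"
      using positive_index_pos[OF subspace_span, of "{v}" Q, unfolded d] inspan assms(2) by fastforce
    moreover have "positive_index (span {v}) (\<lambda>v. - Q v) = 0"
      using assms(2) 1 by (intro positive_index_nonpos) (auto simp: span_singleton)
    ultimately show ?thesis using 1 by (simp add: form_signature_def)
  next
    case 2
    then have "positive_index (span {v}) Q = 0" "positive_index (span {v}) (\<lambda>v. - Q v) = 0"
      using assms(2) by (auto intro!: positive_index_nonpos simp: span_singleton)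
    then show ?thesis using 2 by (simp add: form_signature_def)
  next
    case 3
    then have "positive_index (span {v}) (\<lambda>v. - Q v) = 1"
      using positive_index_pos[OF subspace_span, of "{v}" "\<lambda>v. - Q v", unfolded d] inspan assms(2)
      by (fastforce simp: mult_less_0_iff)
    moreover have "positive_index (span {v}) Q = 0"
      using assms(2) 3 by (intro positive_index_nonpos) (auto simp: span_singleton mult_le_0_iff)
    ultimately show ?thesis using 3 by (simp add: form_signature_def)
  qed
qed

lemma form_signature_0: "form_signature {0} Q = 0"
  by (simp add: form_signature_def positive_index_0)

text \<open>Equals j + 1/2 strictly between neighbouring multiples of pi, and m at m pi, the mean of
  the two values beside it; a crossing at the end of a path thus counts one half.\<close>

definition half_count :: "real \<Rightarrow> real" where
  "half_count x = (of_int \<lfloor>x / pi\<rfloor> + of_int \<lceil>x / pi\<rceil>) / 2"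

lemma half_count_between:
  assumes "of_int j * pi < x" "x < (of_int j + 1) * pi"
  shows "half_count x = of_int j + 1 / 2"
proof -
  have "\<lfloor>x / pi\<rfloor> = j" using assms by (intro floor_unique) (auto simp: field_simps)
  moreover have "\<lceil>x / pi\<rceil> = j + 1" using assms by (intro ceiling_unique) (auto simp: field_simps)
  ultimately show ?thesis by (simp add: half_count_def)
qed

lemma half_count_multiple: "half_count (of_int m * pi) = of_int m"
  by (simp add: half_count_def)

lemma between_multiples_of_pi:
  assumes "sin x \<noteq> 0"
  shows "of_int \<lfloor>x / pi\<rfloor> * pi < x" "x < (of_int \<lfloor>x / pi\<rfloor> + 1) * pi"
proof -
  have "of_int \<lfloor>x / pi\<rfloor> * pi \<noteq> x" using assms by (metis sin_zero_iff_int2)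
  moreover have "of_int \<lfloor>x / pi\<rfloor> * pi \<le> x"
    using mult_right_mono[OF of_int_floor_le[of "x/pi"], of pi] by simp
  ultimately show "of_int \<lfloor>x / pi\<rfloor> * pi < x" by linarith
  show "x < (of_int \<lfloor>x / pi\<rfloor> + 1) * pi"
    using mult_strict_right_mono[OF floor_less_iff[THEN iffD1, of "x/pi" "\<lfloor>x / pi\<rfloor> + 1"], of pi] by simp
qed

text \<open>The reflection \<open>2 P - 1\<close> applied to \<open>dir x0\<close>, in the basis
  \<open>dir x0\<close>, \<open>J2 (dir x0)\<close>: the doubled angle as a number on the unit
  circle. Being a function of the projection, it is continuous on the Grassmannian and blind to the
  choice of an angle.\<close>

definition line_phase :: "real \<Rightarrow> ((real^2) \<Rightarrow>\<^sub>L (real^2)) \<Rightarrow> complex" where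
  "line_phase x0 P = Complex (2 * inner (P (dir x0)) (dir x0) - 1) (2 * inner (P (dir x0)) (J2 (dir x0)))"

lemma continuous_on_line_phase: "continuous_on S (line_phase x0)"
  unfolding line_phase_def by (intro continuous_intros)

lemma line_phase_line: "line_phase x0 (orth_proj (line (x0 + y))) = exp (2 * \<i> * of_real y)"
proof -
  have "cos (2 * y) = 2 * (cos y)\<^sup>2 - 1" by (rule cos_double_cos)
  moreover have "sin (2 * y) = 2 * sin y * cos y" by (rule sin_double)
  ultimately show ?thesis
    by (simp add: line_phase_def orth_proj_line J2_dir dir_inner complex_eq_iff Re_exp Im_exp power2_eq_square
        cos_diff sin_add cos_add algebra_simps)
qed

text \<open>Self-adjointness and idempotence give a = a^2 + b^2 for the components a, b of
  \<open>P (dir x0)\<close>; this circle is doubled and shifted to the unit circle.\<close>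

lemma norm_line_phase:
  assumes "lagrangian omega2 L"
  shows "norm (line_phase x0 (orth_proj L)) = 1"
    and "line_phase x0 (orth_proj L) = 1 \<longleftrightarrow> dir x0 \<in> L"
proof -
  let ?P = "orth_proj L" and ?f = "dir x0"
  define a b where "a = inner (?P ?f) ?f" and "b = inner (?P ?f) (J2 ?f)"
  have sub: "subspace L" using assms by (simp add: lagrangian_def)
  have "?P ?f = a *\<^sub>R ?f + b *\<^sub>R J2 ?f"
    using sin_cos_squared_add[of x0] unfolding a_def b_def
    apply (simp add: vec2_eq_iff inner_real2 power2_eq_square) by algebra
  then have "inner (?P ?f) (?P ?f) = a^2 + b^2"
    by (simp add: inner_add_left inner_add_right J2_dir dir_inner power2_eq_square)
  moreover have "inner (?P ?f) (?P ?f) = a"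
    using orth_proj_selfadjoint[OF sub, of ?f "?P ?f"] orth_proj_fixes[OF sub orth_proj_in[OF sub]]
    by (simp add: a_def inner_commute)
  ultimately have ab: "a = a^2 + b^2" by simp
  have "(2 * a - 1)^2 + (2 * b)^2 = 1" using ab by algebra
  then show "norm (line_phase x0 ?P) = 1" by (simp add: line_phase_def cmod_def a_def b_def)
  show "line_phase x0 ?P = 1 \<longleftrightarrow> ?f \<in> L"
  proof
    assume "line_phase x0 ?P = 1"
    then have "a = 1" "b = 0" by (auto simp: line_phase_def complex_eq_iff a_def b_def)
    then have "?P ?f = ?f" using \<open>?P ?f = a *\<^sub>R ?f + b *\<^sub>R J2 ?f\<close> by simp
    then show "?f \<in> L" using orth_proj_fixed_iff[OF sub] by blast
  next
    assume "?f \<in> L"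
    then have "?P ?f = ?f" using orth_proj_fixes[OF sub] by blast
    then show "line_phase x0 ?P = 1" by (simp add: line_phase_def J2_dir dir_inner complex_eq_iff)
  qed
qed

text \<open>Crossings are the times at which \<phi> is a multiple of pi. There the crossing form on
  \<open>dir x0\<close> is half the derivative of sin (2 \<phi>), the imaginary part of the phase,
  so its sign is the direction in which \<phi> passes the multiple.\<close>

lemma regular_index_line:
  assumes reg: "regular_path omega2 (line x0) \<Lambda>"
    and \<phi>: "continuous_on {0..1} \<phi>"
      "\<And>s. s \<in> {0..1} \<Longrightarrow> line_phase x0 (orth_proj (\<Lambda> s)) = exp (2 * \<i> * of_real (\<phi> s))"
  shows "regular_index omega2 (line x0) \<Lambda> = half_count (\<phi> 1) - half_count (\<phi> 0)"
proof -
  let ?f = "dir x0" and ?C = "crossings (line x0) \<Lambda>"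
  have lag: "lagrangian omega2 (\<Lambda> s)" if "s \<in> {0..1}" for s using reg that by (auto simp: regular_path_def)
  have sub: "subspace (\<Lambda> s)" if "s \<in> {0..1}" for s using lag[OF that] by (simp add: lagrangian_def)
  obtain D :: "real \<Rightarrow> (real^2) \<Rightarrow>\<^sub>L (real^2)" where
    D: "\<And>t. t \<in> {0..1} \<Longrightarrow> ((\<lambda>s. orth_proj (\<Lambda> s)) has_vector_derivative D t) (at t within {0..1})"
    using reg unfolding regular_path_def C1_subspace_path_def o_def by blast
  have cross: "t \<in> ?C \<longleftrightarrow> sin (\<phi> t) = 0" if t: "t \<in> {0..1}" for t
  proof -
    have "t \<in> ?C \<longleftrightarrow> ?f \<in> \<Lambda> t"
    proof
      assume "t \<in> ?C"
      moreover have "0 \<in> \<Lambda> t \<inter> line x0" using sub[OF t] subspace_line by (simp add: subspace_0)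
      ultimately obtain v where "v \<in> \<Lambda> t" "v \<in> line x0" "v \<noteq> 0" unfolding crossings_def by blast
      then obtain r where r: "r *\<^sub>R ?f \<in> \<Lambda> t" "r *\<^sub>R ?f \<noteq> 0" by (auto simp: line_def)
      have "(1 / r) *\<^sub>R (r *\<^sub>R ?f) \<in> \<Lambda> t" by (rule subspace_scale[OF sub[OF t] r(1)])
      moreover have "(1 / r) *\<^sub>R (r *\<^sub>R ?f) = ?f" using r(2) by auto
      ultimately show "?f \<in> \<Lambda> t" by (simp only:)
    next
      assume "?f \<in> \<Lambda> t"
      moreover have "?f \<in> line x0" by (auto simp: line_def intro: range_eqI[of _ _ 1])
      ultimately have "?f \<in> \<Lambda> t \<inter> line x0" by simp
      then show "t \<in> ?C" using t dir_ne_0 unfolding crossings_def by blast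
    qed
    also have "\<dots> \<longleftrightarrow> exp (2 * \<i> * of_real (\<phi> t)) = 1"
      using norm_line_phase(2)[OF lag[OF t], of x0] \<phi>(2)[OF t] by simp
    also have "\<dots> \<longleftrightarrow> sin (\<phi> t) = 0"
      using sin_cos_squared_add[of "\<phi> t"] by (auto simp: complex_eq_iff Re_exp Im_exp cos_double_sin sin_double)
    finally show ?thesis .
  qed
  define q where "q t = omega2 ?f (D t ?f)" for t
  have form: "crossing_form omega2 \<Lambda> t (r *\<^sub>R ?f) = r^2 * q t" if "t \<in> {0..1}" "?f \<in> \<Lambda> t" for t r
  proof -
    interpret \<omega>: bounded_bilinear omega2 by (rule form2.bilinear_\<omega>)
    have "r *\<^sub>R ?f \<in> \<Lambda> t" by (rule subspace_scale[OF sub[OF that(1)] that(2)])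
    from this have "crossing_form omega2 \<Lambda> t (r *\<^sub>R ?f) = omega2 (r *\<^sub>R ?f) (D t (r *\<^sub>R ?f))"
      by (intro form2.crossing_form_eq[OF lag D that(1)]) (use that(1) in auto)
    then show ?thesis
      by (simp add: q_def \<omega>.scaleR_left \<omega>.scaleR_right blinfun.scaleR_right power2_eq_square)
  qed
  have at_cross: "?f \<in> \<Lambda> t \<and> \<Lambda> t \<inter> line x0 = span {?f}" if t: "t \<in> ?C" for t
  proof -
    have t01: "t \<in> {0..1}" using t by (auto simp: crossings_def)
    have f: "?f \<in> \<Lambda> t"
      using norm_line_phase(2)[OF lag[OF t01], of x0] \<phi>(2)[OF t01] cross[OF t01] t sin_cos_squared_add[of "\<phi> t"]
      by (auto simp: complex_eq_iff Re_exp Im_exp cos_double_sin sin_double)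
    have "line x0 \<subseteq> \<Lambda> t" using f sub[OF t01] by (auto simp: line_def subspace_scale)
    then show ?thesis using f by (auto simp: line_def span_singleton)
  qed
  have q0: "q t \<noteq> 0" if t: "t \<in> ?C" for t
  proof
    assume q: "q t = 0"
    have t01: "t \<in> {0..1}" using t by (auto simp: crossings_def)
    have "nondegenerate_form (span {?f}) (crossing_form omega2 \<Lambda> t)"
      using reg t at_cross[OF t] by (auto simp: regular_path_def)
    moreover have "crossing_form omega2 \<Lambda> t v = 0" if "v \<in> span {?f}" for v
      using that form[OF t01] at_cross[OF t] q by (auto simp: span_singleton)
    ultimately have "?f = 0" unfolding nondegenerate_form_def
      by (metis diff_0_right insertI1 span_add span_base)
    then show False by simp
  qed
  have sig: "crossing_signature omega2 (line x0) \<Lambda> t = sgn (q t)" if t: "t \<in> ?C" for t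
  proof -
    have t01: "t \<in> {0..1}" using t by (auto simp: crossings_def)
    show ?thesis unfolding crossing_signature_def using at_cross[OF t] form[OF t01]
      by (auto intro!: form_signature_span)
  qed
  have nosig: "crossing_signature omega2 (line x0) \<Lambda> t = 0" if "t \<in> {0..1}" "t \<notin> ?C" for t
    using that by (auto simp: crossings_def crossing_signature_def form_signature_0)
  have loc: "\<forall>\<^sub>F s in at t within {0..1}.
      (s > t \<longrightarrow> half_count (\<phi> s) = half_count (\<phi> t) + crossing_signature omega2 (line x0) \<Lambda> t / 2) \<and>
      (s < t \<longrightarrow> half_count (\<phi> s) = half_count (\<phi> t) - crossing_signature omega2 (line x0) \<Lambda> t / 2)"
    if t: "t \<in> {0..1}" for t
  proof -
    have lim: "(\<phi> \<longlongrightarrow> \<phi> t) (at t within {0..1})" using \<phi>(1) t by (simp add: continuous_on_def)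
    have in01: "\<forall>\<^sub>F s in at t within {0..1}. s \<in> {0..1} \<and> s \<noteq> t" by (simp add: eventually_at) (use zero_less_one in blast)
    show ?thesis
    proof (cases "t \<in> ?C")
      case False
      then have "sin (\<phi> t) \<noteq> 0" using cross[OF t] by simp
      note b = between_multiples_of_pi[OF this]
      have "half_count (\<phi> t) = of_int \<lfloor>\<phi> t / pi\<rfloor> + 1/2" using b by (rule half_count_between)
      moreover have "\<forall>\<^sub>F s in at t within {0..1}. half_count (\<phi> s) = of_int \<lfloor>\<phi> t / pi\<rfloor> + 1/2"
        using order_tendstoD(1)[OF lim b(1)] order_tendstoD(2)[OF lim b(2)]
        by eventually_elim (rule half_count_between)
      ultimately show ?thesis using nosig[OF t False] by (auto elim: eventually_mono)
    next
      case True
      then have "sin (\<phi> t) = 0" using cross[OF t] by simp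
      then obtain m :: int where m: "\<phi> t = of_int m * pi" by (auto simp: sin_zero_iff_int2)
      let ?g = "\<lambda>s. 2 * inner (orth_proj (\<Lambda> s) ?f) (J2 ?f)"
      have "(?g has_real_derivative 2 * q t) (at t within {0..1})"
      proof -
        have "((\<lambda>s. 2 * inner (orth_proj (\<Lambda> s) ?f) (J2 ?f)) has_vector_derivative 2 * inner (D t ?f) (J2 ?f)) (at t within {0..1})"
          by (rule bounded_linear.has_vector_derivative[OF _ D[OF t], of "\<lambda>P. 2 * inner (blinfun_apply P ?f) (J2 ?f)"])
            (intro bounded_linear_intros)
        then show ?thesis by (simp add: has_real_derivative_iff_has_vector_derivative q_def form2.\<omega>_eq inner_commute)
      qed
      moreover have g: "?g s = sin (2 * \<phi> s)" if "s \<in> {0..1}" for s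
        using arg_cong[OF \<phi>(2)[OF that], of Im] by (simp add: line_phase_def Im_exp)
      moreover have "?g t = 0" using g[OF t] \<open>sin (\<phi> t) = 0\<close> by (simp add: sin_double)
      ultimately have ev: "\<forall>\<^sub>F s in at t within {0..1}. 2 * q t * ((s - t) * ?g s) > 0"
        using q0[OF True] by (intro eventually_deriv_sign) auto
      have "\<forall>\<^sub>F s in at t within {0..1}. \<phi> s > of_int m * pi - pi/2" "\<forall>\<^sub>F s in at t within {0..1}. \<phi> s < of_int m * pi + pi/2"
        by (rule order_tendstoD[OF lim]; simp add: m)+
      then show ?thesis using ev in01
      proof eventually_elim
        case (elim s)
        define y where "y = \<phi> s - of_int m * pi"
        have y: "\<bar>y\<bar> < pi / 2" using elim(1,2) unfolding y_def abs_less_iff by linarith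
        have "sin (2 * \<phi> s) = sin (2 * y + 2 * pi * of_int m)" by (simp add: y_def algebra_simps)
        also have "\<dots> = sin (2 * y)" by (simp add: sin_add sin_int_2pin cos_int_2pin)
        finally have gs: "?g s = sin (2 * y)" using g[of s] elim by simp
        have pos: "y > 0" if "sin (2 * y) > 0"
        proof (rule ccontr)
          assume "\<not> y > 0"
          then have "sin (- (2 * y)) \<ge> 0" using y by (intro sin_ge_zero) auto
          then show False using that by simp
        qed
        have neg: "y < 0" if "sin (2 * y) < 0"
        proof (rule ccontr)
          assume "\<not> y < 0"
          then have "sin (2 * y) \<ge> 0" using y by (intro sin_ge_zero) auto
          then show False using that by simp
        qed
        have up: "half_count (\<phi> s) = m + 1/2" if "y > 0"
          using that y by (intro half_count_between) (auto simp: y_def algebra_simps)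
        have down: "half_count (\<phi> s) = m - 1/2" if "y < 0"
          using that y half_count_between[of "m - 1" "\<phi> s"] by (auto simp: y_def algebra_simps)
        have *: "q t * ((s - t) * sin (2 * y)) > 0" using elim(3) unfolding gs by simp
        consider "q t > 0" "s > t" | "q t > 0" "s < t" | "q t < 0" "s > t" | "q t < 0" "s < t"
          using elim q0[OF True] by linarith
        then show ?case
        proof cases
          case 1
          with * have "sin (2*y) > 0" by (simp add: zero_less_mult_iff)
          then show ?thesis using 1 up pos sig[OF True] m by (simp add: half_count_multiple)
        next
          case 2
          with * have "sin (2*y) < 0" by (simp add: zero_less_mult_iff)
          then show ?thesis using 2 down neg sig[OF True] m by (simp add: half_count_multiple)
        next
          case 3
          with * have "sin (2*y) < 0" by (simp add: zero_less_mult_iff mult_less_0_iff)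
          then show ?thesis using 3 down neg sig[OF True] m by (simp add: half_count_multiple)
        next
          case 4
          with * have "sin (2*y) > 0" by (simp add: zero_less_mult_iff mult_less_0_iff)
          then show ?thesis using 4 up pos sig[OF True] m by (simp add: half_count_multiple)
        qed
      qed
    qed
  qed
  have "half_count (\<phi> 1) - half_count (\<phi> 0) = crossing_signature omega2 (line x0) \<Lambda> 0 / 2 +
     (\<Sum>t\<in>?C \<inter> {0<..<1}. crossing_signature omega2 (line x0) \<Lambda> t) + crossing_signature omega2 (line x0) \<Lambda> 1 / 2"
  proof (rule local_sum_jumps)
    show "finite ?C" using reg by (simp add: regular_path_def)
    show "?C \<subseteq> {0..1}" by (auto simp: crossings_def)
  qed (use nosig loc[unfolded eventually_conj_iff] in \<open>blast+\<close>)
  then show ?thesis by (simp add: regular_index_def)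
qed

text \<open>Supplies the representative demanded by \<open>mu_RS\<close>: under uniform rotation the
  crossing form is \<Delta> times the squared length, and crossings occur only where t \<Delta> is a
  multiple of pi.\<close>

lemma regular_path_line:
  assumes "\<Delta> \<noteq> 0"
  shows "regular_path omega2 (line x0) (\<lambda>s. line (x0 + s * \<Delta>))"
proof -
  let ?\<Lambda> = "\<lambda>s. line (x0 + s * \<Delta>)"
  define E where "E s = Blinfun (\<lambda>v. \<Delta> *\<^sub>R (inner v (J2 (dir (x0 + s * \<Delta>))) *\<^sub>R dir (x0 + s * \<Delta>)
      + inner v (dir (x0 + s * \<Delta>)) *\<^sub>R J2 (dir (x0 + s * \<Delta>))))" for s
  have E: "blinfun_apply (E s) = (\<lambda>v. \<Delta> *\<^sub>R (inner v (J2 (dir (x0 + s * \<Delta>))) *\<^sub>R dir (x0 + s * \<Delta>)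
      + inner v (dir (x0 + s * \<Delta>)) *\<^sub>R J2 (dir (x0 + s * \<Delta>))))" for s
    unfolding E_def by (intro bounded_linear_Blinfun_apply bounded_linear_intros)
  have ddir: "((\<lambda>s. dir (x0 + s * \<Delta>)) has_vector_derivative \<Delta> *\<^sub>R J2 (dir (x0 + t * \<Delta>))) (at t within {0..1})" for t
    by (rule dir_has_vector_derivative) (auto intro!: derivative_eq_intros)
  have D: "((\<lambda>s. orth_proj (?\<Lambda> s)) has_vector_derivative E t) (at t within {0..1})" for t
  proof (rule has_vector_derivative_blinfun)
    fix v :: "real^2"
    have "((\<lambda>s. inner v (dir (x0 + s * \<Delta>))) has_vector_derivative inner v (\<Delta> *\<^sub>R J2 (dir (x0 + t * \<Delta>)))) (at t within {0..1})"
      by (rule bounded_linear.has_vector_derivative[OF bounded_linear_inner_right ddir])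
    from bounded_bilinear.has_vector_derivative[OF bounded_bilinear_scaleR this ddir]
    show "((\<lambda>s. orth_proj (?\<Lambda> s) v) has_vector_derivative E t v) (at t within {0..1})"
      by (simp add: orth_proj_line E scaleR_add_right mult.commute add.commute)
  qed
  have "continuous_on {0..1} E"
    by (rule continuous_on_blinfunI) (auto intro!: continuous_intros simp: E J2_dir)
  then have C1: "C1_subspace_path ?\<Lambda>" unfolding C1_subspace_path_def o_def using D by blast
  have form: "crossing_form omega2 ?\<Lambda> t (r *\<^sub>R dir (x0 + t * \<Delta>)) = r^2 * \<Delta>" if t: "t \<in> {0..1}" for t r
  proof -
    interpret \<omega>: bounded_bilinear omega2 by (rule form2.bilinear_\<omega>)
    have "((\<lambda>s. r *\<^sub>R dir (x0 + s * \<Delta>)) has_vector_derivative r *\<^sub>R (\<Delta> *\<^sub>R J2 (dir (x0 + t * \<Delta>)))) (at t within {0..1})"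
      by (rule bounded_linear.has_vector_derivative[OF bounded_linear_scaleR_right ddir])
    then have "crossing_form omega2 ?\<Lambda> t (r *\<^sub>R dir (x0 + t * \<Delta>)) =
        omega2 (r *\<^sub>R dir (x0 + t * \<Delta>)) (r *\<^sub>R (\<Delta> *\<^sub>R J2 (dir (x0 + t * \<Delta>))))"
      by (intro form2.crossing_form_section[OF lagrangian_line D t]) (auto simp: line_def)
    then show ?thesis
      by (simp add: \<omega>.scaleR_left \<omega>.scaleR_right power2_eq_square J2_dir omega2_dir)
  qed
  have sin0: "\<exists>m::int. t * \<Delta> = of_int m * pi" if "t \<in> crossings (line x0) ?\<Lambda>" for t
  proof -
    have "line (x0 + t * \<Delta>) \<inter> line x0 \<noteq> {0}" using that by (simp add: crossings_def)
    moreover have "0 \<in> line (x0 + t * \<Delta>) \<inter> line x0" using subspace_line by (simp add: subspace_0)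
    ultimately obtain v where "v \<in> line (x0 + t * \<Delta>)" "v \<in> line x0" "v \<noteq> 0" by blast
    then obtain r c where "r *\<^sub>R dir (x0 + t * \<Delta>) = c *\<^sub>R dir x0" "c *\<^sub>R dir x0 \<noteq> 0" by (auto simp: line_def)
    moreover from this have "omega2 (c *\<^sub>R dir x0) (r *\<^sub>R dir (x0 + t * \<Delta>)) = 0" by (simp add: omega2_def)
    moreover have "omega2 (c *\<^sub>R dir x0) (r *\<^sub>R dir (x0 + t * \<Delta>)) = c * r * omega2 (dir x0) (dir (x0 + t * \<Delta>))"
      by (simp add: omega2_def algebra_simps)
    ultimately have "sin (t * \<Delta>) = 0" by (auto simp: omega2_dir)
    then show ?thesis by (auto simp: sin_zero_iff_int2)
  qed
  have "crossings (line x0) ?\<Lambda> \<subseteq> (\<lambda>m. of_int m * pi / \<Delta>) ` {m::int. \<bar>of_int m\<bar> \<le> \<bar>\<Delta>\<bar> / pi}"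
  proof
    fix t assume t: "t \<in> crossings (line x0) ?\<Lambda>"
    from sin0[OF this] obtain m :: int where m: "t * \<Delta> = of_int m * pi" by blast
    have "t \<in> {0..1}" using t by (auto simp: crossings_def)
    then have "\<bar>t * \<Delta>\<bar> \<le> \<bar>\<Delta>\<bar>" by (simp add: abs_mult mult_left_le_one_le)
    then have "\<bar>of_int m\<bar> \<le> \<bar>\<Delta>\<bar> / pi" unfolding m by (simp add: abs_mult field_simps)
    moreover have "t = of_int m * pi / \<Delta>" using m assms by (simp add: field_simps)
    ultimately show "t \<in> (\<lambda>m. of_int m * pi / \<Delta>) ` {m::int. \<bar>of_int m\<bar> \<le> \<bar>\<Delta>\<bar> / pi}" by auto
  qed
  moreover have "finite {m::int. \<bar>of_int m\<bar> \<le> \<bar>\<Delta>\<bar> / pi}"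
  proof (rule finite_subset)
    show "{m::int. \<bar>of_int m\<bar> \<le> \<bar>\<Delta>\<bar> / pi} \<subseteq> {-\<lceil>\<bar>\<Delta>\<bar> / pi\<rceil>..\<lceil>\<bar>\<Delta>\<bar> / pi\<rceil>}"
      by (auto simp: abs_le_iff) linarith+
  qed simp
  ultimately have fin: "finite (crossings (line x0) ?\<Lambda>)" by (meson finite_imageI finite_subset)
  have "nondegenerate_form (?\<Lambda> t \<inter> line x0) (crossing_form omega2 ?\<Lambda> t)" if t: "t \<in> crossings (line x0) ?\<Lambda>" for t
    unfolding nondegenerate_form_def
  proof (intro ballI impI)
    fix u assume u: "u \<in> ?\<Lambda> t \<inter> line x0"
      and *: "\<forall>v\<in>?\<Lambda> t \<inter> line x0. crossing_form omega2 ?\<Lambda> t (u + v) - crossing_form omega2 ?\<Lambda> t u - crossing_form omega2 ?\<Lambda> t v = 0"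
    have t01: "t \<in> {0..1}" using t by (auto simp: crossings_def)
    obtain r where r: "u = r *\<^sub>R dir (x0 + t * \<Delta>)" using u by (auto simp: line_def)
    have "u + u = (r + r) *\<^sub>R dir (x0 + t * \<Delta>)" unfolding r by (rule scaleR_add_left[symmetric])
    then have "(r + r)^2 * \<Delta> - r^2 * \<Delta> - r^2 * \<Delta> = 0"
      using *[rule_format, OF u] form[OF t01] r by simp
    then have "r^2 * \<Delta> = 0" by algebra
    then show "u = 0" using assms r by simp
  qed
  then show ?thesis unfolding regular_path_def using C1 fin lagrangian_line by blast
qed

lemma line_phase_log:
  assumes "continuous_on {0..1::real} p" "\<And>s. s \<in> {0..1} \<Longrightarrow> norm (p s :: complex) = 1"
  obtains \<phi> where "continuous_on {0..1} \<phi>" "\<And>s. s \<in> {0..1} \<Longrightarrow> p s = exp (2 * \<i> * of_real (\<phi> s))"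
proof -
  have "contractible {0..1::real}" by (intro convex_imp_contractible) auto
  then obtain g where g: "continuous_on {0..1} g" "\<And>s. s \<in> {0..1} \<Longrightarrow> p s = exp (g s)"
    using continuous_logarithm_on_contractible[of "{0..1}" p] assms by (metis norm_zero zero_neq_one)
  show ?thesis
  proof
    show "continuous_on {0..1} (\<lambda>s. Im (g s) / 2)" by (intro continuous_intros g) auto
    fix s :: real assume s: "s \<in> {0..1}"
    then have "exp (Re (g s)) = 1" using assms(2)[OF s] g(2)[OF s] by simp
    then have "g s = 2 * \<i> * of_real (Im (g s) / 2)" by (simp add: complex_eq_iff)
    then show "p s = exp (2 * \<i> * of_real (Im (g s) / 2))" using g(2)[OF s] by metis
  qed
qed

lemma orth_proj_line_in_lag_grass: "orth_proj (line x) \<in> lag_grass omega2"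
  unfolding lag_grass_def using lagrangian_line by blast

text \<open>The angle is already lifted to the real line, where \<phi> deforms linearly to uniform
  rotation. Conversely any representative has the same total change of angle. The start contributes
  0 and the end, not a multiple of pi, a floor plus 1/2.\<close>

lemma mu_RS_line:
  assumes \<phi>: "continuous_on {0..1} \<phi>" "\<phi> 0 = 0" "sin (\<phi> 1) \<noteq> 0"
  shows "mu_RS omega2 (line x0) (\<lambda>s. line (x0 + \<phi> s)) = of_int \<lfloor>\<phi> 1 / pi\<rfloor> + 1 / 2"
proof -
  let ?\<Lambda> = "\<lambda>s. line (x0 + \<phi> s)"
  have ind: "regular_index omega2 (line x0) \<Lambda>' = of_int \<lfloor>\<phi> 1 / pi\<rfloor> + 1 / 2"
    if reg: "regular_path omega2 (line x0) \<Lambda>'"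
      and hom: "homotopic_paths (lag_grass omega2) (orth_proj \<circ> ?\<Lambda>) (orth_proj \<circ> \<Lambda>')" for \<Lambda>'
  proof -
    let ?p = "\<lambda>s. line_phase x0 (orth_proj (\<Lambda>' s))"
    have path: "path (orth_proj \<circ> \<Lambda>')" using homotopic_paths_imp_path[OF hom] by blast
    have lag: "lagrangian omega2 (\<Lambda>' s)" if "s \<in> {0..1}" for s using reg that by (auto simp: regular_path_def)
    have cp: "continuous_on {0..1} ?p"
      using path unfolding path_def o_def by (rule continuous_on_compose2[OF continuous_on_line_phase]) auto
    obtain \<psi> where \<psi>: "continuous_on {0..1} \<psi>" "\<And>s. s \<in> {0..1} \<Longrightarrow> ?p s = exp (2 * \<i> * of_real (\<psi> s))"
      using line_phase_log[OF cp] norm_line_phase(1)[OF lag] by metis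
    \<comment> \<open>The angle chosen along the representative may start at any multiple n pi; n
      drops out of the difference of counts.\<close>
    have "orth_proj (?\<Lambda> 0) = orth_proj (\<Lambda>' 0)" using homotopic_paths_imp_pathstart[OF hom] by (simp add: pathstart_def)
    then have "exp (2 * \<i> * of_real (\<psi> 0)) = 1" using \<psi>(2)[of 0] line_phase_line[of x0 "\<phi> 0"] \<phi>(2) by simp
    then have "\<exists>n::int. 2 * \<psi> 0 = of_int (2 * n) * pi" unfolding exp_eq_1 by simp
    then obtain n :: int where "2 * \<psi> 0 = of_int (2 * n) * pi" by blast
    then have n: "\<psi> 0 = of_int n * pi" by simp
    have ne: "line_phase x0 P \<noteq> 0" if "P \<in> lag_grass omega2" for P
      using that norm_line_phase(1)[of _ x0] by (auto simp: lag_grass_def) (metis norm_zero zero_neq_one)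
    have "homotopic_paths (- {0}) (line_phase x0 \<circ> (orth_proj \<circ> ?\<Lambda>)) (line_phase x0 \<circ> (orth_proj \<circ> \<Lambda>'))"
      by (rule homotopic_paths_continuous_image[OF hom continuous_on_line_phase])
       (use ne in blast)
    then have "2 * \<i> * of_real (\<phi> 1) - 2 * \<i> * of_real (\<phi> 0) = 2 * \<i> * of_real (\<psi> 1) - 2 * \<i> * of_real (\<psi> 0)"
      by (rule logs_of_homotopic_paths[where a = "\<lambda>s. 2 * \<i> * of_real (\<phi> s)" and b = "\<lambda>s. 2 * \<i> * of_real (\<psi> s)"])
        (auto intro!: continuous_intros \<phi> \<psi> simp: \<psi>(2) line_phase_line)
    then have "\<phi> 1 = \<psi> 1 - of_int n * pi" using \<phi>(2) n by (simp add: complex_eq_iff)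
    then have \<psi>1: "\<psi> 1 = \<phi> 1 + of_int n * pi" by simp
    note b = between_multiples_of_pi[OF \<phi>(3)]
    have "half_count (\<psi> 1) = of_int (\<lfloor>\<phi> 1 / pi\<rfloor> + n) + 1/2"
      using b unfolding \<psi>1 by (intro half_count_between) (auto simp: algebra_simps)
    then show ?thesis using regular_index_line[OF reg \<psi>] n by (simp add: half_count_multiple)
  qed
  define \<Lambda>' where "\<Lambda>' s = line (x0 + s * \<phi> 1)" for s
  have reg: "regular_path omega2 (line x0) \<Lambda>'" unfolding \<Lambda>'_def using \<phi>(3) by (intro regular_path_line) auto
  have hom: "homotopic_paths (lag_grass omega2) (orth_proj \<circ> ?\<Lambda>) (orth_proj \<circ> \<Lambda>')"
  proof -
    have "homotopic_paths UNIV \<phi> (\<lambda>s. s * \<phi> 1)"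
      by (rule homotopic_paths_linear) (auto simp: path_def pathstart_def pathfinish_def \<phi> intro!: continuous_intros)
    then have "homotopic_paths (lag_grass omega2) ((\<lambda>y. orth_proj (line (x0 + y))) \<circ> \<phi>) ((\<lambda>y. orth_proj (line (x0 + y))) \<circ> (\<lambda>s. s * \<phi> 1))"
    proof (rule homotopic_paths_continuous_image)
      show "continuous_on UNIV (\<lambda>y. orth_proj (line (x0 + y)))"
        by (rule continuous_on_compose2[OF continuous_on_orth_proj_line]) (auto intro!: continuous_intros)
    qed (auto simp: orth_proj_line_in_lag_grass)
    then show ?thesis by (simp add: o_def \<Lambda>'_def)
  qed
  show ?thesis unfolding mu_RS_def
    by (rule the_equality) (use reg hom ind in metis)+
qed

section \<open>Paths of symmetric unitary matrices\<close>

text \<open>A symmetric unitary matrix \<open>(w11 w12; w12 w22)\<close> over the complex numbers; \<open>wdet\<close> is its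
  determinant and \<open>wchar\<close> is \<open>- det (1 - W)\<close>.\<close>

definition sym_unitary :: "complex \<Rightarrow> complex \<Rightarrow> complex \<Rightarrow> bool" where
  "sym_unitary w11 w12 w22 \<longleftrightarrow> w11 * cnj w11 + w12 * cnj w12 = 1 \<and> w12 * cnj w12 + w22 * cnj w22 = 1 \<and>
     w11 * cnj w12 + w12 * cnj w22 = 0"

definition wdet :: "complex \<Rightarrow> complex \<Rightarrow> complex \<Rightarrow> complex" where
  "wdet w11 w12 w22 = w11 * w22 - w12 * w12"

definition wchar :: "complex \<Rightarrow> complex \<Rightarrow> complex \<Rightarrow> complex" where
  "wchar w11 w12 w22 = w12 * w12 - (1 - w11) * (1 - w22)"

text \<open>For a symmetric unitary W the inverse is the entrywise conjugate, and the adjugate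
  expresses it through \<open>wdet\<close>. The last identity says that \<open>wchar\<close> is a
  real multiple of a square root of the determinant.\<close>

lemma sym_unitary_wdet:
  assumes "sym_unitary w11 w12 w22"
  shows "wdet w11 w12 w22 * cnj w22 = w11" "wdet w11 w12 w22 * cnj w11 = w22"
    "wdet w11 w12 w22 * cnj w12 = - w12" "wdet w11 w12 w22 * cnj (wdet w11 w12 w22) = 1"
    "norm (wdet w11 w12 w22) = 1"
    "wdet w11 w12 w22 * cnj (wchar w11 w12 w22) = wchar w11 w12 w22"
proof -
  let ?D = "wdet w11 w12 w22"
  have 1: "w11 * cnj w11 + w12 * cnj w12 = 1" "w12 * cnj w12 + w22 * cnj w22 = 1"
    "w11 * cnj w12 + w12 * cnj w22 = 0" using assms by (auto simp: sym_unitary_def)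
  have 2: "cnj w11 * w12 + cnj w12 * w22 = 0" using arg_cong[OF 1(3), of cnj] by simp
  show a: "?D * cnj w22 = w11" unfolding wdet_def using 1 by algebra
  show b: "?D * cnj w11 = w22" unfolding wdet_def using 1 2 by algebra
  show c: "?D * cnj w12 = - w12" unfolding wdet_def using 1 by algebra
  have "?D * cnj ?D = 1"
  proof -
    have "?D * (?D * cnj ?D) = (?D * cnj w11) * (?D * cnj w22) - (?D * cnj w12) * (?D * cnj w12)"
      by (simp add: wdet_def algebra_simps)
    also have "\<dots> = ?D" unfolding a b c by (simp add: wdet_def mult.commute)
    finally have "?D * (?D * cnj ?D - 1) = 0" by (simp add: algebra_simps)
    moreover have "?D \<noteq> 0"
    proof
      assume "?D = 0"
      then have "w11 = 0" "w12 = 0" using a c by auto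
      then show False using 1 by simp
    qed
    ultimately show ?thesis by simp
  qed
  then show d: "?D * cnj ?D = 1" .
  then have "(norm ?D)^2 = 1" by (metis complex_norm_square of_real_eq_1_iff)
  then show "norm ?D = 1" by (simp add: power2_eq_1_iff) (metis norm_ge_zero not_one_le_zero le_minus_one_simps(3) neg_0_le_iff_le)
  have w: "wchar w11 w12 w22 = w11 + w22 - 1 - ?D" by (simp add: wchar_def wdet_def algebra_simps)
  have "?D * cnj (w11 + w22 - 1 - ?D) = ?D * cnj w11 + ?D * cnj w22 - ?D - ?D * cnj ?D"
    by (simp add: distrib_left right_diff_distrib)
  also have "\<dots> = w11 + w22 - 1 - ?D" unfolding a b d by simp
  finally show "?D * cnj (wchar w11 w12 w22) = wchar w11 w12 w22" unfolding w .
qed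

lemma wchar_eq: "wchar w11 w12 w22 = w11 + w22 - 1 - wdet w11 w12 w22"
  by (simp add: wchar_def wdet_def algebra_simps)

text \<open>Determinant 1 forces w22 to be the conjugate of w11, so \<open>wchar\<close> is 2 Re w11
  - 2. This sign keeps \<rho> from passing a multiple of pi on the wrong branch of the
  count.\<close>

lemma sym_unitary_wdet_1:
  assumes "sym_unitary w11 w12 w22" "wdet w11 w12 w22 = 1"
  shows "Im (wchar w11 w12 w22) = 0" "Re (wchar w11 w12 w22) \<le> 0"
    "wchar w11 w12 w22 = 0 \<Longrightarrow> w11 = 1 \<and> w12 = 0 \<and> w22 = 1"
proof -
  have w22: "w22 = cnj w11" using sym_unitary_wdet(2)[OF assms(1)] assms(2) by simp
  have n: "(norm w11)^2 + (norm w12)^2 = 1"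
    using assms(1) unfolding sym_unitary_def complex_norm_square[symmetric] by (metis of_real_add of_real_eq_1_iff)
  have "(norm w11)^2 \<le> 1^2" using n zero_le_power2[of "norm w12"] unfolding one_power2 by linarith
  then have "norm w11 \<le> 1" by (rule power2_le_imp_le) simp
  then have le: "Re w11 \<le> 1" using complex_Re_le_cmod[of w11] by linarith
  have wc: "wchar w11 w12 w22 = 2 * Re w11 - 2" unfolding wchar_eq assms(2) by (simp add: w22 complex_eq_iff)
  show "Im (wchar w11 w12 w22) = 0" "Re (wchar w11 w12 w22) \<le> 0" using wc le by auto
  assume "wchar w11 w12 w22 = 0"
  then have r: "Re w11 = 1" using wc by (simp add: complex_eq_iff)
  then have "(Im w11)^2 + (norm w12)^2 = 0" using n by (simp add: cmod_power2)
  then have "Im w11 = 0" "norm w12 = 0" by (auto simp: sum_power2_eq_zero_iff)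
  then show "w11 = 1 \<and> w12 = 0 \<and> w22 = 1" using r w22 by (auto simp: complex_eq_iff)
qed

text \<open>Divided by the square root e^(i \<rho>) of the determinant, \<open>wchar\<close> equals
  its own conjugate.\<close>

lemma wchar_phase:
  assumes "sym_unitary w11 w12 w22" "wdet w11 w12 w22 = exp (2 * \<i> * of_real \<rho>)"
  shows "wchar w11 w12 w22 = of_real (Re (wchar w11 w12 w22 * exp (- (\<i> * of_real \<rho>)))) * exp (\<i> * of_real \<rho>)"
proof -
  define x where "x = wchar w11 w12 w22 * exp (- (\<i> * of_real \<rho>))"
  have e: "exp (- (\<i> * of_real \<rho>)) * exp (\<i> * of_real \<rho>) = 1" by (simp flip: exp_add)
  have e2: "exp (2 * \<i> * of_real \<rho>) * exp (- (\<i> * of_real \<rho>)) = exp (\<i> * of_real \<rho>)"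
    by (simp flip: exp_add)
  have "cnj x = cnj (wchar w11 w12 w22) * exp (\<i> * of_real \<rho>)" by (simp add: x_def exp_cnj)
  also have "\<dots> = (exp (2 * \<i> * of_real \<rho>) * cnj (wchar w11 w12 w22)) * exp (- (\<i> * of_real \<rho>))"
    using e2 by (simp add: algebra_simps)
  also have "\<dots> = x" using sym_unitary_wdet(6)[OF assms(1)] assms(2) by (simp add: x_def)
  finally have "x = of_real (Re x)" by (simp add: complex_eq_iff)
  then show ?thesis using e unfolding x_def[symmetric] by (metis (no_types, lifting) mult.assoc mult.right_neutral x_def)
qed

text \<open>The last claim: if the symmetric matrix \<open>1 - W\<close> kills y with y1^2 + y2^2 =
  1, it has rank at most one and is \<mu> times the square of the row (y2, -y1), with \<mu> its
  trace.\<close>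

lemma kernel_algebra:
  fixes w11 w12 w22 y1 y2 :: complex
  assumes "w11 * y1 + w12 * y2 = y1" "w12 * y1 + w22 * y2 = y2"
  shows "wchar w11 w12 w22 * y1 = 0" "wchar w11 w12 w22 * y2 = 0"
    and "y1 * y1 + y2 * y2 = 1 \<Longrightarrow> \<mu> = (1 - w11) + (1 - w22) \<Longrightarrow>
      1 - w11 = \<mu> * (y2 * y2) \<and> 1 - w22 = \<mu> * (y1 * y1) \<and> w12 = \<mu> * (y1 * y2)"
proof -
  have a: "(1 - w11) * y1 = w12 * y2" and b: "(1 - w22) * y2 = w12 * y1" using assms by (auto simp: algebra_simps)
  show "wchar w11 w12 w22 * y1 = 0" unfolding wchar_def using a b by algebra
  show "wchar w11 w12 w22 * y2 = 0" unfolding wchar_def using a b by algebra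
  assume n: "y1 * y1 + y2 * y2 = 1" and \<mu>: "\<mu> = (1 - w11) + (1 - w22)"
  have "1 - w11 = \<mu> * (y2 * y2)" unfolding \<mu> using a b n by algebra
  moreover have "1 - w22 = \<mu> * (y1 * y1)" unfolding \<mu> using a b n by algebra
  moreover have "w12 = \<mu> * (y1 * y2)" unfolding \<mu> using a b n by algebra
  ultimately show "1 - w11 = \<mu> * (y2 * y2) \<and> 1 - w22 = \<mu> * (y1 * y1) \<and> w12 = \<mu> * (y1 * y2)" by blast
qed

lemma wchar_kernel:
  assumes "w11 * of_real x1 + w12 * of_real x2 = of_real x1" "w12 * of_real x1 + w22 * of_real x2 = of_real x2"
    "x1 \<noteq> 0 \<or> x2 \<noteq> 0"
  shows "wchar w11 w12 w22 = 0"
  using kernel_algebra(1,2)[OF assms(1,2)] assms(3) by auto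

text \<open>Away from determinant 1, divide \<open>1 - W\<close> by its trace \<mu>. Inverting W by
  conjugation shows that the quotient is real; it is symmetric with trace 1 and determinant 0, an
  orthogonal projection of the real plane, and its kernel contains a real unit vector.\<close>

lemma wchar_kernel_exists:
  assumes su: "sym_unitary w11 w12 w22" and 0: "wchar w11 w12 w22 = 0"
  shows "\<exists>x1 x2. x1^2 + x2^2 = 1 \<and> w11 * of_real x1 + w12 * of_real x2 = of_real x1 \<and>
    w12 * of_real x1 + w22 * of_real x2 = of_real x2"
proof (cases "wdet w11 w12 w22 = 1")
  case True
  then show ?thesis using sym_unitary_wdet_1(3)[OF su True 0] by (intro exI[of _ 1] exI[of _ 0]) auto
next
  case False
  define D where "D = wdet w11 w12 w22"
  define \<mu> where "\<mu> = 1 - D"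
  have \<mu>: "\<mu> \<noteq> 0" using False by (simp add: \<mu>_def D_def)
  define \<alpha> \<beta> \<gamma> where "\<alpha> = (1 - w11) / \<mu>" and "\<beta> = w12 / \<mu>" and "\<gamma> = (1 - w22) / \<mu>"
  have w: "w11 = 1 - \<mu> * \<alpha>" "w12 = \<mu> * \<beta>" "w22 = 1 - \<mu> * \<gamma>" using \<mu> by (auto simp: \<alpha>_def \<beta>_def \<gamma>_def)
  have D\<mu>: "D * cnj \<mu> = - \<mu>" using sym_unitary_wdet(4)[OF su] by (simp add: \<mu>_def D_def[symmetric] algebra_simps)
  have "w11 + w22 - 1 - D = 0" using 0 wchar_eq D_def by metis
  then have "\<mu> * (\<alpha> + \<gamma>) = \<mu> * 1" unfolding w by (simp add: \<mu>_def algebra_simps)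
  then have sum: "\<alpha> + \<gamma> = 1" using mult_left_cancel[OF \<mu>] by blast
  have "D * cnj w22 = w11" using sym_unitary_wdet(1)[OF su] by (simp add: D_def)
  then have "D * cnj (1 - \<mu> * \<gamma>) = 1 - \<mu> * \<alpha>" unfolding w .
  moreover have "D * cnj (1 - \<mu> * \<gamma>) = D - (D * cnj \<mu>) * cnj \<gamma>" by (simp add: algebra_simps)
  ultimately have "D + \<mu> * cnj \<gamma> = 1 - \<mu> * \<alpha>" unfolding D\<mu> by simp
  then have "\<mu> * (cnj \<gamma> + \<alpha>) = \<mu> * 1" by (simp add: \<mu>_def algebra_simps)
  then have "cnj \<gamma> + \<alpha> = 1" using mult_left_cancel[OF \<mu>] by blast
  then have "cnj \<gamma> = \<gamma>" using sum by (metis add.commute add_right_cancel)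
  then have \<gamma>r: "\<gamma> = of_real (Re \<gamma>)" by (simp add: complex_eq_iff)
  have \<alpha>r: "\<alpha> = of_real (1 - Re \<gamma>)" using sum \<gamma>r by (metis add_diff_cancel_right' of_real_1 of_real_diff)
  have "D * cnj w12 = - w12" using sym_unitary_wdet(3)[OF su] by (simp add: D_def)
  then have "D * cnj (\<mu> * \<beta>) = - (\<mu> * \<beta>)" unfolding w .
  then have "(D * cnj \<mu>) * cnj \<beta> = - \<mu> * \<beta>" by (simp add: mult.assoc)
  then have "\<mu> * cnj \<beta> = \<mu> * \<beta>" unfolding D\<mu> by simp
  then have "cnj \<beta> = \<beta>" using \<mu> by simp
  then have \<beta>r: "\<beta> = of_real (Re \<beta>)" by (simp add: complex_eq_iff)
  define g b where "g = Re \<gamma>" and "b = Re \<beta>"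
  have "\<mu> * \<mu> * (\<beta> * \<beta> - \<alpha> * \<gamma>) = 0" using 0 unfolding wchar_def w by (simp add: algebra_simps)
  then have "\<beta> * \<beta> = \<alpha> * \<gamma>" using \<mu> by simp
  then have "of_real (b * b) = (of_real ((1 - g) * g) :: complex)"
    using \<alpha>r \<beta>r \<gamma>r unfolding g_def b_def by (metis of_real_mult)
  then have bg: "b * b = (1 - g) * g" using of_real_eq_iff by blast
  \<comment> \<open>(g, b) solves both equations and has squared length g, by b^2 = (1 - g) g. For g
    = 0 also b = 0, and the second basis vector serves.\<close>
  obtain x1 x2 :: real where x: "(1 - g) * x1 = b * x2" "b * x1 = g * x2" "x1^2 + x2^2 = 1"
  proof (cases "g = 0")
    case True
    then show ?thesis using bg that[of 0 1] by simp
  next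
    case False
    have g2: "g^2 + b^2 = g" using bg by (simp add: power2_eq_square algebra_simps)
    then have gpos: "g > 0" using False by (metis less_eq_real_def sum_power2_ge_zero)
    show ?thesis
    proof (rule that[of "g / sqrt g" "b / sqrt g"])
      show "(g / sqrt g)\<^sup>2 + (b / sqrt g)\<^sup>2 = 1"
        using gpos g2 by (simp add: power_divide add_divide_distrib[symmetric])
    qed (use bg gpos in \<open>simp_all add: field_simps\<close>)
  qed
  have "\<mu> * \<alpha> * of_real x1 = \<mu> * \<beta> * of_real x2" "\<mu> * \<beta> * of_real x1 = \<mu> * \<gamma> * of_real x2"
  proof -
    have "complex_of_real ((1 - g) * x1) = of_real (b * x2)" "complex_of_real (b * x1) = of_real (g * x2)"
      unfolding x(1,2) by (rule refl)+
    then have "\<alpha> * of_real x1 = \<beta> * of_real x2" "\<beta> * of_real x1 = \<gamma> * of_real x2"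
      using \<alpha>r \<beta>r \<gamma>r unfolding g_def[symmetric] b_def[symmetric] of_real_mult by simp_all
    then show "\<mu> * \<alpha> * of_real x1 = \<mu> * \<beta> * of_real x2" "\<mu> * \<beta> * of_real x1 = \<mu> * \<gamma> * of_real x2"
      by (simp_all add: mult.assoc)
  qed
  then show ?thesis using x(3) unfolding w by (intro exI[of _ x1] exI[of _ x2]) (auto simp: algebra_simps)
qed

section \<open>Jumps of the phase count at a single time\<close>

lemma floor_divide_bounds:
  fixes c x :: real
  assumes "c > 0"
  shows "of_int \<lfloor>x / c\<rfloor> * c \<le> x" "x < (of_int \<lfloor>x / c\<rfloor> + 1) * c"
proof -
  show "of_int \<lfloor>x / c\<rfloor> * c \<le> x"
    using mult_right_mono[OF of_int_floor_le[of "x / c"], of c] assms by simp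
  have "x / c < of_int \<lfloor>x / c\<rfloor> + 1" by linarith
  then show "x < (of_int \<lfloor>x / c\<rfloor> + 1) * c" unfolding pos_divide_less_eq[OF assms] .
qed

text \<open>Away from crossings this is \<open>\<rho> - A\<close> in units of \<open>\<pi>\<close>, where \<open>A \<in> (0, 2\<pi>)\<close> is the sum of the
  half arguments of the eigenvalues of \<open>W\<close>; at a crossing it is the mean of the one-sided limits.\<close>

definition phase_count :: "real \<Rightarrow> real \<Rightarrow> bool \<Rightarrow> real" where
  "phase_count \<rho> \<kappa> e =
    (if \<kappa> > 0 then 2 * of_int \<lfloor>\<rho> / (2 * pi)\<rfloor>
     else if \<kappa> < 0 then 2 * of_int \<lfloor>(\<rho> + pi) / (2 * pi)\<rfloor> - 1
     else if e then of_int \<lfloor>\<rho> / pi\<rfloor> - 1 else of_int \<lfloor>\<rho> / pi\<rfloor> - 1 / 2)"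

lemma phase_count_pos:
  assumes "\<kappa> > 0" "2 * of_int j * pi < \<rho>" "\<rho> < (2 * of_int j + 2) * pi"
  shows "phase_count \<rho> \<kappa> e = 2 * of_int j"
proof -
  have "\<lfloor>\<rho> / (2 * pi)\<rfloor> = j" using assms by (intro floor_unique) (auto simp: field_simps)
  then show ?thesis using assms by (simp add: phase_count_def)
qed

lemma phase_count_neg:
  assumes "\<kappa> < 0" "(2 * of_int j - 1) * pi < \<rho>" "\<rho> < (2 * of_int j + 1) * pi"
  shows "phase_count \<rho> \<kappa> e = 2 * of_int j - 1"
proof -
  have "\<lfloor>(\<rho> + pi) / (2 * pi)\<rfloor> = j" using assms by (intro floor_unique) (auto simp: field_simps)
  then show ?thesis using assms by (simp add: phase_count_def)
qed

lemma exp_i_multiple_of_pi: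
  "exp (\<i> * of_real (2 * of_int j * pi)) = 1" "exp (\<i> * of_real ((2 * of_int j + 1) * pi)) = -1"
  "exp (2 * \<i> * of_real (of_int j * pi)) = 1"
proof -
  show 1: "exp (\<i> * of_real (2 * of_int j * pi)) = 1"
    by (rule exp_eq_1[THEN iffD2]) (auto intro!: exI[of _ j])
  show "exp (\<i> * of_real ((2 * of_int j + 1) * pi)) = -1"
    using 1 by (simp add: algebra_simps exp_add)
  show "exp (2 * \<i> * of_real (of_int j * pi)) = 1"
    by (rule exp_eq_1[THEN iffD2]) (auto intro!: exI[of _ j])
qed

text \<open>The situation near one time t. \<delta> vanishes exactly when W has the eigenvalue 1,
  and \<kappa> is its real amplitude relative to the phase \<rho>. The lemmas
  \<open>noncrossing\<close>, \<open>simple_crossing\<close> and \<open>full_crossing\<close> treat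
  kernels of dimension 0, 1 and 2.\<close>

locale sym_unitary_path =
  fixes w11 w12 w22 :: "real \<Rightarrow> complex" and \<rho> :: "real \<Rightarrow> real" and t :: real and d11 d12 d22 :: complex
  assumes t01: "t \<in> {0..1}"
    and su: "\<And>s. s \<in> {0..1} \<Longrightarrow> sym_unitary (w11 s) (w12 s) (w22 s)"
    and der: "(w11 has_vector_derivative d11) (at t within {0..1})"
      "(w12 has_vector_derivative d12) (at t within {0..1})"
      "(w22 has_vector_derivative d22) (at t within {0..1})"
    and \<rho>_cont: "continuous_on {0..1} \<rho>"
    and \<rho>_det: "\<And>s. s \<in> {0..1} \<Longrightarrow> wdet (w11 s) (w12 s) (w22 s) = exp (2 * \<i> * of_real (\<rho> s))"
begin

abbreviation "\<delta> s \<equiv> wchar (w11 s) (w12 s) (w22 s)"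
abbreviation "F \<equiv> at t within {0..1}"

definition \<kappa> :: "real \<Rightarrow> real" where "\<kappa> s = Re (\<delta> s * exp (- (\<i> * of_real (\<rho> s))))"

definition n :: "real \<Rightarrow> real" where "n s = phase_count (\<rho> s) (\<kappa> s) (w11 s = 1 \<and> w12 s = 0 \<and> w22 s = 1)"

lemma in01: "\<forall>\<^sub>F s in F. s \<in> {0..1} \<and> s \<noteq> t"
  by (simp add: eventually_at) (use zero_less_one in blast)

lemma \<delta>_eq: "s \<in> {0..1} \<Longrightarrow> \<delta> s = of_real (\<kappa> s) * exp (\<i> * of_real (\<rho> s))"
  unfolding \<kappa>_def by (rule wchar_phase[OF su \<rho>_det])

lemma \<rho>_lim: "(\<rho> \<longlongrightarrow> \<rho> t) F"
  using \<rho>_cont t01 by (simp add: continuous_on_def)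

lemma w_lim: "(w11 \<longlongrightarrow> w11 t) F" "(w12 \<longlongrightarrow> w12 t) F" "(w22 \<longlongrightarrow> w22 t) F"
  using der[THEN has_vector_derivative_continuous] by (auto simp: continuous_within)

lemma exp_lim: "((\<lambda>s. exp (- (\<i> * of_real (\<rho> s)))) \<longlongrightarrow> exp (- (\<i> * of_real (\<rho> t)))) F"
  by (intro tendsto_intros \<rho>_lim)

lemma \<kappa>_lim: "(\<kappa> \<longlongrightarrow> \<kappa> t) F"
  unfolding \<kappa>_def wchar_def by (intro tendsto_intros \<rho>_lim w_lim)

text \<open>With the sign of \<kappa> fixed, the count can jump only where \<rho> is an even
  multiple of pi and \<kappa> > 0, or an odd multiple and \<kappa> < 0. Either would give
  determinant 1 and \<delta> > 0, against \<open>sym_unitary_wdet_1\<close>.\<close>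

lemma noncrossing:
  assumes "\<delta> t \<noteq> 0"
  shows "\<forall>\<^sub>F s in F. n s = n t"
proof -
  have D1: "wdet (w11 t) (w12 t) (w22 t) = 1" if "\<rho> t = of_int m * pi" for m
    using \<rho>_det[OF t01] that exp_i_multiple_of_pi(3)[of m] by simp
  have bad: "\<not> Re (\<delta> t) > 0" if "\<rho> t = of_int m * pi" for m
    using sym_unitary_wdet_1(2)[OF su[OF t01] D1[OF that]] by simp
  have "\<kappa> t \<noteq> 0" using \<delta>_eq[OF t01] assms by auto
  then consider "\<kappa> t > 0" | "\<kappa> t < 0" by linarith
  then show ?thesis
  proof cases
    case 1
    define j where "j = \<lfloor>\<rho> t / (2 * pi)\<rfloor>"
    have "\<rho> t \<noteq> 2 * of_int j * pi"
    proof
      assume *: "\<rho> t = 2 * of_int j * pi"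
      have "\<delta> t = of_real (\<kappa> t)" using \<delta>_eq[OF t01] exp_i_multiple_of_pi(1)[of j] by (simp add: *)
      then show False using bad[of "2 * j"] 1 * by simp
    qed
    moreover have "2 * of_int j * pi \<le> \<rho> t" "\<rho> t < (2 * of_int j + 2) * pi"
      using floor_divide_bounds[of "2 * pi" "\<rho> t"] by (auto simp: j_def algebra_simps)
    ultimately have j: "2 * of_int j * pi < \<rho> t" "\<rho> t < (2 * of_int j + 2) * pi" by auto
    show ?thesis using order_tendstoD(1)[OF \<kappa>_lim 1] order_tendstoD(1)[OF \<rho>_lim j(1)] order_tendstoD(2)[OF \<rho>_lim j(2)]
    proof eventually_elim
      case (elim s)
      show ?case unfolding n_def using phase_count_pos[OF 1 j] phase_count_pos[OF elim] by simp
    qed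
  next
    case 2
    define j where "j = \<lfloor>(\<rho> t + pi) / (2 * pi)\<rfloor>"
    have "\<rho> t \<noteq> (2 * of_int j - 1) * pi"
    proof
      assume "\<rho> t = (2 * of_int j - 1) * pi"
      then have *: "\<rho> t = (2 * of_int (j - 1) + 1) * pi" by simp
      have "\<delta> t = - of_real (\<kappa> t)" using \<delta>_eq[OF t01] exp_i_multiple_of_pi(2)[of "j - 1"] unfolding * by simp
      then show False using bad[of "2 * (j - 1) + 1"] 2 * by simp
    qed
    moreover have "(2 * of_int j - 1) * pi \<le> \<rho> t" "\<rho> t < (2 * of_int j + 1) * pi"
      using floor_divide_bounds[of "2 * pi" "\<rho> t + pi"] by (auto simp: j_def algebra_simps)
    ultimately have j: "(2 * of_int j - 1) * pi < \<rho> t" "\<rho> t < (2 * of_int j + 1) * pi" by auto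
    show ?thesis using order_tendstoD(2)[OF \<kappa>_lim 2] order_tendstoD(1)[OF \<rho>_lim j(1)] order_tendstoD(2)[OF \<rho>_lim j(2)]
    proof eventually_elim
      case (elim s)
      show ?case unfolding n_def using phase_count_neg[OF 2 j] phase_count_neg[OF elim] by simp
    qed
  qed
qed

text \<open>W(s) x has constant norm and equals x at time t, so its velocity is orthogonal to x. On
  the kernel the derivative of W is therefore i times a real quadratic form, which will be the
  crossing form.\<close>

lemma kernel_Re_derivative:
  assumes "w11 t * of_real x1 + w12 t * of_real x2 = of_real x1" "w12 t * of_real x1 + w22 t * of_real x2 = of_real x2"
  shows "Re d11 * x1^2 + 2 * Re d12 * x1 * x2 + Re d22 * x2^2 = 0"
proof -
  define u v where "u s = w11 s * of_real x1 + w12 s * of_real x2" and "v s = w12 s * of_real x1 + w22 s * of_real x2" for s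
  define u' v' where "u' = d11 * of_real x1 + d12 * of_real x2" and "v' = d12 * of_real x1 + d22 * of_real x2"
  have u: "(u has_vector_derivative u') F" and v: "(v has_vector_derivative v') F"
    unfolding u_def v_def u'_def v'_def
    by (auto intro!: derivative_eq_intros der)
  have hc: "u s * cnj (u s) + v s * cnj (v s) = of_real (x1^2 + x2^2)" if "s \<in> {0..1}" for s
  proof -
    have 1: "w11 s * cnj (w11 s) + w12 s * cnj (w12 s) = 1" "w12 s * cnj (w12 s) + w22 s * cnj (w22 s) = 1"
      "w11 s * cnj (w12 s) + w12 s * cnj (w22 s) = 0" using su[OF that] by (auto simp: sym_unitary_def)
    have 2: "cnj (w11 s) * w12 s + cnj (w12 s) * w22 s = 0" using arg_cong[OF 1(3), of cnj] by simp
    show ?thesis unfolding u_def v_def using 1 2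
      by (simp add: power2_eq_square) algebra
  qed
  have "((\<lambda>s. u s * cnj (u s) + v s * cnj (v s)) has_vector_derivative
      (u t * cnj u' + u' * cnj (u t)) + (v t * cnj v' + v' * cnj (v t))) F"
    by (intro has_vector_derivative_add bounded_bilinear.has_vector_derivative[OF bounded_bilinear_mult]
        bounded_linear.has_vector_derivative[OF bounded_linear_cnj] u v)
  moreover have "((\<lambda>s. u s * cnj (u s) + v s * cnj (v s)) has_vector_derivative 0) F"
    by (rule has_vector_derivative_transform[OF t01 hc has_vector_derivative_const])
  moreover have "F \<noteq> bot" using t01 by (auto simp: trivial_limit_within islimpt_Icc)
  ultimately have "(u t * cnj u' + u' * cnj (u t)) + (v t * cnj v' + v' * cnj (v t)) = 0"
    using vector_derivative_unique_within by blast
  moreover have "u t = of_real x1" "v t = of_real x2" using assms by (auto simp: u_def v_def)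
  ultimately have "x1 * Re u' + x2 * Re v' = 0" by (simp add: complex_eq_iff)
  then show ?thesis by (simp add: u'_def v'_def algebra_simps power2_eq_square)
qed

text \<open>Here \<kappa> vanishes with derivative 2 q sin \<rho>, while \<rho> stays strictly
  between j pi and (j + 1) pi. The count takes the value j where \<kappa> sin \<rho> > 0 and j - 1
  where it is negative, whatever the parity of j, so it moves with the sign of q.\<close>

lemma simple_crossing:
  assumes x: "x1^2 + x2^2 = 1"
    "w11 t * of_real x1 + w12 t * of_real x2 = of_real x1" "w12 t * of_real x1 + w22 t * of_real x2 = of_real x2"
    and ne: "wdet (w11 t) (w12 t) (w22 t) \<noteq> 1"
    and q: "q = Im d11 * x1^2 + 2 * Im d12 * x1 * x2 + Im d22 * x2^2" "q \<noteq> 0"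
  shows "\<forall>\<^sub>F s in F. (s > t \<longrightarrow> n s = n t + sgn q / 2) \<and> (s < t \<longrightarrow> n s = n t - sgn q / 2)"
proof -
  have \<delta>0: "\<delta> t = 0" using x by (intro wchar_kernel[OF x(2,3)]) auto
  then have \<kappa>0: "\<kappa> t = 0" by (simp add: \<kappa>_def)
  have sin0: "sin (\<rho> t) \<noteq> 0"
  proof
    assume "sin (\<rho> t) = 0"
    then obtain m :: int where "\<rho> t = of_int m * pi" by (auto simp: sin_zero_iff_int2)
    then show False using ne \<rho>_det[OF t01] exp_i_multiple_of_pi(3)[of m] by simp
  qed
  define \<mu> where "\<mu> = 1 - wdet (w11 t) (w12 t) (w22 t)"
  have \<mu>: "\<mu> = (1 - w11 t) + (1 - w22 t)" using \<delta>0 wchar_eq[of "w11 t" "w12 t" "w22 t"] by (simp add: \<mu>_def algebra_simps)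
  have xc: "complex_of_real x1 * of_real x1 + of_real x2 * of_real x2 = 1"
    using x(1) by (metis of_real_1 of_real_add of_real_mult power2_eq_square)
  have A: "1 - w11 t = \<mu> * (of_real x2 * of_real x2)" "1 - w22 t = \<mu> * (of_real x1 * of_real x1)"
    "w12 t = \<mu> * (of_real x1 * of_real x2)"
    using kernel_algebra(3)[OF x(2,3) xc \<mu>] by blast+
  define d' where "d' = d12 * w12 t + w12 t * d12 + d11 * (1 - w22 t) + (1 - w11 t) * d22"
  have "(\<delta> has_vector_derivative d') F"
    unfolding wchar_def d'_def by (rule derivative_eq_intros der refl | simp)+
  have d': "d' = \<mu> * (\<i> * of_real q)"
  proof -
    have "d' = \<mu> * (d11 * (of_real x1 * of_real x1) + 2 * d12 * (of_real x1 * of_real x2) + d22 * (of_real x2 * of_real x2))"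
      unfolding d'_def A by (simp add: algebra_simps)
    also have "d11 * (of_real x1 * of_real x1) + 2 * d12 * (of_real x1 * of_real x2) + d22 * (of_real x2 * of_real x2) = \<i> * of_real q"
      using kernel_Re_derivative[OF x(2,3)] by (simp add: complex_eq_iff q(1) power2_eq_square algebra_simps)
    finally show ?thesis .
  qed
  \<comment> \<open>From 1 - e^(2 i \<rho>) = -2 i sin \<rho> e^(i \<rho>).\<close>
  have \<mu>e: "\<mu> * \<i> = of_real (2 * sin (\<rho> t)) * exp (\<i> * of_real (\<rho> t))"
    unfolding \<mu>_def \<rho>_det[OF t01]
    by (simp add: complex_eq_iff Re_exp Im_exp sin_double cos_double_sin power2_eq_square)
  have "((\<lambda>s. Re ((\<delta> s - \<delta> t) /\<^sub>R (s - t) * exp (- (\<i> * of_real (\<rho> s))))) \<longlongrightarrow> Re (d' * exp (- (\<i> * of_real (\<rho> t))))) F"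
    by (intro tendsto_intros exp_lim has_vector_derivative_quotient) fact
  also have "Re (d' * exp (- (\<i> * of_real (\<rho> t)))) = 2 * q * sin (\<rho> t)"
  proof -
    have "d' * exp (- (\<i> * of_real (\<rho> t))) = (\<mu> * \<i>) * of_real q * exp (- (\<i> * of_real (\<rho> t)))"
      by (simp add: d' algebra_simps)
    also have "\<dots> = of_real (2 * sin (\<rho> t) * q) * (exp (\<i> * of_real (\<rho> t)) * exp (- (\<i> * of_real (\<rho> t))))"
      unfolding \<mu>e by (simp add: algebra_simps)
    also have "exp (\<i> * of_real (\<rho> t)) * exp (- (\<i> * of_real (\<rho> t))) = 1" by (simp flip: exp_add)
    finally show ?thesis by simp
  qed
  finally have "((\<lambda>s. (\<kappa> s - \<kappa> t) / (s - t)) \<longlongrightarrow> 2 * q * sin (\<rho> t)) F"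
    by (simp add: \<delta>0 \<kappa>0 \<kappa>_def divide_inverse mult.commute mult.left_commute)
  then have "(\<kappa> has_real_derivative 2 * q * sin (\<rho> t)) F" by (simp add: has_field_derivative_iff)
  then have ev: "\<forall>\<^sub>F s in F. 2 * q * sin (\<rho> t) * ((s - t) * \<kappa> s) > 0"
    using \<kappa>0 q(2) sin0 by (intro eventually_deriv_sign) auto
  define j where "j = \<lfloor>\<rho> t / pi\<rfloor>"
  have j: "of_int j * pi < \<rho> t" "\<rho> t < (of_int j + 1) * pi" unfolding j_def using between_multiples_of_pi[OF sin0] by auto
  have nt: "n t = of_int j - 1/2"
  proof -
    have "\<not> (w11 t = 1 \<and> w12 t = 0 \<and> w22 t = 1)" using ne by (auto simp: wdet_def)
    then show ?thesis by (simp only: n_def phase_count_def \<kappa>0 j_def) simp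
  qed
  show ?thesis using ev order_tendstoD(1)[OF \<rho>_lim j(1)] order_tendstoD(2)[OF \<rho>_lim j(2)] in01
  proof eventually_elim
    case (elim s)
    have sgnprod: "\<kappa> s > 0 \<and> q * sin (\<rho> t) * (s - t) > 0 \<or> \<kappa> s < 0 \<and> q * sin (\<rho> t) * (s - t) < 0"
    proof -
      have "(q * sin (\<rho> t) * (s - t)) * \<kappa> s > 0" using elim(1) by (simp add: algebra_simps)
      then show ?thesis by (auto simp: zero_less_mult_iff)
    qed
    show ?case
    proof (cases "even j")
      case True
      then obtain i where i: "j = 2 * i" by blast
      have "sin (\<rho> t) > 0"
      proof -
        have "sin (\<rho> t) = sin (\<rho> t - 2 * pi * of_int i)" by (simp add: sin_diff sin_int_2pin cos_int_2pin)
        also have "\<dots> > 0" using j by (intro sin_gt_zero) (auto simp: i algebra_simps)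
        finally show ?thesis .
      qed
      then have "\<kappa> s > 0 \<and> q * (s - t) > 0 \<or> \<kappa> s < 0 \<and> q * (s - t) < 0"
        using sgnprod by (auto simp: zero_less_mult_iff mult_less_0_iff)
      moreover have "n s = 2 * of_int i" if "\<kappa> s > 0"
        unfolding n_def using that elim i by (intro phase_count_pos) (auto simp: algebra_simps)
      moreover have "n s = 2 * of_int i - 1" if "\<kappa> s < 0"
        unfolding n_def using that elim i by (intro phase_count_neg) (auto simp: algebra_simps)
      ultimately show ?thesis using nt i q(2) by (auto simp: zero_less_mult_iff mult_less_0_iff)
    next
      case False
      then obtain i where i: "j = 2 * i + 1" by (metis oddE)
      have "sin (\<rho> t) < 0"
      proof -
        have "sin (\<rho> t) = - sin (\<rho> t - 2 * pi * of_int i - pi)" by (simp add: sin_diff sin_int_2pin cos_int_2pin)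
        moreover have "sin (\<rho> t - 2 * pi * of_int i - pi) > 0" using j by (intro sin_gt_zero) (auto simp: i algebra_simps)
        ultimately show ?thesis by linarith
      qed
      then have "\<kappa> s < 0 \<and> q * (s - t) > 0 \<or> \<kappa> s > 0 \<and> q * (s - t) < 0"
        using sgnprod by (auto simp: zero_less_mult_iff mult_less_0_iff)
      moreover have "n s = 2 * of_int i" if "\<kappa> s > 0"
        unfolding n_def using that elim i by (intro phase_count_pos) (auto simp: algebra_simps)
      moreover have "n s = 2 * of_int (i + 1) - 1" if "\<kappa> s < 0"
        unfolding n_def using that elim i by (intro phase_count_neg) (auto simp: algebra_simps)
      ultimately show ?thesis using nt i q(2) by (auto simp: zero_less_mult_iff mult_less_0_iff)
    qed
  qed
qed

text \<open>At W = 1 the leading term of \<delta> is \<Delta> (s - t)^2, so \<kappa> has the same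
  sign on both sides. If \<Delta> < 0 the form is indefinite and that sign selects the branch which
  is constant around m pi: no jump. If \<Delta> > 0 the form is definite, the trace gives the
  direction in which \<rho> passes m pi, and the count moves by 2 in all.\<close>

lemma full_crossing:
  assumes w1: "w11 t = 1" "w12 t = 0" "w22 t = 1"
    and b: "\<Delta> = Im d11 * Im d22 - Im d12 * Im d12" "\<Delta> \<noteq> 0"
    and \<sigma>: "\<sigma> = (if \<Delta> < 0 then 0 else sgn (Im d11 + Im d22))"
  shows "\<forall>\<^sub>F s in F. (s > t \<longrightarrow> n s = n t + \<sigma>) \<and> (s < t \<longrightarrow> n s = n t - \<sigma>)"
proof -
  have d0: "Re d11 = 0" "Re d22 = 0" using kernel_Re_derivative[of 1 0] kernel_Re_derivative[of 0 1] w1 by auto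
  have d1: "Re d12 = 0" using kernel_Re_derivative[of 1 1] w1 d0 by auto
  have "exp (2 * \<i> * of_real (\<rho> t)) = 1" using \<rho>_det[OF t01] w1 by (simp add: wdet_def)
  then have "\<exists>m::int. 2 * \<rho> t = of_int (2 * m) * pi" unfolding exp_eq_1 by simp
  then obtain m :: int where "2 * \<rho> t = of_int (2 * m) * pi" by blast
  then have m: "\<rho> t = of_int m * pi" by simp
  have "\<kappa> t = 0" by (simp add: \<kappa>_def wchar_def w1)
  then have nt: "n t = of_int m - 1" by (simp add: n_def phase_count_def w1 m)
  define c where "c = (if even m then 1 else -1 :: real)"
  have em: "exp (- (\<i> * of_real (\<rho> t))) = of_real c"
  proof (cases "even m")
    case True
    then obtain i where "m = 2 * i" by blast
    then show ?thesis using exp_i_multiple_of_pi(1)[of i] by (simp add: m c_def exp_minus)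
  next
    case False
    then obtain i where "m = 2 * i + 1" by (metis oddE)
    then show ?thesis using exp_i_multiple_of_pi(2)[of i] by (simp add: m c_def exp_minus)
  qed
  let ?Q = "\<lambda>w s. (w s - w t) /\<^sub>R (s - t)"
  have "((\<lambda>s. Re ((?Q w12 s * ?Q w12 s - ?Q w11 s * ?Q w22 s) * exp (- (\<i> * of_real (\<rho> s))))) \<longlongrightarrow>
      Re ((d12 * d12 - d11 * d22) * exp (- (\<i> * of_real (\<rho> t))))) F"
    by (intro tendsto_intros exp_lim has_vector_derivative_quotient der)
  also have "Re ((d12 * d12 - d11 * d22) * exp (- (\<i> * of_real (\<rho> t)))) = c * \<Delta>"
    unfolding em by (simp add: b(1) d0 d1 algebra_simps)
  finally have "((\<lambda>s. Re ((?Q w12 s * ?Q w12 s - ?Q w11 s * ?Q w22 s) * exp (- (\<i> * of_real (\<rho> s)))) * (c * \<Delta>)) \<longlongrightarrow> (c * \<Delta>) * (c * \<Delta>)) F"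
    by (intro tendsto_intros)
  moreover have "(c * \<Delta>) * (c * \<Delta>) > 0" using b(2) by (auto simp: c_def zero_less_mult_iff)
  ultimately have "\<forall>\<^sub>F s in F. Re ((?Q w12 s * ?Q w12 s - ?Q w11 s * ?Q w22 s) * exp (- (\<i> * of_real (\<rho> s)))) * (c * \<Delta>) > 0"
    by (rule order_tendstoD)
  then have ev\<kappa>: "\<forall>\<^sub>F s in F. \<kappa> s * (c * \<Delta>) > 0"
    using in01
  proof eventually_elim
    case (elim s)
    have "(?Q w12 s * ?Q w12 s - ?Q w11 s * ?Q w22 s) = \<delta> s /\<^sub>R ((s - t) * (s - t))"
    proof -
      have "\<delta> s = w12 s * w12 s - (w11 s - 1) * (w22 s - 1)" by (simp add: wchar_def algebra_simps)
      moreover have "(c *\<^sub>R e) * (c *\<^sub>R e) - (c *\<^sub>R a) * (c *\<^sub>R b) = (c * c) *\<^sub>R (e * e - a * b)"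
        for a b e :: complex and c :: real by (simp add: scaleR_diff_right)
      ultimately show ?thesis by (simp add: w1)
    qed
    then have "Re ((?Q w12 s * ?Q w12 s - ?Q w11 s * ?Q w22 s) * exp (- (\<i> * of_real (\<rho> s)))) = \<kappa> s / ((s - t) * (s - t))"
      by (simp add: \<kappa>_def divide_inverse mult.commute)
    then have pos: "\<kappa> s / ((s - t) * (s - t)) * (c * \<Delta>) > 0" using elim(1) by (simp only:)
    have "s - t \<noteq> 0" using elim(2) by simp
    then have sq: "(s - t) * (s - t) > 0" using not_real_square_gt_zero[of "s - t"] by blast
    have "\<kappa> s / ((s - t) * (s - t)) * (c * \<Delta>) * ((s - t) * (s - t)) > 0"
      by (rule mult_pos_pos[OF pos sq])
    then show ?case using \<open>s - t \<noteq> 0\<close> by simp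
  qed
  define T where "T = Im d11 + Im d22"
  have "((\<lambda>s. wdet (w11 s) (w12 s) (w22 s)) has_vector_derivative (w11 t * d22 + d11 * w22 t - (w12 t * d12 + d12 * w12 t))) F"
    unfolding wdet_def by (intro has_vector_derivative_diff bounded_bilinear.has_vector_derivative[OF bounded_bilinear_mult] der)
  then have "((\<lambda>s. Im (wdet (w11 s) (w12 s) (w22 s))) has_vector_derivative Im (w11 t * d22 + d11 * w22 t - (w12 t * d12 + d12 * w12 t))) F"
    by (rule bounded_linear.has_vector_derivative[OF bounded_linear_Im])
  then have "((\<lambda>s. Im (wdet (w11 s) (w12 s) (w22 s))) has_real_derivative T) F"
    by (simp add: has_real_derivative_iff_has_vector_derivative w1 T_def add.commute)
  moreover have "T \<noteq> 0" if "\<Delta> > 0"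
  proof
    assume "T = 0"
    then have "Im d22 = - Im d11" by (simp add: T_def)
    then have "\<Delta> = - ((Im d11)^2 + (Im d12)^2)" by (simp add: b(1) power2_eq_square)
    then show False using that by (metis neg_0_less_iff_less not_less sum_power2_ge_zero)
  qed
  ultimately have evT: "\<forall>\<^sub>F s in F. \<Delta> > 0 \<longrightarrow> T * ((s - t) * Im (wdet (w11 s) (w12 s) (w22 s))) > 0"
    using eventually_deriv_sign[of "\<lambda>s. Im (wdet (w11 s) (w12 s) (w22 s))" T t "{0..1}"] w1
    by (cases "\<Delta> > 0") (auto simp: wdet_def)
  have "\<forall>\<^sub>F s in F. \<rho> s > of_int m * pi - pi/2" "\<forall>\<^sub>F s in F. \<rho> s < of_int m * pi + pi/2"
    by (rule order_tendstoD[OF \<rho>_lim]; simp add: m)+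
  then show ?thesis using ev\<kappa> evT in01
  proof eventually_elim
    case (elim s)
    define y where "y = \<rho> s - of_int m * pi"
    have y: "\<bar>y\<bar> < pi / 2" using elim(1,2) unfolding y_def abs_less_iff by linarith
    have \<rho>s: "\<rho> s = of_int m * pi + y" by (simp add: y_def)
    show ?case
    proof (cases "\<Delta> > 0")
      case False
      then have neg: "\<Delta> < 0" using b(2) by simp
      have "n s = of_int m - 1"
      proof (cases "even m")
        case True
        then obtain i where i: "m = 2 * i" by blast
        have "\<kappa> s < 0" using elim(3) neg True by (auto simp: c_def zero_less_mult_iff)
        then have "n s = 2 * of_int i - 1" unfolding n_def
          using y by (intro phase_count_neg) (auto simp: \<rho>s i algebra_simps abs_less_iff)
        then show ?thesis by (simp add: i)
      next
        case False
        then obtain i where i: "m = 2 * i + 1" by (metis oddE)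
        have "\<kappa> s > 0" using elim(3) neg False by (auto simp: c_def zero_less_mult_iff mult_less_0_iff)
        then have "n s = 2 * of_int i" unfolding n_def
          using y by (intro phase_count_pos) (auto simp: \<rho>s i algebra_simps abs_less_iff)
        then show ?thesis by (simp add: i)
      qed
      then show ?thesis using nt neg \<sigma> by simp
    next
      case True
      have "Im (wdet (w11 s) (w12 s) (w22 s)) = sin (2 * \<rho> s)" using \<rho>_det[of s] elim by (simp add: Im_exp)
      also have "\<dots> = sin (2 * y + 2 * pi * of_int m)" by (simp add: y_def algebra_simps)
      also have "\<dots> = sin (2 * y)" by (simp add: sin_add sin_int_2pin cos_int_2pin)
      finally have *: "T * ((s - t) * sin (2 * y)) > 0" using elim(4) True by simp
      have sy: "y > 0 \<and> T * (s - t) > 0 \<or> y < 0 \<and> T * (s - t) < 0"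
      proof (rule ccontr)
        assume c: "\<not> (y > 0 \<and> T * (s - t) > 0 \<or> y < 0 \<and> T * (s - t) < 0)"
        have "(T * (s - t)) * sin (2 * y) > 0" using * by (simp add: mult.assoc)
        then consider "T * (s - t) > 0" "sin (2 * y) > 0" | "T * (s - t) < 0" "sin (2 * y) < 0" by (auto simp: zero_less_mult_iff)
        then show False
        proof cases
          case 1
          then have "sin (- (2 * y)) \<ge> 0" using c y by (intro sin_ge_zero) auto
          then show False using 1 by simp
        next
          case 2
          then have "sin (2 * y) \<ge> 0" using c y by (intro sin_ge_zero) auto
          then show False using 2 by simp
        qed
      qed
      have up: "n s = of_int m" if "y > 0"
      proof (cases "even m")
        case ev: True
        then obtain i where i: "m = 2 * i" by blast
        have "\<kappa> s > 0" using elim(3) True ev by (auto simp: c_def zero_less_mult_iff)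
        then have "n s = 2 * of_int i" unfolding n_def
          using y that by (intro phase_count_pos) (auto simp: \<rho>s i algebra_simps abs_less_iff)
        then show ?thesis by (simp add: i)
      next
        case od: False
        then obtain i where i: "m = 2 * i + 1" by (metis oddE)
        have "\<kappa> s < 0" using elim(3) True od by (auto simp: c_def zero_less_mult_iff mult_less_0_iff)
        then have "n s = 2 * of_int (i + 1) - 1" unfolding n_def
          using y that by (intro phase_count_neg) (auto simp: \<rho>s i algebra_simps abs_less_iff)
        then show ?thesis by (simp add: i)
      qed
      have down: "n s = of_int m - 2" if "y < 0"
      proof (cases "even m")
        case ev: True
        then obtain i where i: "m = 2 * i" by blast
        have "\<kappa> s > 0" using elim(3) True ev by (auto simp: c_def zero_less_mult_iff)
        then have "n s = 2 * of_int (i - 1)" unfolding n_def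
          using y that by (intro phase_count_pos) (auto simp: \<rho>s i algebra_simps abs_less_iff)
        then show ?thesis by (simp add: i)
      next
        case od: False
        then obtain i where i: "m = 2 * i + 1" by (metis oddE)
        have "\<kappa> s < 0" using elim(3) True od by (auto simp: c_def zero_less_mult_iff mult_less_0_iff)
        then have "n s = 2 * of_int i - 1" unfolding n_def
          using y that by (intro phase_count_neg) (auto simp: \<rho>s i algebra_simps abs_less_iff)
        then show ?thesis by (simp add: i)
      qed
      show ?thesis using sy up down nt True \<sigma> unfolding T_def[symmetric]
        by (auto simp: zero_less_mult_iff mult_less_0_iff)
    qed
  qed
qed

end

section \<open>Lagrangian planes in four dimensions\<close>

definition I4 :: "(real^2) \<times> (real^2) \<Rightarrow> (real^2) \<times> (real^2)" where
  "I4 u = (- J2 (fst u), J2 (snd u))"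

interpretation form4: compatible_form omega4 I4
proof (rule compatible_form.intro)
  show "linear I4" by (rule linearI) (auto simp: vec2_eq_iff I4_def prod_eq_iff)
qed (auto simp: vec2_eq_iff inner_real2 omega2_def omega4_def I4_def prod_eq_iff inner_prod_def)

text \<open>\<open>f1\<close>, \<open>f2\<close>, \<open>I4 f1\<close>, \<open>I4 f2\<close> are
  orthogonal of squared length 2. This length cancels the 2 of the reflection, so no factor 2
  appears in the entries of W.\<close>

definition f1 :: "(real^2) \<times> (real^2)" where "f1 = (axis 1 1, axis 1 1)"
definition f2 :: "(real^2) \<times> (real^2)" where "f2 = (axis 2 1, axis 2 1)"

lemma inner_frame [simp]:
  "inner u f1 = fst u $ 1 + snd u $ 1" "inner u f2 = fst u $ 2 + snd u $ 2"
  "inner u (I4 f1) = snd u $ 2 - fst u $ 2" "inner u (I4 f2) = fst u $ 1 - snd u $ 1"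
  by (auto simp: inner_prod_def inner_real2 f1_def f2_def I4_def axis_def)

lemma frame_nth [simp]:
  "fst f1 $ 1 = 1" "fst f1 $ 2 = 0" "snd f1 $ 1 = 1" "snd f1 $ 2 = 0"
  "fst f2 $ 1 = 0" "fst f2 $ 2 = 1" "snd f2 $ 1 = 0" "snd f2 $ 2 = 1"
  by (auto simp: f1_def f2_def axis_def)

lemma inner_frame_expansion:
  "2 * inner u v = inner u f1 * inner v f1 + inner u f2 * inner v f2
     + inner u (I4 f1) * inner v (I4 f1) + inner u (I4 f2) * inner v (I4 f2)"
  unfolding inner_frame by (simp add: inner_prod_def inner_real2 algebra_simps)

lemma frame_eqI:
  assumes "inner u f1 = inner v f1" "inner u f2 = inner v f2"
    "inner u (I4 f1) = inner v (I4 f1)" "inner u (I4 f2) = inner v (I4 f2)"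
  shows "u = v"
  using assms by (simp add: prod_eq_iff vec2_eq_iff)

lemma diagonal4_iff: "u \<in> diagonal4 \<longleftrightarrow> (\<exists>x1 x2. u = x1 *\<^sub>R f1 + x2 *\<^sub>R f2)"
proof
  assume "u \<in> diagonal4"
  then obtain x where "u = (x, x)" by (auto simp: diagonal4_def)
  then have "u = (x$1) *\<^sub>R f1 + (x$2) *\<^sub>R f2" by (simp add: prod_eq_iff vec2_eq_iff)
  then show "\<exists>x1 x2. u = x1 *\<^sub>R f1 + x2 *\<^sub>R f2" by blast
next
  assume "\<exists>x1 x2. u = x1 *\<^sub>R f1 + x2 *\<^sub>R f2"
  then obtain x1 x2 where u: "u = x1 *\<^sub>R f1 + x2 *\<^sub>R f2" by blast
  then have "fst u = snd u" by (simp add: vec2_eq_iff)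
  then show "u \<in> diagonal4" unfolding diagonal4_def by (auto simp: prod_eq_iff)
qed

lemma diagonal_combination_0: "x1 *\<^sub>R f1 + x2 *\<^sub>R f2 = 0 \<longleftrightarrow> x1 = 0 \<and> x2 = 0"
  by (auto simp: prod_eq_iff vec2_eq_iff)

lemma subspace_diagonal4: "subspace diagonal4" and dim_diagonal4: "dim diagonal4 = 2"
proof -
  have eq: "diagonal4 = span {f1, f2}"
  proof (rule set_eqI)
    fix u show "u \<in> diagonal4 \<longleftrightarrow> u \<in> span {f1, f2}"
      by (simp add: diagonal4_iff span_insert span_singleton) (metis add_diff_cancel_left' diff_add_cancel add.commute)
  qed
  show "subspace diagonal4" unfolding eq by simp
  have "f1 \<noteq> f2" by (auto simp: prod_eq_iff vec2_eq_iff)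
  moreover have "independent {f1, f2}"
  proof (rule independent_insertI)
    show "f1 \<notin> span {f2}" by (auto simp: span_singleton prod_eq_iff vec2_eq_iff)
    show "independent {f2}" by (simp add: prod_eq_iff vec2_eq_iff)
  qed
  ultimately show "dim diagonal4 = 2" unfolding eq by (simp add: dim_eq_card_independent)
qed

text \<open>The entries of \<open>W\<close>, where the reflection \<open>2 P - 1\<close> acts on the diagonal as the complex matrix \<open>W\<close>
  in the frame \<open>f1, f2\<close>, with \<open>I4\<close> as multiplication by \<open>\<i>\<close>.\<close>

definition W11 :: "(((real^2) \<times> (real^2)) \<Rightarrow>\<^sub>L ((real^2) \<times> (real^2))) \<Rightarrow> complex" where
  "W11 P = Complex (inner (P f1) f1) (inner (P f1) (I4 f1)) - 1"
definition W12 :: "(((real^2) \<times> (real^2)) \<Rightarrow>\<^sub>L ((real^2) \<times> (real^2))) \<Rightarrow> complex" where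
  "W12 P = Complex (inner (P f1) f2) (inner (P f1) (I4 f2))"
definition W22 :: "(((real^2) \<times> (real^2)) \<Rightarrow>\<^sub>L ((real^2) \<times> (real^2))) \<Rightarrow> complex" where
  "W22 P = Complex (inner (P f2) f2) (inner (P f2) (I4 f2)) - 1"

context
  fixes L :: "((real^2) \<times> (real^2)) set" and P
  assumes lagL: "lagrangian omega4 L"
  defines "P \<equiv> orth_proj L"
begin

lemma subspace_L: "subspace L" using lagL by (simp add: lagrangian_def)

text \<open>Real parts by self-adjointness of P, imaginary parts because the reflection anticommutes
  with \<open>I4\<close>.\<close>

lemma P_symmetric:
  "inner (P f2) f1 = inner (P f1) f2" "inner (P f2) (I4 f1) = inner (P f1) (I4 f2)"
proof -
  have sa: "inner (P u) v = inner u (P v)" for u v unfolding P_def by (rule orth_proj_selfadjoint[OF subspace_L])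
  show "inner (P f2) f1 = inner (P f1) f2" using sa[of f2 f1] by (metis inner_commute)
  have "inner (P f2) (I4 f1) = inner f2 (P (I4 f1))" by (rule sa)
  also have "P (I4 f1) = I4 f1 - I4 (P f1)" unfolding P_def by (rule form4.orth_proj_I[OF lagL])
  also have "inner f2 (I4 f1 - I4 (P f1)) = - inner f2 (I4 (P f1))"
    unfolding inner_diff_right by simp
  also have "\<dots> = inner (I4 f2) (P f1)" using form4.I_skew[of f2 "P f1"] by simp
  finally show "inner (P f2) (I4 f1) = inner (P f1) (I4 f2)" by (metis inner_commute)
qed

lemma P_idem: "inner (P u) (P v) = inner (P u) v"
  using orth_proj_selfadjoint[OF subspace_L, of "P u" v] orth_proj_fixes[OF subspace_L orth_proj_in[OF subspace_L], of u]
  unfolding P_def by simp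

lemma P_isotropic: "u \<in> L \<Longrightarrow> inner u (I4 (P v)) = 0"
proof -
  assume "u \<in> L"
  moreover have "P v \<in> L" unfolding P_def by (rule orth_proj_in[OF subspace_L])
  ultimately have "omega4 (P v) u = 0" using lagL by (auto simp: lagrangian_def)
  then show ?thesis by (simp add: form4.\<omega>_eq inner_commute)
qed

lemma inner_I4_frame:
  "inner (I4 u) f1 = - inner u (I4 f1)" "inner (I4 u) f2 = - inner u (I4 f2)"
  "inner (I4 u) (I4 f1) = inner u f1" "inner (I4 u) (I4 f2) = inner u f2"
  by (rule form4.I_skew form4.I_isometry)+

lemma P_in_L: "P v \<in> L" unfolding P_def by (rule orth_proj_in[OF subspace_L])

text \<open>Written in the frame, idempotence of P gives the norm relations and the real part of the
  mixed relation; isotropy of L gives its imaginary part.\<close>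

lemma sym_unitary_W: "sym_unitary (W11 P) (W12 P) (W22 P)"
proof -
  note e1 = inner_frame_expansion[of "P f1" "P f1"] inner_frame_expansion[of "P f2" "P f2"]
    inner_frame_expansion[of "P f1" "P f2"]
  note e2 = inner_frame_expansion[of "P f1" "I4 (P f2)"]
  define a11 a12 a22 b11 b12 b22 where
    "a11 = inner (P f1) f1" and "a12 = inner (P f1) f2" and "a22 = inner (P f2) f2" and
    "b11 = inner (P f1) (I4 f1)" and "b12 = inner (P f1) (I4 f2)" and "b22 = inner (P f2) (I4 f2)"
  note defs = a11_def[symmetric] a12_def[symmetric] a22_def[symmetric] b11_def[symmetric] b12_def[symmetric] b22_def[symmetric]
  have "2 * a11 = a11 * a11 + a12 * a12 + b11 * b11 + b12 * b12"
    using e1(1) unfolding P_idem P_symmetric defs .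
  moreover have "2 * a22 = a12 * a12 + a22 * a22 + b12 * b12 + b22 * b22"
    using e1(2) unfolding P_idem P_symmetric defs .
  moreover have "2 * a12 = a11 * a12 + a12 * a22 + b11 * b12 + b12 * b22"
    using e1(3) unfolding P_idem P_symmetric defs .
  moreover have "0 = - a11 * b12 - a12 * b22 + b11 * a12 + b12 * a22"
    using e2 unfolding P_isotropic[OF P_in_L] inner_I4_frame P_symmetric defs by simp
  ultimately show ?thesis
    unfolding sym_unitary_def W11_def W12_def W22_def defs
    by (simp add: complex_eq_iff algebra_simps)
qed

text \<open>The reflection fixes L pointwise and is antilinear with matrix W, hence the conjugates.
  A basis of L thus determines det W and det (1 - W).\<close>

lemma W_conjugate:
  assumes "u \<in> L"
  defines "z1 \<equiv> Complex (inner u f1) (inner u (I4 f1))" and "z2 \<equiv> Complex (inner u f2) (inner u (I4 f2))"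
  shows "W11 P * cnj z1 + W12 P * cnj z2 = z1" "W12 P * cnj z1 + W22 P * cnj z2 = z2"
proof -
  have fix_u: "inner u v = inner u (P v)" for v
    using orth_proj_selfadjoint[OF subspace_L, of u v] orth_proj_fixes[OF subspace_L assms(1)] unfolding P_def by simp
  define a11 a12 a22 b11 b12 b22 where
    "a11 = inner (P f1) f1" and "a12 = inner (P f1) f2" and "a22 = inner (P f2) f2" and
    "b11 = inner (P f1) (I4 f1)" and "b12 = inner (P f1) (I4 f2)" and "b22 = inner (P f2) (I4 f2)"
  define x1 x2 y1 y2 where "x1 = inner u f1" and "x2 = inner u f2" and "y1 = inner u (I4 f1)" and "y2 = inner u (I4 f2)"
  note defs = a11_def[symmetric] a12_def[symmetric] a22_def[symmetric] b11_def[symmetric] b12_def[symmetric] b22_def[symmetric]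
    x1_def[symmetric] x2_def[symmetric] y1_def[symmetric] y2_def[symmetric]
  have "2 * x1 = x1 * a11 + x2 * a12 + y1 * b11 + y2 * b12"
    using inner_frame_expansion[of u "P f1"] unfolding fix_u[symmetric] P_symmetric defs .
  moreover have "2 * x2 = x1 * a12 + x2 * a22 + y1 * b12 + y2 * b22"
    using inner_frame_expansion[of u "P f2"] unfolding fix_u[symmetric] P_symmetric defs .
  moreover have "0 = - x1 * b11 - x2 * b12 + y1 * a11 + y2 * a12"
    using inner_frame_expansion[of u "I4 (P f1)"] unfolding P_isotropic[OF assms(1)] inner_I4_frame P_symmetric defs by simp
  moreover have "0 = - x1 * b12 - x2 * b22 + y1 * a12 + y2 * a22"
    using inner_frame_expansion[of u "I4 (P f2)"] unfolding P_isotropic[OF assms(1)] inner_I4_frame P_symmetric defs by simp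
  ultimately show "W11 P * cnj z1 + W12 P * cnj z2 = z1" "W12 P * cnj z1 + W22 P * cnj z2 = z2"
    unfolding z1_def z2_def W11_def W12_def W22_def defs
    by (simp_all add: complex_eq_iff algebra_simps)
qed

text \<open>On the diagonal the complex coordinates are real, so the conjugates of
  \<open>W_conjugate\<close> disappear and crossings become real fixed vectors of W.\<close>

lemma diagonal_mem_iff:
  "x1 *\<^sub>R f1 + x2 *\<^sub>R f2 \<in> L \<longleftrightarrow>
    W11 P * of_real x1 + W12 P * of_real x2 = of_real x1 \<and> W12 P * of_real x1 + W22 P * of_real x2 = of_real x2"
proof -
  let ?v = "x1 *\<^sub>R f1 + x2 *\<^sub>R f2"
  have v: "inner ?v f1 = 2 * x1" "inner ?v f2 = 2 * x2" "inner ?v (I4 f1) = 0" "inner ?v (I4 f2) = 0" by simp_all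
  have Pv: "inner (P ?v) w = x1 * inner (P f1) w + x2 * inner (P f2) w" for w
    by (simp add: blinfun.add_right blinfun.scaleR_right inner_add_left)
  have "?v \<in> L \<longleftrightarrow> P ?v = ?v" unfolding P_def using orth_proj_fixed_iff[OF subspace_L] by metis
  also have "\<dots> \<longleftrightarrow> inner (P ?v) f1 = 2 * x1 \<and> inner (P ?v) f2 = 2 * x2 \<and> inner (P ?v) (I4 f1) = 0 \<and> inner (P ?v) (I4 f2) = 0"
    using frame_eqI[of "P ?v" ?v] v by metis
  also have "\<dots> \<longleftrightarrow> W11 P * of_real x1 + W12 P * of_real x2 = of_real x1 \<and> W12 P * of_real x1 + W22 P * of_real x2 = of_real x2"
    unfolding Pv P_symmetric W11_def W12_def W22_def complex_eq_iff
    by (simp del: inner_frame add: algebra_simps) argo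
  finally show ?thesis .
qed

end

section \<open>Index of a regular path relative to the diagonal\<close>

lemma positive_index_indefinite:
  assumes K: "subspace K" "dim K = 2"
    and scale: "\<And>r v. v \<in> K \<Longrightarrow> Q (r *\<^sub>R v) = r^2 * Q v"
    and u: "u \<in> K" "Q u > 0" and v: "v \<in> K" "Q v < 0"
  shows "positive_index K Q = 1"
proof (rule positive_index_eqI[of "span {u}"])
  have u0: "u \<noteq> 0" using scale[OF u(1), of 0] u(2) by auto
  show "subspace (span {u})" by simp
  show "span {u} \<subseteq> K" using u(1) K(1) by (simp add: span_minimal)
  show "Q w > 0" if "w \<in> span {u}" "w \<noteq> 0" for w
    using that scale[OF u(1)] u(2) by (auto simp: span_singleton)
  show "dim (span {u}) = 1" using u0 by (simp add: dim_insert)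
  fix S :: "'a set" assume S: "subspace S" "S \<subseteq> K" "\<And>v. v \<in> S \<Longrightarrow> v \<noteq> 0 \<Longrightarrow> Q v > 0"
  show "dim S \<le> 1"
  proof (rule ccontr)
    assume "\<not> dim S \<le> 1"
    then have "S = K" using S K by (intro subspace_dim_equal) auto
    moreover have "v \<noteq> 0" using scale[OF v(1), of 0] v(2) by auto
    ultimately have "Q v > 0" using S(3) v by auto
    then show False using v by simp
  qed
qed

lemma form_signature_diagonal:
  assumes Q: "\<And>x1 x2. Q (x1 *\<^sub>R f1 + x2 *\<^sub>R f2) = b11 * x1^2 + 2 * b12 * x1 * x2 + b22 * x2^2"
    and ne: "b11 * b22 - b12 * b12 \<noteq> 0"
  shows "form_signature diagonal4 Q = 2 * (if b11 * b22 - b12 * b12 < 0 then 0 else sgn (b11 + b22))"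
proof -
  have scale: "Q (r *\<^sub>R v) = r^2 * Q v" if vd: "v \<in> diagonal4" for r v
  proof -
    obtain x1 x2 where v: "v = x1 *\<^sub>R f1 + x2 *\<^sub>R f2" using vd diagonal4_iff by blast
    have "r *\<^sub>R v = (r * x1) *\<^sub>R f1 + (r * x2) *\<^sub>R f2" by (simp add: v scaleR_add_right)
    then show ?thesis unfolding v using Q[of "r * x1" "r * x2"] Q[of x1 x2] by (simp add: power2_eq_square algebra_simps)
  qed
  have mem: "x1 *\<^sub>R f1 + x2 *\<^sub>R f2 \<in> diagonal4" for x1 x2 using diagonal4_iff by blast
  have sq: "b11 * (b11 * x1^2 + 2 * b12 * x1 * x2 + b22 * x2^2) = (b11 * x1 + b12 * x2)^2 + (b11 * b22 - b12 * b12) * x2^2" for x1 x2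
    by (simp add: power2_eq_square algebra_simps)
  show ?thesis
  proof (cases "b11 * b22 - b12 * b12 < 0")
    case True
    have "\<exists>x1 x2 y1 y2. b11 * x1^2 + 2 * b12 * x1 * x2 + b22 * x2^2 > 0 \<and> b11 * y1^2 + 2 * b12 * y1 * y2 + b22 * y2^2 < 0"
    proof -
      \<comment> \<open>The form takes the value b11 at (1, 0) and b11 times the negative
        discriminant at (-b12, b11), of opposite signs. If b11 = 0, it is 2 b12 x1 + b22 at (x1, 1),
        and x1 is solved for the values 1 and -1.\<close>
      have e: "b11 * b12^2 - 2 * b12 * b12 * b11 + b22 * b11^2 = b11 * (b11 * b22 - b12 * b12)"
        by (simp add: power2_eq_square algebra_simps)
      consider "b11 > 0" | "b11 < 0" | "b11 = 0" by linarith
      then show ?thesis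
      proof cases
        case 1
        then have "b11 * (b11 * b22 - b12 * b12) < 0" using True by (simp add: mult_pos_neg)
        then show ?thesis using 1 e
          by (intro exI[of _ 1] exI[of _ 0] exI[of _ "- b12"] exI[of _ b11]) (auto simp: algebra_simps)
      next
        case 2
        then have "b11 * (b11 * b22 - b12 * b12) > 0" using True by (simp add: mult_neg_neg)
        then show ?thesis using 2 e
          by (intro exI[of _ "- b12"] exI[of _ b11] exI[of _ 1] exI[of _ 0]) (auto simp: algebra_simps)
      next
        case 3
        then have "b12 \<noteq> 0" using True by auto
        then show ?thesis using 3
          by (intro exI[of _ "(1 - b22) / (2 * b12)"] exI[of _ 1] exI[of _ "(- 1 - b22) / (2 * b12)"]) auto
      qed
    qed
    then obtain x1 x2 y1 y2 where xy: "Q (x1 *\<^sub>R f1 + x2 *\<^sub>R f2) > 0" "Q (y1 *\<^sub>R f1 + y2 *\<^sub>R f2) < 0"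
      unfolding Q by blast
    have "positive_index diagonal4 Q = 1"
      by (rule positive_index_indefinite[OF subspace_diagonal4 dim_diagonal4 scale mem xy(1) mem xy(2)])
    moreover have "positive_index diagonal4 (\<lambda>v. - Q v) = 1"
      by (rule positive_index_indefinite[OF subspace_diagonal4 dim_diagonal4 _ mem _ mem])
        (use scale xy in auto)
    ultimately show ?thesis using True by (simp add: form_signature_def)
  next
    case False
    then have pos: "b11 * b22 - b12 * b12 > 0" using ne by simp
    have b0: "b11 \<noteq> 0" "b11 * b22 > 0" using pos by auto (smt (verit) zero_le_square)
    have def: "b11 * Q v > 0" if v: "v \<in> diagonal4" "v \<noteq> 0" for v
    proof -
      obtain x1 x2 where v': "v = x1 *\<^sub>R f1 + x2 *\<^sub>R f2" using v diagonal4_iff by blast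
      then have x: "x1 \<noteq> 0 \<or> x2 \<noteq> 0" using v by auto
      show ?thesis
      proof (cases "x2 = 0")
        case True
        then show ?thesis unfolding v' Q sq using x b0 by simp
      next
        case False
        then have "(b11 * b22 - b12 * b12) * x2^2 > 0" using pos by simp
        then show ?thesis unfolding v' Q sq by (simp add: add_nonneg_pos)
      qed
    qed
    have zero: "Q 0 = 0" using Q[of 0 0] by simp
    show ?thesis
    proof (cases "b11 > 0")
      case True
      then have Qp: "Q v > 0" if "v \<in> diagonal4" "v \<noteq> 0" for v using def[OF that] by (simp add: zero_less_mult_iff)
      have "positive_index diagonal4 Q = 2"
        using positive_index_pos[OF subspace_diagonal4 Qp] dim_diagonal4 by simp
      moreover have "positive_index diagonal4 (\<lambda>v. - Q v) = 0"
      proof (rule positive_index_nonpos)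
        fix v assume "v \<in> diagonal4" then show "- Q v \<le> 0" using Qp[of v] zero by (cases "v = 0") auto
      qed (simp add: subspace_0 subspace_diagonal4)
      moreover have "b11 + b22 > 0" using True b0 by (simp add: zero_less_mult_iff)
      ultimately show ?thesis using pos by (simp add: form_signature_def)
    next
      case False
      then have neg: "b11 < 0" using b0 by simp
      then have Qn: "- Q v > 0" if "v \<in> diagonal4" "v \<noteq> 0" for v using def[OF that] by (simp add: zero_less_mult_iff)
      have "positive_index diagonal4 (\<lambda>v. - Q v) = 2"
        using positive_index_pos[OF subspace_diagonal4 Qn] dim_diagonal4 by simp
      moreover have "positive_index diagonal4 Q = 0"
      proof (rule positive_index_nonpos)
        fix v assume "v \<in> diagonal4" then show "Q v \<le> 0" using Qn[of v] zero by (cases "v = 0") auto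
      qed (simp add: subspace_0 subspace_diagonal4)
      moreover have "b11 + b22 < 0" using neg b0 by (simp add: zero_less_mult_iff)
      ultimately show ?thesis using pos by (simp add: form_signature_def)
    qed
  qed
qed

text \<open>The crossing form has as matrix the imaginary part of the derivative of W. The three
  local lemmas for the count then agree with half the crossing signature; where \<open>wchar\<close>
  vanishes, determinant 1 or not separates a double kernel from a simple one.\<close>

lemma regular_index_diagonal:
  assumes reg: "regular_path omega4 diagonal4 \<Lambda>"
    and \<rho>: "continuous_on {0..1} \<rho>"
      "\<And>s. s \<in> {0..1} \<Longrightarrow> wdet (W11 (orth_proj (\<Lambda> s))) (W12 (orth_proj (\<Lambda> s))) (W22 (orth_proj (\<Lambda> s)))
        = exp (2 * \<i> * of_real (\<rho> s))"
  defines "w11 \<equiv> \<lambda>s. W11 (orth_proj (\<Lambda> s))" and "w12 \<equiv> \<lambda>s. W12 (orth_proj (\<Lambda> s))" and "w22 \<equiv> \<lambda>s. W22 (orth_proj (\<Lambda> s))"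
  defines "cnt \<equiv> \<lambda>s. phase_count (\<rho> s) (Re (wchar (w11 s) (w12 s) (w22 s) * exp (- (\<i> * of_real (\<rho> s)))))
        (w11 s = 1 \<and> w12 s = 0 \<and> w22 s = 1)"
  shows "regular_index omega4 diagonal4 \<Lambda> = cnt 1 - cnt 0"
proof -
  let ?C = "crossings diagonal4 \<Lambda>"
  let ?sig = "crossing_signature omega4 diagonal4 \<Lambda>"
  have lag: "lagrangian omega4 (\<Lambda> s)" if "s \<in> {0..1}" for s using reg that by (auto simp: regular_path_def)
  have sub: "subspace (\<Lambda> s)" if "s \<in> {0..1}" for s using lag[OF that] by (simp add: lagrangian_def)
  obtain D :: "real \<Rightarrow> (((real^2) \<times> (real^2)) \<Rightarrow>\<^sub>L ((real^2) \<times> (real^2)))" where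
    D: "\<And>t. t \<in> {0..1} \<Longrightarrow> ((\<lambda>s. orth_proj (\<Lambda> s)) has_vector_derivative D t) (at t within {0..1})"
    using reg unfolding regular_path_def C1_subspace_path_def o_def by blast
  have su: "sym_unitary (w11 s) (w12 s) (w22 s)" if "s \<in> {0..1}" for s
    unfolding w11_def w12_def w22_def by (rule sym_unitary_W[OF lag[OF that]])
  have mem: "x1 *\<^sub>R f1 + x2 *\<^sub>R f2 \<in> \<Lambda> s \<longleftrightarrow>
      w11 s * of_real x1 + w12 s * of_real x2 = of_real x1 \<and> w12 s * of_real x1 + w22 s * of_real x2 = of_real x2"
    if "s \<in> {0..1}" for s x1 x2
    unfolding w11_def w12_def w22_def by (rule diagonal_mem_iff[OF lag[OF that]])
  have loc: "\<forall>\<^sub>F s in at t within {0..1}. (s > t \<longrightarrow> cnt s = cnt t + ?sig t / 2) \<and> (s < t \<longrightarrow> cnt s = cnt t - ?sig t / 2)"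
    if t: "t \<in> {0..1}" for t
  proof -
    \<comment> \<open>\<open>W11\<close> and \<open>W22\<close> are affine in P with constant term
      -1; adding 1 leaves the linear part, which is the derivative.\<close>
    define e11 e12 e22 where "e11 = W11 (D t) + 1" and "e12 = W12 (D t)" and "e22 = W22 (D t) + 1"
    have der: "(w11 has_vector_derivative e11) (at t within {0..1})"
      "(w12 has_vector_derivative e12) (at t within {0..1})"
      "(w22 has_vector_derivative e22) (at t within {0..1})"
    proof -
      have bl: "((\<lambda>s. inner (orth_proj (\<Lambda> s) u) v) has_vector_derivative inner (D t u) v) (at t within {0..1})" for u v
        by (rule bounded_linear.has_vector_derivative[OF _ D[OF t], of "\<lambda>P. inner (blinfun_apply P u) v"]) (intro bounded_linear_intros)
      show "(w11 has_vector_derivative e11) (at t within {0..1})"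
        unfolding w11_def e11_def W11_def has_vector_derivative_complex_iff
        using bl[of f1 f1] bl[of f1 "I4 f1"]
        by (simp del: inner_frame add: has_real_derivative_iff_has_vector_derivative has_vector_derivative_diff_const)
      show "(w12 has_vector_derivative e12) (at t within {0..1})"
        unfolding w12_def e12_def W12_def has_vector_derivative_complex_iff
        using bl[of f1 f2] bl[of f1 "I4 f2"] by (simp del: inner_frame add: has_real_derivative_iff_has_vector_derivative)
      show "(w22 has_vector_derivative e22) (at t within {0..1})"
        unfolding w22_def e22_def W22_def has_vector_derivative_complex_iff
        using bl[of f2 f2] bl[of f2 "I4 f2"]
        by (simp del: inner_frame add: has_real_derivative_iff_has_vector_derivative has_vector_derivative_diff_const)
    qed
    interpret sym_unitary_path w11 w12 w22 \<rho> t e11 e12 e22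
      using t su der \<rho> by unfold_locales (auto simp: w11_def w12_def w22_def)
    have n_eq: "cnt = n" unfolding cnt_def n_def \<kappa>_def ..
    have form: "crossing_form omega4 \<Lambda> t (x1 *\<^sub>R f1 + x2 *\<^sub>R f2) = Im e11 * x1^2 + 2 * Im e12 * x1 * x2 + Im e22 * x2^2"
      if "x1 *\<^sub>R f1 + x2 *\<^sub>R f2 \<in> \<Lambda> t" for x1 x2
    proof -
      let ?v = "x1 *\<^sub>R f1 + x2 *\<^sub>R f2"
      have sym: "inner (D t f2) (I4 f1) = inner (D t f1) (I4 f2)"
      proof -
        have bl: "((\<lambda>s. inner (orth_proj (\<Lambda> s) u) v) has_vector_derivative inner (D t u) v) (at t within {0..1})" for u v
          by (rule bounded_linear.has_vector_derivative[OF _ D[OF t], of "\<lambda>P. inner (blinfun_apply P u) v"]) (intro bounded_linear_intros)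
        have "((\<lambda>s. inner (orth_proj (\<Lambda> s) f2) (I4 f1)) has_vector_derivative inner (D t f1) (I4 f2)) (at t within {0..1})"
          by (rule has_vector_derivative_transform[OF t _ bl[of f1 "I4 f2"]]) (rule P_symmetric(2)[OF lag])
        moreover have "at t within {0..1} \<noteq> bot" using t by (auto simp: trivial_limit_within islimpt_Icc)
        ultimately show ?thesis using vector_derivative_unique_within bl by blast
      qed
      have "crossing_form omega4 \<Lambda> t ?v = omega4 ?v (D t ?v)"
        by (rule form4.crossing_form_eq[OF _ D[OF t] t that]) (rule lag)
      also have "\<dots> = inner (D t ?v) (I4 ?v)" by (simp add: form4.\<omega>_eq inner_commute)
      also have "I4 ?v = x1 *\<^sub>R I4 f1 + x2 *\<^sub>R I4 f2" using form4.I_linear by (simp add: linear_add linear_scale)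
      also have "inner (D t ?v) (x1 *\<^sub>R I4 f1 + x2 *\<^sub>R I4 f2) = Im e11 * x1^2 + 2 * Im e12 * x1 * x2 + Im e22 * x2^2"
        using sym unfolding e11_def e12_def e22_def W11_def W12_def W22_def
        by (simp del: inner_frame add: blinfun.add_right blinfun.scaleR_right inner_add_left inner_add_right power2_eq_square algebra_simps)
      finally show ?thesis .
    qed
    show ?thesis
    proof (cases "wchar (w11 t) (w12 t) (w22 t) = 0")
      case False
      have "\<Lambda> t \<inter> diagonal4 = {0}"
      proof -
        have "v = 0" if vt: "v \<in> \<Lambda> t" "v \<in> diagonal4" for v
        proof -
          obtain x1 x2 where v: "v = x1 *\<^sub>R f1 + x2 *\<^sub>R f2" using vt(2) diagonal4_iff by blast
          then have "x1 = 0 \<and> x2 = 0" using mem[OF t, of x1 x2] vt(1) False wchar_kernel by blast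
          then show ?thesis by (simp add: v)
        qed
        then show ?thesis using sub[OF t] subspace_diagonal4 by (auto simp: subspace_0)
      qed
      then have "?sig t = 0" by (simp add: crossing_signature_def form_signature_0)
      then show ?thesis using noncrossing[OF False] unfolding n_eq by (auto elim: eventually_mono)
    next
      case True
      obtain x1 x2 where x: "x1^2 + x2^2 = 1" "w11 t * of_real x1 + w12 t * of_real x2 = of_real x1"
          "w12 t * of_real x1 + w22 t * of_real x2 = of_real x2"
        using wchar_kernel_exists[OF su[OF t] True] by blast
      let ?v = "x1 *\<^sub>R f1 + x2 *\<^sub>R f2"
      have v: "?v \<in> \<Lambda> t" using mem[OF t] x by blast
      have v0: "?v \<noteq> 0" using x(1) diagonal_combination_0 by force
      have tC: "t \<in> ?C" using t v v0 diagonal4_iff unfolding crossings_def by blast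
      then have nondeg: "nondegenerate_form (\<Lambda> t \<inter> diagonal4) (crossing_form omega4 \<Lambda> t)"
        using reg by (auto simp: regular_path_def)
      show ?thesis
      proof (cases "wdet (w11 t) (w12 t) (w22 t) = 1")
        case False
        define q where "q = Im e11 * x1^2 + 2 * Im e12 * x1 * x2 + Im e22 * x2^2"
        \<comment> \<open>Since \<open>wchar\<close> is 0 and the determinant is not 1, the trace
          \<mu> of \<open>1 - W\<close> is nonzero; by \<open>kernel_algebra\<close> the real kernel
          is just the line of x.\<close>
        have K: "\<Lambda> t \<inter> diagonal4 = span {?v}"
        proof
          show "span {?v} \<subseteq> \<Lambda> t \<inter> diagonal4"
            using v diagonal4_iff sub[OF t] subspace_diagonal4 by (intro span_minimal subspace_inter) auto
          show "\<Lambda> t \<inter> diagonal4 \<subseteq> span {?v}"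
          proof
            fix u assume u: "u \<in> \<Lambda> t \<inter> diagonal4"
            then obtain y1 y2 where y: "u = y1 *\<^sub>R f1 + y2 *\<^sub>R f2" using diagonal4_iff by blast
            have ey: "w11 t * of_real y1 + w12 t * of_real y2 = of_real y1"
              "w12 t * of_real y1 + w22 t * of_real y2 = of_real y2" using u mem[OF t] y by auto
            define \<mu> where "\<mu> = (1 - w11 t) + (1 - w22 t)"
            have \<mu>0: "\<mu> \<noteq> 0" using True False wchar_eq[of "w11 t" "w12 t" "w22 t"] by (auto simp: \<mu>_def algebra_simps)
            have "complex_of_real x1 * of_real x1 + of_real x2 * of_real x2 = 1"
              using x(1) by (metis of_real_1 of_real_add of_real_mult power2_eq_square)
            note A = kernel_algebra(3)[OF x(2,3) this \<mu>_def]
            have "\<mu> * (of_real x2 * (of_real x2 * of_real y1 - of_real x1 * of_real y2)) = 0"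
              "\<mu> * (of_real x1 * (of_real x1 * of_real y2 - of_real x2 * of_real y1)) = 0"
            proof -
              have A': "1 - w11 t = \<mu> * (of_real x2 * of_real x2)" "1 - w22 t = \<mu> * (of_real x1 * of_real x1)"
                "w12 t = \<mu> * (of_real x1 * of_real x2)" using A by auto
              have "(1 - w11 t) * of_real y1 = w12 t * of_real y2" "(1 - w22 t) * of_real y2 = w12 t * of_real y1"
                using ey by (simp_all add: algebra_simps)
              then show "\<mu> * (of_real x2 * (of_real x2 * of_real y1 - of_real x1 * of_real y2)) = 0"
                "\<mu> * (of_real x1 * (of_real x1 * of_real y2 - of_real x2 * of_real y1)) = 0"
                unfolding A' by (simp_all add: algebra_simps)
            qed
            then have "x2 * (x2 * y1 - x1 * y2) = 0" "x1 * (x1 * y2 - x2 * y1) = 0"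
              using \<mu>0 by (auto simp flip: of_real_mult of_real_diff)
            then have "y1 = (x1 * y1 + x2 * y2) * x1" "y2 = (x1 * y1 + x2 * y2) * x2" using x(1) by algebra+
            then have "u = (x1 * y1 + x2 * y2) *\<^sub>R ?v" unfolding y by (metis scaleR_add_right scaleR_scaleR)
            then show "u \<in> span {?v}" by (auto simp: span_singleton)
          qed
        qed
        have Q: "crossing_form omega4 \<Lambda> t (r *\<^sub>R ?v) = r^2 * q" for r
        proof -
          have e: "r *\<^sub>R ?v = (r * x1) *\<^sub>R f1 + (r * x2) *\<^sub>R f2" by (simp add: scaleR_add_right)
          have "r *\<^sub>R ?v \<in> \<Lambda> t" using v sub[OF t] by (rule subspace_scale[rotated])
          then show ?thesis using form[of "r * x1" "r * x2"] unfolding e q_def by (simp add: power2_eq_square algebra_simps)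
        qed
        have "q \<noteq> 0"
        proof
          assume "q = 0"
          then have "crossing_form omega4 \<Lambda> t u = 0" if "u \<in> span {?v}" for u using that Q by (auto simp: span_singleton)
          then have "?v = 0" using nondeg unfolding K nondegenerate_form_def
            by (metis diff_0_right insertI1 span_add span_base)
          then show False using v0 by simp
        qed
        moreover have "?sig t = sgn q" unfolding crossing_signature_def K by (rule form_signature_span[OF v0 Q])
        ultimately show ?thesis using simple_crossing[OF x False q_def] unfolding n_eq by simp
      next
        case one: True
        have w1: "w11 t = 1" "w12 t = 0" "w22 t = 1" using sym_unitary_wdet_1(3)[OF su[OF t] one True] by auto
        have in_\<Lambda>: "y1 *\<^sub>R f1 + y2 *\<^sub>R f2 \<in> \<Lambda> t" for y1 y2 using mem[OF t] w1 by simp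
        then have K: "\<Lambda> t \<inter> diagonal4 = diagonal4"
        proof -
          have "u \<in> \<Lambda> t" if "u \<in> diagonal4" for u using that diagonal4_iff[of u] in_\<Lambda> by auto
          then show ?thesis by auto
        qed
        define \<Delta> where "\<Delta> = Im e11 * Im e22 - Im e12 * Im e12"
        have "\<Delta> \<noteq> 0"
        proof
          assume 0: "\<Delta> = 0"
          have "\<exists>y1 y2. (y1 \<noteq> 0 \<or> y2 \<noteq> 0) \<and> Im e11 * y1 + Im e12 * y2 = 0 \<and> Im e12 * y1 + Im e22 * y2 = 0"
          proof (cases "Im e22 = 0 \<and> Im e12 = 0")
            case True
            show ?thesis
            proof (cases "Im e11 = 0")
              case True then show ?thesis using \<open>Im e22 = 0 \<and> Im e12 = 0\<close> by (intro exI[of _ 1] exI[of _ 0]) simp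
            next
              case False then show ?thesis using True by (intro exI[of _ 0] exI[of _ 1]) simp
            qed
          next
            case False
            then show ?thesis using 0 by (intro exI[of _ "Im e22"] exI[of _ "- Im e12"]) (auto simp: \<Delta>_def)
          qed
          then obtain y1 y2 where y: "y1 \<noteq> 0 \<or> y2 \<noteq> 0" "Im e11 * y1 + Im e12 * y2 = 0" "Im e12 * y1 + Im e22 * y2 = 0" by blast
          let ?u = "y1 *\<^sub>R f1 + y2 *\<^sub>R f2"
          have "crossing_form omega4 \<Lambda> t (?u + u) - crossing_form omega4 \<Lambda> t ?u - crossing_form omega4 \<Lambda> t u = 0"
            if ud: "u \<in> diagonal4" for u
          proof -
            obtain z1 z2 where z: "u = z1 *\<^sub>R f1 + z2 *\<^sub>R f2" using ud diagonal4_iff by blast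
            have e: "?u + (z1 *\<^sub>R f1 + z2 *\<^sub>R f2) = (y1 + z1) *\<^sub>R f1 + (y2 + z2) *\<^sub>R f2" by (simp add: scaleR_add_left)
            have "crossing_form omega4 \<Lambda> t (?u + u) - crossing_form omega4 \<Lambda> t ?u - crossing_form omega4 \<Lambda> t u
               = 2 * z1 * (Im e11 * y1 + Im e12 * y2) + 2 * z2 * (Im e12 * y1 + Im e22 * y2)"
              unfolding z e form[OF in_\<Lambda>] by (simp add: power2_eq_square algebra_simps)
            then show ?thesis using y by simp
          qed
          moreover have "?u \<in> diagonal4" using diagonal4_iff by blast
          ultimately have "?u = 0" using nondeg unfolding K nondegenerate_form_def by blast
          then show False using y(1) diagonal_combination_0 by blast
        qed
        moreover have "?sig t = 2 * (if \<Delta> < 0 then 0 else sgn (Im e11 + Im e22))"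
          unfolding crossing_signature_def K \<Delta>_def
          by (rule form_signature_diagonal[OF form[OF in_\<Lambda>]]) (use calculation in \<open>simp add: \<Delta>_def\<close>)
        ultimately show ?thesis using full_crossing[OF w1 \<Delta>_def _ refl] unfolding n_eq by simp
      qed
    qed
  qed
  have nosig: "?sig t = 0" if "t \<in> {0..1}" "t \<notin> ?C" for t
    using that by (auto simp: crossings_def crossing_signature_def form_signature_0)
  have "cnt 1 - cnt 0 = ?sig 0 / 2 + (\<Sum>t\<in>?C \<inter> {0<..<1}. ?sig t) + ?sig 1 / 2"
  proof (rule local_sum_jumps)
    show "finite ?C" using reg by (simp add: regular_path_def)
    show "?C \<subseteq> {0..1}" by (auto simp: crossings_def)
  qed (use nosig loc[unfolded eventually_conj_iff] in \<open>blast+\<close>)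
  then show ?thesis by (simp add: regular_index_def)
qed

section \<open>Graphs of symplectic matrices\<close>

definition mat2 :: "real \<Rightarrow> real \<Rightarrow> real \<Rightarrow> real \<Rightarrow> real^2^2" where
  "mat2 a b c d = vector [vector [a, b], vector [c, d]]"

lemma mat2_nth [simp]:
  "mat2 a b c d $ 1 $ 1 = a" "mat2 a b c d $ 1 $ 2 = b" "mat2 a b c d $ 2 $ 1 = c" "mat2 a b c d $ 2 $ 2 = d"
  by (simp_all add: mat2_def)

lemma mat2_eq_iff:
  "(M::real^2^2) = M' \<longleftrightarrow> M$1$1 = M'$1$1 \<and> M$1$2 = M'$1$2 \<and> M$2$1 = M'$2$1 \<and> M$2$2 = M'$2$2"
  by (auto simp: vec2_eq_iff)

lemma mat2_mult_vec [simp]: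
  fixes M :: "real^2^2"
  shows "(M *v x) $ 1 = M$1$1 * x$1 + M$1$2 * x$2" "(M *v x) $ 2 = M$2$1 * x$1 + M$2$2 * x$2"
  by (simp_all add: matrix_vector_mult_def sum_2)

lemma mat_1_nth [simp]: "(mat 1 :: real^2^2) $ 1 $ 1 = 1" "(mat 1 :: real^2^2) $ 1 $ 2 = 0"
  "(mat 1 :: real^2^2) $ 2 $ 1 = 0" "(mat 1 :: real^2^2) $ 2 $ 2 = 1"
  by (simp_all add: mat_def)

lemma continuous_on_mat2:
  assumes "continuous_on S a" "continuous_on S b" "continuous_on S c" "continuous_on S d"
  shows "continuous_on S (\<lambda>s. mat2 (a s) (b s) (c s) (d s))"
proof -
  have eq: "(\<lambda>s. mat2 (a s) (b s) (c s) (d s)) =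
      (\<lambda>s. a s *\<^sub>R mat2 1 0 0 0 + b s *\<^sub>R mat2 0 1 0 0 + c s *\<^sub>R mat2 0 0 1 0 + d s *\<^sub>R mat2 0 0 0 1)"
    by (simp add: mat2_eq_iff fun_eq_iff)
  show ?thesis by (subst eq) (intro continuous_intros assms)
qed

lemma Sp2_iff: "M \<in> Sp2 \<longleftrightarrow> M$1$1 * M$2$2 - M$1$2 * M$2$1 = 1"
proof
  assume "M \<in> Sp2"
  then have "omega2 (M *v axis 1 1) (M *v axis 2 1) = omega2 (axis 1 1) (axis 2 1)" by (simp add: Sp2_def)
  then show "M$1$1 * M$2$2 - M$1$2 * M$2$1 = 1" by (simp add: omega2_def axis_def algebra_simps)
next
  assume 1: "M$1$1 * M$2$2 - M$1$2 * M$2$1 = 1"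
  have "omega2 (M *v u) (M *v v) = (M$1$1 * M$2$2 - M$1$2 * M$2$1) * omega2 u v" for u v
    by (simp add: omega2_def algebra_simps)
  then show "M \<in> Sp2" using 1 by (simp add: Sp2_def)
qed

text \<open>Twice the complex-linear part of M, with the plane read as the complex numbers. On Sp(2)
  its modulus is at least 2, so a path has a continuous argument.\<close>

definition zeta :: "real^2^2 \<Rightarrow> complex" where
  "zeta M = Complex (M$1$1 + M$2$2) (M$2$1 - M$1$2)"

lemma norm_zeta:
  assumes "M \<in> Sp2"
  shows "(norm (zeta M))^2 = 4 + (M$1$1 - M$2$2)^2 + (M$1$2 + M$2$1)^2"
proof -
  have "(norm (zeta M))^2 = (M$1$1 + M$2$2)^2 + (M$2$1 - M$1$2)^2" by (simp add: zeta_def cmod_def)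
  also have "\<dots> = 4 * (M$1$1 * M$2$2 - M$1$2 * M$2$1) + (M$1$1 - M$2$2)^2 + (M$1$2 + M$2$1)^2"
    by (simp add: power2_eq_square algebra_simps)
  finally show ?thesis using assms by (simp add: Sp2_iff)
qed

lemma zeta_ne_0: "M \<in> Sp2 \<Longrightarrow> zeta M \<noteq> 0"
  using norm_zeta[of M] by (auto simp: add_nonneg_eq_0_iff)

lemma lagrangian_Gr: "M \<in> Sp2 \<Longrightarrow> lagrangian omega4 (Gr M)"
proof -
  assume M: "M \<in> Sp2"
  have eq: "Gr M = (\<lambda>x. (x, M *v x)) ` UNIV" by (auto simp: Gr_def)
  have lin: "linear (\<lambda>x. (x, M *v x))" by (rule linearI) (simp_all add: matrix_vector_right_distrib matrix_vector_mult_scaleR)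
  have "subspace (Gr M)" unfolding eq by (intro linear_subspace_image lin subspace_UNIV)
  moreover have "dim (Gr M) = 2" unfolding eq by (subst dim_image_eq[OF lin]) (auto simp: inj_on_def)
  ultimately show ?thesis using M by (auto simp: lagrangian_def Gr_def omega4_def Sp2_def)
qed

lemma Gr_1: "Gr (mat 1) = diagonal4" by (auto simp: Gr_def diagonal4_def)

text \<open>The determinant of 1 + \<open>M\<^sup>T M\<close> when det M = 1: one, plus the sum of
  squares, plus the square of the determinant.\<close>

definition gram_det :: "real^2^2 \<Rightarrow> real" where
  "gram_det M = 2 + M$1$1 * M$1$1 + M$1$2 * M$1$2 + M$2$1 * M$2$1 + M$2$2 * M$2$2"

lemma gram_det_pos: "gram_det M > 0"
  unfolding gram_det_def by (intro add_pos_nonneg) auto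

text \<open>The solution \<open>w\<close> of \<open>(1 + M\<^sup>T M) w = y + M\<^sup>T z\<close>; then \<open>(w, M w)\<close> is the point of the graph of \<open>M\<close>
  closest to \<open>(y, z)\<close>.\<close>

definition graph_coord :: "real^2^2 \<Rightarrow> (real^2) \<times> (real^2) \<Rightarrow> real^2" where
  "graph_coord M v = (let p = fst v $ 1 + M$1$1 * snd v $ 1 + M$2$1 * snd v $ 2;
       q = fst v $ 2 + M$1$2 * snd v $ 1 + M$2$2 * snd v $ 2;
       m = M$1$1 * M$1$2 + M$2$1 * M$2$2 in
     vector [((1 + M$1$2 * M$1$2 + M$2$2 * M$2$2) * p - m * q) * inverse (gram_det M),
             ((1 + M$1$1 * M$1$1 + M$2$1 * M$2$1) * q - m * p) * inverse (gram_det M)])"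

lemma orth_proj_Gr:
  assumes "M \<in> Sp2"
  shows "blinfun_apply (orth_proj (Gr M)) = (\<lambda>v. (graph_coord M v, M *v graph_coord M v))"
proof (rule orth_proj_apply)
  show "subspace (Gr M)" using lagrangian_Gr[OF assms] by (simp add: lagrangian_def)
  show "(graph_coord M v, M *v graph_coord M v) \<in> Gr M" for v by (auto simp: Gr_def)
  fix v y :: "(real^2) \<times> (real^2)" assume "y \<in> Gr M"
  then obtain x where y: "y = (x, M *v x)" by (auto simp: Gr_def)
  define a b c d where abcd: "a = M$1$1" "b = M$1$2" "c = M$2$1" "d = M$2$2"
  have det: "a * d - b * c = 1" using assms by (simp add: Sp2_iff abcd)
  define p q where pq: "p = fst v $ 1 + a * snd v $ 1 + c * snd v $ 2" "q = fst v $ 2 + b * snd v $ 1 + d * snd v $ 2"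
  define g where "g = 2 + a * a + b * b + c * c + d * d"
  define w1 w2 where w: "w1 = ((1 + b * b + d * d) * p - (a * b + c * d) * q) * inverse g"
    "w2 = ((1 + a * a + c * c) * q - (a * b + c * d) * p) * inverse g"
  have g: "g * inverse g = 1" using gram_det_pos[of M] by (simp add: g_def gram_det_def abcd)
  have gc: "graph_coord M v $ 1 = w1" "graph_coord M v $ 2 = w2"
    by (simp_all add: graph_coord_def Let_def w pq g_def gram_det_def abcd)
  have S: "(1 + a * a + c * c) * (1 + b * b + d * d) - (a * b + c * d) * (a * b + c * d) = g"
    unfolding g_def using det by algebra
  have "(1 + a * a + c * c) * w1 + (a * b + c * d) * w2 =
      ((1 + a * a + c * c) * (1 + b * b + d * d) - (a * b + c * d) * (a * b + c * d)) * inverse g * p"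
    unfolding w by (simp add: algebra_simps)
  also have "\<dots> = p" unfolding S g by simp
  finally have "(1 + a * a + c * c) * w1 + (a * b + c * d) * w2 = p" .
  moreover have "(a * b + c * d) * w1 + (1 + b * b + d * d) * w2 = q"
  proof -
    have "(a * b + c * d) * w1 + (1 + b * b + d * d) * w2 =
        ((1 + a * a + c * c) * (1 + b * b + d * d) - (a * b + c * d) * (a * b + c * d)) * inverse g * q"
      unfolding w by (simp add: algebra_simps)
    also have "\<dots> = q" unfolding S g by simp
    finally show ?thesis .
  qed
  moreover have "inner (v - (graph_coord M v, M *v graph_coord M v)) y =
      x$1 * (p - ((1 + a * a + c * c) * w1 + (a * b + c * d) * w2)) + x$2 * (q - ((a * b + c * d) * w1 + (1 + b * b + d * d) * w2))"
    unfolding y by (simp add: inner_prod_def inner_real2 gc abcd[symmetric] pq algebra_simps)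
  ultimately show "inner (v - (graph_coord M v, M *v graph_coord M v)) y = 0" by simp
qed

lemma inner_orth_proj_Gr:
  fixes u v :: "(real^2) \<times> (real^2)"
  assumes "M \<in> Sp2"
  shows "inner (orth_proj (Gr M) u) v = graph_coord M u $ 1 * fst v $ 1 + graph_coord M u $ 2 * fst v $ 2 +
    (M$1$1 * graph_coord M u $ 1 + M$1$2 * graph_coord M u $ 2) * snd v $ 1 +
    (M$2$1 * graph_coord M u $ 1 + M$2$2 * graph_coord M u $ 2) * snd v $ 2"
  by (simp add: orth_proj_Gr[OF assms] inner_prod_def inner_real2)

section \<open>Differentiable and continuous dependence of graph projections\<close>

definition C1_unit :: "(real \<Rightarrow> real) \<Rightarrow> bool" where
  "C1_unit f \<longleftrightarrow> (\<exists>f'. continuous_on {0..1} f' \<and> (\<forall>t\<in>{0..1}. (f has_real_derivative f' t) (at t within {0..1})))"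

lemma C1_unit_continuous: "C1_unit f \<Longrightarrow> continuous_on {0..1} f"
  unfolding C1_unit_def by (metis DERIV_continuous_on)

lemma C1_unit_const: "C1_unit (\<lambda>s. c)"
  unfolding C1_unit_def by (intro exI[of _ "\<lambda>_. 0"]) auto

lemma C1_unit_add:
  assumes "C1_unit f" "C1_unit g" shows "C1_unit (\<lambda>s. f s + g s)"
proof -
  obtain f' g' where "continuous_on {0..1} f'" "\<forall>t\<in>{0..1}. (f has_real_derivative f' t) (at t within {0..1})"
    "continuous_on {0..1} g'" "\<forall>t\<in>{0..1}. (g has_real_derivative g' t) (at t within {0..1})"
    using assms unfolding C1_unit_def by blast
  then show ?thesis unfolding C1_unit_def
    by (intro exI[of _ "\<lambda>t. f' t + g' t"]) (auto intro!: continuous_intros DERIV_add)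
qed

lemma C1_unit_mult:
  assumes "C1_unit f" "C1_unit g" shows "C1_unit (\<lambda>s. f s * g s)"
proof -
  obtain f' g' where "continuous_on {0..1} f'" "\<forall>t\<in>{0..1}. (f has_real_derivative f' t) (at t within {0..1})"
    "continuous_on {0..1} g'" "\<forall>t\<in>{0..1}. (g has_real_derivative g' t) (at t within {0..1})"
    using assms unfolding C1_unit_def by blast
  then show ?thesis unfolding C1_unit_def
    by (intro exI[of _ "\<lambda>t. f' t * g t + g' t * f t"])
      (auto intro!: continuous_intros DERIV_mult C1_unit_continuous[OF assms(1)] C1_unit_continuous[OF assms(2)])
qed

lemma C1_unit_inverse:
  assumes "C1_unit f" "\<And>s. s \<in> {0..1} \<Longrightarrow> f s \<noteq> 0" shows "C1_unit (\<lambda>s. inverse (f s))"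
proof -
  obtain f' where "continuous_on {0..1} f'" "\<forall>t\<in>{0..1}. (f has_real_derivative f' t) (at t within {0..1})"
    using assms unfolding C1_unit_def by blast
  then show ?thesis unfolding C1_unit_def using assms(2)
    by (intro exI[of _ "\<lambda>t. - (inverse (f t) * f' t * inverse (f t))"])
      (auto intro!: continuous_intros DERIV_inverse' C1_unit_continuous[OF assms(1)])
qed

lemma C1_unit_minus: "C1_unit f \<Longrightarrow> C1_unit (\<lambda>s. - f s)"
  using C1_unit_mult[OF C1_unit_const[of "-1"]] by simp

lemma C1_unit_diff: "C1_unit f \<Longrightarrow> C1_unit g \<Longrightarrow> C1_unit (\<lambda>s. f s - g s)"
  using C1_unit_add[OF _ C1_unit_minus] by simp

lemma C1_unit_sin: "C1_unit (\<lambda>s. sin (s * c))" and C1_unit_cos: "C1_unit (\<lambda>s. cos (s * c))"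
proof -
  show "C1_unit (\<lambda>s. sin (s * c))" unfolding C1_unit_def
    by (intro exI[of _ "\<lambda>t. cos (t * c) * c"]) (auto intro!: continuous_intros derivative_eq_intros)
  show "C1_unit (\<lambda>s. cos (s * c))" unfolding C1_unit_def
    by (intro exI[of _ "\<lambda>t. - sin (t * c) * c"]) (auto intro!: continuous_intros derivative_eq_intros)
qed

lemmas C1_unit_intros = C1_unit_const C1_unit_add C1_unit_mult C1_unit_inverse C1_unit_minus C1_unit_diff
  C1_unit_sin C1_unit_cos

lemma C1_subspace_pathI:
  fixes \<Lambda> :: "real \<Rightarrow> 'v::euclidean_space set"
  assumes "\<And>u v. C1_unit (\<lambda>s. inner (orth_proj (\<Lambda> s) u) v)"
  shows "C1_subspace_path \<Lambda>"
proof -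
  have "\<exists>d. \<forall>u v. continuous_on {0..1} (d u v) \<and>
      (\<forall>t\<in>{0..1}. ((\<lambda>s. inner (orth_proj (\<Lambda> s) u) v) has_real_derivative d u v t) (at t within {0..1}))"
    using assms unfolding C1_unit_def by metis
  then obtain d where d: "\<And>u v. continuous_on {0..1} (d u v)"
      "\<And>u v t. t \<in> {0..1} \<Longrightarrow> ((\<lambda>s. inner (orth_proj (\<Lambda> s) u) v) has_real_derivative d u v t) (at t within {0..1})" by blast
  let ?E = "\<lambda>i j. Blinfun (\<lambda>v::'v. (inner v i) *\<^sub>R (j::'v))"
  define D where "D t = (\<Sum>i\<in>Basis. \<Sum>j\<in>Basis. d i j t *\<^sub>R ?E i j)" for t
  have "continuous_on {0..1} D" unfolding D_def by (intro continuous_intros d)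
  moreover have "((\<lambda>s. orth_proj (\<Lambda> s)) has_vector_derivative D t) (at t within {0..1})" if "t \<in> {0..1}" for t
  proof -
    have "((\<lambda>s. \<Sum>i\<in>Basis. \<Sum>j\<in>Basis. (inner (orth_proj (\<Lambda> s) i) j) *\<^sub>R ?E i j) has_vector_derivative D t) (at t within {0..1})"
      unfolding D_def
      by (intro has_vector_derivative_sum bounded_linear.has_vector_derivative[OF bounded_linear_scaleR_left])
        (use d(2)[OF that] in \<open>simp add: has_real_derivative_iff_has_vector_derivative\<close>)
    then show ?thesis by (simp flip: blinfun_matrix_sum)
  qed
  ultimately show ?thesis unfolding C1_subspace_path_def o_def by blast
qed

lemma C1_subspace_path_Gr:
  assumes "\<And>s. s \<in> {0..1} \<Longrightarrow> M s \<in> Sp2"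
    and "\<And>i j. C1_unit (\<lambda>s. M s $ i $ j)"
  shows "C1_subspace_path (\<lambda>s. Gr (M s))"
proof (rule C1_subspace_pathI)
  fix u v :: "(real^2) \<times> (real^2)"
  have cong: "C1_unit f" if "C1_unit g" "\<And>s. s \<in> {0..1} \<Longrightarrow> f s = g s" for f g
    using that unfolding C1_unit_def has_real_derivative_iff_has_vector_derivative
    by (metis has_vector_derivative_transform)
  have gd: "C1_unit (\<lambda>s. inverse (gram_det (M s)))"
    by (intro C1_unit_inverse) (auto simp: gram_det_def intro!: C1_unit_intros assms, smt (verit) zero_le_square)
  have "C1_unit (\<lambda>s. graph_coord (M s) u $ 1)" "C1_unit (\<lambda>s. graph_coord (M s) u $ 2)"
    unfolding graph_coord_def Let_def by (simp_all, (intro C1_unit_intros assms gd)+)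
  then have "C1_unit (\<lambda>s. graph_coord (M s) u $ 1 * fst v $ 1 + graph_coord (M s) u $ 2 * fst v $ 2 +
    (M s$1$1 * graph_coord (M s) u $ 1 + M s$1$2 * graph_coord (M s) u $ 2) * snd v $ 1 +
    (M s$2$1 * graph_coord (M s) u $ 1 + M s$2$2 * graph_coord (M s) u $ 2) * snd v $ 2)"
    by (intro C1_unit_intros assms)
  then show "C1_unit (\<lambda>s. inner (orth_proj (Gr (M s)) u) v)"
    by (rule cong) (rule inner_orth_proj_Gr[OF assms(1)])
qed

lemma continuous_on_orth_proj_Gr: "continuous_on Sp2 (\<lambda>M. orth_proj (Gr M))"
proof (rule continuous_on_blinfunI)
  fix i :: "(real^2) \<times> (real^2)"
  have e: "continuous_on Sp2 (\<lambda>M::real^2^2. M $ k $ l)" for k l by (intro continuous_intros)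
  have gd: "continuous_on Sp2 (\<lambda>M. inverse (gram_det M))"
  proof (rule continuous_on_inverse)
    show "continuous_on Sp2 gram_det" unfolding gram_det_def by (intro continuous_intros e)
    show "\<forall>x\<in>Sp2. gram_det x \<noteq> 0" using gram_det_pos by (metis less_irrefl)
  qed
  have gc: "continuous_on Sp2 (\<lambda>M. graph_coord M i $ 1)" "continuous_on Sp2 (\<lambda>M. graph_coord M i $ 2)"
    unfolding graph_coord_def Let_def by (simp_all, (intro continuous_on_mult continuous_on_add continuous_on_diff continuous_on_const e gd)+)
  have "x = x $ 1 *\<^sub>R axis 1 1 + x $ 2 *\<^sub>R axis 2 1" for x :: "real^2" by (simp add: vec2_eq_iff axis_def)
  then have eq: "(x, M *v x) = (x$1 *\<^sub>R axis 1 1 + x$2 *\<^sub>R axis 2 1, (M$1$1 * x$1 + M$1$2 * x$2) *\<^sub>R axis 1 1 + (M$2$1 * x$1 + M$2$2 * x$2) *\<^sub>R axis 2 1)"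
    for M :: "real^2^2" and x by (simp add: vec2_eq_iff axis_def)
  have "continuous_on Sp2 (\<lambda>M. (graph_coord M i, M *v graph_coord M i))"
    unfolding eq
    by (intro continuous_on_Pair continuous_on_add continuous_on_scaleR continuous_on_mult continuous_on_const gc e)
  then show "continuous_on Sp2 (\<lambda>M. orth_proj (Gr M) i)"
    by (rule continuous_on_eq) (simp add: orth_proj_Gr)
qed

text \<open>Determinants of W C = Z and of (1 - W) C = C - Z, where (c11, c12) and (c21, c22) are
  the columns of C.\<close>

lemma det_algebra:
  fixes w11 w12 w22 z11 z12 z21 z22 c11 c12 c21 c22 :: complex
  assumes "w11 * c11 + w12 * c12 = z11" "w12 * c11 + w22 * c12 = z12"
    "w11 * c21 + w12 * c22 = z21" "w12 * c21 + w22 * c22 = z22"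
  shows "wdet w11 w12 w22 * (c11 * c22 - c12 * c21) = z11 * z22 - z12 * z21"
    "wchar w11 w12 w22 * (c11 * c22 - c12 * c21) = - ((c11 - z11) * (c22 - z22) - (c12 - z12) * (c21 - z21))"
  unfolding wdet_def wchar_def assms[symmetric] by (simp_all add: algebra_simps)

text \<open>The images of the basis vectors span the graph. By \<open>W_conjugate\<close> their
  coordinate matrix Z satisfies W cnj Z = Z; here det Z = 2 \<open>zeta M\<close> and det (cnj Z -
  Z) = -4 (2 - tr M).\<close>

lemma W_Gr:
  assumes M: "M \<in> Sp2"
  defines "P \<equiv> orth_proj (Gr M)"
  shows "wdet (W11 P) (W12 P) (W22 P) * cnj (zeta M) = zeta M"
    "wchar (W11 P) (W12 P) (W22 P) * cnj (zeta M) = of_real (2 * (2 - (M$1$1 + M$2$2)))"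
proof -
  define a b c d where abcd: "a = M$1$1" "b = M$1$2" "c = M$2$1" "d = M$2$2"
  have det: "a * d - b * c = 1" using M by (simp add: Sp2_iff abcd)
  define z11 z12 z21 z22 where z: "z11 = Complex (1 + a) c" "z12 = Complex c (1 - a)" "z21 = Complex b (d - 1)" "z22 = Complex (1 + d) (- b)"
  let ?w11 = "W11 P" and ?w12 = "W12 P" and ?w22 = "W22 P"
  have u1: "(axis 1 1, M *v axis 1 1) \<in> Gr M" and u2: "(axis 2 1, M *v axis 2 1) \<in> Gr M" by (auto simp: Gr_def)
  have 1: "?w11 * cnj z11 + ?w12 * cnj z12 = z11" "?w12 * cnj z11 + ?w22 * cnj z12 = z12"
    using W_conjugate[OF lagrangian_Gr[OF M] u1] unfolding P_def[symmetric] by (simp_all add: z abcd axis_def)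
  have 2: "?w11 * cnj z21 + ?w12 * cnj z22 = z21" "?w12 * cnj z21 + ?w22 * cnj z22 = z22"
    using W_conjugate[OF lagrangian_Gr[OF M] u2] unfolding P_def[symmetric] by (simp_all add: z abcd axis_def)
  have dz: "z11 * z22 - z12 * z21 = 2 * zeta M"
    using det by (simp add: z zeta_def abcd complex_eq_iff algebra_simps)
  then have dzc: "cnj z11 * cnj z22 - cnj z12 * cnj z21 = 2 * cnj (zeta M)"
    by (metis complex_cnj_diff complex_cnj_mult complex_cnj_numeral)
  have dy: "(cnj z11 - z11) * (cnj z22 - z22) - (cnj z12 - z12) * (cnj z21 - z21) = - of_real (4 * (2 - (a + d)))"
    using det by (simp add: z complex_eq_iff algebra_simps)
  have "wdet ?w11 ?w12 ?w22 * (cnj z11 * cnj z22 - cnj z12 * cnj z21) = z11 * z22 - z12 * z21"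
    by (rule det_algebra[OF 1 2])
  then show "wdet ?w11 ?w12 ?w22 * cnj (zeta M) = zeta M" unfolding dz dzc by simp
  have "wchar ?w11 ?w12 ?w22 * (cnj z11 * cnj z22 - cnj z12 * cnj z21)
      = - ((cnj z11 - z11) * (cnj z22 - z22) - (cnj z12 - z12) * (cnj z21 - z21))"
    by (rule det_algebra[OF 1 2])
  then have "2 * (wchar ?w11 ?w12 ?w22 * cnj (zeta M)) = 2 * of_real (2 * (2 - (a + d)))"
    unfolding dzc dy by (simp add: mult.left_commute)
  then have "wchar ?w11 ?w12 ?w22 * cnj (zeta M) = of_real (2 * (2 - (a + d)))"
    by (rule mult_left_cancel[THEN iffD1, rotated]) simp
  then show "wchar (W11 P) (W12 P) (W22 P) * cnj (zeta M) = of_real (2 * (2 - (M$1$1 + M$2$2)))"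
    by (simp only: abcd)
qed

text \<open>Dividing \<open>zeta M\<close> by its conjugate squares its phase, so any argument of
  \<open>zeta M\<close> can serve as \<rho> for the graph, and \<kappa> has the sign of 2 - tr
  M.\<close>

lemma W_Gr_phase:
  assumes M: "M \<in> Sp2" and \<rho>: "zeta M = of_real (norm (zeta M)) * exp (\<i> * of_real \<rho>)"
  defines "P \<equiv> orth_proj (Gr M)"
  shows "wdet (W11 P) (W12 P) (W22 P) = exp (2 * \<i> * of_real \<rho>)"
    "Re (wchar (W11 P) (W12 P) (W22 P) * exp (- (\<i> * of_real \<rho>))) = 2 * (2 - (M$1$1 + M$2$2)) / norm (zeta M)"
proof -
  have n0: "norm (zeta M) > 0" using zeta_ne_0[OF M] by simp
  have c: "cnj (zeta M) = of_real (norm (zeta M)) * exp (- (\<i> * of_real \<rho>))"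
    by (subst \<rho>) (simp add: exp_cnj)
  have e: "exp (- (\<i> * of_real \<rho>)) * exp (\<i> * of_real \<rho>) = 1" by (simp flip: exp_add)
  have "of_real (norm (zeta M)) * (wdet (W11 P) (W12 P) (W22 P) * exp (- (\<i> * of_real \<rho>))) = of_real (norm (zeta M)) * exp (\<i> * of_real \<rho>)"
    using W_Gr(1)[OF M] unfolding P_def[symmetric] c \<rho>[symmetric] by (simp add: mult.left_commute)
  then have "wdet (W11 P) (W12 P) (W22 P) * exp (- (\<i> * of_real \<rho>)) = exp (\<i> * of_real \<rho>)"
    using n0 by (metis mult_cancel_left norm_of_real of_real_eq_0_iff less_irrefl)
  then have "wdet (W11 P) (W12 P) (W22 P) * (exp (- (\<i> * of_real \<rho>)) * exp (\<i> * of_real \<rho>)) = exp (\<i> * of_real \<rho>) * exp (\<i> * of_real \<rho>)"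
    by (simp only: mult.assoc[symmetric])
  then show "wdet (W11 P) (W12 P) (W22 P) = exp (2 * \<i> * of_real \<rho>)"
    unfolding e by (simp flip: exp_add add: mult.assoc)
  have "of_real (norm (zeta M)) * (wchar (W11 P) (W12 P) (W22 P) * exp (- (\<i> * of_real \<rho>))) = of_real (2 * (2 - (M$1$1 + M$2$2)))"
    using W_Gr(2)[OF M] unfolding P_def[symmetric] c by (simp add: mult.left_commute)
  then have "norm (zeta M) * Re (wchar (W11 P) (W12 P) (W22 P) * exp (- (\<i> * of_real \<rho>))) = 2 * (2 - (M$1$1 + M$2$2))"
    by (metis Re_complex_of_real times_complex.sel(1) Im_complex_of_real mult_zero_left diff_zero)
  then show "Re (wchar (W11 P) (W12 P) (W22 P) * exp (- (\<i> * of_real \<rho>))) = 2 * (2 - (M$1$1 + M$2$2)) / norm (zeta M)"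
    using n0 by (simp add: field_simps)
qed

text \<open>Identifying the plane with the complex numbers, \<open>sp_polar r x y\<close> is the map
  \<open>z \<mapsto> s e\<^sup>i\<^sup>r z + (x + \<i> y) \<bar>z\<close> with \<open>s\<^sup>2 - x\<^sup>2 - y\<^sup>2 = 1\<close>.\<close>

definition sp_polar :: "real \<Rightarrow> real \<Rightarrow> real \<Rightarrow> real^2^2" where
  "sp_polar r x y = (let s = sqrt (1 + x^2 + y^2) in
     mat2 (s * cos r + x) (y - s * sin r) (s * sin r + y) (s * cos r - x))"

lemma sp_polar_in_Sp2: "sp_polar r x y \<in> Sp2"
proof -
  define s where "s = sqrt (1 + x^2 + y^2)"
  have "s * s = 1 + x^2 + y^2" unfolding s_def by (rule real_sqrt_mult_self[THEN trans]) (simp add: add_nonneg_nonneg)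
  then have "(s * cos r + x) * (s * cos r - x) - (y - s * sin r) * (s * sin r + y) = 1"
    using sin_cos_squared_add[of r] by (simp add: power2_eq_square) algebra
  then show ?thesis by (simp add: Sp2_iff sp_polar_def Let_def s_def[symmetric])
qed

lemma sp_polar_eq:
  assumes M: "M \<in> Sp2" and \<rho>: "zeta M = of_real (norm (zeta M)) * exp (\<i> * of_real \<rho>)"
  shows "M = sp_polar \<rho> ((M$1$1 - M$2$2) / 2) ((M$1$2 + M$2$1) / 2)"
proof -
  have "(norm (zeta M) / 2)^2 = 1 + ((M$1$1 - M$2$2) / 2)^2 + ((M$1$2 + M$2$1) / 2)^2"
    using norm_zeta[OF M] by (simp add: power_divide)
  then have s: "sqrt (1 + ((M$1$1 - M$2$2) / 2)^2 + ((M$1$2 + M$2$1) / 2)^2) = norm (zeta M) / 2"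
    by (metis norm_ge_zero real_sqrt_unique zero_le_divide_iff zero_le_numeral)
  have "M$1$1 + M$2$2 = norm (zeta M) * cos \<rho>" "M$2$1 - M$1$2 = norm (zeta M) * sin \<rho>"
    using arg_cong[OF \<rho>, of Re] arg_cong[OF \<rho>, of Im] by (simp_all add: zeta_def Re_exp Im_exp)
  then show ?thesis unfolding sp_polar_def s Let_def by (simp add: mat2_eq_iff field_simps)
qed

lemma zeta_sp_polar:
  "zeta (sp_polar r x y) = of_real (2 * sqrt (1 + x^2 + y^2)) * exp (\<i> * of_real r)"
  "norm (zeta (sp_polar r x y)) = 2 * sqrt (1 + x^2 + y^2)"
proof -
  show 1: "zeta (sp_polar r x y) = of_real (2 * sqrt (1 + x^2 + y^2)) * exp (\<i> * of_real r)"
    by (simp add: zeta_def sp_polar_def Let_def complex_eq_iff Re_exp Im_exp)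
  show "norm (zeta (sp_polar r x y)) = 2 * sqrt (1 + x^2 + y^2)"
    unfolding 1 norm_mult by (simp add: add_nonneg_nonneg)
qed

lemma continuous_on_sp_polar: "continuous_on UNIV (\<lambda>(r, x, y). sp_polar r x y)"
  unfolding sp_polar_def Let_def case_prod_unfold
  by (intro continuous_on_mat2 continuous_intros)

text \<open>The coordinates of \<open>sp_polar\<close> unroll Sp(2) to three-space, once an argument
  is chosen along each path; there the straight-line homotopy keeps the ends fixed.\<close>

lemma homotopic_paths_Sp2:
  assumes M: "continuous_on {0..1} M" "\<And>s. s \<in> {0..1} \<Longrightarrow> M s \<in> Sp2" "continuous_on {0..1} \<rho>"
      "\<And>s. s \<in> {0..1} \<Longrightarrow> zeta (M s) = of_real (norm (zeta (M s))) * exp (\<i> * of_real (\<rho> s))"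
    and M': "continuous_on {0..1} M'" "\<And>s. s \<in> {0..1} \<Longrightarrow> M' s \<in> Sp2" "continuous_on {0..1} \<rho>'"
      "\<And>s. s \<in> {0..1} \<Longrightarrow> zeta (M' s) = of_real (norm (zeta (M' s))) * exp (\<i> * of_real (\<rho>' s))"
    and ends: "M 0 = M' 0" "M 1 = M' 1" "\<rho> 0 = \<rho>' 0" "\<rho> 1 = \<rho>' 1"
  shows "homotopic_paths Sp2 M M'"
proof -
  let ?c = "\<lambda>M \<rho> s. (\<rho> s, (M s$1$1 - M s$2$2) / 2, (M s$1$2 + M s$2$1) / 2) :: real \<times> real \<times> real"
  let ?sp = "\<lambda>(r, x, y). sp_polar r x y"
  have cont: "continuous_on {0..1} (?c M \<rho>)" if "continuous_on {0..1} M" "continuous_on {0..1} \<rho>" for M :: "real \<Rightarrow> real^2^2" and \<rho>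
    by (intro continuous_intros that) auto
  have "homotopic_paths UNIV (?c M \<rho>) (?c M' \<rho>')"
    by (rule homotopic_paths_linear) (auto simp: path_def pathstart_def pathfinish_def ends intro!: cont M M')
  then have h: "homotopic_paths Sp2 (?sp \<circ> ?c M \<rho>) (?sp \<circ> ?c M' \<rho>')"
    by (rule homotopic_paths_continuous_image[OF _ continuous_on_sp_polar]) (auto simp: sp_polar_in_Sp2)
  have "homotopic_paths Sp2 M (?sp \<circ> ?c M \<rho>)" "homotopic_paths Sp2 M' (?sp \<circ> ?c M' \<rho>')"
    using M M' sp_polar_eq[OF M(2) M(4)] sp_polar_eq[OF M'(2) M'(4)]
    by (auto intro!: homotopic_paths_eq simp: path_def path_image_def)
  then show ?thesis using h by (meson homotopic_paths_sym homotopic_paths_trans)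
qed

section \<open>Regular model paths from the identity\<close>

lemma finite_unit_multiples:
  assumes "c \<noteq> 0"
  shows "finite {s \<in> {0..1}. \<exists>m::int. s * c = of_int m * pi}"
proof (rule finite_subset)
  show "{s \<in> {0..1}. \<exists>m::int. s * c = of_int m * pi} \<subseteq> (\<lambda>m. of_int m * pi / c) ` {-\<lceil>\<bar>c\<bar> / pi\<rceil>..\<lceil>\<bar>c\<bar> / pi\<rceil>}"
  proof
    fix s assume "s \<in> {s \<in> {0..1}. \<exists>m::int. s * c = of_int m * pi}"
    then obtain m :: int where s: "0 \<le> s" "s \<le> 1" and m: "s * c = of_int m * pi" by auto
    have "\<bar>s * c\<bar> \<le> \<bar>c\<bar>" using s by (simp add: abs_mult mult_left_le_one_le)
    then have "\<bar>of_int m\<bar> \<le> \<bar>c\<bar> / pi" unfolding m by (simp add: abs_mult field_simps)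
    then have "m \<in> {-\<lceil>\<bar>c\<bar> / pi\<rceil>..\<lceil>\<bar>c\<bar> / pi\<rceil>}" by (simp add: abs_le_iff) linarith
    moreover have "s = of_int m * pi / c" using m assms by (simp add: field_simps)
    ultimately show "s \<in> (\<lambda>m. of_int m * pi / c) ` {-\<lceil>\<bar>c\<bar> / pi\<rceil>..\<lceil>\<bar>c\<bar> / pi\<rceil>}" by blast
  qed
qed simp

text \<open>For determinant 1 the characteristic polynomial takes the value 2 - tr M at 1.\<close>

lemma eigenvector_trace:
  assumes "M \<in> Sp2" "M *v v = v" "v \<noteq> 0"
  shows "M$1$1 + M$2$2 = 2"
proof -
  have "(2 - (a + d)) * u = 0 \<and> (2 - (a + d)) * w = 0"
    if "a * u + b * w = u" "c * u + d * w = w" "a * d - b * c = 1" for a b c d u w :: real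
  proof -
    have 1: "b * w = (1 - a) * u" "c * u = (1 - d) * w" using that by (auto simp: algebra_simps)
    have "(2 - (a + d)) * u = ((1 - a) * u) * (1 - d) - b * (c * u) + u * (1 - (a * d - b * c))" by (simp add: algebra_simps)
    also have "\<dots> = 0" unfolding 1(1)[symmetric] 1(2) that(3) by (simp add: algebra_simps)
    finally have "(2 - (a + d)) * u = 0" .
    moreover have "(2 - (a + d)) * w = ((1 - d) * w) * (1 - a) - c * (b * w) + w * (1 - (a * d - b * c))" by (simp add: algebra_simps)
    then have "(2 - (a + d)) * w = 0" unfolding 1(2)[symmetric] 1(1) that(3) by (simp add: algebra_simps)
    ultimately show ?thesis by blast
  qed
  from this[of "M$1$1" "v$1" "M$1$2" "v$2" "M$2$1" "M$2$2"]
  have "(2 - (M$1$1 + M$2$2)) * v$1 = 0 \<and> (2 - (M$1$1 + M$2$2)) * v$2 = 0"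
    using assms(1,2) unfolding Sp2_iff vec2_eq_iff mat2_mult_vec by auto
  then show ?thesis using assms(3) by (auto simp: vec2_eq_iff)
qed

lemma has_vector_derivative_real2:
  fixes f :: "real \<Rightarrow> real^2"
  assumes "((\<lambda>s. f s $ 1) has_real_derivative d $ 1) F" "((\<lambda>s. f s $ 2) has_real_derivative d $ 2) F"
  shows "(f has_vector_derivative d) F"
proof -
  have "((\<lambda>s. f s $ 1 *\<^sub>R axis 1 1 + f s $ 2 *\<^sub>R axis 2 1 :: real^2) has_vector_derivative d $ 1 *\<^sub>R axis 1 1 + d $ 2 *\<^sub>R axis 2 1) F"
    using assms unfolding has_real_derivative_iff_has_vector_derivative
    by (intro has_vector_derivative_add bounded_linear.has_vector_derivative[OF bounded_linear_scaleR_left])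
  moreover have "w$1 *\<^sub>R axis 1 1 + w$2 *\<^sub>R axis 2 1 = w" for w :: "real^2" by (simp add: vec2_eq_iff axis_def)
  ultimately show ?thesis by simp
qed

text \<open>In polar coordinates the path has phase \<open>s r\<close> and radius \<open>tan (s p)\<close>, so that its trace is
  \<open>2 cos (s r) / cos (s p)\<close> and all crossings with the diagonal are regular as soon as \<open>r \<noteq> \<plusminus>p\<close>.\<close>

definition model_path :: "real \<Rightarrow> real \<Rightarrow> real \<Rightarrow> real \<Rightarrow> real \<Rightarrow> real^2^2" where
  "model_path r p x y s = mat2
     ((cos (s * r) + sin (s * p) * x) * inverse (cos (s * p))) ((sin (s * p) * y - sin (s * r)) * inverse (cos (s * p)))
     ((sin (s * r) + sin (s * p) * y) * inverse (cos (s * p))) ((cos (s * r) - sin (s * p) * x) * inverse (cos (s * p)))"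

text \<open>At time 1 the trace is 2 cos r / cos p, so the last assumption keeps the end off the
  diagonal; it also excludes r = p and r = -p, the degenerate crossings.\<close>

locale model_path_params =
  fixes r p x y :: real
  assumes p: "0 \<le> p" "p < pi / 2" and xy: "x^2 + y^2 = 1" and r: "cos r \<noteq> cos p"
begin

lemma cos_pos: "s \<in> {0..1} \<Longrightarrow> cos (s * p) > 0"
proof -
  assume "s \<in> {0..1}"
  then have "0 \<le> s * p" "s * p \<le> p" using p by (auto simp: mult_left_le_one_le)
  then show ?thesis using p by (intro cos_gt_zero_pi) auto
qed

lemma model_path_sp_polar:
  assumes "s \<in> {0..1}"
  shows "model_path r p x y s = sp_polar (s * r) (tan (s * p) * x) (tan (s * p) * y)"
proof -
  have c: "cos (s * p) > 0" using cos_pos[OF assms] .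
  have "1 + (tan (s * p) * x)^2 + (tan (s * p) * y)^2 = 1 + (tan (s * p))^2 * (x^2 + y^2)"
    by (simp add: power_mult_distrib algebra_simps)
  also have "\<dots> = (inverse (cos (s * p)))^2" using tan_sec[of "s * p"] c by (simp add: xy)
  finally have "sqrt (1 + (tan (s * p) * x)^2 + (tan (s * p) * y)^2) = inverse (cos (s * p))"
    using c by simp
  then show ?thesis unfolding sp_polar_def Let_def model_path_def
    by (simp add: mat2_eq_iff tan_def divide_inverse algebra_simps)
qed

lemma r_ne: "r \<noteq> p" "r \<noteq> - p" using r by auto

lemma eigenvector_cos:
  assumes s: "s \<in> {0..1}" and v: "model_path r p x y s *v v = v" "v \<noteq> 0"
  shows "cos (s * r) = cos (s * p)"
proof -
  let ?M = "model_path r p x y s"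
  have "?M \<in> Sp2" using sp_polar_in_Sp2 model_path_sp_polar[OF s] by simp
  then have "?M$1$1 + ?M$2$2 = 2" using eigenvector_trace v by blast
  then have "2 * cos (s * r) * inverse (cos (s * p)) = 2" by (simp add: model_path_def algebra_simps)
  then show ?thesis using cos_pos[OF s] by (simp add: field_simps)
qed

definition vel :: "real \<Rightarrow> real^2 \<Rightarrow> real^2" where
  "vel s v = vector
    [((- r * sin (s * r) + p * cos (s * p) * x) * v$1 + (p * cos (s * p) * y - r * cos (s * r)) * v$2) * inverse (cos (s * p))
       + p * sin (s * p) * inverse (cos (s * p)) * ((model_path r p x y s *v v)$1),
     ((r * cos (s * r) + p * cos (s * p) * y) * v$1 + (- r * sin (s * r) - p * cos (s * p) * x) * v$2) * inverse (cos (s * p))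
       + p * sin (s * p) * inverse (cos (s * p)) * ((model_path r p x y s *v v)$2)]"

lemma vel_derivative:
  assumes s: "s \<in> {0..1}"
  shows "((\<lambda>s. model_path r p x y s *v v) has_vector_derivative vel s v) (at s within {0..1})"
proof -
  have c: "cos (s * p) \<noteq> 0" using cos_pos[OF s] by simp
  have 1: "((\<lambda>s. (model_path r p x y s *v v)$1) has_real_derivative vel s v $ 1) (at s within {0..1})"
    unfolding vel_def mat2_mult_vec model_path_def mat2_nth vector_2
    by (rule derivative_eq_intros refl c | simp)+ (simp add: c algebra_simps power2_eq_square)
  have 2: "((\<lambda>s. (model_path r p x y s *v v)$2) has_real_derivative vel s v $ 2) (at s within {0..1})"
    unfolding vel_def mat2_mult_vec model_path_def mat2_nth vector_2
    by (rule derivative_eq_intros refl c | simp)+ (simp add: c algebra_simps power2_eq_square)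
  from 1 2 show ?thesis by (rule has_vector_derivative_real2)
qed

lemma vel_form:
  assumes s: "s \<in> {0..1}" and v: "model_path r p x y s *v v = v"
  shows "cos (s * p) * omega2 v (vel s v) = r * cos (s * r) * (v$1 * v$1 + v$2 * v$2)
     + p * cos (s * p) * (v$1 * (y * v$1 - x * v$2) - v$2 * (x * v$1 + y * v$2))"
proof -
  have c: "cos (s * p) * inverse (cos (s * p)) = 1" using cos_pos[OF s] by simp
  define i where "i = inverse (cos (s * p))"
  have ci: "cos (s * p) * i = 1" using c by (simp add: i_def)
  show ?thesis unfolding vel_def v omega2_def vector_2 i_def[symmetric]
    using ci by algebra
qed

text \<open>A crossing requires cos (s r) = cos (s p), so s (r - p) or s (r + p) is a multiple of
  pi: finitely many times. Where the path is the identity the form has discriminant r^2 - p^2;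
  elsewhere it is a positive multiple of (r - \<sigma> p) |v|^2 on fixed vectors, with \<sigma> a
  sign.\<close>

lemma regular_model_path: "regular_path omega4 diagonal4 (\<lambda>s. Gr (model_path r p x y s))"
proof -
  let ?M = "model_path r p x y" and ?\<Lambda> = "\<lambda>s. Gr (model_path r p x y s)"
  have Sp: "?M s \<in> Sp2" if "s \<in> {0..1}" for s using model_path_sp_polar[OF that] sp_polar_in_Sp2 by simp
  have C1: "C1_subspace_path ?\<Lambda>"
  proof (rule C1_subspace_path_Gr[OF Sp])
    have ci: "C1_unit (\<lambda>s. inverse (cos (s * p)))"
      by (rule C1_unit_inverse[OF C1_unit_cos]) (use cos_pos in force)
    fix i j :: 2 show "C1_unit (\<lambda>s. ?M s $ i $ j)"
      using exhaust_2[of i] exhaust_2[of j] unfolding model_path_def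
      by (elim disjE) (simp_all, (intro C1_unit_intros ci)+)
  qed
  have cross: "\<exists>v. v \<noteq> 0 \<and> ?M s *v v = v" if "s \<in> crossings diagonal4 ?\<Lambda>" for s
  proof -
    have "Gr (?M s) \<inter> diagonal4 \<noteq> {0}" and s: "s \<in> {0..1}" using that by (auto simp: crossings_def)
    moreover have "0 \<in> Gr (?M s) \<inter> diagonal4"
      using lagrangian_Gr[OF Sp[OF s]] subspace_diagonal4 by (auto simp: lagrangian_def subspace_0)
    ultimately obtain u where u: "u \<in> Gr (?M s)" "u \<in> diagonal4" "u \<noteq> 0" by blast
    then obtain v where "u = (v, v)" "?M s *v v = v" by (auto simp: Gr_def diagonal4_def)
    then show ?thesis using u by (intro exI[of _ v]) (auto simp: prod_eq_iff)
  qed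
  have "crossings diagonal4 ?\<Lambda> \<subseteq> {s \<in> {0..1}. \<exists>m::int. s * (r - p) = of_int m * pi} \<union> {s \<in> {0..1}. \<exists>m::int. s * (r + p) = of_int m * pi}"
  proof
    fix s assume sc: "s \<in> crossings diagonal4 ?\<Lambda>"
    then have s: "s \<in> {0..1}" by (auto simp: crossings_def)
    obtain v where "v \<noteq> 0" "?M s *v v = v" using cross[OF sc] by blast
    then have "cos (s * r) = cos (s * p)" using eigenvector_cos[OF s] by blast
    then obtain n where n: "n \<in> \<int>" "s * r = s * p + 2 * n * pi \<or> s * r = - (s * p) + 2 * n * pi"
      unfolding cos_eq by blast
    then obtain m :: int where "n = of_int m" by (auto elim: Ints_cases)
    then have "s * (r - p) = of_int (2 * m) * pi \<or> s * (r + p) = of_int (2 * m) * pi"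
      using n(2) by (auto simp: algebra_simps)
    then show "s \<in> {s \<in> {0..1}. \<exists>m::int. s * (r - p) = of_int m * pi} \<union> {s \<in> {0..1}. \<exists>m::int. s * (r + p) = of_int m * pi}"
      using s by blast
  qed
  then have fin: "finite (crossings diagonal4 ?\<Lambda>)"
    using r_ne by (elim finite_subset) (intro finite_UnI finite_unit_multiples, auto)
  obtain D :: "real \<Rightarrow> ((real^2) \<times> (real^2)) \<Rightarrow>\<^sub>L ((real^2) \<times> (real^2))" where
    D: "\<And>t. t \<in> {0..1} \<Longrightarrow> ((\<lambda>s. orth_proj (?\<Lambda> s)) has_vector_derivative D t) (at t within {0..1})"
    using C1 unfolding C1_subspace_path_def o_def by blast
  have form: "crossing_form omega4 ?\<Lambda> t (v, v) = omega2 v (vel t v)" if t: "t \<in> {0..1}" and v: "?M t *v v = v" for t v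
  proof -
    have "((\<lambda>s. (v, ?M s *v v)) has_vector_derivative (0, vel t v)) (at t within {0..1})"
      using vel_derivative[OF t] by (intro has_vector_derivative_Pair has_vector_derivative_const)
    then have "crossing_form omega4 ?\<Lambda> t (v, ?M t *v v) = omega4 (v, ?M t *v v) (0, vel t v)"
      by (intro form4.crossing_form_section[OF lagrangian_Gr[OF Sp] D[OF t] t]) (auto simp: Gr_def)
    then show ?thesis by (simp add: v omega4_def omega2_def)
  qed
  have "nondegenerate_form (?\<Lambda> t \<inter> diagonal4) (crossing_form omega4 ?\<Lambda> t)" if t: "t \<in> crossings diagonal4 ?\<Lambda>" for t
    unfolding nondegenerate_form_def
  proof (intro ballI impI)
    fix u assume u: "u \<in> ?\<Lambda> t \<inter> diagonal4"
      and *: "\<forall>v\<in>?\<Lambda> t \<inter> diagonal4. crossing_form omega4 ?\<Lambda> t (u + v) - crossing_form omega4 ?\<Lambda> t u - crossing_form omega4 ?\<Lambda> t v = 0"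
    have t01: "t \<in> {0..1}" using t by (auto simp: crossings_def)
    have c0: "cos (t * p) > 0" using cos_pos[OF t01] .
    obtain v where v: "u = (v, v)" "?M t *v v = v" using u by (auto simp: Gr_def diagonal4_def)
    have mem: "(w, w) \<in> ?\<Lambda> t \<inter> diagonal4" if "?M t *v w = w" for w
      unfolding Gr_def diagonal4_def by (auto intro!: exI[of _ w] simp: that)
    define B where "B w = cos (t * p) * omega2 w (vel t w)" for w
    have polar: "B (v + w) - B v - B w = 0" if w: "?M t *v w = w" for w
    proof -
      have "?M t *v (v + w) = v + w" using v w by (simp add: matrix_vector_right_distrib)
      then have "omega2 (v + w) (vel t (v + w)) - omega2 v (vel t v) - omega2 w (vel t w) = 0"
        using *[rule_format, OF mem[OF w]] form[OF t01] v w by simp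
      then show ?thesis unfolding B_def by (simp add: right_diff_distrib[symmetric])
    qed
    have "v = 0"
    proof (rule ccontr)
      assume v0: "v \<noteq> 0"
      have cc: "cos (t * r) = cos (t * p)" using eigenvector_cos[OF t01 v(2) v0] .
      have Bv: "B w = cos (t * p) * (r * (w$1 * w$1 + w$2 * w$2) + p * (w$1 * (y * w$1 - x * w$2) - w$2 * (x * w$1 + y * w$2)))"
        if "?M t *v w = w" for w
        unfolding B_def vel_form[OF t01 that] cc by (simp add: algebra_simps)
      show False
      proof (cases "sin (t * p) = 0")
        case True
        have "(cos (t * p))^2 = 1" using sin_cos_squared_add[of "t * p"] True by simp
        then have c1: "cos (t * p) = 1" using c0 by (simp add: power2_eq_1_iff)
        have "(sin (t * r))^2 = 0" using sin_cos_squared_add[of "t * r"] cc c1 by simp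
        then have "?M t = mat 1" unfolding model_path_def using True c1 cc by (simp add: mat2_eq_iff)
        then have all: "?M t *v w = w" for w by simp
        have B: "B w = r * (w$1 * w$1 + w$2 * w$2) + p * (w$1 * (y * w$1 - x * w$2) - w$2 * (x * w$1 + y * w$2))" for w
          using Bv[OF all] c1 by simp
        have e: "(r + p * y) * v$1 - p * x * v$2 = 0" "- p * x * v$1 + (r - p * y) * v$2 = 0"
          using polar[OF all, of "axis 1 1"] polar[OF all, of "axis 2 1"] unfolding B
          by (simp_all add: axis_def algebra_simps)
        have "(r^2 - p^2 * (x^2 + y^2)) * v$1 = 0" using e by algebra
        moreover have "(r^2 - p^2 * (x^2 + y^2)) * v$2 = 0" using e by algebra
        moreover have "r^2 - p^2 * (x^2 + y^2) \<noteq> 0" using r_ne xy by (auto simp: power2_eq_iff)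
        ultimately show False using v0 by (auto simp: vec2_eq_iff)
      next
        case False
        have "?M t *v (v + v) = v + v" unfolding matrix_vector_right_distrib v(2) ..
        then have "B v = 0" using polar[OF v(2)] Bv[of "v + v"] Bv[OF v(2)] by (simp add: algebra_simps)
        then have q: "r * (v$1 * v$1 + v$2 * v$2) + p * (v$1 * (y * v$1 - x * v$2) - v$2 * (x * v$1 + y * v$2)) = 0"
          using Bv[OF v(2)] c0 by simp
        have "(sin (t * r))^2 = (sin (t * p))^2"
          by (simp add: sin_squared_eq cc)
        \<comment> \<open>Equal cosines leave the sines equal up to \<sigma>. The equations of a
          fixed vector then turn the p-part of the form into -\<sigma> p |v|^2.\<close>
        then obtain \<sigma> :: real where \<sigma>: "sin (t * r) = \<sigma> * sin (t * p)" "\<sigma> = 1 \<or> \<sigma> = -1"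
          unfolding power2_eq_iff by (metis mult_1 mult_minus1)
        have "(cos (t * r) + sin (t * p) * x) * v$1 + (sin (t * p) * y - sin (t * r)) * v$2 = cos (t * p) * v$1"
          "(sin (t * r) + sin (t * p) * y) * v$1 + (cos (t * r) - sin (t * p) * x) * v$2 = cos (t * p) * v$2"
        proof -
          have clear: "X = c * w" if "X * inverse c = w" "c > 0" for X c w :: real using that by (simp add: field_simps)
          have "((cos (t * r) + sin (t * p) * x) * v$1 + (sin (t * p) * y - sin (t * r)) * v$2) * inverse (cos (t * p)) = v$1"
            "((sin (t * r) + sin (t * p) * y) * v$1 + (cos (t * r) - sin (t * p) * x) * v$2) * inverse (cos (t * p)) = v$2"
            using v(2) unfolding vec2_eq_iff mat2_mult_vec model_path_def mat2_nth by (simp_all add: algebra_simps)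
          then show "(cos (t * r) + sin (t * p) * x) * v$1 + (sin (t * p) * y - sin (t * r)) * v$2 = cos (t * p) * v$1"
            "(sin (t * r) + sin (t * p) * y) * v$1 + (cos (t * r) - sin (t * p) * x) * v$2 = cos (t * p) * v$2"
            using clear c0 by blast+
        qed
        then have "sin (t * p) * (x * v$1 + y * v$2 - \<sigma> * v$2) = 0" "sin (t * p) * (y * v$1 - x * v$2 + \<sigma> * v$1) = 0"
          unfolding cc \<sigma>(1) by (simp_all add: algebra_simps)
        then have "x * v$1 + y * v$2 = \<sigma> * v$2" "y * v$1 - x * v$2 = - \<sigma> * v$1" using False by auto
        then have "(r - \<sigma> * p) * (v$1 * v$1 + v$2 * v$2) = 0" using q by algebra
        moreover have "v$1 * v$1 + v$2 * v$2 \<noteq> 0" using v0 by (auto simp: vec2_eq_iff add_nonneg_eq_0_iff)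
        ultimately show False using \<sigma>(2) r_ne by auto
      qed
    qed
    then show "u = 0" using v by (simp add: prod_eq_iff)
  qed
  then show ?thesis unfolding regular_path_def using C1 fin lagrangian_Gr Sp by blast
qed

end

text \<open>The final value of \<open>phase_count\<close> minus its value -1 at the identity; trace
  below 2 corresponds to \<kappa> > 0, trace above 2 to \<kappa> < 0.\<close>

definition cz_value :: "real \<Rightarrow> real \<Rightarrow> real" where
  "cz_value \<rho> tr = (if tr < 2 then 2 * of_int \<lfloor>\<rho> / (2 * pi)\<rfloor> + 1 else 2 * of_int \<lfloor>(\<rho> + pi) / (2 * pi)\<rfloor>)"

text \<open>Homotopic representatives have the same change of the argument of det W and the same
  ends, hence the same counts. A model path with the same end and the same final argument as M is
  homotopic to M and regular.\<close>

lemma mu_RS_Gr: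
  assumes M: "continuous_on {0..1} M" "\<And>s. s \<in> {0..1} \<Longrightarrow> M s \<in> Sp2" "M 0 = mat 1" "M 1 $ 1 $ 1 + M 1 $ 2 $ 2 \<noteq> 2"
    and \<rho>: "continuous_on {0..1} \<rho>" "\<rho> 0 = 0"
      "\<And>s. s \<in> {0..1} \<Longrightarrow> zeta (M s) = of_real (norm (zeta (M s))) * exp (\<i> * of_real (\<rho> s))"
  shows "mu_RS omega4 diagonal4 (\<lambda>s. Gr (M s)) = cz_value (\<rho> 1) (M 1 $ 1 $ 1 + M 1 $ 2 $ 2)"
proof -
  let ?\<Lambda> = "\<lambda>s. Gr (M s)" and ?tr = "M 1 $ 1 $ 1 + M 1 $ 2 $ 2"
  let ?D = "\<lambda>P. wdet (W11 P) (W12 P) (W22 P)"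
  have Dc: "continuous_on S ?D" for S
  proof -
    have cplx: "Complex a b = of_real a + \<i> * of_real b" for a b by (simp add: complex_eq_iff)
    show ?thesis unfolding wdet_def W11_def W12_def W22_def cplx
      by (intro continuous_intros)
  qed
  have Dn: "norm (?D (orth_proj L)) = 1" if "lagrangian omega4 L" for L
    by (rule sym_unitary_wdet(5)[OF sym_unitary_W[OF that]])
  have ind: "regular_index omega4 diagonal4 \<Lambda>' = cz_value (\<rho> 1) ?tr"
    if reg: "regular_path omega4 diagonal4 \<Lambda>'"
      and hom: "homotopic_paths (lag_grass omega4) (orth_proj \<circ> ?\<Lambda>) (orth_proj \<circ> \<Lambda>')" for \<Lambda>'
  proof -
    let ?p = "\<lambda>s. ?D (orth_proj (\<Lambda>' s))"
    have path: "path (orth_proj \<circ> \<Lambda>')" using homotopic_paths_imp_path[OF hom] by blast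
    have lag: "lagrangian omega4 (\<Lambda>' s)" if "s \<in> {0..1}" for s using reg that by (auto simp: regular_path_def)
    have cp: "continuous_on {0..1} ?p"
      using path unfolding path_def o_def by (rule continuous_on_compose2[OF Dc]) auto
    obtain \<psi>0 where \<psi>0: "continuous_on {0..1} \<psi>0" "\<And>s. s \<in> {0..1} \<Longrightarrow> ?p s = exp (2 * \<i> * of_real (\<psi>0 s))"
      using line_phase_log[OF cp] Dn[OF lag] by metis
    have P0: "orth_proj (\<Lambda>' 0) = orth_proj (Gr (mat 1))"
      using homotopic_paths_imp_pathstart[OF hom] M(3) by (simp add: pathstart_def)
    have P1: "orth_proj (\<Lambda>' 1) = orth_proj (Gr (M 1))"
      using homotopic_paths_imp_pathfinish[OF hom] by (simp add: pathfinish_def)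
    have W0: "W11 (orth_proj (\<Lambda>' 0)) = 1" "W12 (orth_proj (\<Lambda>' 0)) = 0" "W22 (orth_proj (\<Lambda>' 0)) = 1"
    proof -
      have f: "f1 \<in> diagonal4" "f2 \<in> diagonal4" by (auto simp: diagonal4_def f1_def f2_def)
      show "W11 (orth_proj (\<Lambda>' 0)) = 1" "W12 (orth_proj (\<Lambda>' 0)) = 0" "W22 (orth_proj (\<Lambda>' 0)) = 1"
        unfolding P0 Gr_1 W11_def W12_def W22_def
        using orth_proj_fixes[OF subspace_diagonal4 f(1)] orth_proj_fixes[OF subspace_diagonal4 f(2)]
        by (simp_all add: complex_eq_iff)
    qed
    then have "exp (2 * \<i> * of_real (\<psi>0 0)) = 1" using \<psi>0(2)[of 0] by (simp add: wdet_def)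
    then have "\<exists>n::int. 2 * \<psi>0 0 = of_int (2 * n) * pi" unfolding exp_eq_1 by simp
    then obtain n :: int where "2 * \<psi>0 0 = of_int (2 * n) * pi" by blast
    then have n: "\<psi>0 0 = of_int n * pi" by simp
    define \<psi> where "\<psi> s = \<psi>0 s - of_int n * pi" for s
    have \<psi>: "continuous_on {0..1} \<psi>" "\<psi> 0 = 0" unfolding \<psi>_def using \<psi>0(1) n by (auto intro!: continuous_intros)
    have \<psi>D: "?p s = exp (2 * \<i> * of_real (\<psi> s))" if "s \<in> {0..1}" for s
    proof -
      have "exp (2 * \<i> * of_real (\<psi>0 s)) = exp (2 * \<i> * of_real (\<psi> s)) * exp (2 * \<i> * of_real (of_int n * pi))"
        unfolding exp_add[symmetric] by (simp add: \<psi>_def algebra_simps)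
      then show ?thesis using \<psi>0(2)[OF that] exp_i_multiple_of_pi(3)[of n] by simp
    qed
    have ne: "?D P \<noteq> 0" if "P \<in> lag_grass omega4" for P
      using that Dn by (auto simp: lag_grass_def) (metis norm_zero zero_neq_one)
    have "homotopic_paths (- {0}) (?D \<circ> (orth_proj \<circ> ?\<Lambda>)) (?D \<circ> (orth_proj \<circ> \<Lambda>'))"
      by (rule homotopic_paths_continuous_image[OF hom Dc]) (use ne in blast)
    then have "2 * \<i> * of_real (\<rho> 1) - 2 * \<i> * of_real (\<rho> 0) = 2 * \<i> * of_real (\<psi> 1) - 2 * \<i> * of_real (\<psi> 0)"
      by (rule logs_of_homotopic_paths[where a = "\<lambda>s. 2 * \<i> * of_real (\<rho> s)" and b = "\<lambda>s. 2 * \<i> * of_real (\<psi> s)"])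
        (auto intro!: continuous_intros \<rho>(1) \<psi>(1) simp: \<psi>D W_Gr_phase(1)[OF M(2) \<rho>(3)])
    then have \<psi>1: "\<psi> 1 = \<rho> 1" using \<rho>(2) \<psi>(2) by (simp add: complex_eq_iff)
    let ?\<kappa> = "2 * (2 - ?tr) / norm (zeta (M 1))"
    have nz: "norm (zeta (M 1)) > 0" using zeta_ne_0[OF M(2)] by simp
    have "regular_index omega4 diagonal4 \<Lambda>' = phase_count (\<rho> 1) ?\<kappa>
        (W11 (orth_proj (\<Lambda>' 1)) = 1 \<and> W12 (orth_proj (\<Lambda>' 1)) = 0 \<and> W22 (orth_proj (\<Lambda>' 1)) = 1) - phase_count 0 0 True"
      using regular_index_diagonal[OF reg \<psi>(1) \<psi>D] W_Gr_phase(2)[OF M(2) \<rho>(3), of 1]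
      unfolding \<psi>(2) \<psi>1 W0 P1 by (simp add: wchar_def)
    also have "phase_count 0 0 True = - 1" by (simp add: phase_count_def)
    finally have ri: "regular_index omega4 diagonal4 \<Lambda>' = phase_count (\<rho> 1) ?\<kappa>
        (W11 (orth_proj (\<Lambda>' 1)) = 1 \<and> W12 (orth_proj (\<Lambda>' 1)) = 0 \<and> W22 (orth_proj (\<Lambda>' 1)) = 1) - (- 1)" .
    show ?thesis
    proof (cases "?tr < 2")
      case True
      then have "?\<kappa> > 0" using nz by simp
      then show ?thesis unfolding ri using True by (simp add: phase_count_def cz_value_def)
    next
      case False
      then have "?\<kappa> < 0" using nz M(4) by (simp add: divide_less_0_iff)
      then show ?thesis unfolding ri using False by (simp add: phase_count_def cz_value_def)
    qed
  qed
  \<comment> \<open>The end \<open>M 1\<close> has polar coordinates (\<rho> 1, h x, h y) with h =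
    tan p and (x, y) a unit vector; trace different from 2 becomes cos (\<rho> 1) different from cos
    p.\<close>
  define x0 y0 where "x0 = (M 1 $ 1 $ 1 - M 1 $ 2 $ 2) / 2" and "y0 = (M 1 $ 1 $ 2 + M 1 $ 2 $ 1) / 2"
  define h where "h = sqrt (x0^2 + y0^2)"
  define p where "p = arctan h"
  have h0: "h \<ge> 0" by (simp add: h_def)
  have hh: "h^2 = x0^2 + y0^2" by (simp add: h_def)
  obtain x y where xy: "x^2 + y^2 = 1" "h * x = x0" "h * y = y0"
  proof (cases "h = 0")
    case True
    then have "x0 = 0" "y0 = 0" using hh by (auto simp: sum_power2_eq_zero_iff)
    then show ?thesis using that[of 1 0] True by simp
  next
    case False
    have "(x0 / h)^2 + (y0 / h)^2 = 1" using False by (simp add: power_divide add_divide_distrib[symmetric] hh[symmetric])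
    then show ?thesis using that[of "x0 / h" "y0 / h"] False by simp
  qed
  have M1: "M 1 = sp_polar (\<rho> 1) x0 y0" unfolding x0_def y0_def by (rule sp_polar_eq[OF M(2) \<rho>(3)]) auto
  have p: "0 \<le> p" "p < pi / 2" using h0 arctan_ubound by (auto simp: p_def)
  have tanp: "tan p = h" by (simp add: p_def tan_arctan)
  have "cos (\<rho> 1) \<noteq> cos p"
  proof
    assume eq: "cos (\<rho> 1) = cos p"
    have "?tr = 2 * sqrt (1 + x0^2 + y0^2) * cos (\<rho> 1)" unfolding M1 sp_polar_def Let_def by simp
    also have "sqrt (1 + x0^2 + y0^2) = 1 / cos p"
      by (simp add: p_def cos_arctan hh add.assoc)
    also have "2 * (1 / cos p) * cos (\<rho> 1) = 2" using eq cos_gt_zero_pi[of p] p by simp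
    finally show False using M(4) by simp
  qed
  then interpret mp: model_path_params "\<rho> 1" p x y using p xy by unfold_locales auto
  let ?M' = "model_path (\<rho> 1) p x y"
  have M'c: "continuous_on {0..1} ?M'"
    unfolding model_path_def using mp.cos_pos
    by (intro continuous_on_mat2 continuous_intros) (force)+
  have M'Sp: "?M' s \<in> Sp2" if "s \<in> {0..1}" for s using mp.model_path_sp_polar[OF that] sp_polar_in_Sp2 by simp
  have "homotopic_paths Sp2 M ?M'"
  proof (rule homotopic_paths_Sp2[OF M(1,2) \<rho>(1,3) M'c M'Sp])
    show "continuous_on {0..1} (\<lambda>s. s * \<rho> 1)" by (intro continuous_intros)
    show "zeta (?M' s) = of_real (norm (zeta (?M' s))) * exp (\<i> * of_real (s * \<rho> 1))" if "s \<in> {0..1}" for s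
      unfolding mp.model_path_sp_polar[OF that] zeta_sp_polar(2) by (rule zeta_sp_polar(1))
    show "M 0 = ?M' 0" unfolding M(3) by (simp add: model_path_def mat2_eq_iff)
    show "M 1 = ?M' 1" using mp.model_path_sp_polar[of 1] by (simp add: tanp xy M1)
  qed (auto simp: \<rho>(2))
  then have "homotopic_paths (lag_grass omega4) ((\<lambda>M. orth_proj (Gr M)) \<circ> M) ((\<lambda>M. orth_proj (Gr M)) \<circ> ?M')"
    by (rule homotopic_paths_continuous_image[OF _ continuous_on_orth_proj_Gr]) (auto simp: lag_grass_def lagrangian_Gr)
  then have hom: "homotopic_paths (lag_grass omega4) (orth_proj \<circ> ?\<Lambda>) (orth_proj \<circ> (\<lambda>s. Gr (?M' s)))" by (simp add: o_def)
  show ?thesis unfolding mu_RS_def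
    by (rule the_equality) (use mp.regular_model_path hom ind in metis)+
qed

section \<open>Lifts of the action on directions\<close>

text \<open>The argument in (-pi/2, pi/2) of z times the conjugate of \<open>zeta M\<close>, with z
  the complex quotient of \<open>M *v dir x\<close> by \<open>dir x\<close>: how far the turning of
  this direction deviates from \<rho>. The denominator is the real part and is positive, so
  \<open>arctan\<close> is smooth here.\<close>

definition lift_arg :: "real^2^2 \<Rightarrow> real \<Rightarrow> real" where
  "lift_arg M x = arctan (((M$1$1 + M$2$2) * inner (M *v dir x) (J2 (dir x)) - (M$2$1 - M$1$2) * inner (M *v dir x) (dir x))
     / (1 + inner (M *v dir x) (M *v dir x)))"

text \<open>The lift to the real line of the action of \<open>M\<close> on directions that is within \<open>\<pi>/2\<close> of the
  translation by \<open>\<rho>\<close>, where \<open>\<rho>\<close> is an argument of \<open>zeta M\<close>.\<close>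

definition lift :: "real^2^2 \<Rightarrow> real \<Rightarrow> real \<Rightarrow> real" where
  "lift M \<rho> x = x + \<rho> + lift_arg M x"

abbreviation is_arg :: "real^2^2 \<Rightarrow> real \<Rightarrow> bool" where
  "is_arg M \<rho> \<equiv> zeta M = of_real (norm (zeta M)) * exp (\<i> * of_real \<rho>)"

lemma lift_bounds: "\<bar>lift M \<rho> x - x - \<rho>\<bar> < pi / 2"
  using arctan_bounded[of "((M$1$1 + M$2$2) * inner (M *v dir x) (J2 (dir x)) - (M$2$1 - M$1$2) * inner (M *v dir x) (dir x))
     / (1 + inner (M *v dir x) (M *v dir x))"] unfolding lift_def lift_arg_def by linarith

lemma dir_plus_pi [simp]: "dir (x + pi) = - dir x"
  by (simp add: vec2_eq_iff)

lemma dir_plus_multiple: "dir (x + of_int m * pi) = (if even m then dir x else - dir x)"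
proof (cases "even m")
  case True
  then obtain j where "m = 2 * j" by blast
  then have "x + of_int m * pi = x + 2 * pi * of_int j" by simp
  then have "dir (x + of_int m * pi) = dir x"
    by (simp only: vec2_eq_iff dir_nth sin_add cos_add sin_int_2pin cos_int_2pin) simp
  then show ?thesis using True by simp
next
  case False
  then obtain j where "m = 2 * j + 1" by (metis oddE)
  then have "x + of_int m * pi = (x + 2 * pi * of_int j) + pi" by (simp add: algebra_simps)
  then have "dir (x + of_int m * pi) = - dir x"
    by (simp only: dir_plus_pi) (simp only: vec2_eq_iff vector_uminus_component dir_nth sin_add cos_add sin_int_2pin cos_int_2pin, simp)
  then show ?thesis using False by simp
qed

lemma matrix_mult_neg: "M *v (- v) = - (M *v v)" for M :: "real^2^2"
  by (simp add: vec2_eq_iff algebra_simps)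

lemma lift_plus_multiple: "lift M \<rho> (x + of_int j * pi) = lift M \<rho> x + of_int j * pi"
proof -
  have "dir (x + of_int j * pi) = dir x \<or> dir (x + of_int j * pi) = - dir x" by (auto simp: dir_plus_multiple)
  then have "lift_arg M (x + of_int j * pi) = lift_arg M x"
    unfolding lift_arg_def by (elim disjE) (simp_all add: matrix_mult_neg linear_neg[OF form2.I_linear])
  then show ?thesis by (simp add: lift_def)
qed

text \<open>With \<open>z\<close> the quotient of \<open>M (dir x)\<close> by \<open>dir x\<close> as complex numbers, the real part of
  \<open>z cnj (zeta M)\<close> is \<open>\<langle>(1 + M\<^sup>T M) dir x, dir x\<rangle>\<close>.\<close>

lemma lift_dir:
  assumes M: "M \<in> Sp2" and \<rho>: "is_arg M \<rho>"
  obtains r where "r > 0" "M *v dir x = r *\<^sub>R dir (lift M \<rho> x)"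
proof -
  define a b c d where abcd: "a = M$1$1" "b = M$1$2" "c = M$2$1" "d = M$2$2"
  define C S where CS: "C = cos x" "S = sin x"
  have det: "a * d - b * c = 1" using M by (simp add: Sp2_iff abcd)
  have cs: "C * C + S * S = 1" using sin_cos_squared_add[of x] by (simp add: CS power2_eq_square algebra_simps)
  define zr zi where z: "zr = inner (M *v dir x) (dir x)" "zi = inner (M *v dir x) (J2 (dir x))"
  define wr wi where w: "wr = 1 + inner (M *v dir x) (M *v dir x)" "wi = (a + d) * zi - (c - b) * zr"
  have wr: "wr = (a + d) * zr + (c - b) * zi"
  proof -
    have "(a + d) * zr + (c - b) * zi = (a * d - b * c) * (C * C + S * S) + inner (M *v dir x) (M *v dir x)"
      unfolding z by (simp add: inner_real2 abcd[symmetric] CS[symmetric] algebra_simps)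
    then show ?thesis using det cs by (simp add: w)
  qed
  have wpos: "wr > 0" unfolding w by (intro add_pos_nonneg) auto
  define n where "n = norm (zeta M)"
  have n: "n > 0" using zeta_ne_0[OF M] by (simp add: n_def)
  have nc: "a + d = n * cos \<rho>" "c - b = n * sin \<rho>"
    using arg_cong[OF \<rho>, of Re] arg_cong[OF \<rho>, of Im] by (simp_all add: zeta_def Re_exp Im_exp n_def abcd)
  have nn: "n * n = (a + d) * (a + d) + (c - b) * (c - b)"
    unfolding nc using sin_cos_squared_add[of \<rho>] by (simp add: power2_eq_square) algebra
  define \<delta> where "\<delta> = lift_arg M x"
  have \<delta>: "\<delta> = arctan (wi / wr)" by (simp add: \<delta>_def lift_arg_def w z abcd)
  define m where "m = wr / cos \<delta>"
  have cpos: "cos \<delta> > 0" unfolding \<delta> cos_arctan by (simp add: add_pos_nonneg)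
  have mpos: "m > 0" using wpos cpos by (simp add: m_def)
  have tan: "sin \<delta> / cos \<delta> = wi / wr" using tan_arctan[of "wi / wr"] by (simp add: \<delta> tan_def)
  have mw: "wr = m * cos \<delta>" "wi = m * sin \<delta>"
    using tan wpos cpos by (simp_all add: m_def field_simps)
  have "n * n * zr = (a + d) * wr - (c - b) * wi" unfolding nn wr w(2) by (simp add: algebra_simps)
  also have "\<dots> = n * m * cos (\<rho> + \<delta>)" unfolding nc mw by (simp add: cos_add algebra_simps)
  finally have zr: "zr = (m / n) * cos (\<rho> + \<delta>)" using n by (simp add: field_simps)
  have "n * n * zi = (c - b) * wr + (a + d) * wi" unfolding nn wr w(2) by (simp add: algebra_simps)
  also have "\<dots> = n * m * sin (\<rho> + \<delta>)" unfolding nc mw by (simp add: sin_add algebra_simps)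
  finally have zi: "zi = (m / n) * sin (\<rho> + \<delta>)" using n by (simp add: field_simps)
  have "M *v dir x = zr *\<^sub>R dir x + zi *\<^sub>R J2 (dir x)"
  proof -
    have "u *\<^sub>R 1 = u * (C * C + S * S)" for u using cs by simp
    then show ?thesis unfolding z vec2_eq_iff using cs
      by (simp add: inner_real2 CS[symmetric] abcd[symmetric]) (intro conjI; algebra)
  qed
  also have "\<dots> = (m / n) *\<^sub>R (cos (\<rho> + \<delta>) *\<^sub>R dir x + sin (\<rho> + \<delta>) *\<^sub>R J2 (dir x))"
    unfolding zr zi by (simp add: scaleR_add_right)
  also have "cos (\<rho> + \<delta>) *\<^sub>R dir x + sin (\<rho> + \<delta>) *\<^sub>R J2 (dir x) = dir (x + (\<rho> + \<delta>))"
  proof -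
    have "cos y *\<^sub>R dir x + sin y *\<^sub>R J2 (dir x) = dir (x + y)" for y
      by (simp add: vec2_eq_iff sin_add cos_add algebra_simps)
    then show ?thesis .
  qed
  finally have "M *v dir x = (m / n) *\<^sub>R dir (lift M \<rho> x)" by (simp add: lift_def \<delta>_def add.assoc)
  moreover have "m / n > 0" using mpos n by simp
  ultimately show thesis using that by blast
qed

text \<open>M preserves \<open>omega2\<close>, so for y - x in (0, pi) the sine of the difference of
  the lifts is positive; closeness to the translation by \<rho> excludes a nonpositive difference.
  For larger y - x the closeness alone suffices.\<close>

lemma lift_strict_mono_aux:
  assumes M: "M \<in> Sp2" "is_arg M \<rho>" and "x < y"
  shows "lift M \<rho> x < lift M \<rho> y"
proof (cases "y - x < pi")
  case False
  then show ?thesis using lift_bounds[of M \<rho> x] lift_bounds[of M \<rho> y] by linarith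
next
  case True
  obtain r where r: "r > 0" "M *v dir x = r *\<^sub>R dir (lift M \<rho> x)" using lift_dir[OF M] .
  obtain q where q: "q > 0" "M *v dir y = q *\<^sub>R dir (lift M \<rho> y)" using lift_dir[OF M] .
  have "omega2 (M *v dir x) (M *v dir y) = sin (y - x)" using M(1) omega2_dir by (simp add: Sp2_def)
  moreover have "omega2 (M *v dir x) (M *v dir y) = r * q * omega2 (dir (lift M \<rho> x)) (dir (lift M \<rho> y))"
    unfolding r q by (simp add: omega2_def algebra_simps)
  ultimately have "r * q * sin (lift M \<rho> y - lift M \<rho> x) = sin (y - x)" by (simp add: omega2_dir)
  moreover have "sin (y - x) > 0" using True assms by (intro sin_gt_zero) auto
  ultimately have pos: "sin (lift M \<rho> y - lift M \<rho> x) > 0" using r q by (metis mult_pos_pos zero_less_mult_pos)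
  show ?thesis
  proof (rule ccontr)
    assume "\<not> lift M \<rho> x < lift M \<rho> y"
    then have "sin (lift M \<rho> x - lift M \<rho> y) \<ge> 0"
      using lift_bounds[of M \<rho> x] lift_bounds[of M \<rho> y] assms(3) by (intro sin_ge_zero) linarith+
    then show False using pos sin_minus[of "lift M \<rho> y - lift M \<rho> x"] by simp
  qed
qed

lemma lift_less_iff: "M \<in> Sp2 \<Longrightarrow> is_arg M \<rho> \<Longrightarrow> lift M \<rho> x < lift M \<rho> y \<longleftrightarrow> x < y"
  using lift_strict_mono_aux by (metis less_asym linorder_less_linear)

lemma lift_le_iff: "M \<in> Sp2 \<Longrightarrow> is_arg M \<rho> \<Longrightarrow> lift M \<rho> x \<le> lift M \<rho> y \<longleftrightarrow> x \<le> y"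
  using lift_less_iff by (metis not_less)

lemma dir_eq_imp_cos:
  assumes "r *\<^sub>R dir x = q *\<^sub>R dir y" "r > 0" "q > 0"
  shows "cos (x - y) = 1"
proof -
  have "norm (dir z) = 1" for z using dir_inner[of z z] by (simp add: norm_eq_sqrt_inner)
  then have "norm (r *\<^sub>R dir x) = r" "norm (q *\<^sub>R dir y) = q" using assms(2,3) by simp_all
  then have "r = q" using assms(1) by metis
  then have "dir x = dir y" using assms by simp
  then show ?thesis using dir_inner[of x y] dir_inner[of y y] by simp
qed

lemma cos_eq_1_imp_0:
  assumes "cos x = 1" "\<bar>x\<bar> < 2 * pi" shows "x = (0::real)"
proof -
  obtain n :: int where n: "x = of_int n * 2 * pi" using assms(1) by (auto simp: cos_one_2pi_int)
  then have "\<bar>of_int n\<bar> * (2 * pi) < 1 * (2 * pi)" using assms(2) by (simp add: abs_mult)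
  then have "\<bar>of_int n\<bar> < (1::real)" by (simp only: mult_less_cancel_right) auto
  then have "n = 0" by linarith
  then show ?thesis using n by simp
qed

text \<open>Promotes an equality of directions, known modulo 2 pi, to an equality of lifts, by
  connectedness starting at t = 0.\<close>

lemma continuous_cos_1_imp_0:
  assumes "continuous_on UNIV g" "\<And>t. cos (g t) = 1" "g (0::real) = (0::real)"
  shows "g t = 0"
proof -
  have "g constant_on UNIV"
  proof (rule continuous_discrete_range_constant[OF connected_UNIV assms(1)])
    fix x show "\<exists>e>0. \<forall>y. y \<in> UNIV \<and> g y \<noteq> g x \<longrightarrow> e \<le> norm (g y - g x)"
    proof (intro exI[of _ "2 * pi"] conjI allI impI)
      fix y assume "y \<in> UNIV \<and> g y \<noteq> g x"
      moreover have "cos (g y - g x) = 1"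
      proof -
        have "sin (g t) = 0" for t using assms(2)[of t] sin_cos_squared_add[of "g t"] by simp
        then show ?thesis by (simp add: cos_diff assms(2))
      qed
      ultimately show "2 * pi \<le> norm (g y - g x)" using cos_eq_1_imp_0[of "g y - g x"] by (simp add: not_le[symmetric]) (metis diff_self eq_iff_diff_eq_0)
    qed simp
  qed
  then show ?thesis using assms(3) unfolding constant_on_def by auto
qed

lemma trace_2_eigenvector:
  assumes "M \<in> Sp2" "M$1$1 + M$2$2 = 2"
  shows "\<exists>v. v \<noteq> 0 \<and> M *v v = v"
proof -
  have det: "M$1$1 * M$2$2 - M$1$2 * M$2$1 = 1" using assms by (simp add: Sp2_iff)
  show ?thesis
  proof (cases "M$1$2 = 0 \<and> M$1$1 = 1")
    case True
    then show ?thesis using assms by (intro exI[of _ "vector [0, 1]"]) (auto simp: vec2_eq_iff)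
  next
    case False
    have "M$2$1 * M$1$2 + M$2$2 * (1 - M$1$1) = 1 - M$1$1" using det assms(2) by (simp add: algebra_simps)
    then show ?thesis using False
      by (intro exI[of _ "vector [M$1$2, 1 - M$1$1]"]) (auto simp: vec2_eq_iff algebra_simps)
  qed
qed

text \<open>An eigendirection turned by m half turns has an eigenvalue l of sign (-1)^m, and (tr -
  2) l = (l - 1)^2 compares the trace with 2. As \<rho> lies within pi/2 of m pi, the floors in
  \<open>cz_value\<close> are determined.\<close>

lemma cz_value_eigendirection:
  assumes M: "M \<in> Sp2" "is_arg M \<rho>" and x: "lift M \<rho> x = x + of_int m * pi" and tr: "M$1$1 + M$2$2 \<noteq> 2"
  shows "cz_value \<rho> (M$1$1 + M$2$2) = of_int m" "even m \<longleftrightarrow> M$1$1 + M$2$2 > 2"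
proof -
  obtain r where r: "r > 0" "M *v dir x = r *\<^sub>R dir (lift M \<rho> x)" using lift_dir[OF M] .
  define l where "l = (if even m then r else - r)"
  have l: "M *v dir x = l *\<^sub>R dir x" "l \<noteq> 0" using r by (auto simp: x dir_plus_multiple l_def)
  have "(l * l - (a + d) * l + 1) * u = 0 \<and> (l * l - (a + d) * l + 1) * w = 0"
    if "a * u + b * w = l * u" "c * u + d * w = l * w" "a * d - b * c = 1" for a b c d u w :: real
  proof -
    have 1: "b * w = (l - a) * u" "c * u = (l - d) * w" using that by (auto simp: algebra_simps)
    have "(l * l - (a + d) * l + 1) * u = ((l - a) * u) * (l - d) - b * (c * u) + u * (1 - (a * d - b * c))" by (simp add: algebra_simps)
    also have "\<dots> = 0" unfolding 1(1)[symmetric] 1(2) that(3) by (simp add: algebra_simps)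
    finally have "(l * l - (a + d) * l + 1) * u = 0" .
    moreover have "(l * l - (a + d) * l + 1) * w = ((l - d) * w) * (l - a) - c * (b * w) + w * (1 - (a * d - b * c))" by (simp add: algebra_simps)
    then have "(l * l - (a + d) * l + 1) * w = 0" unfolding 1(2)[symmetric] 1(1) that(3) by (simp add: algebra_simps)
    ultimately show ?thesis by blast
  qed
  from this[of "M$1$1" "dir x$1" "M$1$2" "dir x$2" "M$2$1" "M$2$2"]
  have "(l * l - (M$1$1 + M$2$2) * l + 1) * dir x$1 = 0 \<and> (l * l - (M$1$1 + M$2$2) * l + 1) * dir x$2 = 0"
    using M(1) l(1) unfolding Sp2_iff vec2_eq_iff mat2_mult_vec by auto
  then have char: "l * l - (M$1$1 + M$2$2) * l + 1 = 0" using dir_ne_0[of x] unfolding vec2_eq_iff by auto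
  then have trl: "((M$1$1 + M$2$2) - 2) * l = (l - 1)^2" by (simp add: power2_eq_square algebra_simps)
  then have l1: "l \<noteq> 1" using tr by auto
  have ev: "M$1$1 + M$2$2 > 2" if "even m"
  proof -
    have "l > 0" using r that by (simp add: l_def)
    moreover have "((M$1$1 + M$2$2) - 2) * l > 0" unfolding trl using l1 by simp
    ultimately show ?thesis by (simp add: zero_less_mult_iff)
  qed
  have od: "M$1$1 + M$2$2 < 2" if "odd m"
  proof -
    have "l < 0" using r that by (simp add: l_def)
    moreover have "((M$1$1 + M$2$2) - 2) * l > 0" unfolding trl using l1 by simp
    ultimately show ?thesis by (simp add: zero_less_mult_iff)
  qed
  show "even m \<longleftrightarrow> M$1$1 + M$2$2 > 2" using ev od by force
  have b: "of_int m * pi - pi / 2 < \<rho>" "\<rho> < of_int m * pi + pi / 2"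
    using lift_bounds[of M \<rho> x] unfolding x by linarith+
  show "cz_value \<rho> (M$1$1 + M$2$2) = of_int m"
  proof (cases "even m")
    case True
    then obtain j where j: "m = 2 * j" by blast
    have "\<lfloor>(\<rho> + pi) / (2 * pi)\<rfloor> = j" using b by (intro floor_unique) (auto simp: j field_simps)
    then show ?thesis using ev[OF True] by (simp add: cz_value_def j)
  next
    case False
    then obtain j where j: "m = 2 * j + 1" by (metis oddE)
    have "\<lfloor>\<rho> / (2 * pi)\<rfloor> = j" using b by (intro floor_unique) (auto simp: j field_simps)
    then show ?thesis using od[OF False] by (simp add: cz_value_def j)
  qed
qed

lemma floor_div_pi:
  assumes "of_int j * pi \<le> x" "x < (of_int j + 1) * pi" shows "\<lfloor>x / pi\<rfloor> = j"
  using assms by (intro floor_unique) (auto simp: field_simps)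

text \<open>What the index computation takes from the geometry: \<tau>-equivariance, conjugation by
  the matrix of N under time reversal, and no iterate with eigenvalue 1.\<close>

locale brake_path =
  fixes \<Psi> :: "real \<Rightarrow> real^2^2" and \<tau> :: real
  assumes \<tau>_pos: "\<tau> > 0" and \<Psi>_cont: "continuous_on UNIV \<Psi>" and \<Psi>_Sp2: "\<Psi> t \<in> Sp2"
    and \<Psi>_0: "\<Psi> 0 = mat 1" and \<Psi>_period: "\<Psi> (t + \<tau>) = \<Psi> t ** \<Psi> \<tau>"
    and \<Psi>_reflect: "\<Psi> (- t) = mat2 (\<Psi> t$1$1) (- \<Psi> t$1$2) (- \<Psi> t$2$1) (\<Psi> t$2$2)"
    and nondeg: "k \<ge> 1 \<Longrightarrow> \<Psi> (real k * \<tau>) *v v = v \<Longrightarrow> v = 0"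
begin

lemma \<rho>_exists: "\<exists>\<rho>. continuous_on UNIV \<rho> \<and> \<rho> 0 = 0 \<and> (\<forall>t. is_arg (\<Psi> t) (\<rho> t))"
proof -
  have cplx: "Complex a b = of_real a + \<i> * of_real b" for a b by (simp add: complex_eq_iff)
  have "continuous_on UNIV (\<lambda>t. zeta (\<Psi> t))" unfolding zeta_def cplx
    by (intro continuous_intros \<Psi>_cont)
  moreover have "zeta (\<Psi> t) \<noteq> 0" for t using zeta_ne_0[OF \<Psi>_Sp2] .
  moreover have "contractible (UNIV :: real set)" by (intro convex_imp_contractible) auto
  ultimately obtain g where g: "continuous_on UNIV g" "\<And>t. zeta (\<Psi> t) = exp (g t)"
    using continuous_logarithm_on_contractible[of "UNIV :: real set" "\<lambda>t. zeta (\<Psi> t)"] by (metis UNIV_I)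
  have z0: "zeta (\<Psi> 0) = 2" by (simp add: \<Psi>_0 zeta_def complex_eq_iff)
  \<comment> \<open>The value 2 of \<open>zeta\<close> at time 0 is positive, so the imaginary part
    of its logarithm is a multiple of 2 pi; subtracting it normalizes \<rho> to start at 0 and keeps
    it an argument.\<close>
  have e0: "exp (\<i> * of_real (Im (g 0))) = 1"
  proof -
    have "norm (exp (g 0)) = 2" using g(2)[of 0] z0 by (metis norm_numeral)
    then have r: "exp (Re (g 0)) = 2" by (simp only: norm_exp_eq_Re)
    have "exp (g 0) = of_real (exp (Re (g 0))) * exp (\<i> * of_real (Im (g 0)))"
      by (simp add: complex_eq_iff Re_exp Im_exp)
    then have "2 = 2 * exp (\<i> * of_real (Im (g 0)))" unfolding g(2)[symmetric] z0 r by simp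
    then show ?thesis by simp
  qed
  show ?thesis
  proof (intro exI[of _ "\<lambda>t. Im (g t) - Im (g 0)"] conjI allI)
    show "continuous_on UNIV (\<lambda>t. Im (g t) - Im (g 0))" by (intro continuous_intros g)
    fix t
    have "exp (\<i> * of_real (Im (g t) - Im (g 0))) * exp (\<i> * of_real (Im (g 0))) = exp (\<i> * of_real (Im (g t)))"
      unfolding exp_add[symmetric] by (simp add: algebra_simps)
    then have "exp (\<i> * of_real (Im (g t) - Im (g 0))) = exp (\<i> * of_real (Im (g t)))" unfolding e0 by simp
    then show "is_arg (\<Psi> t) (Im (g t) - Im (g 0))" unfolding g(2) by (simp add: complex_eq_iff Re_exp Im_exp)
  qed simp
qed

definition \<rho> :: "real \<Rightarrow> real" where
  "\<rho> = (SOME \<rho>. continuous_on UNIV \<rho> \<and> \<rho> 0 = 0 \<and> (\<forall>t. is_arg (\<Psi> t) (\<rho> t)))"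

lemma \<rho>: "continuous_on UNIV \<rho>" "\<rho> 0 = 0" "is_arg (\<Psi> t) (\<rho> t)"
  using someI_ex[OF \<rho>_exists] unfolding \<rho>_def[symmetric] by blast+

definition f :: "real \<Rightarrow> real \<Rightarrow> real" where "f t = lift (\<Psi> t) (\<rho> t)"

lemma f_less: "f t x < f t y \<longleftrightarrow> x < y" and f_le: "f t x \<le> f t y \<longleftrightarrow> x \<le> y"
  unfolding f_def by (rule lift_less_iff[OF \<Psi>_Sp2 \<rho>(3)], rule lift_le_iff[OF \<Psi>_Sp2 \<rho>(3)])

lemma f_multiple: "f t (x + of_int j * pi) = f t x + of_int j * pi"
  unfolding f_def by (rule lift_plus_multiple)

lemma f_bounds: "\<bar>f t x - x - \<rho> t\<bar> < pi / 2"
  unfolding f_def by (rule lift_bounds)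

lemma f_dir: obtains r where "r > 0" "\<Psi> t *v dir x = r *\<^sub>R dir (f t x)"
  unfolding f_def using lift_dir[OF \<Psi>_Sp2 \<rho>(3)] by blast

lemma f_0: "f 0 x = x"
proof -
  have "lift_arg (mat 1) x = 0" by (simp add: lift_arg_def inner_real2)
  then show ?thesis by (simp add: f_def lift_def \<Psi>_0 \<rho>(2))
qed

lemma f_cont: "continuous_on UNIV (\<lambda>t. f (p t) (q t))" if "continuous_on UNIV p" "continuous_on UNIV q"
  for p q :: "real \<Rightarrow> real"
proof -
  have e: "continuous_on UNIV (\<lambda>t. \<Psi> (p t) $ i $ j)" for i j
    by (intro continuous_on_component continuous_on_compose2[OF \<Psi>_cont that(1)]) auto
  have s: "continuous_on UNIV (\<lambda>t. sin (q t))" "continuous_on UNIV (\<lambda>t. cos (q t))"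
    by (intro continuous_on_sin continuous_on_cos that)+
  have r: "continuous_on UNIV (\<lambda>t. \<rho> (p t))" by (intro continuous_on_compose2[OF \<rho>(1) that(1)]) auto
  have nz: "1 + (u * u + v * v) \<noteq> 0" for u v :: real using sum_squares_ge_zero[of u v] by linarith
  then show ?thesis unfolding f_def lift_def lift_arg_def
    apply (intro continuous_on_add that r continuous_on_arctan continuous_on_divide)
    unfolding inner_real2 mat2_mult_vec dir_nth J2_nth
    by (auto intro!: continuous_on_add continuous_on_mult continuous_on_diff continuous_on_minus continuous_on_const e s simp: nz)
qed

lemma f_period: "f (t + \<tau>) x = f t (f \<tau> x)"
proof -
  let ?g = "\<lambda>t. f (t + \<tau>) x - f t (f \<tau> x)"
  have "?g t = 0"
  proof (rule continuous_cos_1_imp_0[of ?g])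
    show "continuous_on UNIV ?g" by (intro continuous_on_diff f_cont continuous_intros)
    show "?g 0 = 0" by (simp add: f_0)
    fix t
    obtain r where r: "r > 0" "\<Psi> (t + \<tau>) *v dir x = r *\<^sub>R dir (f (t + \<tau>) x)" by (rule f_dir)
    obtain q where q: "q > 0" "\<Psi> \<tau> *v dir x = q *\<^sub>R dir (f \<tau> x)" by (rule f_dir)
    obtain s where s: "s > 0" "\<Psi> t *v dir (f \<tau> x) = s *\<^sub>R dir (f t (f \<tau> x))" by (rule f_dir)
    have "\<Psi> (t + \<tau>) *v dir x = \<Psi> t *v (\<Psi> \<tau> *v dir x)" by (simp add: \<Psi>_period matrix_vector_mul_assoc)
    also have "\<dots> = (q * s) *\<^sub>R dir (f t (f \<tau> x))" unfolding q(2) by (simp add: matrix_vector_mult_scaleR s(2))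
    finally show "cos (?g t) = 1" using r q s by (intro dir_eq_imp_cos[of r _ "q * s"]) auto
  qed
  then show ?thesis by simp
qed

lemma f_reflect: "f (- t) x = - f t (- x)"
proof -
  let ?g = "\<lambda>t. f (- t) x + f t (- x)"
  have "?g t = 0"
  proof (rule continuous_cos_1_imp_0[of ?g])
    show "continuous_on UNIV ?g" by (intro continuous_on_add f_cont continuous_intros)
    show "?g 0 = 0" by (simp add: f_0)
    fix t
    obtain r where r: "r > 0" "\<Psi> (- t) *v dir x = r *\<^sub>R dir (f (- t) x)" by (rule f_dir)
    obtain q where q: "q > 0" "\<Psi> t *v dir (- x) = q *\<^sub>R dir (f t (- x))" by (rule f_dir)
    have "\<Psi> (- t) *v dir x = q *\<^sub>R dir (- f t (- x))"
      using q(2) unfolding \<Psi>_reflect[of t] vec2_eq_iff by (simp add: algebra_simps)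
    then have "cos (f (- t) x - (- f t (- x))) = 1" using r q by (intro dir_eq_imp_cos[of r _ q]) auto
    then show "cos (?g t) = 1" by simp
  qed
  then show ?thesis by simp
qed

lemma f_iterate: "f (t + real n * \<tau>) x = f t (f (real n * \<tau>) x)"
proof (induction n arbitrary: x)
  case 0 then show ?case by (simp add: f_0)
next
  case (Suc n)
  have "f (t + real (Suc n) * \<tau>) x = f ((t + real n * \<tau>) + \<tau>) x" by (simp add: algebra_simps)
  also have "\<dots> = f t (f (real n * \<tau>) (f \<tau> x))" by (simp add: f_period Suc)
  also have "f (real n * \<tau>) (f \<tau> x) = f (real n * \<tau> + \<tau>) x" by (simp add: f_period)
  finally show ?case by (simp add: algebra_simps)
qed

text \<open>Half a period is minus half a period plus a full one; the reflection then relates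
  \<open>f (\<tau> / 2)\<close> to itself through \<open>f \<tau>\<close>. All information on odd
  iterates comes from this relation.\<close>

lemma f_half: "f (\<tau> / 2) x = - f (\<tau> / 2) (- f \<tau> x)"
proof -
  have "f (\<tau> / 2) x = f (- (\<tau> / 2) + \<tau>) x" by simp
  also have "\<dots> = - f (\<tau> / 2) (- f \<tau> x)" unfolding f_period f_reflect ..
  finally show ?thesis .
qed

lemma \<Psi>_iterate: "\<Psi> (t + real n * \<tau>) = \<Psi> t ** \<Psi> (real n * \<tau>)"
proof (induction n)
  case 0 then show ?case by (simp add: \<Psi>_0)
next
  case (Suc n)
  have e: "real (Suc n) * \<tau> = real n * \<tau> + \<tau>" by (simp add: algebra_simps)
  have "\<Psi> (t + real (Suc n) * \<tau>) = \<Psi> ((t + real n * \<tau>) + \<tau>)" unfolding e by (simp add: add.assoc)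
  also have "\<dots> = \<Psi> t ** (\<Psi> (real n * \<tau>) ** \<Psi> \<tau>)" by (simp only: \<Psi>_period Suc matrix_mul_assoc)
  also have "\<Psi> (real n * \<tau>) ** \<Psi> \<tau> = \<Psi> (real n * \<tau> + \<tau>)" by (simp only: \<Psi>_period)
  finally show ?case unfolding e .
qed

lemma trace_ne_2: "k \<ge> 1 \<Longrightarrow> \<Psi> (real k * \<tau>)$1$1 + \<Psi> (real k * \<tau>)$2$2 \<noteq> 2"
  using trace_2_eigenvector[OF \<Psi>_Sp2] nondeg by blast

text \<open>\<Psi>(T/2) = \<Psi>(-T/2) \<Psi>(T) with T = k \<tau>, so a vector on which both
  half-period matrices agree is fixed by \<Psi>(T).\<close>

lemma half_fixed:
  assumes k: "k \<ge> 1" and v: "v \<noteq> 0" "\<Psi> (- (real k * \<tau> / 2)) *v v = \<Psi> (real k * \<tau> / 2) *v v"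
  shows False
proof -
  let ?M = "\<Psi> (- (real k * \<tau> / 2))"
  have "- (real k * \<tau> / 2) + real k * \<tau> = real k * \<tau> / 2" by simp
  then have "\<Psi> (real k * \<tau> / 2) = \<Psi> (- (real k * \<tau> / 2) + real k * \<tau>)" by (simp only:)
  also have "\<dots> = ?M ** \<Psi> (real k * \<tau>)" by (rule \<Psi>_iterate)
  finally have "?M *v v = ?M *v (\<Psi> (real k * \<tau>) *v v)" using v by (simp add: matrix_vector_mul_assoc)
  then have "?M *v (\<Psi> (real k * \<tau>) *v v - v) = 0" by (simp add: matrix_vector_mult_diff_distrib)
  moreover have "omega2 (\<Psi> (real k * \<tau>) *v v - v) w = omega2 (?M *v (\<Psi> (real k * \<tau>) *v v - v)) (?M *v w)" for w
    using \<Psi>_Sp2[of "- (real k * \<tau> / 2)"] by (simp add: Sp2_def)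
  ultimately have z: "omega2 (\<Psi> (real k * \<tau>) *v v - v) w = 0" for w
    by (simp only:) (simp add: omega2_def)
  have "\<Psi> (real k * \<tau>) *v v - v = 0"
    using z[of "vector [1, 0]"] z[of "vector [0, 1]"] by (simp add: omega2_def vec2_eq_iff)
  then show False using nondeg[OF k] v by simp
qed

text \<open>If an off-diagonal entry at half period vanished, the matrix and its reflected copy
  would agree on a coordinate axis. So the Lagrangian paths defining \<open>mu_1\<close> and
  \<open>mu_2\<close> do not end on their reference line.\<close>

lemma entries_ne_0:
  assumes k: "k \<ge> 1"
  shows "\<Psi> (real k * \<tau> / 2)$1$2 \<noteq> 0" "\<Psi> (real k * \<tau> / 2)$2$1 \<noteq> 0"
proof -
  show "\<Psi> (real k * \<tau> / 2)$1$2 \<noteq> 0"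
    using half_fixed[OF k, of "vector [0, 1]"] unfolding \<Psi>_reflect[of "real k * \<tau> / 2"] by (auto simp: vec2_eq_iff)
  show "\<Psi> (real k * \<tau> / 2)$2$1 \<noteq> 0"
    using half_fixed[OF k, of "vector [1, 0]"] unfolding \<Psi>_reflect[of "real k * \<tau> / 2"] by (auto simp: vec2_eq_iff)
qed

lemma image_line: "(\<lambda>v. \<Psi> t *v v) ` line x = line (f t x)"
proof -
  obtain r where r: "r > 0" "\<Psi> t *v dir x = r *\<^sub>R dir (f t x)" by (rule f_dir)
  have im: "\<Psi> t *v (c *\<^sub>R dir x) = (c * r) *\<^sub>R dir (f t x)" for c by (simp add: matrix_vector_mult_scaleR r)
  show ?thesis
  proof (intro equalityI subsetI)
    fix v assume "v \<in> (\<lambda>v. \<Psi> t *v v) ` line x"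
    then show "v \<in> line (f t x)" by (auto simp: line_def im)
  next
    fix v assume "v \<in> line (f t x)"
    then obtain c where "v = c *\<^sub>R dir (f t x)" by (auto simp: line_def)
    then have "v = \<Psi> t *v ((c / r) *\<^sub>R dir x)" unfolding im using r(1) by simp
    then show "v \<in> (\<lambda>v. \<Psi> t *v v) ` line x" by (auto simp: line_def)
  qed
qed

lemma mu_1_eq: "k \<ge> 1 \<Longrightarrow> mu_1 \<Psi> (real k * \<tau>) = of_int \<lfloor>f (real k * \<tau> / 2) 0 / pi\<rfloor> + 1 / 2"
  and sin_f: "k \<ge> 1 \<Longrightarrow> sin (f (real k * \<tau> / 2) 0) \<noteq> 0"
proof -
  assume k: "k \<ge> 1"
  obtain r where r: "r > 0" "\<Psi> (real k * \<tau> / 2) *v dir 0 = r *\<^sub>R dir (f (real k * \<tau> / 2) 0)" by (rule f_dir)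
  show s: "sin (f (real k * \<tau> / 2) 0) \<noteq> 0" using arg_cong[OF r(2), of "\<lambda>v. v$1"] entries_ne_0(1)[OF k] by auto
  have "mu_RS omega2 (line 0) (\<lambda>s. line (0 + f (real k * \<tau> / 2 * s) 0)) = of_int \<lfloor>f (real k * \<tau> / 2 * 1) 0 / pi\<rfloor> + 1 / 2"
    by (rule mu_RS_line) (use s in \<open>auto simp: f_0 intro!: continuous_on_subset[OF f_cont] continuous_intros\<close>)
  then show "mu_1 \<Psi> (real k * \<tau>) = of_int \<lfloor>f (real k * \<tau> / 2) 0 / pi\<rfloor> + 1 / 2"
    unfolding mu_1_def L0_eq_line image_line by simp
qed

lemma mu_2_eq: "k \<ge> 1 \<Longrightarrow> mu_2 \<Psi> (real k * \<tau>) = of_int \<lfloor>(f (real k * \<tau> / 2) (- (pi / 2)) + pi / 2) / pi\<rfloor> + 1 / 2"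
proof -
  assume k: "k \<ge> 1"
  let ?\<phi> = "\<lambda>s. f (real k * \<tau> / 2 * s) (- (pi / 2)) + pi / 2"
  obtain r where r: "r > 0" "\<Psi> (real k * \<tau> / 2) *v dir (- (pi / 2)) = r *\<^sub>R dir (f (real k * \<tau> / 2) (- (pi / 2)))" by (rule f_dir)
  have s: "sin (?\<phi> 1) \<noteq> 0" using arg_cong[OF r(2), of "\<lambda>v. v$2"] entries_ne_0(2)[OF k] by (auto simp: sin_add)
  have "mu_RS omega2 (line (- (pi / 2))) (\<lambda>s. line (- (pi / 2) + ?\<phi> s)) = of_int \<lfloor>?\<phi> 1 / pi\<rfloor> + 1 / 2"
    by (rule mu_RS_line) (use s in \<open>auto simp: f_0 intro!: continuous_on_add continuous_on_const continuous_on_subset[OF f_cont] continuous_intros\<close>)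
  then show ?thesis
    unfolding mu_2_def L1_eq_line image_line by simp
qed

lemma mu_CZ_eq:
  assumes "k \<ge> 1"
  shows "mu_CZ \<Psi> (real k * \<tau>) = cz_value (\<rho> (real k * \<tau>)) (\<Psi> (real k * \<tau>)$1$1 + \<Psi> (real k * \<tau>)$2$2)"
proof -
  have "mu_RS omega4 diagonal4 (\<lambda>s. Gr (\<Psi> (real k * \<tau> * s))) =
      cz_value (\<rho> (real k * \<tau> * 1)) (\<Psi> (real k * \<tau> * 1)$1$1 + \<Psi> (real k * \<tau> * 1)$2$2)"
    by (rule mu_RS_Gr)
      (use trace_ne_2[OF assms] in \<open>auto simp: \<Psi>_Sp2 \<Psi>_0 \<rho>(2) intro!: \<rho>(3) continuous_on_compose2[OF \<Psi>_cont] continuous_on_compose2[OF \<rho>(1)] continuous_intros\<close>)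
  then show ?thesis unfolding mu_CZ_def by simp
qed

text \<open>\<Psi>(\<tau>) is the product N0 M^-1 N0 M with M = \<Psi>(\<tau>/2) and N0 the
  reflection; both its diagonal entries are a d + b c. Hence eigendirections come in pairs
  \<plusminus>x and the conjugation to a rotation can be diagonal.\<close>

lemma \<Psi>_\<tau>_diagonal: "\<Psi> \<tau>$1$1 = \<Psi> \<tau>$2$2"
proof -
  define M where "M = \<Psi> (\<tau> / 2)"
  have "M = \<Psi> (- (\<tau> / 2) + \<tau>)" by (simp add: M_def)
  also have "\<dots> = mat2 (M$1$1) (- M$1$2) (- M$2$1) (M$2$2) ** \<Psi> \<tau>" unfolding \<Psi>_period \<Psi>_reflect M_def ..
  finally have M: "M = mat2 (M$1$1) (- M$1$2) (- M$2$1) (M$2$2) ** \<Psi> \<tau>" .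
  define a b c d x y z w where v: "a = M$1$1" "b = M$1$2" "c = M$2$1" "d = M$2$2"
    "x = \<Psi> \<tau>$1$1" "y = \<Psi> \<tau>$1$2" "z = \<Psi> \<tau>$2$1" "w = \<Psi> \<tau>$2$2"
  have e: "a = a * x - b * z" "b = a * y - b * w" "c = d * z - c * x" "d = d * w - c * y"
    using arg_cong[OF M, of "\<lambda>N. N$1$1"] arg_cong[OF M, of "\<lambda>N. N$1$2"]
      arg_cong[OF M, of "\<lambda>N. N$2$1"] arg_cong[OF M, of "\<lambda>N. N$2$2"]
    unfolding v by (simp_all add: matrix_matrix_mult_def sum_2)
  have det: "a * d - b * c = 1" using \<Psi>_Sp2[of "\<tau> / 2"] by (simp add: Sp2_iff v M_def)
  have "x = (a * d - b * c) * x" using det by simp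
  also have "\<dots> = d * (a * x - b * z) + b * (d * z - c * x)" by (simp add: algebra_simps)
  also have "\<dots> = a * d + b * c" using e by (simp add: mult.commute)
  finally have x: "x = a * d + b * c" .
  have "w = (a * d - b * c) * w" using det by simp
  also have "\<dots> = a * (d * w - c * y) + c * (a * y - b * w)" by (simp add: algebra_simps)
  also have "\<dots> = a * d + b * c" using e by (simp add: mult.commute)
  finally show ?thesis using x v by simp
qed

lemma det_\<tau>: "\<Psi> \<tau>$1$1 * \<Psi> \<tau>$1$1 - \<Psi> \<tau>$1$2 * \<Psi> \<tau>$2$1 = 1"
  using \<Psi>_Sp2[of \<tau>] by (simp add: Sp2_iff \<Psi>_\<tau>_diagonal)

end

section \<open>Indices of reflection-symmetric paths\<close>

lemma complex_eigenvalue_char: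
  assumes M: "M \<in> Sp2" and z: "z \<in> complex_eigenvalues M"
  shows "z * z - of_real (M$1$1 + M$2$2) * z + 1 = 0"
proof -
  obtain v :: "complex^2" where v: "v \<noteq> 0" "(\<chi> i j. complex_of_real (M$i$j)) *v v = z *s v"
    using z by (auto simp: complex_eigenvalues_def)
  have e: "of_real (M$1$1) * v$1 + of_real (M$1$2) * v$2 = z * v$1"
    "of_real (M$2$1) * v$1 + of_real (M$2$2) * v$2 = z * v$2"
    using arg_cong[OF v(2), of "\<lambda>w. w$1"] arg_cong[OF v(2), of "\<lambda>w. w$2"]
    by (simp_all add: matrix_vector_mult_def sum_2)
  have det: "of_real (M$1$1) * of_real (M$2$2) - of_real (M$1$2) * of_real (M$2$1) = (1::complex)"
    using M[unfolded Sp2_iff, THEN arg_cong[of _ _ complex_of_real]] by simp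
  have "(z * z - (a + d) * z + 1) * u = 0 \<and> (z * z - (a + d) * z + 1) * w = 0"
    if "a * u + b * w = z * u" "c * u + d * w = z * w" "a * d - b * c = 1" for a b c d u w :: complex
  proof -
    have 1: "b * w = (z - a) * u" "c * u = (z - d) * w" using that by (auto simp: algebra_simps)
    have "(z * z - (a + d) * z + 1) * u = ((z - a) * u) * (z - d) - b * (c * u) + u * (1 - (a * d - b * c))" by (simp add: algebra_simps)
    also have "\<dots> = 0" unfolding 1(1)[symmetric] 1(2) that(3) by (simp add: algebra_simps)
    finally have "(z * z - (a + d) * z + 1) * u = 0" .
    moreover have "(z * z - (a + d) * z + 1) * w = ((z - d) * w) * (z - a) - c * (b * w) + w * (1 - (a * d - b * c))" by (simp add: algebra_simps)
    then have "(z * z - (a + d) * z + 1) * w = 0" unfolding 1(2)[symmetric] 1(1) that(3) by (simp add: algebra_simps)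
    ultimately show ?thesis by blast
  qed
  from this[OF e det] show ?thesis using v(1) by (auto simp: vec2_eq_iff)
qed

lemma complex_eigenvalue_exists: "complex_eigenvalues M \<noteq> {}" if M: "M \<in> Sp2" for M
proof -
  obtain z where z: "z * z - of_real (M$1$1 + M$2$2) * z + 1 = (0::complex)"
  proof -
    define t where "t = complex_of_real (M$1$1 + M$2$2)"
    define w where "w = csqrt (t\<^sup>2 / 4 - 1)"
    have "w * w = t\<^sup>2 / 4 - 1" by (simp add: w_def flip: power2_eq_square)
    then have "(t / 2 + w) * (t / 2 + w) - t * (t / 2 + w) + 1 = 0"
      by (simp add: algebra_simps power2_eq_square add_divide_distrib)
    then show thesis using that unfolding t_def by blast
  qed
  have det: "of_real (M$1$1) * of_real (M$2$2) - of_real (M$1$2) * of_real (M$2$1) = (1::complex)"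
    using M[unfolded Sp2_iff, THEN arg_cong[of _ _ complex_of_real]] by simp
  define a b c d where abcd: "a = complex_of_real (M$1$1)" "b = complex_of_real (M$1$2)" "c = complex_of_real (M$2$1)" "d = complex_of_real (M$2$2)"
  have q: "(z - a) * (z - d) = b * c"
  proof -
    have "(z - a) * (z - d) = (z * z - (a + d) * z + 1) + (a * d - b * c - 1) + b * c" by (simp add: algebra_simps)
    then show ?thesis using z det by (simp add: abcd)
  qed
  have "\<exists>u w. (u \<noteq> 0 \<or> w \<noteq> 0) \<and> a * u + b * w = z * u \<and> c * u + d * w = z * w"
  proof (cases "b = 0 \<and> z = a")
    case False
    then show ?thesis using q by (intro exI[of _ b] exI[of _ "z - a"]) (auto simp: algebra_simps)
  next
    case b: True
    show ?thesis
    proof (cases "c = 0 \<and> z = d")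
      case False
      then show ?thesis using b by (intro exI[of _ "z - d"] exI[of _ c]) (auto simp: algebra_simps)
    next
      case True
      then show ?thesis using b by (intro exI[of _ 1] exI[of _ 0]) auto
    qed
  qed
  then obtain u w where uw: "u \<noteq> 0 \<or> w \<noteq> 0" "a * u + b * w = z * u" "c * u + d * w = z * w" by blast
  have "z \<in> complex_eigenvalues M" unfolding complex_eigenvalues_def
    using uw by (intro CollectI exI[of _ "vector [u, w]"])
      (auto simp: vec2_eq_iff matrix_vector_mult_def sum_2 abcd)
  then show ?thesis by blast
qed

lemma eigenvalue_types:
  assumes M: "M \<in> Sp2"
  defines "t \<equiv> M$1$1 + M$2$2"
  shows "\<bar>t\<bar> < 2 \<Longrightarrow> elliptic M \<and> \<not> positive_hyperbolic M \<and> \<not> negative_hyperbolic M"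
    and "t > 2 \<Longrightarrow> \<not> elliptic M \<and> positive_hyperbolic M \<and> \<not> negative_hyperbolic M"
    and "t < -2 \<Longrightarrow> \<not> elliptic M \<and> \<not> positive_hyperbolic M \<and> negative_hyperbolic M"
proof -
  obtain z0 where z0: "z0 \<in> complex_eigenvalues M" using complex_eigenvalue_exists[OF M] by blast
  have eq: "Re z * Re z - Im z * Im z - t * Re z + 1 = 0" "Im z * (2 * Re z - t) = 0" if "z \<in> complex_eigenvalues M" for z
    using complex_eigenvalue_char[OF M that] unfolding t_def[symmetric] complex_eq_iff by (auto simp: algebra_simps)
  have real: "Im z = 0" "Re z * Re z - t * Re z + 1 = 0" if z: "z \<in> complex_eigenvalues M" and t: "\<bar>t\<bar> > 2" for z
  proof -
    show i: "Im z = 0"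
    proof (rule ccontr)
      assume "Im z \<noteq> 0"
      then have r: "t = 2 * Re z" using eq(2)[OF z] by simp
      have "Im z * Im z = 1 - Re z * Re z" using eq(1)[OF z] unfolding r by simp
      moreover have "Re z * Re z > 1"
      proof -
        have "\<bar>Re z\<bar> > 1" using t r by simp
        then have "1 * 1 < \<bar>Re z\<bar> * \<bar>Re z\<bar>" by (intro mult_strict_mono) auto
        then show ?thesis by (simp add: abs_mult_self_eq)
      qed
      ultimately show False using zero_le_square[of "Im z"] by linarith
    qed
    show "Re z * Re z - t * Re z + 1 = 0" using eq(1)[OF z] i by simp
  qed
  have norm_ne: "cmod z \<noteq> 1" if z: "z \<in> complex_eigenvalues M" and t: "\<bar>t\<bar> > 2" for z
  proof
    assume "cmod z = 1"
    then have "Re z = 1 \<or> Re z = -1" using real(1)[OF z t] by (auto simp: cmod_def abs_if split: if_splits)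
    then show False using real(2)[OF z t] t by auto
  qed
  show "elliptic M \<and> \<not> positive_hyperbolic M \<and> \<not> negative_hyperbolic M" if t: "\<bar>t\<bar> < 2"
  proof -
    have im: "Im z \<noteq> 0" if z: "z \<in> complex_eigenvalues M" for z
    proof
      assume "Im z = 0"
      then have "Re z * Re z - t * Re z + 1 = 0" using eq(1)[OF z] by simp
      then have "(Re z - t / 2)^2 = (t / 2)^2 - 1" by (simp add: power2_eq_square algebra_simps)
      moreover have "(t / 2)^2 < 1" using t by (simp add: abs_square_less_1)
      ultimately show False using zero_le_power2[of "Re z - t / 2"] by linarith
    qed
    have "cmod z = 1" if z: "z \<in> complex_eigenvalues M" for z
    proof -
      have r: "t = 2 * Re z" using eq(2)[OF z] im[OF z] by simp
      have "(cmod z)^2 = 1" using eq(1)[OF z] unfolding r cmod_power2 by (simp add: power2_eq_square)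
      then show ?thesis by (simp add: power2_eq_1_iff) (metis norm_ge_zero neg_0_le_iff_le not_one_le_zero)
    qed
    then show ?thesis using im z0 unfolding elliptic_def positive_hyperbolic_def negative_hyperbolic_def
      by (metis complex_is_Real_iff)
  qed
  show "\<not> elliptic M \<and> positive_hyperbolic M \<and> \<not> negative_hyperbolic M" if t: "t > 2"
  proof -
    have t': "\<bar>t\<bar> > 2" using t by simp
    have "Re z > 0" if z: "z \<in> complex_eigenvalues M" for z
    proof -
      have "t * Re z = Re z * Re z + 1" using real(2)[OF z t'] by simp
      also have "\<dots> > 0" by (intro add_nonneg_pos) auto
      finally show ?thesis using t by (simp add: zero_less_mult_iff)
    qed
    then show ?thesis using real(1)[OF _ t'] norm_ne[OF _ t'] z0
      unfolding elliptic_def positive_hyperbolic_def negative_hyperbolic_def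
      by (metis complex_is_Real_iff less_asym)
  qed
  show "\<not> elliptic M \<and> \<not> positive_hyperbolic M \<and> negative_hyperbolic M" if t: "t < -2"
  proof -
    have t': "\<bar>t\<bar> > 2" using t by simp
    have "Re z < 0" if z: "z \<in> complex_eigenvalues M" for z
    proof -
      have "t * Re z = Re z * Re z + 1" using real(2)[OF z t'] by simp
      also have "\<dots> > 0" by (intro add_nonneg_pos) auto
      finally show ?thesis using t by (simp add: zero_less_mult_iff)
    qed
    then show ?thesis using real(1)[OF _ t'] norm_ne[OF _ t'] z0
      unfolding elliptic_def positive_hyperbolic_def negative_hyperbolic_def
      by (metis complex_is_Real_iff less_asym)
  qed
qed

text \<open>For odd m the point m pi/2 is the midpoint between two multiples of pi, so an error
  below pi/2 leaves the floor unchanged. For even m it is itself a multiple and, as in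
  \<open>floor_half_even\<close>, the sign of the error decides.\<close>

lemma floor_half_odd:
  assumes "odd (m::int)" "\<bar>F - of_int m * pi / 2\<bar> < pi / 2"
  shows "of_int \<lfloor>F / pi\<rfloor> + 1 / 2 = of_int m / (2::real)"
proof -
  obtain j where j: "m = 2 * j + 1" using assms(1) by (metis oddE)
  have "\<lfloor>F / pi\<rfloor> = j" using assms(2) by (intro floor_div_pi) (auto simp: j abs_less_iff field_simps)
  then show ?thesis by (simp add: j)
qed

lemma floor_half_even:
  assumes "even (m::int)" "\<bar>F - of_int m * pi / 2\<bar> < pi / 2" "\<epsilon> * (F - of_int m * pi / 2) > 0" "\<epsilon> = 1 \<or> \<epsilon> = -1"
  shows "of_int \<lfloor>F / pi\<rfloor> + 1 / 2 = of_int m / 2 + \<epsilon> / (2::real)"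
proof -
  obtain j where j: "m = 2 * j" using assms(1) by blast
  show ?thesis
  proof (cases "\<epsilon> = 1")
    case True
    have "\<lfloor>F / pi\<rfloor> = j" using assms(2,3) True by (intro floor_div_pi) (auto simp: j abs_less_iff field_simps)
    then show ?thesis using True by (simp add: j)
  next
    case False
    then have e: "\<epsilon> = -1" using assms by simp
    have "\<lfloor>F / pi\<rfloor> = j - 1" using assms(2,3) e by (intro floor_div_pi) (auto simp: j abs_less_iff field_simps)
    then show ?thesis using e by (simp add: j)
  qed
qed

section \<open>The hyperbolic case\<close>

context brake_path
begin

definition \<mu>1 where "\<mu>1 k = mu_1 \<Psi> (real k * \<tau>)"
definition \<mu>2 where "\<mu>2 k = mu_2 \<Psi> (real k * \<tau>)"
definition \<mu>CZ where "\<mu>CZ k = mu_CZ \<Psi> (real k * \<tau>)"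

lemma f_iterate_multiple:
  assumes "f \<tau> x = x + of_int n * pi"
  shows "f (real m * \<tau>) x = x + of_int (int m * n) * pi"
proof (induction m)
  case 0 then show ?case by (simp add: f_0)
next
  case (Suc m)
  have "f (real (Suc m) * \<tau>) x = f (real m * \<tau> + \<tau>) x" by (simp add: algebra_simps)
  also have "\<dots> = f (real m * \<tau>) (x + of_int n * pi)" by (simp add: f_period assms)
  also have "\<dots> = x + of_int (int m * n) * pi + of_int n * pi" by (simp only: f_multiple Suc)
  finally show ?case by (simp add: algebra_simps)
qed

text \<open>n is the number of half turns of the eigendirections in one period, which gives
  \<open>\<mu>CZ\<close>; \<epsilon> is the sign of \<open>f \<tau> 0 - n pi\<close>. For the angle
  F k of \<open>L0\<close> after k half periods, the eigendirections confine F k - k n pi/2 to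
  (-pi/2, pi/2) and monotonicity gives it the sign \<epsilon>, which is felt only if k n is
  even.\<close>

lemma hyperbolic:
  assumes tr: "\<bar>\<Psi> \<tau>$1$1 + \<Psi> \<tau>$2$2\<bar> > 2"
  obtains n :: int and \<epsilon> :: real where "\<epsilon> = 1 \<or> \<epsilon> = -1" "even n \<longleftrightarrow> \<Psi> \<tau>$1$1 + \<Psi> \<tau>$2$2 > 2"
    "\<And>k. k \<ge> 1 \<Longrightarrow> \<mu>CZ k = real k * of_int n"
    "\<And>k. k \<ge> 1 \<Longrightarrow> \<mu>1 k = (if odd (int k * n) then real k * of_int n / 2 else real k * of_int n / 2 + \<epsilon> / 2)"
    "\<mu>1 2 - \<mu>2 2 = \<epsilon>"
proof -
  define p q r where pqr: "p = \<Psi> \<tau>$1$1" "q = \<Psi> \<tau>$1$2" "r = \<Psi> \<tau>$2$1"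
  have p22: "\<Psi> \<tau>$2$2 = p" using \<Psi>_\<tau>_diagonal by (simp add: pqr)
  have det: "q * r = p * p - 1" using det_\<tau> by (simp add: pqr)
  have "\<bar>p\<bar> > 1" using tr p22 pqr by simp
  then have "1 * 1 < \<bar>p\<bar> * \<bar>p\<bar>" by (intro mult_strict_mono) auto
  then have qr: "q * r > 0" using det by (simp add: abs_mult_self_eq)
  then have qr0: "q \<noteq> 0" "r \<noteq> 0" "q / r > 0" by (auto simp: zero_less_mult_iff zero_less_divide_iff)
  \<comment> \<open>Eigenvectors are (-w, 1) and (w, 1): with equal diagonal entries p one needs w^2
    = q / r, positive because q r = p^2 - 1.\<close>
  obtain w where w: "w > 0" "q = r * (w * w)"
  proof (rule that[of "sqrt (q / r)"])
    show "q = r * (sqrt (q / r) * sqrt (q / r))"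
      by (simp only: real_sqrt_mult_self abs_of_pos[OF qr0(3)]) (use qr0 in simp)
  qed (use qr0 in simp)
  define x where "x = arctan w"
  have x: "0 < x" "x < pi / 2" using w arctan_ubound by (auto simp: x_def)
  have cx: "cos x > 0" using x by (intro cos_gt_zero_pi) auto
  have tan: "sin x = w * cos x"
    using tan_arctan[of w] cx unfolding x_def[symmetric] tan_def by (simp add: field_simps)
  have eig: "\<Psi> \<tau> *v dir y = l *\<^sub>R dir y" if "y = x \<and> l = p - r * w \<or> y = - x \<and> l = p + r * w" for y l
    using that unfolding vec2_eq_iff mat2_mult_vec p22 pqr[symmetric] w(2)
    by (elim disjE conjE; hypsubst; simp add: tan algebra_simps)
  have fix_multiple: "\<exists>n::int. f \<tau> y = y + of_int n * pi" if l: "\<Psi> \<tau> *v dir y = l *\<^sub>R dir y" for y l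
  proof -
    obtain s where s: "s > 0" "\<Psi> \<tau> *v dir y = s *\<^sub>R dir (f \<tau> y)" by (rule f_dir)
    have "omega2 (dir y) (s *\<^sub>R dir (f \<tau> y)) = 0" unfolding s(2)[symmetric] l by (simp add: omega2_def)
    moreover have "omega2 (dir y) (s *\<^sub>R dir (f \<tau> y)) = s * sin (f \<tau> y - y)"
      unfolding omega2_dir[symmetric] by (simp add: omega2_def algebra_simps)
    ultimately have "sin (f \<tau> y - y) = 0" using s by simp
    then obtain n :: int where "f \<tau> y - y = of_int n * pi" by (auto simp: sin_zero_iff_int2)
    then show ?thesis by (intro exI[of _ n]) simp
  qed
  obtain n :: int where n: "f \<tau> x = x + of_int n * pi" using fix_multiple[OF eig] by blast
  obtain n' :: int where n': "f \<tau> (- x) = - x + of_int n' * pi" using fix_multiple[OF eig] by blast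
  \<comment> \<open>Since -x < x < -x + pi, monotonicity leaves no room for different numbers of
    half turns.\<close>
  have "n' = n"
  proof -
    have "f \<tau> (- x) < f \<tau> x" "f \<tau> x < f \<tau> (- x + of_int 1 * pi)" unfolding f_less using x by auto
    then have "of_int (n' - n) * pi < 1 * pi" "of_int (-1) * pi < of_int (n' - n) * pi"
      unfolding f_multiple n n' using x by (auto simp: algebra_simps)
    then have "of_int (n' - n) < (1::real)" "of_int (-1) < (of_int (n' - n) :: real)"
      by (simp_all only: mult_less_cancel_right) auto
    then have "n' - n < 1" "-1 < n' - n" by (simp_all only: of_int_less_iff of_int_less_1_iff)
    then show ?thesis by simp
  qed
  with n' have n'': "f \<tau> (- x) = - x + of_int n * pi" by simp
  have cz: "\<mu>CZ k = real k * of_int n" if k: "k \<ge> 1" for k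
  proof -
    have "lift (\<Psi> (real k * \<tau>)) (\<rho> (real k * \<tau>)) x = x + of_int (int k * n) * pi"
      using f_iterate_multiple[OF n, of k] by (simp add: f_def)
    from cz_value_eigendirection(1)[OF \<Psi>_Sp2 \<rho>(3) this trace_ne_2[OF k]]
    show ?thesis unfolding \<mu>CZ_def mu_CZ_eq[OF k] by simp
  qed
  have parity: "even n \<longleftrightarrow> \<Psi> \<tau>$1$1 + \<Psi> \<tau>$2$2 > 2"
  proof -
    have "lift (\<Psi> \<tau>) (\<rho> \<tau>) x = x + of_int n * pi" using n by (simp add: f_def)
    from cz_value_eigendirection(2)[OF \<Psi>_Sp2 \<rho>(3) this] trace_ne_2[of 1] show ?thesis by simp
  qed
  let ?h = "f (\<tau> / 2)"
  \<comment> \<open>Together with \<open>hdiff\<close>: the half-period images of \<plusminus>x are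
    symmetric about n pi/2 and closer to it than pi/2.\<close>
  have hsum: "?h x + ?h (- x) = of_int n * pi"
  proof -
    have "?h x = - ?h (- x + of_int (- n) * pi)" using f_half[of x] unfolding n by simp
    then show ?thesis unfolding f_multiple by simp
  qed
  have hdiff: "?h (- x) < ?h x" "?h x < ?h (- x) + pi"
  proof -
    show "?h (- x) < ?h x" unfolding f_less using x by simp
    have "?h x < ?h (- x + of_int 1 * pi)" unfolding f_less using x by simp
    then show "?h x < ?h (- x) + pi" unfolding f_multiple by simp
  qed
  define g where "g m = f (real m * \<tau>) 0" for m :: nat
  have gb: "of_int (int m * n) * pi - x < g m" "g m < of_int (int m * n) * pi + x" for m
  proof -
    have "f (real m * \<tau>) (- x) < g m" "g m < f (real m * \<tau>) x" unfolding g_def f_less using x by auto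
    then show "of_int (int m * n) * pi - x < g m" "g m < of_int (int m * n) * pi + x"
      unfolding f_iterate_multiple[OF n] f_iterate_multiple[OF n''] by auto
  qed
  have Feven: "f (real (2 * m) * \<tau> / 2) 0 = g m" for m by (simp add: g_def)
  have Fodd: "f (real (2 * m + 1) * \<tau> / 2) 0 = ?h (g m)" for m
  proof -
    have "real (2 * m + 1) * \<tau> / 2 = \<tau> / 2 + real m * \<tau>" by (simp add: field_simps)
    then show ?thesis by (simp only: f_iterate g_def)
  qed
  define F where "F k = f (real k * \<tau> / 2) 0" for k :: nat
  have Fb: "\<bar>F k - of_int (int k * n) * pi / 2\<bar> < pi / 2" for k
  proof (cases "even k")
    case True
    then obtain m where m: "k = 2 * m" by blast
    have c: "of_int (int k * n) * pi / 2 = of_int (int m * n) * pi" by (simp add: m)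
    have "F k = g m" unfolding F_def m Feven ..
    then show ?thesis unfolding c abs_less_iff using gb[of m] x by linarith
  next
    case False
    then obtain m where m: "k = 2 * m + 1" by (metis oddE)
    have "?h (- x + of_int (int m * n) * pi) < ?h (g m)" "?h (g m) < ?h (x + of_int (int m * n) * pi)"
      unfolding f_less using gb[of m] by auto
    then have "?h (- x) + of_int (int m * n) * pi < F k" "F k < ?h x + of_int (int m * n) * pi"
      unfolding f_multiple F_def m Fodd .
    moreover have "of_int (int k * n) * pi / 2 = of_int (int m * n) * pi + of_int n * pi / 2" by (simp add: m algebra_simps add_divide_distrib)
    ultimately show ?thesis using hsum hdiff unfolding abs_less_iff by linarith
  qed
  define \<delta> where "\<delta> = f \<tau> 0 - of_int n * pi"
  have F2: "F 2 = f \<tau> 0" by (simp add: F_def)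
  have \<delta>0: "\<delta> \<noteq> 0"
  proof
    assume "\<delta> = 0"
    then have "f \<tau> 0 = of_int n * pi" by (simp add: \<delta>_def)
    then have "sin (f \<tau> 0) = 0" unfolding sin_zero_iff_int2 by blast
    then show False using sin_f[of 2] by simp
  qed
  have \<delta>b: "\<bar>\<delta>\<bar> < pi / 2" using Fb[of 2] unfolding F2 \<delta>_def by simp
  define \<epsilon> where "\<epsilon> = sgn \<delta>"
  have \<epsilon>: "\<epsilon> = 1 \<or> \<epsilon> = -1" using \<delta>0 by (auto simp: \<epsilon>_def sgn_real_def)
  have pos_diff: "0 < d \<Longrightarrow> d + b < c \<Longrightarrow> 0 < 1 * (c - b)" and neg_diff: "d < 0 \<Longrightarrow> c < d + b \<Longrightarrow> 0 < - 1 * (c - b)"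
    for b c d :: real by simp_all
  \<comment> \<open>\<open>f \<tau>\<close> sends m n pi to (m + 1) n pi + \<delta>, and by
    monotonicity a point on the \<epsilon>-side of m n pi goes beyond that value.\<close>
  have g_sign: "m \<ge> 1 \<Longrightarrow> \<epsilon> * (g m - of_int (int m * n) * pi) > 0" for m
  proof (induction m rule: nat_induct_at_least)
    case base
    have "g 1 - of_int (int 1 * n) * pi = \<delta>" by (simp add: g_def \<delta>_def)
    then show ?case using \<delta>0 by (simp only: \<epsilon>_def) (simp add: sgn_real_def)
  next
    case (Suc m)
    have step: "g (Suc m) = f \<tau> (g m)"
    proof -
      have "real (Suc m) * \<tau> = \<tau> + real m * \<tau>" by (simp add: algebra_simps)
      then show ?thesis by (simp only: g_def f_iterate)
    qed
    have base': "f \<tau> (of_int (int m * n) * pi) = \<delta> + of_int (int (Suc m) * n) * pi"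
      using f_multiple[of \<tau> 0 "int m * n"] by (simp add: \<delta>_def algebra_simps)
    show ?case
    proof (cases "\<epsilon> = 1")
      case True
      then have "\<delta> > 0" using \<delta>0 by (auto simp: \<epsilon>_def sgn_real_def split: if_splits)
      moreover have "f \<tau> (of_int (int m * n) * pi) < f \<tau> (g m)" unfolding f_less using Suc True by simp
      ultimately show ?thesis unfolding step base' True by (rule pos_diff)
    next
      case False
      then have e: "\<epsilon> = -1" using \<epsilon> by simp
      then have "\<delta> < 0" using \<delta>0 by (auto simp: \<epsilon>_def sgn_real_def split: if_splits)
      moreover have "f \<tau> (g m) < f \<tau> (of_int (int m * n) * pi)" unfolding f_less using Suc e by simp
      ultimately show ?thesis unfolding step base' e by (rule neg_diff)
    qed
  qed
  \<comment> \<open>The half-period relation at 0 makes \<open>?h 0\<close> and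
    \<open>?h (- \<delta>)\<close> add up to n pi, so the sign of \<delta> tells which of them
    exceeds n pi/2.\<close>
  have h0: "\<epsilon> * (?h 0 - of_int n * pi / 2) > 0"
  proof -
    have e: "?h 0 = - ?h (- \<delta> + of_int (- n) * pi)" using f_half[of 0] by (simp add: \<delta>_def)
    then have e: "?h 0 + ?h (- \<delta>) = of_int n * pi" unfolding f_multiple by simp
    show ?thesis
    proof (cases "\<epsilon> = 1")
      case True
      then have "\<delta> > 0" using \<delta>0 by (auto simp: \<epsilon>_def sgn_real_def split: if_splits)
      then have "?h (- \<delta>) < ?h 0" unfolding f_less by simp
      then show ?thesis using e True by simp
    next
      case False
      then have "\<delta> < 0" using \<delta>0 by (auto simp: \<epsilon>_def sgn_real_def split: if_splits)
      then have "?h 0 < ?h (- \<delta>)" unfolding f_less by simp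
      then show ?thesis using e False \<epsilon> by simp
    qed
  qed
  have F_sign: "\<epsilon> * (F k - of_int (int k * n) * pi / 2) > 0" if k: "k \<ge> 1" for k
  proof (cases "even k")
    case True
    then obtain m where m: "k = 2 * m" by blast
    have c: "of_int (int k * n) * pi / 2 = of_int (int m * n) * pi" by (simp add: m)
    show ?thesis unfolding c unfolding F_def m Feven using g_sign[of m] k m by simp
  next
    case False
    then obtain m where m: "k = 2 * m + 1" by (metis oddE)
    have c: "of_int (int k * n) * pi / 2 = of_int (int m * n) * pi + of_int n * pi / 2" by (simp add: m algebra_simps add_divide_distrib)
    have base': "?h (of_int (int m * n) * pi) = ?h 0 + of_int (int m * n) * pi"
      using f_multiple[of "\<tau> / 2" 0 "int m * n"] by simp
    have gm: "\<epsilon> * (g m - of_int (int m * n) * pi) \<ge> 0"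
    proof (cases "m = 0")
      case True then show ?thesis by (simp add: g_def f_0)
    next
      case False then show ?thesis using g_sign[of m] by simp
    qed
    show ?thesis
    proof (cases "\<epsilon> = 1")
      case True
      then have "?h (of_int (int m * n) * pi) \<le> ?h (g m)" unfolding f_le using gm by simp
      then have "0 \<le> ?h (g m) - (?h 0 + of_int (int m * n) * pi)" unfolding base' by simp
      moreover have "F k = ?h (g m)" unfolding F_def m Fodd ..
      ultimately show ?thesis using h0 True unfolding c by (simp add: algebra_simps)
    next
      case False
      then have e: "\<epsilon> = -1" using \<epsilon> by simp
      then have "?h (g m) \<le> ?h (of_int (int m * n) * pi)" unfolding f_le using gm by simp
      then have "0 \<le> (?h 0 + of_int (int m * n) * pi) - ?h (g m)" unfolding base' by simp
      moreover have "F k = ?h (g m)" unfolding F_def m Fodd ..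
      ultimately show ?thesis using h0 e unfolding c by (simp add: algebra_simps)
    qed
  qed
  have m1: "\<mu>1 k = (if odd (int k * n) then real k * of_int n / 2 else real k * of_int n / 2 + \<epsilon> / 2)" if k: "k \<ge> 1" for k
    using floor_half_odd[OF _ Fb[of k]] floor_half_even[OF _ Fb[of k] F_sign[OF k] \<epsilon>]
    unfolding \<mu>1_def mu_1_eq[OF k] F_def[symmetric] by auto
  \<comment> \<open>G is the angle of \<open>L1\<close> after one period, measured from
    \<open>L1\<close>. The entries q and r have the same sign, which forces \<open>L1\<close> to the
    opposite side from \<open>L0\<close> once n half turns are removed; hence the difference
    \<epsilon> of the two indices.\<close>
  define G where "G = f \<tau> (- (pi / 2)) + pi / 2"
  have Gb: "\<bar>G - of_int n * pi\<bar> < pi / 2"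
  proof -
    have "f \<tau> (x + of_int (-1) * pi) < f \<tau> (- (pi / 2))" "f \<tau> (- (pi / 2)) < f \<tau> (- x)" unfolding f_less using x by auto
    then show ?thesis unfolding f_multiple n n'' G_def abs_less_iff using x by simp
  qed
  have Gs: "- \<epsilon> * (G - of_int n * pi) > 0"
  proof -
    define \<gamma> where "\<gamma> = G - of_int n * pi"
    obtain s where s: "s > 0" "\<Psi> \<tau> *v dir 0 = s *\<^sub>R dir (f \<tau> 0)" by (rule f_dir)
    obtain s' where s': "s' > 0" "\<Psi> \<tau> *v dir (- (pi / 2)) = s' *\<^sub>R dir (f \<tau> (- (pi / 2)))" by (rule f_dir)
    define c where "c = (if even n then 1 else -1 :: real)"
    have "f \<tau> 0 = \<delta> + of_int n * pi" by (simp add: \<delta>_def)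
    then have d1: "dir (f \<tau> 0) = c *\<^sub>R dir \<delta>" by (simp add: dir_plus_multiple c_def)
    have "f \<tau> (- (pi / 2)) = (\<gamma> - pi / 2) + of_int n * pi" by (simp add: \<gamma>_def G_def)
    then have d2: "dir (f \<tau> (- (pi / 2))) = c *\<^sub>R dir (\<gamma> - pi / 2)" by (simp add: dir_plus_multiple c_def)
    have "q = - (s * c * sin \<delta>)" using arg_cong[OF s(2), of "\<lambda>v. v$1"] unfolding d1 by (simp add: pqr)
    moreover have "r = s' * c * sin \<gamma>" using arg_cong[OF s'(2), of "\<lambda>v. v$2"] unfolding d2 by (simp add: pqr cos_diff)
    ultimately have "q * r = (s * s' * (c * c)) * (- (sin \<delta> * sin \<gamma>))" by (simp add: algebra_simps)
    moreover have "c * c = 1" by (simp add: c_def)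
    ultimately have neg: "- (sin \<delta> * sin \<gamma>) > 0" using qr s s' by (simp add: mult_less_0_iff zero_less_mult_iff)
    have sg: "sgn (sin y) = sgn y" if "\<bar>y\<bar> < pi / 2" for y
    proof (cases y "0::real" rule: linorder_cases)
      case less
      then have "sin (- y) > 0" using that by (intro sin_gt_zero) auto
      then show ?thesis using less by simp
    next
      case greater
      then have "sin y > 0" using that by (intro sin_gt_zero) auto
      then show ?thesis using greater by simp
    qed simp
    have "sgn (- (sin \<delta> * sin \<gamma>)) = 1" using neg by simp
    then have "- (sgn \<delta> * sgn \<gamma>) = 1" using sg[OF \<delta>b] sg[of \<gamma>] Gb by (simp add: sgn_mult \<gamma>_def)
    then have "- \<epsilon> * sgn \<gamma> = 1" by (simp add: \<epsilon>_def)
    then show ?thesis using \<epsilon> unfolding \<gamma>_def[symmetric] by (auto simp: sgn_real_def split: if_splits)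
  qed
  have m2: "\<mu>2 2 = of_int n - \<epsilon> / 2"
  proof -
    have "of_int \<lfloor>G / pi\<rfloor> + 1 / 2 = of_int (2 * n) / 2 + (- \<epsilon>) / (2::real)"
      using Gb Gs \<epsilon> by (intro floor_half_even) (auto simp: mult.assoc)
    then show ?thesis unfolding \<mu>2_def using mu_2_eq[of 2] by (simp add: G_def)
  qed
  show thesis
    by (rule that[OF \<epsilon> parity cz m1]) (use m1[of 2] m2 in simp_all)
qed

end

section \<open>Rotations conjugated by diagonal matrices\<close>

lemma rot_eq: "rot a = mat2 (cos a) (- sin a) (sin a) (cos a)"
  by (simp add: rot_def mat2_def)

lemma mat2_mult: "mat2 a b c d ** mat2 a' b' c' d' = mat2 (a * a' + b * c') (a * b' + b * d') (c * a' + d * c') (c * b' + d * d')"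
  by (simp add: mat2_eq_iff matrix_matrix_mult_def sum_2)

lemma matrix_inv_diag: "u \<noteq> 0 \<Longrightarrow> matrix_inv (mat2 u 0 0 (1 / u)) = mat2 (1 / u) 0 0 u"
  unfolding matrix_inv_def
proof (rule some_equality)
  assume u: "u \<noteq> 0"
  let ?P = "mat2 u 0 0 (1 / u)" and ?Q = "mat2 (1 / u) 0 0 u"
  show PQ: "?P ** ?Q = mat 1 \<and> ?Q ** ?P = mat 1" using u by (simp add: mat2_mult mat2_eq_iff)
  fix X assume "?P ** X = mat 1 \<and> X ** ?P = mat 1"
  then have "(?Q ** ?P) ** X = ?Q" by (simp add: matrix_mul_assoc[symmetric])
  then show "X = ?Q" using PQ by simp
qed

text \<open>The conjugate of the rotation by \<open>a\<close> under \<open>diag(u, 1/u)\<close>; here \<open>v = u\<^sup>2\<close>.\<close>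

definition conj_rot :: "real \<Rightarrow> real \<Rightarrow> real^2^2" where
  "conj_rot v a = mat2 (cos a) (- v * sin a) (sin a / v) (cos a)"

lemma conj_rot_eq:
  assumes "u \<noteq> 0"
  shows "mat2 u 0 0 (1 / u) ** rot a ** matrix_inv (mat2 u 0 0 (1 / u)) = conj_rot (u * u) a"
  using assms by (simp add: matrix_inv_diag rot_eq mat2_mult conj_rot_def mat2_eq_iff)

lemma conj_rot_Sp2: "v \<noteq> 0 \<Longrightarrow> conj_rot v a \<in> Sp2"
  using sin_cos_squared_add[of a] by (simp add: Sp2_iff conj_rot_def power2_eq_square algebra_simps)

lemma conj_rot_add: "v \<noteq> 0 \<Longrightarrow> conj_rot v a ** conj_rot v b = conj_rot v (a + b)"
  by (simp add: conj_rot_def mat2_mult mat2_eq_iff sin_add cos_add field_simps)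

text \<open>The argument of 2 cos a + i (v + 1/v) sin a that stays within pi/2 of a: the
  \<open>arctan\<close> term is the argument of this number times e^(-i a), whose real part is the
  positive denominator.\<close>

definition conj_rot_arg :: "real \<Rightarrow> real \<Rightarrow> real" where
  "conj_rot_arg v a = a + arctan ((v + 1 / v - 2) * sin a * cos a / (2 * cos a * cos a + (v + 1 / v) * sin a * sin a))"

lemma conj_rot_denominator:
  fixes a v :: real
  assumes "v > 0" shows "2 * cos a * cos a + (v + 1 / v) * sin a * sin a > 0"
proof (cases "sin a = 0")
  case True
  then have "cos a \<noteq> 0" using sin_cos_squared_add[of a] by auto
  then have "cos a * cos a > 0" using not_real_square_gt_zero by blast
  then show ?thesis using True by (simp add: mult.assoc)
next
  case False
  then have "sin a * sin a > 0" using not_real_square_gt_zero by blast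
  moreover have "v + 1 / v > 0" using assms by (simp add: add_pos_pos)
  ultimately have "(v + 1 / v) * (sin a * sin a) > 0" by (rule mult_pos_pos[rotated])
  moreover have "2 * (cos a * cos a) \<ge> 0" by simp
  ultimately show ?thesis by (simp only: mult.assoc)
qed

lemma conj_rot_arg:
  assumes v: "v > 0"
  shows "is_arg (conj_rot v a) (conj_rot_arg v a)" "\<bar>conj_rot_arg v a - a\<bar> < pi / 2"
proof -
  define s where "s = v + 1 / v"
  define wr wi where w: "wr = 2 * cos a * cos a + s * sin a * sin a" "wi = (s - 2) * sin a * cos a"
  have wr: "wr > 0" using conj_rot_denominator[OF v] by (simp add: w s_def)
  define \<delta> where "\<delta> = arctan (wi / wr)"
  have arg: "conj_rot_arg v a = a + \<delta>" by (simp add: conj_rot_arg_def \<delta>_def w s_def)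
  show "\<bar>conj_rot_arg v a - a\<bar> < pi / 2" using arctan_bounded[of "wi / wr"] unfolding arg \<delta>_def by linarith
  have cpos: "cos \<delta> > 0" unfolding \<delta>_def cos_arctan by (simp add: add_pos_nonneg)
  define m where "m = wr / cos \<delta>"
  have mpos: "m > 0" using wr cpos by (simp add: m_def)
  have tan: "sin \<delta> / cos \<delta> = wi / wr" using tan_arctan[of "wi / wr"] by (simp add: \<delta>_def tan_def)
  have mw: "wr = m * cos \<delta>" "wi = m * sin \<delta>" using tan wr cpos by (simp_all add: m_def field_simps)
  have cs: "cos a * cos a + sin a * sin a = 1" using sin_cos_squared_add[of a] by (simp add: power2_eq_square)
  have zr: "2 * cos a = m * cos (a + \<delta>)"
  proof -
    have "m * cos (a + \<delta>) = cos a * wr - sin a * wi" unfolding mw by (simp add: cos_add algebra_simps)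
    also have "\<dots> = 2 * cos a * (cos a * cos a + sin a * sin a)"
    proof -
      have "c * (2 * c * c + t * s * s) - s * ((t - 2) * s * c) = 2 * c * (c * c + s * s)" for c s t :: real
        by (simp add: algebra_simps)
      then show ?thesis unfolding w .
    qed
    finally show ?thesis unfolding cs by simp
  qed
  have zi: "s * sin a = m * sin (a + \<delta>)"
  proof -
    have "m * sin (a + \<delta>) = sin a * wr + cos a * wi" unfolding mw by (simp add: sin_add algebra_simps)
    also have "\<dots> = s * sin a * (cos a * cos a + sin a * sin a)"
    proof -
      have "s * (2 * c * c + t * s * s) + c * ((t - 2) * s * c) = t * s * (c * c + s * s)" for c s t :: real
        by (simp add: algebra_simps)
      then show ?thesis unfolding w .
    qed
    finally show ?thesis unfolding cs by simp
  qed
  have z: "zeta (conj_rot v a) = of_real m * exp (\<i> * of_real (a + \<delta>))"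
    using zr zi v by (simp add: zeta_def conj_rot_def s_def complex_eq_iff Re_exp Im_exp algebra_simps)
  then have "norm (zeta (conj_rot v a)) = m" using mpos by (simp add: norm_mult)
  then show "is_arg (conj_rot v a) (conj_rot_arg v a)" using z unfolding arg by simp
qed

lemma conj_rot_0: "conj_rot_arg v 0 = 0" "conj_rot v 0 = mat 1"
  by (simp_all add: conj_rot_arg_def conj_rot_def mat2_eq_iff)

lemma is_arg_cos:
  assumes "M \<in> Sp2" "is_arg M \<rho>" "is_arg M \<rho>'" shows "cos (\<rho> - \<rho>') = 1"
proof -
  have n: "norm (zeta M) \<noteq> 0" using zeta_ne_0[OF assms(1)] by simp
  have "of_real (norm (zeta M)) * exp (\<i> * of_real \<rho>) = of_real (norm (zeta M)) * exp (\<i> * of_real \<rho>')"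
    using assms(2,3) by metis
  then have "exp (\<i> * of_real \<rho>) = exp (\<i> * of_real \<rho>')" using n by simp
  then have "cos \<rho> = cos \<rho>'" "sin \<rho> = sin \<rho>'" by (simp_all add: complex_eq_iff Re_exp Im_exp)
  then show ?thesis using sin_cos_squared_add[of \<rho>'] by (simp add: cos_diff power2_eq_square)
qed

lemma cos_1_near:
  fixes x :: real assumes "cos x = 1" obtains j :: int where "x = 2 * pi * of_int j"
  using assms by (auto simp: cos_one_2pi_int mult.commute mult.left_commute)

text \<open>A multiple of 2 pi separating two points at distance below pi/2 would prevent their
  sines from having the same nonzero sign.\<close>

lemma floor_2pi_eq:
  assumes "\<bar>x - y\<bar> < pi / 2" "sgn (sin x) = sgn (sin y)" "sin y \<noteq> 0"
  shows "\<lfloor>x / (2 * pi)\<rfloor> = \<lfloor>y / (2 * pi)\<rfloor>"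
proof -
  define j where "j = \<lfloor>y / (2 * pi)\<rfloor>"
  define y' x' where "y' = y - 2 * pi * of_int j" and "x' = x - 2 * pi * of_int j"
  have sx: "sin x = sin x'" and sy: "sin y = sin y'" by (simp_all add: x'_def y'_def sin_diff sin_int_2pin cos_int_2pin)
  have "0 \<le> y'" "y' < 2 * pi"
    using floor_divide_bounds[of "2 * pi" y] by (simp_all add: y'_def j_def algebra_simps)
  moreover have "y' \<noteq> 0" using assms(3) sy by auto
  ultimately have y': "0 < y'" "y' < 2 * pi" by auto
  have d: "\<bar>x' - y'\<bar> < pi / 2" using assms(1) by (simp add: x'_def y'_def)
  have "0 < x'"
  proof (rule ccontr)
    assume c: "\<not> 0 < x'"
    then have "sin y' > 0" using y' d by (intro sin_gt_zero) auto
    moreover have "sin (- x') \<ge> 0" using c y' d by (intro sin_ge_zero) auto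
    ultimately show False using assms(2) unfolding sx sy by (auto simp: sgn_real_def split: if_splits)
  qed
  moreover have "x' < 2 * pi"
  proof (rule ccontr)
    assume c: "\<not> x' < 2 * pi"
    have "sin (2 * pi - y') > 0" using c y' d by (intro sin_gt_zero) auto
    then have "sin y' < 0" by (simp add: sin_diff)
    moreover have "sin (x' - 2 * pi) \<ge> 0" using c y' d by (intro sin_ge_zero) auto
    then have "sin x' \<ge> 0" by (simp add: sin_diff)
    ultimately show False using assms(2) unfolding sx sy by (auto simp: sgn_real_def split: if_splits)
  qed
  ultimately have "\<lfloor>x / (2 * pi)\<rfloor> = j" by (intro floor_unique) (auto simp: x'_def field_simps)
  then show ?thesis by (simp add: j_def)
qed

section \<open>The elliptic case\<close>

context brake_path
begin

text \<open>Equal diagonal entries and q r < 0 make \<Psi>(\<tau>) a rotation conjugated by diag(u,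
  1/u). Matching the final arguments fixes its angle as a real number and yields the homotopy; the
  odd lift of the conjugating matrix turns iteration into translation by that angle.\<close>

lemma elliptic:
  assumes tr: "\<bar>\<Psi> \<tau>$1$1 + \<Psi> \<tau>$2$2\<bar> < 2"
  obtains \<theta> where "\<theta> \<notin> \<rat>" "rotation_number \<Psi> \<tau> \<theta>"
    "\<exists>P\<in>Sp2. \<Psi> \<tau> = P ** rot (2 * pi * \<theta>) ** matrix_inv P"
    "\<And>k. k \<ge> 1 \<Longrightarrow> \<mu>1 k = of_int \<lfloor>real k * \<theta>\<rfloor> + 1 / 2 \<and> \<mu>CZ k = 2 * of_int \<lfloor>real k * \<theta>\<rfloor> + 1"
proof -
  define p q r where pqr: "p = \<Psi> \<tau>$1$1" "q = \<Psi> \<tau>$1$2" "r = \<Psi> \<tau>$2$1"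
  have p22: "\<Psi> \<tau>$2$2 = p" using \<Psi>_\<tau>_diagonal by (simp add: pqr)
  have det: "p * p - q * r = 1" using det_\<tau> by (simp add: pqr)
  have "\<bar>p\<bar> < 1" using tr p22 pqr by simp
  then have "p^2 < 1" by (simp add: abs_square_less_1)
  then have qr: "q * r < 0" using det by (simp add: power2_eq_square)
  then have qr0: "q \<noteq> 0" "r \<noteq> 0" "- q / r > 0" by (auto simp: mult_less_0_iff divide_less_0_iff)
  define v where "v = sqrt (- q / r)"
  have v: "v > 0" using qr0 by (simp add: v_def)
  have vv: "v * v = - q / r" unfolding v_def by (simp only: real_sqrt_mult_self abs_of_pos[OF qr0(3)])
  have qv: "q = - v * (r * v)"
  proof -
    have "- v * (r * v) = - r * (v * v)" by (simp add: algebra_simps)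
    then show ?thesis using qr0 unfolding vv by simp
  qed
  have "p * p + (r * v) * (r * v) = 1"
  proof -
    have "(r * v) * (r * v) = - (q * r)" using qv by (simp add: algebra_simps)
    then show ?thesis using det by simp
  qed
  then obtain a0 where a0: "p = cos a0" "r * v = sin a0"
    using sincos_total_2pi[of p "r * v"] by (metis power2_eq_square)
  have \<Psi>\<tau>0: "\<Psi> \<tau> = conj_rot v a0"
    using a0 qv v p22 by (simp add: mat2_eq_iff conj_rot_def pqr[symmetric] field_simps)
  have "cos (\<rho> \<tau> - conj_rot_arg v a0) = 1"
    using is_arg_cos[OF \<Psi>_Sp2 \<rho>(3)] conj_rot_arg(1)[OF v] \<Psi>\<tau>0 by metis
  then obtain j :: int where j: "\<rho> \<tau> - conj_rot_arg v a0 = 2 * pi * of_int j" by (rule cos_1_near)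
  \<comment> \<open>The matrix determines the angle only modulo 2 pi. This choice makes the argument
    along the model rotation end at \<open>\<rho> \<tau>\<close>, as a homotopy with fixed ends
    requires.\<close>
  define a where "a = a0 + 2 * pi * of_int j"
  have cr_a: "conj_rot v a = conj_rot v a0" "conj_rot_arg v a = conj_rot_arg v a0 + 2 * pi * of_int j"
    by (simp_all add: a_def conj_rot_def conj_rot_arg_def sin_add cos_add sin_int_2pin cos_int_2pin)
  have \<Psi>\<tau>: "\<Psi> \<tau> = conj_rot v a" using \<Psi>\<tau>0 cr_a by simp
  have \<rho>a: "conj_rot_arg v a = \<rho> \<tau>" using j cr_a by simp
  define u where "u = sqrt v"
  have u: "u > 0" "u * u = v" using v by (simp_all add: u_def)
  define P where "P = mat2 u 0 0 (1 / u)"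
  have P: "P \<in> Sp2" using u by (simp add: P_def Sp2_iff)
  have Prot: "P ** rot x ** matrix_inv P = conj_rot v x" for x
    unfolding P_def using conj_rot_eq[of u x] u by simp
  define \<theta> where "\<theta> = a / (2 * pi)"
  have a\<theta>: "a = 2 * pi * \<theta>" by (simp add: \<theta>_def)
  have \<Psi>k: "\<Psi> (real k * \<tau>) = conj_rot v (real k * a)" for k
  proof (induction k)
    case 0 then show ?case by (simp add: \<Psi>_0 conj_rot_def mat2_eq_iff)
  next
    case (Suc k)
    have "\<Psi> (real (Suc k) * \<tau>) = \<Psi> (real k * \<tau> + \<tau>)" by (simp add: algebra_simps)
    also have "\<dots> = conj_rot v (real k * a) ** conj_rot v a" by (simp only: \<Psi>_period Suc \<Psi>\<tau>)
    also have "\<dots> = conj_rot v (real k * a + a)" using v by (intro conj_rot_add) simp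
    finally show ?case by (simp add: algebra_simps)
  qed
  have cos_k: "cos (real k * a) \<noteq> 1" if "k \<ge> 1" for k
    using trace_ne_2[OF that] unfolding \<Psi>k by (auto simp: conj_rot_def)
  have sin_k: "sin (real k * a) \<noteq> 0" if k: "k \<ge> 1" for k
  proof
    assume "sin (real k * a) = 0"
    then have "cos (2 * (real k * a)) = 1" by (simp add: cos_double_sin)
    then have "cos (real (2 * k) * a) = 1" by (simp add: mult.assoc)
    then show False using cos_k[of "2 * k"] k by simp
  qed
  \<comment> \<open>A rational \<theta> would make the return map of some iterate the
    identity.\<close>
  have irr: "\<theta> \<notin> \<rat>"
  proof
    assume "\<theta> \<in> \<rat>"
    then obtain i :: int and k :: int where ik: "k > 0" "\<theta> = of_int i / of_int k"
      by (metis Rats_cases' )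
    then have "real (nat k) * a = of_int i * (2 * pi)" by (simp add: a\<theta> field_simps)
    then have "cos (real (nat k) * a) = 1" using cos_int_2pin[of i] by (simp only: mult.commute)
    moreover have "nat k \<ge> 1" using ik(1) by linarith
    ultimately show False using cos_k by blast
  qed
  have rn: "rotation_number \<Psi> \<tau> \<theta>" unfolding rotation_number_def
  proof (rule bexI[OF _ P])
    have eq: "(\<lambda>s. P ** rot (2 * pi * \<theta> * s) ** matrix_inv P) = (\<lambda>s. conj_rot v (a * s))"
      by (simp add: Prot a\<theta>)
    show "homotopic_paths Sp2 (\<lambda>s. \<Psi> (\<tau> * s)) (\<lambda>s. P ** rot (2 * pi * \<theta> * s) ** matrix_inv P)" unfolding eq
    proof (rule homotopic_paths_Sp2)
      show "continuous_on {0..1} (\<lambda>s. \<Psi> (\<tau> * s))" "continuous_on {0..1} (\<lambda>s. \<rho> (\<tau> * s))"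
        by (auto intro!: continuous_on_compose2[OF \<Psi>_cont] continuous_on_compose2[OF \<rho>(1)] continuous_intros)
      show "continuous_on {0..1} (\<lambda>s. conj_rot v (a * s))" unfolding conj_rot_def
        using v by (intro continuous_on_mat2 continuous_intros) auto
      show "continuous_on {0..1} (\<lambda>s. conj_rot_arg v (a * s))" unfolding conj_rot_arg_def
        using conj_rot_denominator[OF v] by (intro continuous_intros) (auto simp: less_imp_neq[symmetric])
      show "is_arg (conj_rot v (a * s)) (conj_rot_arg v (a * s))" for s by (rule conj_rot_arg(1)[OF v])
      show "is_arg (\<Psi> (\<tau> * s)) (\<rho> (\<tau> * s))" for s by (rule \<rho>(3))
    qed (use v in \<open>auto simp: \<Psi>_Sp2 \<Psi>_0 \<rho>(2) \<rho>a \<Psi>\<tau> conj_rot_Sp2 conj_rot_0\<close>)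
  qed
  have zP: "is_arg P 0"
  proof -
    have "zeta P = of_real (u + 1 / u)" by (simp add: zeta_def P_def complex_eq_iff)
    moreover have "u + 1 / u > 0" using u by (simp add: add_pos_pos)
    ultimately show ?thesis by (simp add: norm_of_real del: of_real_add)
  qed
  \<comment> \<open>P is diagonal with positive real \<open>zeta\<close>, so 0 is an argument and
    the lift commutes with the reflection: g is odd and fixes 0.\<close>
  define g where "g = lift P 0"
  have g_less: "g x < g y \<longleftrightarrow> x < y" and g_le: "g x \<le> g y \<longleftrightarrow> x \<le> y" for x y
    unfolding g_def by (rule lift_less_iff[OF P zP], rule lift_le_iff[OF P zP])
  have g_multiple: "g (x + of_int i * pi) = g x + of_int i * pi" for x i unfolding g_def by (rule lift_plus_multiple)
  have g_neg: "g (- x) = - g x" for x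
  proof -
    have "lift_arg P (- x) = - lift_arg P x"
    proof -
      have dn: "dir (- x) = vector [sin x, cos x]" by (simp add: vec2_eq_iff dir_nth)
      have "P *v dir x = vector [- (u * sin x), cos x / u]" "P *v vector [sin x, cos x] = vector [u * sin x, cos x / u]"
        by (simp_all add: vec2_eq_iff mat2_mult_vec P_def dir_nth)
      moreover have "P$2$1 - P$1$2 = 0" by (simp add: P_def)
      ultimately show ?thesis unfolding lift_arg_def dn arctan_minus[symmetric]
        by (simp add: inner_real2 J2_def) (simp only: minus_divide_left minus_mult_right minus_diff_eq)
    qed
    then show ?thesis by (simp add: g_def lift_def)
  qed
  have g0: "g 0 = 0" using g_neg[of 0] by simp
  have gb: "\<bar>g x - x\<bar> < pi / 2" for x using lift_bounds[of P 0 x] by (simp add: g_def)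
  have fg: "f \<tau> (g x) = g (x + a)" for x
  proof -
    obtain s where s: "s > 0" "P *v dir x = s *\<^sub>R dir (g x)" unfolding g_def using lift_dir[OF P zP] by blast
    obtain s' where s': "s' > 0" "P *v dir (x + a) = s' *\<^sub>R dir (g (x + a))" unfolding g_def using lift_dir[OF P zP] by blast
    obtain c where c: "c > 0" "\<Psi> \<tau> *v dir (g x) = c *\<^sub>R dir (f \<tau> (g x))" by (rule f_dir)
    have "\<Psi> \<tau> *v (P *v dir x) = P *v dir (x + a)"
      unfolding vec2_eq_iff mat2_mult_vec \<Psi>\<tau> conj_rot_def mat2_nth P_def dir_nth u(2)[symmetric] using u(1)
      by (simp add: sin_add cos_add field_simps)
    then have "(s * c) *\<^sub>R dir (f \<tau> (g x)) = s' *\<^sub>R dir (g (x + a))"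
      unfolding s s' by (simp add: matrix_vector_mult_scaleR c)
    then have "cos (f \<tau> (g x) - g (x + a)) = 1" using s s' c by (intro dir_eq_imp_cos[of "s * c" _ s']) auto
    \<comment> \<open>Four deviations below pi/2 each: of f from the translation by \<rho>, of g
      from the identity at x and at x + a, and of \<rho> from a.\<close>
    moreover have "\<bar>f \<tau> (g x) - g (x + a)\<bar> < 2 * pi"
      using f_bounds[of \<tau> "g x"] gb[of x] gb[of "x + a"] conj_rot_arg(2)[OF v, of a] unfolding \<rho>a by linarith
    ultimately show ?thesis using cos_eq_1_imp_0 by fastforce
  qed
  have fgk: "f (real k * \<tau>) (g x) = g (x + real k * a)" for k x
  proof (induction k arbitrary: x)
    case 0 then show ?case by (simp add: f_0)
  next
    case (Suc k)
    have "f (real (Suc k) * \<tau>) (g x) = f (real k * \<tau> + \<tau>) (g x)" by (simp add: algebra_simps)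
    also have "\<dots> = g (x + a + real k * a)" by (simp only: f_period fg Suc)
    finally show ?case by (simp add: algebra_simps)
  qed
  define H where "H x = f (\<tau> / 2) (g x)" for x
  have H_le: "H x \<le> H y \<longleftrightarrow> x \<le> y" and H_less: "H x < H y \<longleftrightarrow> x < y" for x y
    by (simp_all add: H_def f_le f_less g_le g_less)
  \<comment> \<open>The half-period relation makes H antisymmetric about -a/2. Its zero there
    anchors the odd iterates: for k = 2 m + 1 the distance from -a/2 to m a is k a/2.\<close>
  have "H x = - H (- x - a)" for x
  proof -
    have "H x = - f (\<tau> / 2) (- g (x + a))" unfolding H_def using f_half[of "g x"] by (simp add: fg)
    then show ?thesis unfolding g_neg[symmetric] by (simp add: H_def)
  qed
  from this[of "- a / 2"] have H0: "H (- a / 2) = 0" by (simp add: field_simps)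
  have Hm: "H (- a / 2 + of_int i * pi) = of_int i * pi" for i
    using H0 unfolding H_def g_multiple f_multiple by simp
  have k\<theta>: "real k * \<theta> = (real k * a / 2) / pi" for k by (simp add: \<theta>_def field_simps)
  have m1: "\<mu>1 k = of_int \<lfloor>real k * \<theta>\<rfloor> + 1 / 2" if k: "k \<ge> 1" for k
  proof -
    define i where "i = \<lfloor>real k * \<theta>\<rfloor>"
    have ib: "of_int i * pi \<le> real k * a / 2" "real k * a / 2 < (of_int i + 1) * pi"
      using floor_divide_bounds[of pi "real k * a / 2"] by (simp_all add: i_def k\<theta>)
    have "\<lfloor>f (real k * \<tau> / 2) 0 / pi\<rfloor> = i"
    proof (cases "even k")
      case True
      then obtain m where m: "k = 2 * m" by blast
      have F: "f (real k * \<tau> / 2) 0 = g (real m * a)" using fgk[of m 0] g0 by (simp add: m)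
      have "g (0 + of_int i * pi) \<le> g (real m * a)" "g (real m * a) < g (0 + of_int (i + 1) * pi)"
        unfolding g_le g_less using ib by (simp_all add: m)
      then show ?thesis unfolding F g_multiple g0 by (intro floor_div_pi) auto
    next
      case False
      then obtain m where m: "k = 2 * m + 1" by (metis oddE)
      have "real k * \<tau> / 2 = \<tau> / 2 + real m * \<tau>" by (simp add: m field_simps)
      then have F: "f (real k * \<tau> / 2) 0 = H (real m * a)" using fgk[of m 0] g0 by (simp only: f_iterate H_def) simp
      have "H (- a / 2 + of_int i * pi) \<le> H (real m * a)" "H (real m * a) < H (- a / 2 + of_int (i + 1) * pi)"
        unfolding H_le H_less using ib by (simp_all add: m field_simps)
      then show ?thesis unfolding F Hm by (intro floor_div_pi) auto
    qed
    then show ?thesis unfolding \<mu>1_def mu_1_eq[OF k] i_def by simp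
  qed
  have mCZ: "\<mu>CZ k = 2 * of_int \<lfloor>real k * \<theta>\<rfloor> + 1" if k: "k \<ge> 1" for k
  proof -
    let ?x = "\<rho> (real k * \<tau>)" and ?y = "real k * a"
    have "cos (?x - conj_rot_arg v ?y) = 1"
      using is_arg_cos[OF \<Psi>_Sp2 \<rho>(3)] conj_rot_arg(1)[OF v] \<Psi>k by metis
    \<comment> \<open>The crude bound pi, read off from the lift at 0, is enough to select the
      branch of the argument; \<open>conj_rot_arg\<close> then improves it to pi/2.\<close>
    moreover have near: "\<bar>?x - ?y\<bar> < pi"
    proof -
      have "f (real k * \<tau>) 0 = g ?y" using fgk[of k 0] g0 by simp
      then show ?thesis using f_bounds[of "real k * \<tau>" 0] gb[of ?y] by linarith
    qed
    then have "\<bar>?x - conj_rot_arg v ?y\<bar> < 2 * pi" using conj_rot_arg(2)[OF v, of ?y] by linarith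
    ultimately have x: "?x = conj_rot_arg v ?y" using cos_eq_1_imp_0 by fastforce
    have d: "\<bar>?x - ?y\<bar> < pi / 2" using conj_rot_arg(2)[OF v, of ?y] x by simp
    have "zeta (conj_rot v ?y) = of_real (norm (zeta (conj_rot v ?y))) * exp (\<i> * of_real ?x)"
      using conj_rot_arg(1)[OF v] x by simp
    from arg_cong[OF this, of Im] have "(v + 1 / v) * sin ?y = norm (zeta (conj_rot v ?y)) * sin ?x"
      by (simp add: zeta_def conj_rot_def Im_exp algebra_simps)
    then have "sgn ((v + 1 / v) * sin ?y) = sgn (norm (zeta (conj_rot v ?y)) * sin ?x)" by simp
    moreover have "norm (zeta (conj_rot v ?y)) > 0" using zeta_ne_0[OF conj_rot_Sp2] v by simp
    moreover have "v + 1 / v > 0" using v by (simp add: add_pos_pos)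
    ultimately have "sgn (sin ?x) = sgn (sin ?y)" by (simp add: sgn_mult)
    from floor_2pi_eq[OF d this sin_k[OF k]]
    have fl: "\<lfloor>?x / (2 * pi)\<rfloor> = \<lfloor>real k * \<theta>\<rfloor>" by (simp add: \<theta>_def)
    have "\<Psi> (real k * \<tau>)$1$1 + \<Psi> (real k * \<tau>)$2$2 < 2"
      using cos_k[OF k] cos_le_one[of ?y] unfolding \<Psi>k by (simp add: conj_rot_def less_le)
    then show ?thesis unfolding \<mu>CZ_def mu_CZ_eq[OF k] cz_value_def by (simp add: fl)
  qed
  show thesis
  proof (rule that[OF irr rn])
    show "\<exists>P\<in>Sp2. \<Psi> \<tau> = P ** rot (2 * pi * \<theta>) ** matrix_inv P"
      by (rule bexI[OF _ P]) (simp add: Prot \<Psi>\<tau> a\<theta>)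
  qed (use m1 mCZ in auto)
qed

text \<open>The square of a matrix of determinant 1 has trace tr^2 - 2, so nondegeneracy of the
  second iterate excludes both 2 and -2.\<close>

lemma trace_cases: "\<bar>\<Psi> \<tau>$1$1 + \<Psi> \<tau>$2$2\<bar> \<noteq> 2"
proof -
  have "\<Psi> (real 2 * \<tau>) = \<Psi> (\<tau> + \<tau>)" by simp
  also have "\<dots> = \<Psi> \<tau> ** \<Psi> \<tau>" by (rule \<Psi>_period)
  finally have "\<Psi> (real 2 * \<tau>)$1$1 + \<Psi> (real 2 * \<tau>)$2$2 = (\<Psi> \<tau>$1$1 + \<Psi> \<tau>$2$2)^2 - 2 * (\<Psi> \<tau>$1$1 * \<Psi> \<tau>$2$2 - \<Psi> \<tau>$1$2 * \<Psi> \<tau>$2$1)"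
    by (simp only: matrix_matrix_mult_def) (simp add: sum_2 power2_eq_square algebra_simps)
  then have "(\<Psi> \<tau>$1$1 + \<Psi> \<tau>$2$2)^2 - 2 \<noteq> 2" using trace_ne_2[of 2] \<Psi>_Sp2[of \<tau>] by (simp add: Sp2_iff)
  moreover have "\<bar>x\<bar> = 2 \<Longrightarrow> x^2 = 4" for x :: real by (metis power2_abs four_x_squared mult_1 power2_eq_square numeral_times_numeral semiring_norm(12) semiring_norm(13))
  ultimately show ?thesis by fastforce
qed

theorem brake_path_indices:
  shows "(\<exists>!i::nat. i < 5 \<and>
            [elliptic (\<Psi> \<tau>),
             negative_hyperbolic (\<Psi> \<tau>) \<and> type_one \<Psi> \<tau>,
             negative_hyperbolic (\<Psi> \<tau>) \<and> type_two \<Psi> \<tau>,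
             positive_hyperbolic (\<Psi> \<tau>) \<and> type_one \<Psi> \<tau>,
             positive_hyperbolic (\<Psi> \<tau>) \<and> type_two \<Psi> \<tau>] ! i) \<and>
    (elliptic (\<Psi> \<tau>) \<longrightarrow>
       (\<exists>\<theta>. \<theta> \<notin> \<rat> \<and> rotation_number \<Psi> \<tau> \<theta> \<and>
          (\<exists>P\<in>Sp2. \<Psi> \<tau> = P ** rot (2 * pi * \<theta>) ** matrix_inv P) \<and>
          (\<forall>k\<ge>1. \<mu>1 k = of_int \<lfloor>real k * \<theta>\<rfloor> + 1 / 2 \<and>
                  \<mu>CZ k = 2 * of_int \<lfloor>real k * \<theta>\<rfloor> + 1))) \<and>
    (negative_hyperbolic (\<Psi> \<tau>) \<and> type_one \<Psi> \<tau> \<longrightarrow>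
       \<mu>1 2 - \<mu>2 2 = 1 \<and> \<mu>CZ 1 = 2 * \<mu>1 1 \<and>
       (\<forall>k\<ge>1. \<mu>1 k = (if odd k then real k * \<mu>1 1 else real k * \<mu>1 1 + 1 / 2) \<and>
               \<mu>CZ k = real k * \<mu>CZ 1 \<and> \<mu>CZ k = 2 * real k * \<mu>1 1)) \<and>
    (negative_hyperbolic (\<Psi> \<tau>) \<and> type_two \<Psi> \<tau> \<longrightarrow>
       \<mu>1 2 - \<mu>2 2 = -1 \<and> \<mu>CZ 1 = 2 * \<mu>1 1 \<and>
       (\<forall>k\<ge>1. \<mu>1 k = (if odd k then real k * \<mu>1 1 else real k * \<mu>1 1 - 1 / 2) \<and>
               \<mu>CZ k = real k * \<mu>CZ 1 \<and> \<mu>CZ k = 2 * real k * \<mu>1 1)) \<and>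
    (positive_hyperbolic (\<Psi> \<tau>) \<and> type_one \<Psi> \<tau> \<longrightarrow>
       \<mu>1 2 - \<mu>2 2 = 1 \<and> \<mu>CZ 1 = 2 * \<mu>1 1 - 1 \<and>
       (\<forall>k\<ge>1. \<mu>1 k = real k * \<mu>1 1 + (1 - real k) / 2 \<and>
               \<mu>CZ k = real k * \<mu>CZ 1 \<and> \<mu>CZ k = 2 * real k * \<mu>1 1 - real k)) \<and>
    (positive_hyperbolic (\<Psi> \<tau>) \<and> type_two \<Psi> \<tau> \<longrightarrow>
       \<mu>1 2 - \<mu>2 2 = -1 \<and> \<mu>CZ 1 = 2 * \<mu>1 1 + 1 \<and>
       (\<forall>k\<ge>1. \<mu>1 k = real k * \<mu>1 1 + (real k - 1) / 2 \<and>
               \<mu>CZ k = real k * \<mu>CZ 1 \<and> \<mu>CZ k = 2 * real k * \<mu>1 1 + real k))"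
proof -
  let ?t = "\<Psi> \<tau>$1$1 + \<Psi> \<tau>$2$2"
  have types: "type_one \<Psi> \<tau> \<longleftrightarrow> \<mu>1 2 - \<mu>2 2 > 0" "type_two \<Psi> \<tau> \<longleftrightarrow> \<mu>1 2 - \<mu>2 2 < 0"
    by (simp_all add: type_one_def type_two_def \<mu>1_def \<mu>2_def)
  have less5: "i < 5 \<longleftrightarrow> i = 0 \<or> i = 1 \<or> i = 2 \<or> i = 3 \<or> i = (4::nat)" for i by auto
  consider "\<bar>?t\<bar> < 2" | "?t > 2" | "?t < -2" using trace_cases by fastforce
  then show ?thesis
  proof cases
    case 1
    note e = eigenvalue_types(1)[OF \<Psi>_Sp2 1]
    obtain \<theta> where "\<theta> \<notin> \<rat>" "rotation_number \<Psi> \<tau> \<theta>"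
      "\<exists>P\<in>Sp2. \<Psi> \<tau> = P ** rot (2 * pi * \<theta>) ** matrix_inv P"
      "\<And>k. k \<ge> 1 \<Longrightarrow> \<mu>1 k = of_int \<lfloor>real k * \<theta>\<rfloor> + 1 / 2 \<and> \<mu>CZ k = 2 * of_int \<lfloor>real k * \<theta>\<rfloor> + 1"
      proof (rule elliptic[OF 1], goal_cases)
      case (1 \<theta>) show ?case by (rule that) (fact 1)+
    qed
    then have "\<exists>\<theta>. \<theta> \<notin> \<rat> \<and> rotation_number \<Psi> \<tau> \<theta> \<and>
          (\<exists>P\<in>Sp2. \<Psi> \<tau> = P ** rot (2 * pi * \<theta>) ** matrix_inv P) \<and>
          (\<forall>k\<ge>1. \<mu>1 k = of_int \<lfloor>real k * \<theta>\<rfloor> + 1 / 2 \<and> \<mu>CZ k = 2 * of_int \<lfloor>real k * \<theta>\<rfloor> + 1)" by blast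
    moreover have "\<exists>!i::nat. i < 5 \<and> [elliptic (\<Psi> \<tau>),
             negative_hyperbolic (\<Psi> \<tau>) \<and> type_one \<Psi> \<tau>, negative_hyperbolic (\<Psi> \<tau>) \<and> type_two \<Psi> \<tau>,
             positive_hyperbolic (\<Psi> \<tau>) \<and> type_one \<Psi> \<tau>, positive_hyperbolic (\<Psi> \<tau>) \<and> type_two \<Psi> \<tau>] ! i"
      using e by (intro ex1I[of _ 0]) (auto simp: less5)
    ultimately show ?thesis using e by simp
  next
    case 2
    then have t: "\<bar>?t\<bar> > 2" by simp
    note e = eigenvalue_types(2)[OF \<Psi>_Sp2 2]
    obtain n \<epsilon> where h: "\<epsilon> = 1 \<or> \<epsilon> = -1" "even n \<longleftrightarrow> ?t > 2" "\<And>k. k \<ge> 1 \<Longrightarrow> \<mu>CZ k = real k * of_int n"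
      "\<And>k. k \<ge> 1 \<Longrightarrow> \<mu>1 k = (if odd (int k * n) then real k * of_int n / 2 else real k * of_int n / 2 + \<epsilon> / 2)"
      "\<mu>1 2 - \<mu>2 2 = \<epsilon>"
      proof (rule hyperbolic[OF t], goal_cases)
      case (1 n \<epsilon>) show ?case by (rule that) (fact 1)+
    qed
    have n: "even n" using h(2) 2 by simp
    have m1: "\<mu>1 k = real k * of_int n / 2 + \<epsilon> / 2" if "k \<ge> 1" for k using h(4)[OF that] n by simp
    have m11: "\<mu>1 1 = of_int n / 2 + \<epsilon> / 2" using m1[of 1] by simp
    have cz1: "\<mu>CZ 1 = of_int n" using h(3)[of 1] by simp
    have "\<exists>!i::nat. i < 5 \<and> [elliptic (\<Psi> \<tau>),
             negative_hyperbolic (\<Psi> \<tau>) \<and> type_one \<Psi> \<tau>, negative_hyperbolic (\<Psi> \<tau>) \<and> type_two \<Psi> \<tau>,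
             positive_hyperbolic (\<Psi> \<tau>) \<and> type_one \<Psi> \<tau>, positive_hyperbolic (\<Psi> \<tau>) \<and> type_two \<Psi> \<tau>] ! i"
      using e h(1,5) unfolding types by (intro ex1I[of _ "if \<epsilon> = 1 then 3 else 4"]) (auto simp: less5)
    then show ?thesis using e h(1) unfolding types h(5) m11 cz1
      by (auto simp: m1 h(3) field_simps)
  next
    case 3
    then have t: "\<bar>?t\<bar> > 2" by simp
    note e = eigenvalue_types(3)[OF \<Psi>_Sp2 3]
    obtain n \<epsilon> where h: "\<epsilon> = 1 \<or> \<epsilon> = -1" "even n \<longleftrightarrow> ?t > 2" "\<And>k. k \<ge> 1 \<Longrightarrow> \<mu>CZ k = real k * of_int n"
      "\<And>k. k \<ge> 1 \<Longrightarrow> \<mu>1 k = (if odd (int k * n) then real k * of_int n / 2 else real k * of_int n / 2 + \<epsilon> / 2)"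
      "\<mu>1 2 - \<mu>2 2 = \<epsilon>"
      proof (rule hyperbolic[OF t], goal_cases)
      case (1 n \<epsilon>) show ?case by (rule that) (fact 1)+
    qed
    have n: "odd n" using h(2) 3 by simp
    have m1: "\<mu>1 k = (if odd k then real k * of_int n / 2 else real k * of_int n / 2 + \<epsilon> / 2)" if "k \<ge> 1" for k
      using h(4)[OF that] n by simp
    have m11: "\<mu>1 1 = of_int n / 2" using m1[of 1] by simp
    have cz1: "\<mu>CZ 1 = of_int n" using h(3)[of 1] by simp
    have "\<exists>!i::nat. i < 5 \<and> [elliptic (\<Psi> \<tau>),
             negative_hyperbolic (\<Psi> \<tau>) \<and> type_one \<Psi> \<tau>, negative_hyperbolic (\<Psi> \<tau>) \<and> type_two \<Psi> \<tau>,
             positive_hyperbolic (\<Psi> \<tau>) \<and> type_one \<Psi> \<tau>, positive_hyperbolic (\<Psi> \<tau>) \<and> type_two \<Psi> \<tau>] ! i"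
      using e h(1,5) unfolding types by (intro ex1I[of _ "if \<epsilon> = 1 then 1 else 2"]) (auto simp: less5)
    then show ?thesis using e h(1) unfolding types h(5) m11 cz1
      by (auto simp: m1 h(3) field_simps)
  qed
qed

end

section \<open>Second derivatives and pullbacks of 1-forms\<close>

abbreviation fderiv :: "('a::real_normed_vector \<Rightarrow> 'b::real_normed_vector) \<Rightarrow> 'a \<Rightarrow> 'a \<Rightarrow> 'b" where
  "fderiv f x \<equiv> frechet_derivative f (at x)"

lemma fderiv_eq: "(f has_derivative f') (at x) \<Longrightarrow> fderiv f x = f'"
  by (rule frechet_derivative_at[symmetric])

lemma fderiv_works: "f differentiable (at x) \<Longrightarrow> (f has_derivative fderiv f x) (at x)"
  by (simp add: frechet_derivative_works)

lemma fderiv_linear: "f differentiable (at x) \<Longrightarrow> linear (fderiv f x)"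
  by (rule linear_frechet_derivative)

lemma has_fderiv_along:
  fixes f :: "'a::real_normed_vector \<Rightarrow> real"
  assumes "f differentiable (at (z + s *\<^sub>R w))"
  shows "((\<lambda>s. f (z + s *\<^sub>R w)) has_real_derivative fderiv f (z + s *\<^sub>R w) w) (at s)"
proof -
  have "((\<lambda>s. z + s *\<^sub>R w) has_derivative (\<lambda>r. r *\<^sub>R w)) (at s)"
    by (auto intro!: derivative_eq_intros)
  from has_derivative_compose[OF this fderiv_works[OF assms]]
  show ?thesis
    by (simp add: has_field_derivative_def linear_cmul[OF fderiv_linear[OF assms]] mult.commute[of _ "fderiv f _ w"])
qed

text \<open>The mean value theorem along u, applied to the increment in direction v, and then along
  v. The left side is symmetric in u and v.\<close>

lemma second_difference:
  fixes g :: "'a::real_normed_vector \<Rightarrow> real"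
  assumes h: "h > 0"
    and box: "\<And>s t. 0 \<le> s \<Longrightarrow> s \<le> h \<Longrightarrow> 0 \<le> t \<Longrightarrow> t \<le> h \<Longrightarrow> x + s *\<^sub>R u + t *\<^sub>R v \<in> U"
    and d1: "\<And>y. y \<in> U \<Longrightarrow> g differentiable (at y)"
    and d2: "\<And>y. y \<in> U \<Longrightarrow> (\<lambda>y. fderiv g y u) differentiable (at y)"
  obtains s t where "0 < s" "s < h" "0 < t" "t < h"
    "g (x + h *\<^sub>R u + h *\<^sub>R v) - g (x + h *\<^sub>R u) - g (x + h *\<^sub>R v) + g x
       = h * h * fderiv (\<lambda>y. fderiv g y u) (x + s *\<^sub>R u + t *\<^sub>R v) v"
proof -
  have sw: "x + t *\<^sub>R v + s *\<^sub>R u = x + s *\<^sub>R u + t *\<^sub>R v" for s t by (simp add: algebra_simps)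
  define F where "F s = g (x + h *\<^sub>R v + s *\<^sub>R u) - g (x + s *\<^sub>R u)" for s
  define F' where "F' s = fderiv g (x + h *\<^sub>R v + s *\<^sub>R u) u - fderiv g (x + s *\<^sub>R u) u" for s
  have "(F has_real_derivative F' s) (at s)" if "0 \<le> s" "s \<le> h" for s
    unfolding F_def F'_def using box[OF that, of h] box[OF that, of 0] h
    by (intro DERIV_diff has_fderiv_along d1) (simp_all add: sw)
  then obtain s where s: "0 < s" "s < h" "F h - F 0 = (h - 0) * F' s" using MVT2[of 0 h F F'] h by blast
  define G where "G t = fderiv g (x + s *\<^sub>R u + t *\<^sub>R v) u" for t
  define G' where "G' t = fderiv (\<lambda>y. fderiv g y u) (x + s *\<^sub>R u + t *\<^sub>R v) v" for t
  have "(G has_real_derivative G' t) (at t)" if "0 \<le> t" "t \<le> h" for t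
    unfolding G_def G'_def using s by (intro has_fderiv_along[of "\<lambda>y. fderiv g y u"] d2 box that) auto
  then obtain t where t: "0 < t" "t < h" "G h - G 0 = (h - 0) * G' t" using MVT2[of 0 h G G'] h by blast
  have "F' s = G h - G 0" by (simp add: F'_def G_def sw)
  then have "F h - F 0 = h * h * G' t" using s t by simp
  moreover have "F h - F 0 = g (x + h *\<^sub>R u + h *\<^sub>R v) - g (x + h *\<^sub>R u) - g (x + h *\<^sub>R v) + g x"
    by (simp add: F_def sw)
  ultimately show thesis using that[of s t] s t by (simp add: G'_def)
qed

lemma Ck_on_2D:
  assumes "Ck_on 2 U f"
  shows "x \<in> U \<Longrightarrow> f differentiable (at x)"
    and "x \<in> U \<Longrightarrow> (\<lambda>y. fderiv f y v) differentiable (at x)"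
    and "continuous_on U (\<lambda>x. fderiv (\<lambda>y. fderiv f y v) x w)"
  using assms by (simp_all add: numeral_2_eq_2)

text \<open>Both mixed derivatives arise from one second difference over a small parallelogram, at
  different intermediate points; continuity at x identifies them.\<close>

theorem fderiv_symmetric:
  fixes f :: "'a::real_normed_vector \<Rightarrow> 'b::euclidean_space"
  assumes f: "Ck_on 2 U f" and U: "open U" "x \<in> U"
  shows "fderiv (\<lambda>y. fderiv f y u) x v = fderiv (\<lambda>y. fderiv f y v) x u"
proof (rule euclidean_eqI)
  fix b :: 'b assume "b \<in> Basis"
  define g where "g y = f y \<bullet> b" for y
  define P where "P u v y = fderiv (\<lambda>y. fderiv f y u) y v \<bullet> b" for u v y
  have g1: "(g has_derivative (\<lambda>w. fderiv f y w \<bullet> b)) (at y)" if "y \<in> U" for y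
    unfolding g_def by (rule has_derivative_inner_left[OF fderiv_works[OF Ck_on_2D(1)[OF f that]]])
  have g2: "((\<lambda>y. fderiv g y w) has_derivative (\<lambda>z. P w z y)) (at y)" if "y \<in> U" for y w
  proof (rule has_derivative_transform_within_open[OF _ U(1) that])
    show "((\<lambda>y. fderiv f y w \<bullet> b) has_derivative (\<lambda>z. P w z y)) (at y)"
      unfolding P_def by (rule has_derivative_inner_left[OF fderiv_works[OF Ck_on_2D(2)[OF f that]]])
  qed (simp add: fderiv_eq[OF g1])
  have Pc: "isCont (P w z) x" for w z
    unfolding P_def by (intro continuous_inner continuous_const continuous_on_interior[OF Ck_on_2D(3)[OF f]])
      (simp add: interior_open[OF U(1)] U(2))
  have "\<bar>P u v x - P v u x\<bar> < e" if "e > 0" for e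
  proof -
    obtain d1 where d1: "d1 > 0" "\<And>y. dist y x < d1 \<Longrightarrow> \<bar>P u v y - P u v x\<bar> < e / 2"
      using Pc[of u v] \<open>e > 0\<close> unfolding continuous_at dist_real_def by (metis half_gt_zero continuous_at_eps_delta Pc dist_real_def)
    obtain d2 where d2: "d2 > 0" "\<And>y. dist y x < d2 \<Longrightarrow> \<bar>P v u y - P v u x\<bar> < e / 2"
      using Pc[of v u] \<open>e > 0\<close> unfolding continuous_at dist_real_def by (metis half_gt_zero continuous_at_eps_delta Pc dist_real_def)
    obtain d3 where d3: "d3 > 0" "\<And>y. dist y x < d3 \<Longrightarrow> y \<in> U" using U unfolding open_dist by blast
    define d where "d = min d1 (min d2 d3)"
    define h where "h = d / (norm u + norm v + 1)"
    have n: "norm u + norm v + 1 > 0" by (simp add: add_nonneg_pos)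
    have d: "d > 0" using d1 d2 d3 by (simp add: d_def)
    have h: "h > 0" using n d by (simp add: h_def)
    have near: "dist (x + s *\<^sub>R u + t *\<^sub>R v) x < d" if "0 \<le> s" "s \<le> h" "0 \<le> t" "t \<le> h" for s t
    proof -
      have "dist (x + s *\<^sub>R u + t *\<^sub>R v) x \<le> s * norm u + t * norm v"
        using norm_triangle_ineq[of "s *\<^sub>R u" "t *\<^sub>R v"] that by (simp add: dist_norm)
      also have "\<dots> \<le> h * norm u + h * norm v" using that by (intro add_mono mult_right_mono) auto
      also have "\<dots> < h * (norm u + norm v + 1)" using h by (simp add: algebra_simps)
      also have "\<dots> = d" using n by (simp add: h_def)
      finally show ?thesis .
    qed
    have sw: "x + t *\<^sub>R v + s *\<^sub>R u = x + s *\<^sub>R u + t *\<^sub>R v" for s t by (simp add: algebra_simps)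
    have inU: "x + s *\<^sub>R u + t *\<^sub>R v \<in> U" if "0 \<le> s" "s \<le> h" "0 \<le> t" "t \<le> h" for s t
      using near[OF that] by (intro d3) (simp add: d_def)
    have df: "g differentiable (at y)" "(\<lambda>y. fderiv g y w) differentiable (at y)" if "y \<in> U" for y w
      using g1[OF that] g2[OF that] unfolding differentiable_def by blast+
    obtain s t where st: "0 < s" "s < h" "0 < t" "t < h"
      "g (x + h *\<^sub>R u + h *\<^sub>R v) - g (x + h *\<^sub>R u) - g (x + h *\<^sub>R v) + g x
        = h * h * fderiv (\<lambda>y. fderiv g y u) (x + s *\<^sub>R u + t *\<^sub>R v) v"
      by (rule second_difference[OF h inU df])
    have inU': "x + t *\<^sub>R v + s *\<^sub>R u \<in> U" if "0 \<le> t" "t \<le> h" "0 \<le> s" "s \<le> h" for s t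
      unfolding sw using that by (intro inU)
    obtain t' s' where st': "0 < t'" "t' < h" "0 < s'" "s' < h"
      "g (x + h *\<^sub>R v + h *\<^sub>R u) - g (x + h *\<^sub>R v) - g (x + h *\<^sub>R u) + g x
        = h * h * fderiv (\<lambda>y. fderiv g y v) (x + t' *\<^sub>R v + s' *\<^sub>R u) u"
      by (rule second_difference[OF h inU' df])
    have "h * h * P u v (x + s *\<^sub>R u + t *\<^sub>R v) = h * h * P v u (x + s' *\<^sub>R u + t' *\<^sub>R v)"
    proof -
      have "g (x + h *\<^sub>R u + h *\<^sub>R v) - g (x + h *\<^sub>R u) - g (x + h *\<^sub>R v) + g x = h * h * P u v (x + s *\<^sub>R u + t *\<^sub>R v)"
        using st by (simp add: fderiv_eq[OF g2] inU)
      moreover have "g (x + h *\<^sub>R u + h *\<^sub>R v) - g (x + h *\<^sub>R v) - g (x + h *\<^sub>R u) + g x = h * h * P v u (x + s' *\<^sub>R u + t' *\<^sub>R v)"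
        using st' by (simp add: sw fderiv_eq[OF g2] inU)
      ultimately show ?thesis by linarith
    qed
    then have "P u v (x + s *\<^sub>R u + t *\<^sub>R v) = P v u (x + s' *\<^sub>R u + t' *\<^sub>R v)" using h by simp
    moreover have "\<bar>P u v (x + s *\<^sub>R u + t *\<^sub>R v) - P u v x\<bar> < e / 2"
      using near[of s t] st by (intro d1) (simp add: d_def)
    moreover have "\<bar>P v u (x + s' *\<^sub>R u + t' *\<^sub>R v) - P v u x\<bar> < e / 2"
      using near[of s' t'] st' by (intro d2) (simp add: d_def)
    ultimately show ?thesis by linarith
  qed
  then have "P u v x = P v u x" by (metis abs_le_zero_iff eq_iff_diff_eq_0 less_irrefl not_le)
  then show "fderiv (\<lambda>y. fderiv f y u) x v \<bullet> b = fderiv (\<lambda>y. fderiv f y v) x u \<bullet> b" by (simp add: P_def)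
qed

text \<open>A 1-form is given by its values \<open>a w\<close> on constant fields; these commute, so
  the exterior derivative has no bracket term.\<close>

definition dform :: "('a::real_normed_vector \<Rightarrow> 'a \<Rightarrow> real) \<Rightarrow> 'a \<Rightarrow> 'a \<Rightarrow> 'a \<Rightarrow> real" where
  "dform a x u v = fderiv (a v) x u - fderiv (a u) x v"

text \<open>The product rule leaves one term with the second derivative of F and one with the
  derivative of a. The first is symmetric and cancels in the antisymmetrization. Expanding in a
  basis exhibits the coefficient as a finite sum of products to which the rule applies.\<close>

theorem dform_pullback:
  fixes F :: "'a::real_normed_vector \<Rightarrow> 'b::euclidean_space" and a :: "'b \<Rightarrow> 'b \<Rightarrow> real"
  assumes F: "Ck_on 2 U F" and U: "open U" "x \<in> U" and V: "open V" "F ` U \<subseteq> V"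
    and lin: "\<And>y. y \<in> V \<Longrightarrow> linear (\<lambda>w. a w y)"
    and a: "\<And>w y. y \<in> V \<Longrightarrow> a w differentiable (at y)"
  shows "(\<lambda>y. a (fderiv F y w) (F y)) differentiable (at x)"
    and "dform (\<lambda>w y. a (fderiv F y w) (F y)) x u v = dform a (F x) (fderiv F x u) (fderiv F x v)"
proof -
  note F1 = Ck_on_2D(1)[OF F] and F2 = Ck_on_2D(2)[OF F]
  have exp: "a w y = (\<Sum>i\<in>Basis. (w \<bullet> i) * a i y)" if "y \<in> V" for w y
  proof -
    have "a w y = a (\<Sum>i\<in>Basis. (w \<bullet> i) *\<^sub>R i) y" by (simp add: euclidean_representation)
    then show ?thesis by (simp add: linear_sum[OF lin[OF that]] linear_cmul[OF lin[OF that]])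
  qed
  have xV: "F x \<in> V" using U V by blast
  have expD: "fderiv (a w) (F x) z = (\<Sum>i\<in>Basis. (w \<bullet> i) * fderiv (a i) (F x) z)" for w z
  proof -
    have "((\<lambda>y. \<Sum>i\<in>Basis. (w \<bullet> i) * a i y) has_derivative (\<lambda>z. \<Sum>i\<in>Basis. (w \<bullet> i) * fderiv (a i) (F x) z)) (at (F x))"
      by (intro has_derivative_sum has_derivative_mult_right fderiv_works a xV)
    from has_derivative_transform_within_open[OF this V(1) xV, of "a w"] exp show ?thesis
      by (simp add: fderiv_eq)
  qed
  have *: "((\<lambda>y. a (fderiv F y w) (F y)) has_derivative
      (\<lambda>z. a (fderiv (\<lambda>y. fderiv F y w) x z) (F x) + fderiv (a (fderiv F x w)) (F x) (fderiv F x z))) (at x)" for w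
  proof -
    have "((\<lambda>y. \<Sum>i\<in>Basis. (fderiv F y w \<bullet> i) * a i (F y)) has_derivative
      (\<lambda>z. \<Sum>i\<in>Basis. (fderiv F x w \<bullet> i) * fderiv (a i) (F x) (fderiv F x z)
         + (fderiv (\<lambda>y. fderiv F y w) x z \<bullet> i) * a i (F x))) (at x)"
      by (intro has_derivative_sum has_derivative_mult has_derivative_inner_left fderiv_works F2 U
          has_derivative_compose[OF fderiv_works[OF F1[OF U(2)]] fderiv_works[OF a[OF xV]]])
    then have "((\<lambda>y. \<Sum>i\<in>Basis. (fderiv F y w \<bullet> i) * a i (F y)) has_derivative
      (\<lambda>z. a (fderiv (\<lambda>y. fderiv F y w) x z) (F x) + fderiv (a (fderiv F x w)) (F x) (fderiv F x z))) (at x)"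
      by (simp add: sum.distrib expD[symmetric] exp[OF xV, symmetric] add.commute)
    then show ?thesis
      by (rule has_derivative_transform_within_open[OF _ U]) (use V exp in auto)
  qed
  show "(\<lambda>y. a (fderiv F y w) (F y)) differentiable (at x)" using * unfolding differentiable_def by blast
  show "dform (\<lambda>w y. a (fderiv F y w) (F y)) x u v = dform a (F x) (fderiv F x u) (fderiv F x v)"
    by (simp add: dform_def fderiv_eq[OF *] fderiv_symmetric[OF F U, of u v])
qed

section \<open>Tangent maps\<close>

lemma chart_inv_right: "x \<in> chart_img c \<Longrightarrow> chart_inv c x \<in> chart_dom c"
  "x \<in> chart_img c \<Longrightarrow> chart_map c (chart_inv c x) = x"
  unfolding chart_img_def chart_inv_def by (auto intro: inv_into_into f_inv_into_f)

locale manifold =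
  fixes A :: "'y::t2_space chart set"
  assumes atlas: "smooth_atlas A"
begin

lemma chart_open: "c \<in> A \<Longrightarrow> open (chart_dom c)" "c \<in> A \<Longrightarrow> open (chart_img c)"
  and chart_homeo: "c \<in> A \<Longrightarrow> homeomorphism (chart_dom c) (chart_img c) (chart_map c) (chart_inv c)"
  using atlas by (auto simp: smooth_atlas_def)

lemma chart_inv_left: "c \<in> A \<Longrightarrow> p \<in> chart_dom c \<Longrightarrow> chart_inv c (chart_map c p) = p"
  using chart_homeo by (auto simp: homeomorphism_def)

lemma chart_map_in: "p \<in> chart_dom c \<Longrightarrow> chart_map c p \<in> chart_img c"
  by (simp add: chart_img_def)

lemma chart_exists: obtains c where "c \<in> A" "p \<in> chart_dom c"
proof -
  have "p \<in> (\<Union>c\<in>A. chart_dom c)" using atlas by (simp add: smooth_atlas_def)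
  then show thesis using that by blast
qed

lemma chart_at: "chart_at A p \<in> A" "p \<in> chart_dom (chart_at A p)"
  unfolding chart_at_def using someI_ex[of "\<lambda>c. c \<in> A \<and> p \<in> chart_dom c"] chart_exists[of p] by blast+

lemma chart_inv_cont: "c \<in> A \<Longrightarrow> continuous_on (chart_img c) (chart_inv c)"
  using chart_homeo[of c] by (auto simp: homeomorphism_def)

lemma open_chart_preimage:
  assumes "c \<in> A" "continuous_on UNIV F" "open S"
  shows "open {x \<in> chart_img c. F (chart_inv c x) \<in> S}"
proof -
  have "continuous_on (chart_img c) (\<lambda>x. F (chart_inv c x))"
    by (rule continuous_on_compose2[OF assms(2) chart_inv_cont[OF assms(1)]]) auto
  from continuous_open_preimage[OF this chart_open(2)[OF assms(1)] assms(3)]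
  show ?thesis by (simp add: vimage_def Int_def)
qed

lemma chart_image_eq:
  assumes "c \<in> A" shows "chart_map c ` (chart_dom c \<inter> F -` S) = {x \<in> chart_img c. F (chart_inv c x) \<in> S}"
proof (intro equalityI subsetI)
  fix x assume "x \<in> {x \<in> chart_img c. F (chart_inv c x) \<in> S}"
  then show "x \<in> chart_map c ` (chart_dom c \<inter> F -` S)"
    by (intro image_eqI[of _ _ "chart_inv c x"]) (simp_all add: chart_inv_right)
qed (auto simp: chart_map_in chart_inv_left assms)

text \<open>First-order differentiability in all pairs of charts, enough for a functorial tangent
  map; the identity, the flow maps and N are instances.\<close>

definition dmap :: "('y \<Rightarrow> 'y) \<Rightarrow> bool" where
  "dmap F \<longleftrightarrow> continuous_on UNIV F \<and>
     (\<forall>c\<in>A. \<forall>d\<in>A. \<forall>p. p \<in> chart_dom c \<longrightarrow> F p \<in> chart_dom d \<longrightarrow>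
        (chart_map d \<circ> F \<circ> chart_inv c) differentiable (at (chart_map c p)))"

definition loc :: "('y \<Rightarrow> 'y) \<Rightarrow> 'y chart \<Rightarrow> 'y chart \<Rightarrow> 'y \<Rightarrow> real^3 \<Rightarrow> real^3" where
  "loc F c d p = fderiv (chart_map d \<circ> F \<circ> chart_inv c) (chart_map c p)"

lemma loc_derivative:
  "dmap F \<Longrightarrow> c \<in> A \<Longrightarrow> d \<in> A \<Longrightarrow> p \<in> chart_dom c \<Longrightarrow> F p \<in> chart_dom d \<Longrightarrow>
    ((chart_map d \<circ> F \<circ> chart_inv c) has_derivative loc F c d p) (at (chart_map c p))"
  unfolding loc_def by (rule fderiv_works) (simp add: dmap_def)

lemma loc_linear:
  "dmap F \<Longrightarrow> c \<in> A \<Longrightarrow> d \<in> A \<Longrightarrow> p \<in> chart_dom c \<Longrightarrow> F p \<in> chart_dom d \<Longrightarrow> linear (loc F c d p)"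
  by (rule has_derivative_linear[OF loc_derivative])

lemma loc_compose_derivative:
  assumes F: "dmap F" and G: "dmap G" and c: "c \<in> A" "p \<in> chart_dom c" and e: "e \<in> A" "G p \<in> chart_dom e"
    and d: "d \<in> A" "F (G p) \<in> chart_dom d"
  shows "((chart_map d \<circ> (F \<circ> G) \<circ> chart_inv c) has_derivative (\<lambda>w. loc F e d (G p) (loc G c e p w))) (at (chart_map c p))"
proof (rule has_derivative_transform_within_open)
  have *: "(chart_map e \<circ> G \<circ> chart_inv c) (chart_map c p) = chart_map e (G p)"
    using c by (simp add: chart_inv_left)
  show "((\<lambda>x. (chart_map d \<circ> F \<circ> chart_inv e) ((chart_map e \<circ> G \<circ> chart_inv c) x)) has_derivative
      (\<lambda>w. loc F e d (G p) (loc G c e p w))) (at (chart_map c p))"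
    by (rule has_derivative_compose[OF loc_derivative[OF G c(1) e(1) c(2) e(2)]])
      (unfold *, rule loc_derivative[OF F e(1) d(1) e(2) d(2)])
  show "open {x \<in> chart_img c. G (chart_inv c x) \<in> chart_dom e}"
    using G c chart_open[OF e(1)] by (intro open_chart_preimage) (auto simp: dmap_def)
  show "chart_map c p \<in> {x \<in> chart_img c. G (chart_inv c x) \<in> chart_dom e}"
    using c e by (simp add: chart_inv_left chart_map_in)
qed (simp add: chart_inv_left e)

lemma dmap_compose: assumes "dmap F" "dmap G" shows "dmap (F \<circ> G)"
  unfolding dmap_def
proof (intro conjI ballI allI impI)
  show "continuous_on UNIV (F \<circ> G)"
    using assms unfolding dmap_def by (metis continuous_on_compose continuous_on_subset subset_UNIV)
  fix c d p assume *: "c \<in> A" "d \<in> A" "p \<in> chart_dom c" "(F \<circ> G) p \<in> chart_dom d"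
  obtain e where "e \<in> A" "G p \<in> chart_dom e" by (rule chart_exists)
  with * show "(chart_map d \<circ> (F \<circ> G) \<circ> chart_inv c) differentiable (at (chart_map c p))"
    using loc_compose_derivative[OF assms *(1,3), of e d] unfolding differentiable_def by auto
qed

lemma loc_compose:
  assumes "dmap F" "dmap G" "c \<in> A" "p \<in> chart_dom c" "e \<in> A" "G p \<in> chart_dom e" "d \<in> A" "F (G p) \<in> chart_dom d"
  shows "loc (F \<circ> G) c d p w = loc F e d (G p) (loc G c e p w)"
  using fun_cong[OF fderiv_eq[OF loc_compose_derivative[OF assms]]] by (simp only: loc_def)

lemma Ck_on_transition:
  assumes "c \<in> A" "d \<in> A"
  shows "Ck_on n {x \<in> chart_img c. chart_inv c x \<in> chart_dom d} (chart_map d \<circ> chart_inv c)"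
proof -
  have "Ck_on n (chart_map c ` (chart_dom c \<inter> chart_dom d)) (chart_map d \<circ> chart_inv c)"
    using atlas assms by (simp add: smooth_atlas_def smooth_on_def)
  then show ?thesis using chart_image_eq[OF assms(1), of id "chart_dom d"] by simp
qed

lemma dmap_id: "dmap id"
  unfolding dmap_def
proof (intro conjI ballI allI impI)
  fix c d p assume *: "c \<in> A" "d \<in> A" "p \<in> chart_dom c" "id p \<in> chart_dom d"
  show "(chart_map d \<circ> id \<circ> chart_inv c) differentiable (at (chart_map c p))"
    using Ck_on_2D(1)[OF Ck_on_transition[OF *(1,2)], of "chart_map c p"] * by (simp add: chart_map_in chart_inv_left)
qed (simp add: continuous_on_id)

text \<open>The transformation law is the local derivative of the identity map, so changes of charts
  become instances of the chain rule \<open>loc_compose\<close>.\<close>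

lemma tangent_space_loc:
  "v \<in> tangent_space A p \<longleftrightarrow>
    (\<forall>c\<in>A. \<forall>d\<in>A. p \<in> chart_dom c \<longrightarrow> p \<in> chart_dom d \<longrightarrow> v d = loc id c d p (v c)) \<and>
    (\<forall>c. \<not> (c \<in> A \<and> p \<in> chart_dom c) \<longrightarrow> v c = 0)"
  by (simp add: tangent_space_def loc_def)

lemma tangent_spaceI:
  assumes "\<And>c d. c \<in> A \<Longrightarrow> d \<in> A \<Longrightarrow> p \<in> chart_dom c \<Longrightarrow> p \<in> chart_dom d \<Longrightarrow> v d = loc id c d p (v c)"
    and "\<And>c. \<not> (c \<in> A \<and> p \<in> chart_dom c) \<Longrightarrow> v c = 0"
  shows "v \<in> tangent_space A p"
  using assms unfolding tangent_space_loc by blast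

lemma tangent_space_outside: "v \<in> tangent_space A p \<Longrightarrow> \<not> (c \<in> A \<and> p \<in> chart_dom c) \<Longrightarrow> v c = 0"
  unfolding tangent_space_loc by blast

lemma tangent_spaceD:
  "v \<in> tangent_space A p \<Longrightarrow> c \<in> A \<Longrightarrow> d \<in> A \<Longrightarrow> p \<in> chart_dom c \<Longrightarrow> p \<in> chart_dom d \<Longrightarrow> v d = loc id c d p (v c)"
  unfolding tangent_space_loc by blast

lemma loc_self: "c \<in> A \<Longrightarrow> p \<in> chart_dom c \<Longrightarrow> loc id c c p w = w"
proof -
  assume c: "c \<in> A" "p \<in> chart_dom c"
  have "((chart_map c \<circ> id \<circ> chart_inv c) has_derivative (\<lambda>w. w)) (at (chart_map c p))"
    by (rule has_derivative_transform_within_open[OF has_derivative_ident chart_open(2)[OF c(1)]])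
      (auto simp: chart_map_in c chart_inv_right)
  then show ?thesis by (simp add: loc_def fderiv_eq)
qed

lemma tangent_eqI:
  assumes "u \<in> tangent_space A p" "v \<in> tangent_space A p" "c \<in> A" "p \<in> chart_dom c" "u c = v c"
  shows "u = v"
proof
  fix d show "u d = v d"
  proof (cases "d \<in> A \<and> p \<in> chart_dom d")
    case True
    then show ?thesis
      using tangent_spaceD[OF assms(1,3) _ assms(4), of d] tangent_spaceD[OF assms(2,3) _ assms(4), of d] assms(5) by metis
  qed (use assms(1,2) tangent_space_outside in metis)
qed

lemma tcomb_in:
  assumes "u \<in> tangent_space A p" "v \<in> tangent_space A p" shows "tcomb a u b v \<in> tangent_space A p"
proof (rule tangent_spaceI)
  fix c d assume *: "c \<in> A" "d \<in> A" "p \<in> chart_dom c" "p \<in> chart_dom d"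
  have lin: "linear (loc id c d p)" using * by (intro loc_linear dmap_id) auto
  show "tcomb a u b v d = loc id c d p (tcomb a u b v c)"
    unfolding tcomb_def linear_add[OF lin] linear_cmul[OF lin]
    using tangent_spaceD[OF assms(1) *] tangent_spaceD[OF assms(2) *] by metis
next
  fix c assume "\<not> (c \<in> A \<and> p \<in> chart_dom c)"
  then show "tcomb a u b v c = 0"
    using tangent_space_outside[OF assms(1)] tangent_space_outside[OF assms(2)] by (simp add: tcomb_def)
qed

lemma tvec_of_loc: "tvec_of A c p w d = (if d \<in> A \<and> p \<in> chart_dom d then loc id c d p w else 0)"
  by (simp add: tvec_of_def loc_def)

lemma tvec_of_in: assumes c: "c \<in> A" "p \<in> chart_dom c" shows "tvec_of A c p w \<in> tangent_space A p"
proof (rule tangent_spaceI)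
  fix d e assume *: "d \<in> A" "e \<in> A" "p \<in> chart_dom d" "p \<in> chart_dom e"
  then show "tvec_of A c p w e = loc id d e p (tvec_of A c p w d)"
    using loc_compose[OF dmap_id dmap_id c *(1) _ *(2), of w] by (simp add: tvec_of_loc)
qed (auto simp: tvec_of_loc)

lemma tvec_of_self: "c \<in> A \<Longrightarrow> p \<in> chart_dom c \<Longrightarrow> tvec_of A c p w c = w"
  by (simp add: tvec_of_loc loc_self)

lemma tvec_of_chart:
  assumes "v \<in> tangent_space A p" "c \<in> A" "p \<in> chart_dom c" shows "tvec_of A c p (v c) = v"
  by (rule tangent_eqI[OF tvec_of_in[OF assms(2,3)] assms tvec_of_self[OF assms(2,3)]])

lemma tvec_of_tcomb:
  assumes c: "c \<in> A" "p \<in> chart_dom c"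
  shows "tvec_of A c p (a *\<^sub>R v + b *\<^sub>R w) = tcomb a (tvec_of A c p v) b (tvec_of A c p w)"
  by (rule tangent_eqI[OF tvec_of_in[OF c] tcomb_in[OF tvec_of_in[OF c] tvec_of_in[OF c]] c])
    (simp add: tcomb_def tvec_of_self c)

text \<open>Frees \<open>tangent_map\<close> from the chart picked by \<open>chart_at\<close>: chain
  rule with the identity, then the transformation law.\<close>

lemma tangent_map_loc:
  assumes F: "dmap F" and v: "v \<in> tangent_space A p" and c: "c \<in> A" "p \<in> chart_dom c" and d: "d \<in> A" "F p \<in> chart_dom d"
  shows "tangent_map A F p v d = loc F c d p (v c)"
proof -
  have "loc F (chart_at A p) d p (v (chart_at A p)) = loc F c d p (loc id (chart_at A p) c p (v (chart_at A p)))"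
    using loc_compose[OF F dmap_id chart_at[of p] c(1) _ d(1)] c d by simp
  also have "\<dots> = loc F c d p (v c)"
    using tangent_spaceD[OF v chart_at(1) c(1) chart_at(2) c(2)] by metis
  finally show ?thesis using d by (simp add: tangent_map_def Let_def loc_def)
qed

lemma tangent_map_in:
  assumes F: "dmap F" and v: "v \<in> tangent_space A p" shows "tangent_map A F p v \<in> tangent_space A (F p)"
proof (rule tangent_spaceI)
  fix d e assume *: "d \<in> A" "e \<in> A" "F p \<in> chart_dom d" "F p \<in> chart_dom e"
  obtain c where c: "c \<in> A" "p \<in> chart_dom c" by (rule chart_exists)
  show "tangent_map A F p v e = loc id d e (F p) (tangent_map A F p v d)"
    using loc_compose[OF dmap_id F c *(1,3,2)] * by (simp add: tangent_map_loc[OF F v c])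
qed (auto simp: tangent_map_def)

lemma tangent_map_compose:
  assumes F: "dmap F" and G: "dmap G" and v: "v \<in> tangent_space A p"
  shows "tangent_map A (F \<circ> G) p v = tangent_map A F (G p) (tangent_map A G p v)"
proof -
  obtain c where c: "c \<in> A" "p \<in> chart_dom c" by (rule chart_exists)
  obtain e where e: "e \<in> A" "G p \<in> chart_dom e" by (rule chart_exists)
  obtain d where d: "d \<in> A" "F (G p) \<in> chart_dom d" by (rule chart_exists)
  note FG = dmap_compose[OF F G] and Gv = tangent_map_in[OF G v]
  show ?thesis
  proof (rule tangent_eqI[OF _ tangent_map_in[OF F Gv] d])
    show "tangent_map A (F \<circ> G) p v \<in> tangent_space A (F (G p))" using tangent_map_in[OF FG v] by simp
    show "tangent_map A (F \<circ> G) p v d = tangent_map A F (G p) (tangent_map A G p v) d"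
      using tangent_map_loc[OF FG v c d(1)] d
      by (simp add: tangent_map_loc[OF F Gv e d] tangent_map_loc[OF G v c e] loc_compose[OF F G c e d])
  qed
qed

lemma tangent_map_id:
  assumes v: "v \<in> tangent_space A p" shows "tangent_map A id p v = v"
proof -
  obtain c where c: "c \<in> A" "p \<in> chart_dom c" by (rule chart_exists)
  have "tangent_map A id p v \<in> tangent_space A p" using tangent_map_in[OF dmap_id v] by simp
  from tangent_eqI[OF this v c] show ?thesis
    using tangent_map_loc[OF dmap_id v c c(1)] c by (simp add: loc_self)
qed

lemma tangent_map_tcomb:
  assumes F: "dmap F" and uv: "u \<in> tangent_space A p" "v \<in> tangent_space A p"
  shows "tangent_map A F p (tcomb a u b v) = tcomb a (tangent_map A F p u) b (tangent_map A F p v)"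
proof -
  obtain c where c: "c \<in> A" "p \<in> chart_dom c" by (rule chart_exists)
  obtain d where d: "d \<in> A" "F p \<in> chart_dom d" by (rule chart_exists)
  note in1 = tcomb_in[OF uv] and in2 = tangent_map_in[OF F uv(1)] and in3 = tangent_map_in[OF F uv(2)]
  show ?thesis
  proof (rule tangent_eqI[OF tangent_map_in[OF F in1] tcomb_in[OF in2 in3] d])
    show "tangent_map A F p (tcomb a u b v) d = tcomb a (tangent_map A F p u) b (tangent_map A F p v) d"
      using loc_linear[OF F c(1) d(1) c(2) d(2)] unfolding tangent_map_loc[OF F in1 c d]
      by (simp add: tcomb_def tangent_map_loc[OF F uv(1) c d] tangent_map_loc[OF F uv(2) c d] linear_add linear_cmul)
  qed
qed

text \<open>The set where the curve has its initial value is closed, as the space is Hausdorff, and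
  open, as zero velocity in a chart makes the curve locally constant.\<close>

lemma constant_curve:
  fixes \<delta> :: "real \<Rightarrow> 'y"
  assumes cont: "continuous_on UNIV \<delta>"
    and vel: "\<And>t d. d \<in> A \<Longrightarrow> \<delta> t \<in> chart_dom d \<Longrightarrow> ((chart_map d \<circ> \<delta>) has_vector_derivative 0) (at t)"
  shows "\<delta> t = \<delta> 0"
proof -
  have "closed {t. \<delta> t = \<delta> 0}" by (intro closed_Collect_eq cont continuous_on_const)
  moreover have "open {t. \<delta> t = \<delta> 0}"
    unfolding open_contains_ball
  proof (intro ballI)
    fix t assume t: "t \<in> {t. \<delta> t = \<delta> 0}"
    obtain d where d: "d \<in> A" "\<delta> t \<in> chart_dom d" by (rule chart_exists)
    have "eventually (\<lambda>s. \<delta> s \<in> chart_dom d) (nhds t)"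
      using cont d chart_open[OF d(1)] by (metis UNIV_I continuous_on_eq_continuous_at open_UNIV isCont_def tendsto_at_iff_tendsto_nhds topological_tendstoD)
    then obtain e where e: "e > 0"
      "\<And>s. dist s t < e \<Longrightarrow> \<delta> s \<in> chart_dom d \<and> ((chart_map d \<circ> \<delta>) has_vector_derivative 0) (at s)"
      unfolding eventually_nhds_metric using vel[OF d(1)] by blast
    have "s \<in> {t. \<delta> t = \<delta> 0}" if s: "s \<in> ball t e" for s
    proof -
      obtain k where "\<And>x. x \<in> ball t e \<Longrightarrow> (chart_map d \<circ> \<delta>) x = k"
        using has_vector_derivative_zero_constant[of "ball t e" "chart_map d \<circ> \<delta>"] e(2)
        by (metis convex_ball dist_commute has_vector_derivative_at_within mem_ball)
      then have "chart_map d (\<delta> s) = chart_map d (\<delta> t)" using s e(1) by (metis centre_in_ball comp_apply)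
      moreover have "\<delta> s \<in> chart_dom d" using e(2)[of s] s by (simp add: dist_commute)
      ultimately have "\<delta> s = \<delta> t" using chart_inv_left[OF d(1)] d(2) by metis
      also have "\<delta> t = \<delta> 0" using t by simp
      finally show ?thesis by simp
    qed
    then show "\<exists>e>0. ball t e \<subseteq> {t. \<delta> t = \<delta> 0}" using e(1) by blast
  qed
  ultimately show ?thesis using clopen[of "{t. \<delta> t = \<delta> 0}"] by blast
qed

end

section \<open>The exterior derivative\<close>

lemma vector_derivative_chain:
  assumes "(f has_vector_derivative v) (at t)" "(g has_derivative L) (at (f t))"
  shows "((\<lambda>s. g (f s)) has_vector_derivative L v) (at t)"
  using has_derivative_compose[OF assms(1)[unfolded has_vector_derivative_def] assms(2)]
  by (simp add: has_vector_derivative_def linear_cmul[OF has_derivative_linear[OF assms(2)]])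

lemma Ck_on_cong:
  assumes "open U" "\<And>x. x \<in> U \<Longrightarrow> f x = g x" "Ck_on n U f" shows "Ck_on n U g"
  using assms(2,3)
proof (induction n arbitrary: f g)
  case 0 then show ?case using continuous_on_cong[of U U f g] by simp
next
  case (Suc n)
  have d: "f differentiable (at x)" if "x \<in> U" for x using Suc.prems(2) that by simp
  have g: "(g has_derivative fderiv f x) (at x)" if "x \<in> U" for x
    by (rule has_derivative_transform_within_open[OF fderiv_works[OF d[OF that]] assms(1) that]) (rule Suc.prems(1))
  have "Ck_on n U (\<lambda>x. fderiv g x v)" for v
    by (rule Suc.IH[of "\<lambda>x. fderiv f x v"]) (use Suc.prems(2) fderiv_eq[OF g] in auto)
  then show ?case using g by (auto simp: differentiable_def)
qed

lemma Ck_on_slice: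
  assumes "open U" "Ck_on n U f" shows "Ck_on n {x. (t, x) \<in> U} (\<lambda>x. f (t, x))"
  using assms(2)
proof (induction n arbitrary: f)
  case 0
  then have "continuous_on U f" by simp
  then have "continuous_on {x. (t, x) \<in> U} (\<lambda>x. f (t, x))"
    by (rule continuous_on_compose2) (auto intro!: continuous_on_Pair continuous_on_const continuous_on_id)
  then show ?case by simp
next
  case (Suc n)
  have op: "open {x. (t, x) \<in> U}"
    using open_vimage[OF assms(1), of "Pair t"] by (simp add: vimage_def continuous_on_Pair continuous_on_const continuous_on_id)
  have d: "((\<lambda>x. f (t, x)) has_derivative (\<lambda>w. fderiv f (t, x) (0, w))) (at x)" if "(t, x) \<in> U" for x
  proof -
    have p: "((\<lambda>x. (t, x)) has_derivative (\<lambda>w. (0, w))) (at x)"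
      by (intro has_derivative_Pair has_derivative_const has_derivative_ident)
    have "(f has_derivative fderiv f (t, x)) (at (t, x))" using Suc.prems that by (intro fderiv_works) simp
    from has_derivative_compose[OF p this] show ?thesis .
  qed
  have "Ck_on n {x. (t, x) \<in> U} (\<lambda>x. fderiv (\<lambda>x. f (t, x)) x v)" for v
  proof (rule Ck_on_cong[OF op])
    show "Ck_on n {x. (t, x) \<in> U} (\<lambda>x. fderiv f (t, x) (0, v))"
      using Suc.prems by (intro Suc.IH[of "\<lambda>z. fderiv f z (0, v)"]) simp
  qed (simp add: fderiv_eq[OF d])
  then show ?case using d by (auto simp: differentiable_def)
qed

lemma fderiv_transform:
  assumes "f differentiable (at x)" "open U" "x \<in> U" "\<And>y. y \<in> U \<Longrightarrow> f y = g y"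
  shows "fderiv f x = fderiv g x"
  by (rule fderiv_eq[OF has_derivative_transform_within_open[OF fderiv_works[OF assms(1)] assms(2-4)], symmetric])

context manifold
begin

lemma dmapI:
  assumes "continuous_on UNIV F"
    and "\<And>c d. c \<in> A \<Longrightarrow> d \<in> A \<Longrightarrow> Ck_on 2 {x \<in> chart_img c. F (chart_inv c x) \<in> chart_dom d} (chart_map d \<circ> F \<circ> chart_inv c)"
  shows "dmap F"
  unfolding dmap_def using assms(1) Ck_on_2D(1)[OF assms(2)] by (simp add: chart_map_in chart_inv_left)

end

locale one_form = manifold A for A :: "'y::t2_space chart set" +
  fixes \<alpha> :: "'y one_form"
  assumes form: "smooth_one_form A \<alpha>"
begin

lemma form_tcomb:
  "u \<in> tangent_space A p \<Longrightarrow> v \<in> tangent_space A p \<Longrightarrow> \<alpha> p (tcomb a u b v) = a * \<alpha> p u + b * \<alpha> p v"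
  using form by (simp add: smooth_one_form_def)

lemma form_coord_eq:
  "c \<in> A \<Longrightarrow> p \<in> chart_dom c \<Longrightarrow> v \<in> tangent_space A p \<Longrightarrow> form_coord A \<alpha> c (v c) (chart_map c p) = \<alpha> p v"
  by (simp add: form_coord_def chart_inv_left tvec_of_chart)

lemma form_coord_combination:
  assumes "c \<in> A" "x \<in> chart_img c"
  shows "form_coord A \<alpha> c (a *\<^sub>R v + b *\<^sub>R w) x = a * form_coord A \<alpha> c v x + b * form_coord A \<alpha> c w x"
  using assms by (simp add: form_coord_def tvec_of_tcomb form_tcomb tvec_of_in chart_inv_right)

lemma form_coord_linear:
  assumes "c \<in> A" "x \<in> chart_img c" shows "linear (\<lambda>w. form_coord A \<alpha> c w x)"
proof (rule linearI)
  show "form_coord A \<alpha> c (v + w) x = form_coord A \<alpha> c v x + form_coord A \<alpha> c w x" for v w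
    using form_coord_combination[OF assms, of 1 v 1 w] by simp
  show "form_coord A \<alpha> c (r *\<^sub>R v) x = r *\<^sub>R form_coord A \<alpha> c v x" for r v
    using form_coord_combination[OF assms, of r v 0 v] by simp
qed

lemma form_coord_differentiable: "c \<in> A \<Longrightarrow> x \<in> chart_img c \<Longrightarrow> form_coord A \<alpha> c w differentiable (at x)"
  and form_coord_deriv_cont: "c \<in> A \<Longrightarrow> continuous_on (chart_img c) (\<lambda>x. fderiv (form_coord A \<alpha> c w) x z)"
proof -
  assume "c \<in> A"
  then have "Ck_on (Suc 0) (chart_img c) (form_coord A \<alpha> c w)"
    using form unfolding smooth_one_form_def smooth_on_def by blast
  then show "x \<in> chart_img c \<Longrightarrow> form_coord A \<alpha> c w differentiable (at x)"
    "continuous_on (chart_img c) (\<lambda>x. fderiv (form_coord A \<alpha> c w) x z)" by simp_all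
qed

lemma form_coord_deriv_combination:
  assumes c: "c \<in> A" "x \<in> chart_img c"
  shows "fderiv (form_coord A \<alpha> c (a *\<^sub>R v + b *\<^sub>R w)) x z =
    a * fderiv (form_coord A \<alpha> c v) x z + b * fderiv (form_coord A \<alpha> c w) x z"
proof -
  have "((\<lambda>y. a * form_coord A \<alpha> c v y + b * form_coord A \<alpha> c w y) has_derivative
    (\<lambda>z. a * fderiv (form_coord A \<alpha> c v) x z + b * fderiv (form_coord A \<alpha> c w) x z)) (at x)"
    by (intro has_derivative_add has_derivative_mult_right fderiv_works form_coord_differentiable c)
  from has_derivative_transform_within_open[OF this chart_open(2)[OF c(1)] c(2),
      of "form_coord A \<alpha> c (a *\<^sub>R v + b *\<^sub>R w)"]
  show ?thesis by (simp add: fderiv_eq form_coord_combination[OF c(1)])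
qed

lemma dform_combination:
  assumes c: "c \<in> A" "x \<in> chart_img c"
  shows "dform (form_coord A \<alpha> c) x (a *\<^sub>R u + b *\<^sub>R v) w =
    a * dform (form_coord A \<alpha> c) x u w + b * dform (form_coord A \<alpha> c) x v w"
  using fderiv_linear[OF form_coord_differentiable[OF c]]
  by (simp add: dform_def form_coord_deriv_combination[OF c] linear_add linear_cmul algebra_simps)

lemma form_pullback:
  fixes G :: "'a::real_normed_vector \<Rightarrow> real^3"
  assumes "Ck_on 2 U G" "open U" "x \<in> U" "d \<in> A" "G ` U \<subseteq> chart_img d"
  shows "(\<lambda>y. form_coord A \<alpha> d (fderiv G y w) (G y)) differentiable (at x)"
    and "dform (\<lambda>w y. form_coord A \<alpha> d (fderiv G y w) (G y)) x u v =
      dform (form_coord A \<alpha> d) (G x) (fderiv G x u) (fderiv G x v)"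
  by (rule dform_pullback[OF assms(1-3) chart_open(2)[OF assms(4)] assms(5)];
      simp add: form_coord_linear form_coord_differentiable assms(4))+

lemma dform_cong:
  assumes "open U" "x \<in> U" "\<And>w y. y \<in> U \<Longrightarrow> a w y = b w y" "\<And>w. a w differentiable (at x)"
  shows "dform a x u v = dform b x u v"
  unfolding dform_def using fderiv_transform[OF assms(4,1,2,3)] by simp

text \<open>The transition map pulls one coordinate expression of the form back to the other, so
  \<open>dform_pullback\<close> gives independence of the chart.\<close>

lemma ext_deriv_chart:
  assumes c: "c \<in> A" "p \<in> chart_dom c" and uv: "u \<in> tangent_space A p" "v \<in> tangent_space A p"
  shows "ext_deriv A \<alpha> p u v = dform (form_coord A \<alpha> c) (chart_map c p) (u c) (v c)"
proof -
  define e where "e = chart_at A p"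
  have e: "e \<in> A" "p \<in> chart_dom e" using chart_at by (simp_all add: e_def)
  define U G where "U = {x \<in> chart_img e. id (chart_inv e x) \<in> chart_dom c}" and "G = chart_map c \<circ> id \<circ> chart_inv e"
  have U: "open U" unfolding U_def
    by (intro open_chart_preimage e chart_open c) (simp add: continuous_on_id)
  have pU: "chart_map e p \<in> U" using c e by (simp add: U_def chart_map_in chart_inv_left)
  have GU: "G ` U \<subseteq> chart_img c" by (auto simp: G_def U_def chart_map_in)
  have G: "Ck_on 2 U G" using Ck_on_transition[OF e(1) c(1)] by (simp add: U_def G_def)
  have eq: "form_coord A \<alpha> c (fderiv G y w) (G y) = form_coord A \<alpha> e w y" if "y \<in> U" for w y
  proof -
    define q where "q = chart_inv e y"
    have q: "q \<in> chart_dom e" "q \<in> chart_dom c" "chart_map e q = y"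
      using that by (simp_all add: q_def U_def chart_inv_right)
    have "fderiv G y w = tvec_of A e q w c" using q c by (simp add: tvec_of_loc loc_def G_def)
    moreover have "G y = chart_map c q" by (simp add: G_def q_def)
    ultimately show ?thesis
      using form_coord_eq[OF c(1) q(2) tvec_of_in[OF e(1) q(1)]] by (simp add: form_coord_def q_def)
  qed
  have fu: "fderiv G (chart_map e p) (w e) = w c" if "w \<in> tangent_space A p" for w
    using tangent_spaceD[OF that e(1) c(1) e(2) c(2)] by (simp only: G_def loc_def)
  have Gp: "G (chart_map e p) = chart_map c p" using e by (simp add: G_def chart_inv_left)
  have "dform (form_coord A \<alpha> c) (chart_map c p) (u c) (v c)
      = dform (\<lambda>w y. form_coord A \<alpha> c (fderiv G y w) (G y)) (chart_map e p) (u e) (v e)"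
    unfolding form_pullback(2)[OF G U pU c(1) GU] by (simp add: fu uv Gp)
  also have "\<dots> = dform (form_coord A \<alpha> e) (chart_map e p) (u e) (v e)"
    by (rule dform_cong[OF U pU eq form_pullback(1)[OF G U pU c(1) GU]])
  finally show ?thesis by (simp add: ext_deriv_def Let_def e_def dform_def)
qed

lemma ext_deriv_swap: "ext_deriv A \<alpha> p u v = - ext_deriv A \<alpha> p v u"
  by (simp add: ext_deriv_def Let_def)

lemma ext_deriv_tcomb:
  assumes "u \<in> tangent_space A p" "v \<in> tangent_space A p" "w \<in> tangent_space A p"
  shows "ext_deriv A \<alpha> p (tcomb a u b v) w = a * ext_deriv A \<alpha> p u w + b * ext_deriv A \<alpha> p v w"
    and "ext_deriv A \<alpha> p w (tcomb a u b v) = a * ext_deriv A \<alpha> p w u + b * ext_deriv A \<alpha> p w v"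
proof -
  obtain c where c: "c \<in> A" "p \<in> chart_dom c" by (rule chart_exists)
  show 1: "ext_deriv A \<alpha> p (tcomb a u b v) w = a * ext_deriv A \<alpha> p u w + b * ext_deriv A \<alpha> p v w"
    using assms by (simp add: ext_deriv_chart[OF c] tcomb_in)
      (simp add: tcomb_def dform_combination[OF c(1) chart_map_in[OF c(2)]])
  show "ext_deriv A \<alpha> p w (tcomb a u b v) = a * ext_deriv A \<alpha> p w u + b * ext_deriv A \<alpha> p w v"
    using 1 ext_deriv_swap[of p w] by simp
qed

text \<open>In charts the pullback of the form is k times the form, and \<open>dform\<close>
  commutes with both operations. The factor is 1 for the flow and -1 for N.\<close>

lemma ext_deriv_pullback:
  assumes F: "continuous_on UNIV F"
      "\<And>c d. c \<in> A \<Longrightarrow> d \<in> A \<Longrightarrow> Ck_on 2 {x \<in> chart_img c. F (chart_inv c x) \<in> chart_dom d} (chart_map d \<circ> F \<circ> chart_inv c)"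
    and k: "\<And>p v. v \<in> tangent_space A p \<Longrightarrow> \<alpha> (F p) (tangent_map A F p v) = k * \<alpha> p v"
    and uv: "u \<in> tangent_space A p" "v \<in> tangent_space A p"
  shows "ext_deriv A \<alpha> (F p) (tangent_map A F p u) (tangent_map A F p v) = k * ext_deriv A \<alpha> p u v"
proof -
  obtain c where c: "c \<in> A" "p \<in> chart_dom c" by (rule chart_exists)
  obtain d where d: "d \<in> A" "F p \<in> chart_dom d" by (rule chart_exists)
  have dF: "dmap F" by (rule dmapI[OF F])
  define U G where "U = {x \<in> chart_img c. F (chart_inv c x) \<in> chart_dom d}" and "G = chart_map d \<circ> F \<circ> chart_inv c"
  have U: "open U" unfolding U_def by (intro open_chart_preimage c F chart_open d)
  have pU: "chart_map c p \<in> U" using c d by (simp add: U_def chart_map_in chart_inv_left)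
  have GU: "G ` U \<subseteq> chart_img d" by (auto simp: G_def U_def chart_map_in)
  have G: "Ck_on 2 U G" using F(2)[OF c(1) d(1)] by (simp add: U_def G_def)
  have eq: "form_coord A \<alpha> d (fderiv G y w) (G y) = k * form_coord A \<alpha> c w y" if "y \<in> U" for w y
  proof -
    define q where "q = chart_inv c y"
    have q: "q \<in> chart_dom c" "F q \<in> chart_dom d" "chart_map c q = y"
      using that by (simp_all add: q_def U_def chart_inv_right)
    note t = tvec_of_in[OF c(1) q(1), of w]
    have "fderiv G y w = tangent_map A F q (tvec_of A c q w) d"
      using q by (simp add: tangent_map_loc[OF dF t c(1) q(1) d(1) q(2)] tvec_of_self c(1) loc_def G_def)
    moreover have "G y = chart_map d (F q)" by (simp add: G_def q_def)
    ultimately show ?thesis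
      using form_coord_eq[OF d(1) q(2) tangent_map_in[OF dF t]] k[OF t] by (simp add: form_coord_def q_def)
  qed
  have fu: "fderiv G (chart_map c p) (w c) = tangent_map A F p w d" if "w \<in> tangent_space A p" for w
    by (simp add: tangent_map_loc[OF dF that c d] loc_def G_def)
  have Gp: "G (chart_map c p) = chart_map d (F p)" using c by (simp add: G_def chart_inv_left)
  have "ext_deriv A \<alpha> (F p) (tangent_map A F p u) (tangent_map A F p v)
      = dform (\<lambda>w y. form_coord A \<alpha> d (fderiv G y w) (G y)) (chart_map c p) (u c) (v c)"
    unfolding form_pullback(2)[OF G U pU d(1) GU]
    by (simp add: fu uv Gp ext_deriv_chart[OF d] tangent_map_in[OF dF])
  also have "\<dots> = dform (\<lambda>w y. k * form_coord A \<alpha> c w y) (chart_map c p) (u c) (v c)"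
    by (rule dform_cong[OF U pU eq form_pullback(1)[OF G U pU d(1) GU]])
  also have "\<dots> = k * dform (form_coord A \<alpha> c) (chart_map c p) (u c) (v c)"
  proof -
    have "fderiv (\<lambda>y. k * form_coord A \<alpha> c w y) (chart_map c p) = (\<lambda>z. k * fderiv (form_coord A \<alpha> c w) (chart_map c p) z)" for w
      by (intro fderiv_eq has_derivative_mult_right fderiv_works form_coord_differentiable c chart_map_in)
    then show ?thesis by (simp add: dform_def algebra_simps)
  qed
  finally show ?thesis by (simp add: ext_deriv_chart[OF c] uv)
qed

end

section \<open>The Reeb flow\<close>

locale reeb_flow = one_form A \<alpha> for A :: "'y::t2_space chart set" and \<alpha> +
  fixes R :: "'y \<Rightarrow> 'y tvec" and \<phi> :: "real \<Rightarrow> 'y \<Rightarrow> 'y" and J :: "'y \<Rightarrow> 'y tvec \<Rightarrow> 'y tvec"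
  assumes reeb: "reeb_field A \<alpha> R" and flow: "flow_of A R \<phi>" and acs: "compatible_acs A \<alpha> R J"
begin

lemma R_in: "R p \<in> tangent_space A p" and form_R: "\<alpha> p (R p) = 1"
  and ext_deriv_R: "v \<in> tangent_space A p \<Longrightarrow> ext_deriv A \<alpha> p (R p) v = 0"
  using reeb by (auto simp: reeb_field_def)

lemma flow_0: "\<phi> 0 p = p" and flow_add: "\<phi> (s + t) p = \<phi> s (\<phi> t p)"
  and flow_velocity: "has_velocity A (\<lambda>s. \<phi> s p) (R (\<phi> t p)) t"
  and flow_joint: "continuous_on UNIV (\<lambda>(t, p). \<phi> t p)"
  using flow by (auto simp: flow_of_def)

lemma flow_cont: "continuous_on UNIV (\<phi> t)" "continuous_on UNIV (\<lambda>t. \<phi> t p)"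
  using continuous_on_compose2[OF flow_joint, of UNIV "\<lambda>p. (t, p)"]
    continuous_on_compose2[OF flow_joint, of UNIV "\<lambda>t. (t, p)"]
  by (auto simp: continuous_on_Pair continuous_on_const continuous_on_id)

section \<open>The flow in charts, with time as a coordinate\<close>

definition fdom :: "'y chart \<Rightarrow> 'y chart \<Rightarrow> (real \<times> (real^3)) set" where
  "fdom c d = {(t, x). x \<in> chart_img c \<and> \<phi> t (chart_inv c x) \<in> chart_dom d}"

definition fmap :: "'y chart \<Rightarrow> 'y chart \<Rightarrow> real \<times> (real^3) \<Rightarrow> real^3" where
  "fmap c d = (\<lambda>(t, x). chart_map d (\<phi> t (chart_inv c x)))"

lemma fmap_Ck: "c \<in> A \<Longrightarrow> d \<in> A \<Longrightarrow> Ck_on n (fdom c d) (fmap c d)"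
  using flow by (simp add: flow_of_def smooth_on_def fdom_def fmap_def)

lemma fdom_iff: "c \<in> A \<Longrightarrow> p \<in> chart_dom c \<Longrightarrow> (t, chart_map c p) \<in> fdom c d \<longleftrightarrow> \<phi> t p \<in> chart_dom d"
  by (simp add: fdom_def chart_map_in chart_inv_left)

lemma fdom_open:
  assumes "c \<in> A" "d \<in> A" shows "open (fdom c d)"
proof -
  have "continuous_on (UNIV \<times> chart_img c) (\<lambda>z. (fst z, chart_inv c (snd z)))"
    by (intro continuous_on_Pair continuous_on_fst continuous_on_id
        continuous_on_compose2[OF chart_inv_cont[OF assms(1)] continuous_on_snd[OF continuous_on_id]]) auto
  from continuous_on_compose2[OF flow_joint this]
  have "continuous_on (UNIV \<times> chart_img c) (\<lambda>z. \<phi> (fst z) (chart_inv c (snd z)))" by simp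
  note continuous_open_preimage[OF this open_Times[OF open_UNIV chart_open(2)[OF assms(1)]] chart_open(1)[OF assms(2)]]
  moreover have "fdom c d = UNIV \<times> chart_img c \<inter> (\<lambda>z. \<phi> (fst z) (chart_inv c (snd z))) -` chart_dom d"
    by (auto simp: fdom_def)
  ultimately show ?thesis by simp
qed

lemma flow_Ck:
  assumes "c \<in> A" "d \<in> A"
  shows "Ck_on n {x \<in> chart_img c. \<phi> t (chart_inv c x) \<in> chart_dom d} (chart_map d \<circ> \<phi> t \<circ> chart_inv c)"
  using Ck_on_slice[OF fdom_open[OF assms] fmap_Ck[OF assms], of n t]
  by (simp add: fdom_def fmap_def comp_def)

lemma flow_dmap: "dmap (\<phi> t)"
  by (rule dmapI[OF flow_cont(1) flow_Ck])

lemma fmap_deriv: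
  assumes c: "c \<in> A" "p \<in> chart_dom c" and d: "d \<in> A" "\<phi> t p \<in> chart_dom d"
  shows "(fmap c d has_derivative fderiv (fmap c d) (t, chart_map c p)) (at (t, chart_map c p))"
    and "fderiv (fmap c d) (t, chart_map c p) (0, w) = loc (\<phi> t) c d p w"
    and "fderiv (fmap c d) (t, chart_map c p) (1, 0) = R (\<phi> t p) d"
proof -
  let ?L = "fderiv (fmap c d) (t, chart_map c p)"
  have "(t, chart_map c p) \<in> fdom c d" using fdom_iff[OF c] d by simp
  then show L: "(fmap c d has_derivative ?L) (at (t, chart_map c p))"
    by (intro fderiv_works Ck_on_2D(1)[OF fmap_Ck[OF c(1) d(1)]])
  have "((\<lambda>x. (t, x)) has_derivative (\<lambda>w. (0, w))) (at (chart_map c p))"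
    by (intro has_derivative_Pair has_derivative_const has_derivative_ident)
  from has_derivative_compose[OF this L] show "?L (0, w) = loc (\<phi> t) c d p w"
    by (simp add: loc_def fmap_def comp_def fderiv_eq)
  have "((\<lambda>s. (s, chart_map c p)) has_vector_derivative (1, 0)) (at t)"
    unfolding has_vector_derivative_def by (auto intro!: derivative_eq_intros)
  from vector_derivative_chain[OF this L]
  have "((\<lambda>s. chart_map d (\<phi> s p)) has_vector_derivative ?L (1, 0)) (at t)"
    by (simp add: fmap_def chart_inv_left c)
  moreover have "((\<lambda>s. chart_map d (\<phi> s p)) has_vector_derivative R (\<phi> t p) d) (at t)"
    using flow_velocity[of p t] d by (auto simp: has_velocity_def comp_def)
  ultimately show "?L (1, 0) = R (\<phi> t p) d" by (rule vector_derivative_unique_at)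
qed

text \<open>Cartan's formula in coordinates: pull the form back to b on time times a chart by (t, x)
  \<mapsto> \<phi>(t, x). Then b is 1 on the time field, and db of the time field and (0, v)
  vanishes since R is in the kernel of d\<alpha>; so b of (0, v) does not change with time.\<close>

lemma form_invariant:
  assumes v: "v \<in> tangent_space A p"
  shows "\<alpha> (\<phi> t p) (tangent_map A (\<phi> t) p v) = \<alpha> p v"
proof -
  obtain c where c: "c \<in> A" "p \<in> chart_dom c" by (rule chart_exists)
  define g where "g t = \<alpha> (\<phi> t p) (tangent_map A (\<phi> t) p v)" for t
  have "(g has_real_derivative 0) (at t)" for t
  proof -
    obtain d where d: "d \<in> A" "\<phi> t p \<in> chart_dom d" by (rule chart_exists)
    let ?G = "fmap c d" and ?U = "fdom c d" and ?z = "(t, chart_map c p)"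
    define b where "b w z = form_coord A \<alpha> d (fderiv ?G z w) (?G z)" for w z
    note U = fdom_open[OF c(1) d(1)]
    have z: "?z \<in> ?U" using fdom_iff[OF c] d by simp
    have GU: "?G ` ?U \<subseteq> chart_img d" by (auto simp: fmap_def fdom_def chart_map_in)
    note pb = form_pullback[OF fmap_Ck[OF c(1) d(1)] U z d(1) GU, folded b_def]
    have b1: "b (1, 0) y = 1" if y: "y \<in> ?U" for y
    proof -
      obtain s x where sx: "y = (s, x)" by (cases y)
      define q where "q = chart_inv c x"
      have q: "q \<in> chart_dom c" "\<phi> s q \<in> chart_dom d" "chart_map c q = x"
        using y by (auto simp: sx q_def fdom_def chart_inv_right)
      have "b (1, 0) y = form_coord A \<alpha> d (R (\<phi> s q) d) (chart_map d (\<phi> s q))"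
        using fmap_deriv(3)[OF c(1) q(1) d(1) q(2)] by (simp add: b_def sx q(3)) (simp add: fmap_def q_def)
      then show ?thesis using form_coord_eq[OF d(1) q(2) R_in] by (simp add: form_R)
    qed
    have b0: "b (0, v c) (s, chart_map c p) = g s" if "\<phi> s p \<in> chart_dom d" for s
    proof -
      have "b (0, v c) (s, chart_map c p) = form_coord A \<alpha> d (tangent_map A (\<phi> s) p v d) (chart_map d (\<phi> s p))"
        using fmap_deriv(2)[OF c d(1) that, of "v c"] c
        by (simp add: b_def tangent_map_loc[OF flow_dmap v c d(1) that]) (simp add: fmap_def chart_inv_left)
      then show ?thesis using form_coord_eq[OF d(1) that tangent_map_in[OF flow_dmap v]] by (simp add: g_def)
    qed
    have "dform b ?z (1, 0) (0, v c) = dform (form_coord A \<alpha> d) (chart_map d (\<phi> t p)) (R (\<phi> t p) d) (tangent_map A (\<phi> t) p v d)"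
      using pb(2)[of "(1, 0)" "(0, v c)"] fmap_deriv(2,3)[OF c d] c
      by (simp add: tangent_map_loc[OF flow_dmap v c d]) (simp add: fmap_def chart_inv_left)
    also have "\<dots> = ext_deriv A \<alpha> (\<phi> t p) (R (\<phi> t p)) (tangent_map A (\<phi> t) p v)"
      by (rule ext_deriv_chart[OF d R_in tangent_map_in[OF flow_dmap v], symmetric])
    also have "\<dots> = 0" by (rule ext_deriv_R[OF tangent_map_in[OF flow_dmap v]])
    finally have "dform b ?z (1, 0) (0, v c) = 0" .
    moreover have "(b (1, 0) has_derivative (\<lambda>_. 0)) (at ?z)"
      by (rule has_derivative_transform_within_open[OF has_derivative_const[of 1] U z]) (simp add: b1)
    ultimately have D: "fderiv (b (0, v c)) ?z (1, 0) = 0" by (simp add: dform_def fderiv_eq)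
    have "((\<lambda>s. (s, chart_map c p)) has_vector_derivative (1, 0)) (at t)"
      unfolding has_vector_derivative_def by (auto intro!: derivative_eq_intros)
    from vector_derivative_chain[OF this fderiv_works[OF pb(1)[of "(0, v c)"]]]
    have "((\<lambda>s. b (0, v c) (s, chart_map c p)) has_vector_derivative 0) (at t)" by (simp add: D)
    from has_vector_derivative_transform_within_open[OF this, of "{s. \<phi> s p \<in> chart_dom d}" g]
    have "(g has_vector_derivative 0) (at t)"
      using open_vimage[OF chart_open(1)[OF d(1)] flow_cont(2)] b0 d by (simp add: vimage_def)
    then show ?thesis by (simp add: has_real_derivative_iff_has_vector_derivative)
  qed
  then have "g t = g 0" by (intro DERIV_isconst_all) simp
  moreover have "\<phi> 0 = id" using flow_0 by auto
  ultimately show ?thesis using tangent_map_id[OF v] by (simp add: g_def)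
qed

lemma ext_deriv_invariant:
  assumes "u \<in> tangent_space A p" "v \<in> tangent_space A p"
  shows "ext_deriv A \<alpha> (\<phi> t p) (tangent_map A (\<phi> t) p u) (tangent_map A (\<phi> t) p v) = ext_deriv A \<alpha> p u v"
  using ext_deriv_pullback[OF flow_cont(1) flow_Ck, of t 1 u p v] form_invariant assms by simp

lemma contact_plane_nondegenerate:
  assumes "z \<in> contact_plane A \<alpha> p" "\<And>v. v \<in> contact_plane A \<alpha> p \<Longrightarrow> ext_deriv A \<alpha> p z v = 0"
  shows "z = tzero"
proof (rule ccontr)
  assume "z \<noteq> tzero"
  then have "ext_deriv A \<alpha> p z (J p z) > 0" "J p z \<in> contact_plane A \<alpha> p"
    using acs assms(1) unfolding compatible_acs_def by blast+
  then show False using assms(2) by force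
qed

lemma R_unique:
  assumes X: "X \<in> tangent_space A p" "\<alpha> p X = 1" "\<And>v. v \<in> tangent_space A p \<Longrightarrow> ext_deriv A \<alpha> p X v = 0"
  shows "X = R p"
proof -
  have "tcomb 1 X (-1) (R p) = tzero"
  proof (rule contact_plane_nondegenerate)
    show "tcomb 1 X (-1) (R p) \<in> contact_plane A \<alpha> p"
      using X R_in by (simp add: contact_plane_def tcomb_in form_tcomb form_R)
    show "ext_deriv A \<alpha> p (tcomb 1 X (-1) (R p)) v = 0" if "v \<in> contact_plane A \<alpha> p" for v
      using that X R_in by (simp add: contact_plane_def ext_deriv_tcomb ext_deriv_R)
  qed
  then show ?thesis by (simp add: tcomb_def tzero_def fun_eq_iff)
qed

text \<open>k times the image of R satisfies the equations that characterise R. The inverse map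
  provides a preimage for an arbitrary vector at the image point, so that d\<alpha> can be pulled
  back.\<close>

lemma tangent_map_R:
  assumes F: "dmap F" "dmap F'" "\<And>p. F' (F p) = p" "\<And>p. F (F' p) = p"
    and k: "k * k = 1"
    and a: "\<And>p v. v \<in> tangent_space A p \<Longrightarrow> \<alpha> (F p) (tangent_map A F p v) = k * \<alpha> p v"
    and da: "\<And>p u v. u \<in> tangent_space A p \<Longrightarrow> v \<in> tangent_space A p \<Longrightarrow>
      ext_deriv A \<alpha> (F p) (tangent_map A F p u) (tangent_map A F p v) = k * ext_deriv A \<alpha> p u v"
  shows "tangent_map A F p (R p) c = k *\<^sub>R R (F p) c"
proof -
  let ?T = "tangent_map A F p (R p)"
  note T = tangent_map_in[OF F(1) R_in]
  have "tcomb k ?T 0 ?T = R (F p)"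
  proof (rule R_unique)
    show "\<alpha> (F p) (tcomb k ?T 0 ?T) = 1" using k by (simp add: form_tcomb T a R_in form_R)
    fix v assume v: "v \<in> tangent_space A (F p)"
    define w where "w = tangent_map A F' (F p) v"
    have w: "w \<in> tangent_space A p" using tangent_map_in[OF F(2) v] F(3) by (simp add: w_def)
    have "F \<circ> F' = id" using F(4) by auto
    then have "v = tangent_map A F p w" using tangent_map_compose[OF F(1,2) v] tangent_map_id[OF v] F(3) by (simp add: w_def)
    then show "ext_deriv A \<alpha> (F p) (tcomb k ?T 0 ?T) v = 0"
      using da[OF R_in w] ext_deriv_R[OF w] T v by (simp add: ext_deriv_tcomb)
  qed (intro tcomb_in T)
  then have "k *\<^sub>R ?T c = R (F p) c" by (metis add.right_neutral scaleR_zero_left tcomb_def)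
  then have "k *\<^sub>R k *\<^sub>R ?T c = k *\<^sub>R R (F p) c" by simp
  then show ?thesis using k by simp
qed

lemma flow_inverse: "\<phi> t (\<phi> (- t) p) = p" "\<phi> (- t) (\<phi> t p) = p"
  using flow_add[of t "- t" p] flow_add[of "- t" t p] flow_0 by simp_all

lemma tangent_flow_R: "tangent_map A (\<phi> t) p (R p) c = R (\<phi> t p) c"
  using tangent_map_R[where k = 1 and F = "\<phi> t" and F' = "\<phi> (- t)", OF flow_dmap flow_dmap flow_inverse(2,1)] form_invariant ext_deriv_invariant by simp

text \<open>Moving \<open>\<gamma> t\<close> back by the flow for time \<epsilon> t gives a curve of
  zero velocity, because the flow preserves R. It yields uniqueness of integral curves for
  \<epsilon> = 1 and covers reversed ones for \<epsilon> = -1.\<close>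

lemma flow_curve:
  assumes cont: "continuous_on UNIV \<gamma>"
    and vel: "\<And>t c. c \<in> A \<Longrightarrow> \<gamma> t \<in> chart_dom c \<Longrightarrow> ((chart_map c \<circ> \<gamma>) has_vector_derivative \<epsilon> *\<^sub>R R (\<gamma> t) c) (at t)"
  shows "\<gamma> t = \<phi> (\<epsilon> * t) (\<gamma> 0)"
proof -
  define \<delta> where "\<delta> t = \<phi> (- (\<epsilon> * t)) (\<gamma> t)" for t
  have "\<delta> t = \<delta> 0" for t
  proof (rule constant_curve)
    have "continuous_on UNIV (\<lambda>t. (- (\<epsilon> * t), \<gamma> t))" by (intro continuous_intros cont)
    from continuous_on_compose2[OF flow_joint this] show "continuous_on UNIV \<delta>" by (simp add: \<delta>_def[abs_def])
    fix t d assume d: "d \<in> A" "\<delta> t \<in> chart_dom d"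
    obtain c where c: "c \<in> A" "\<gamma> t \<in> chart_dom c" by (rule chart_exists)
    have d': "\<phi> (- (\<epsilon> * t)) (\<gamma> t) \<in> chart_dom d" using d by (simp add: \<delta>_def)
    note L = fmap_deriv[OF c d(1) d']
    let ?L = "fderiv (fmap c d) (- (\<epsilon> * t), chart_map c (\<gamma> t))" and ?r = "\<epsilon> *\<^sub>R R (\<gamma> t) c"
    have "((\<lambda>s. (- (\<epsilon> * s), (chart_map c \<circ> \<gamma>) s)) has_vector_derivative (- \<epsilon>, ?r)) (at t)"
    proof -
      have "((\<lambda>s. - (\<epsilon> * s)) has_derivative (\<lambda>h. h *\<^sub>R - \<epsilon>)) (at t)" by (auto intro!: derivative_eq_intros)
      from has_derivative_Pair[OF this vel[OF c, unfolded has_vector_derivative_def]] show ?thesis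
        by (simp add: has_vector_derivative_def)
    qed
    from vector_derivative_chain[OF this, of "fmap c d" ?L] L(1)
    have "((\<lambda>s. fmap c d (- (\<epsilon> * s), chart_map c (\<gamma> s))) has_vector_derivative ?L (- \<epsilon>, ?r)) (at t)"
      by simp
    moreover have "?L (- \<epsilon>, ?r) = 0"
    proof -
      have lin: "linear ?L" using L(1) by (rule has_derivative_linear)
      have "(- \<epsilon>, ?r) = (- \<epsilon>) *\<^sub>R (1, 0) + \<epsilon> *\<^sub>R (0, R (\<gamma> t) c)" by simp
      then have "?L (- \<epsilon>, ?r) = (- \<epsilon>) *\<^sub>R ?L (1, 0) + \<epsilon> *\<^sub>R ?L (0, R (\<gamma> t) c)"
        by (simp only: linear_add[OF lin] linear_cmul[OF lin])
      also have "?L (0, R (\<gamma> t) c) = R (\<delta> t) d"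
        unfolding L(2) tangent_map_loc[OF flow_dmap R_in c d(1) d', symmetric] tangent_flow_R \<delta>_def ..
      finally show ?thesis unfolding L(3) \<delta>_def by simp
    qed
    ultimately have "((\<lambda>s. fmap c d (- (\<epsilon> * s), chart_map c (\<gamma> s))) has_vector_derivative 0) (at t)" by simp
    then show "((chart_map d \<circ> \<delta>) has_vector_derivative 0) (at t)"
      by (rule has_vector_derivative_transform_within_open[of _ _ _ "{s. \<gamma> s \<in> chart_dom c}"])
        (use open_vimage[OF chart_open(1)[OF c(1)] cont] c in \<open>auto simp: vimage_def fmap_def \<delta>_def chart_inv_left\<close>)
  qed
  then show ?thesis using flow_inverse(1)[of "\<epsilon> * t" "\<gamma> t"] by (simp add: \<delta>_def flow_0)
qed

end

section \<open>The linearized flow along a brake orbit\<close>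

locale brake_setting = reeb_flow A \<alpha> R \<phi> J
  for A :: "'y::t2_space chart set" and \<alpha> R \<phi> J +
  fixes N :: "'y \<Rightarrow> 'y" and \<beta> :: "real \<Rightarrow> 'y" and \<tau> :: real and e1 e2 :: "real \<Rightarrow> 'y tvec"
  assumes involution: "anticontact_involution A \<alpha> N" and brake: "brake_orbit A R N \<beta> \<tau>"
    and frame: "brake_trivialization A \<alpha> N J \<beta> \<tau> e1 e2"
    and nondegenerate: "\<And>\<gamma> T. periodic_orbit A R \<gamma> T \<Longrightarrow> nondegenerate_orbit A \<alpha> \<phi> \<gamma> T"
begin

lemma N_N: "N (N p) = p" and N_cont: "continuous_on UNIV N"
  and N_form: "v \<in> tangent_space A p \<Longrightarrow> \<alpha> (N p) (tangent_map A N p v) = - \<alpha> p v"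
  using involution by (auto simp: anticontact_involution_def smooth_self_map_def)

lemma N_Ck:
  assumes "c \<in> A" "d \<in> A"
  shows "Ck_on n {x \<in> chart_img c. N (chart_inv c x) \<in> chart_dom d} (chart_map d \<circ> N \<circ> chart_inv c)"
proof -
  have "Ck_on n (chart_map c ` (chart_dom c \<inter> N -` chart_dom d)) (chart_map d \<circ> N \<circ> chart_inv c)"
    using involution assms by (simp add: anticontact_involution_def smooth_self_map_def smooth_on_def)
  then show ?thesis by (simp only: chart_image_eq[OF assms(1)])
qed

lemma N_dmap: "dmap N"
  by (rule dmapI[OF N_cont N_Ck])

lemma tangent_N_R: "tangent_map A N p (R p) c = - R (N p) c"
  using tangent_map_R[where k = "-1" and F = N and F' = N, OF N_dmap N_dmap N_N N_N]
    N_form ext_deriv_pullback[where F = N and k = "-1", OF N_cont N_Ck] by simp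

lemma flow_chart_derivative:
  "d \<in> A \<Longrightarrow> \<phi> t p \<in> chart_dom d \<Longrightarrow> ((\<lambda>s. chart_map d (\<phi> s p)) has_vector_derivative R (\<phi> t p) d) (at t)"
  using flow_velocity[of p t] by (auto simp: has_velocity_def comp_def)

text \<open>As N reverses R, the image under N of a trajectory has velocity -R.\<close>

lemma N_flow: "N (\<phi> t p) = \<phi> (- t) (N p)"
proof -
  have cont: "continuous_on UNIV (\<lambda>t. N (\<phi> t p))"
    by (rule continuous_on_compose2[OF N_cont flow_cont(2)]) simp
  have "((chart_map c \<circ> (\<lambda>t. N (\<phi> t p))) has_vector_derivative (-1) *\<^sub>R R (N (\<phi> t p)) c) (at t)"
    if c: "c \<in> A" "N (\<phi> t p) \<in> chart_dom c" for t c
  proof -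
    obtain e where e: "e \<in> A" "\<phi> t p \<in> chart_dom e" by (rule chart_exists)
    have "((\<lambda>s. (chart_map c \<circ> N \<circ> chart_inv e) (chart_map e (\<phi> s p))) has_vector_derivative
        loc N e c (\<phi> t p) (R (\<phi> t p) e)) (at t)"
      by (rule vector_derivative_chain[OF flow_chart_derivative[OF e] loc_derivative[OF N_dmap e(1) c(1) e(2) c(2)]])
    then have "((\<lambda>s. (chart_map c \<circ> N \<circ> chart_inv e) (chart_map e (\<phi> s p))) has_vector_derivative
        (-1) *\<^sub>R R (N (\<phi> t p)) c) (at t)"
      using tangent_map_loc[OF N_dmap R_in e c] tangent_N_R by simp
    then show ?thesis
      by (rule has_vector_derivative_transform_within_open[of _ _ _ "{s. \<phi> s p \<in> chart_dom e}"])
        (use open_vimage[OF chart_open(1)[OF e(1)] flow_cont(2)] e in \<open>auto simp: vimage_def chart_inv_left\<close>)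
  qed
  from flow_curve[where \<epsilon> = "-1", OF cont this] show ?thesis by (simp add: flow_0)
qed

lemma \<beta>_velocity: "has_velocity A \<beta> (R (\<beta> t)) t" and \<beta>_period: "\<beta> (t + \<tau>) = \<beta> t"
  and \<beta>_reflect: "\<beta> (- t) = N (\<beta> t)" and \<tau>_positive: "\<tau> > 0"
  using brake by (auto simp: brake_orbit_def periodic_orbit_def)

lemma \<beta>_cont: "continuous_on UNIV \<beta>"
  using \<beta>_velocity by (simp add: has_velocity_def continuous_on_eq_continuous_at)

lemma \<beta>_flow: "\<phi> t (\<beta> 0) = \<beta> t"
proof -
  have "\<beta> t = \<phi> (1 * t) (\<beta> 0)"
    by (rule flow_curve[OF \<beta>_cont]) (use \<beta>_velocity in \<open>simp add: has_velocity_def\<close>)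
  from this[symmetric] show ?thesis by (simp only: mult_1_left)
qed

lemma frame_in: "e1 t \<in> contact_plane A \<alpha> (\<beta> t)" "e2 t \<in> contact_plane A \<alpha> (\<beta> t)"
  and frame_pairing: "ext_deriv A \<alpha> (\<beta> t) (e1 t) (e2 t) = 1"
  and frame_period: "e1 (t + \<tau>) = e1 t" "e2 (t + \<tau>) = e2 t"
  and frame_N: "tangent_map A N (\<beta> t) (e1 t) = tcomb (-1) (e1 (- t)) 0 (e2 (- t))"
    "tangent_map A N (\<beta> t) (e2 t) = e2 (- t)"
  and frame_cont: "c \<in> A \<Longrightarrow> continuous_on {t. \<beta> t \<in> chart_dom c} (\<lambda>t. e1 t c)"
    "c \<in> A \<Longrightarrow> continuous_on {t. \<beta> t \<in> chart_dom c} (\<lambda>t. e2 t c)"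
  using frame unfolding brake_trivialization_def by blast+

lemma plane_in: "v \<in> contact_plane A \<alpha> p \<Longrightarrow> v \<in> tangent_space A p"
  by (simp add: contact_plane_def)

lemmas frame_tangent = frame_in[THEN plane_in]

lemma ext_deriv_self: "ext_deriv A \<alpha> p u u = 0"
  using ext_deriv_swap[of p u u] by linarith

lemma ext_deriv_frame:
  "ext_deriv A \<alpha> (\<beta> t) (tcomb a (e1 t) b (e2 t)) (e2 t) = a"
  "ext_deriv A \<alpha> (\<beta> t) (e1 t) (tcomb a (e1 t) b (e2 t)) = b"
  using frame_tangent[of t] by (simp_all add: ext_deriv_tcomb ext_deriv_self frame_pairing)

lemma frame_unique: "tcomb a (e1 t) b (e2 t) = tcomb a' (e1 t) b' (e2 t) \<Longrightarrow> a = a' \<and> b = b'"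
  using ext_deriv_frame by metis

text \<open>In a chart, \<open>w \<mapsto> (\<alpha>(w), d\<alpha>(w, e2), d\<alpha>(e1, w))\<close> is onto, as seen on \<open>R, e1, e2\<close>, hence
  injective.\<close>

lemma frame_expansion:
  assumes v: "v \<in> contact_plane A \<alpha> (\<beta> t)"
  shows "v = tcomb (ext_deriv A \<alpha> (\<beta> t) v (e2 t)) (e1 t) (ext_deriv A \<alpha> (\<beta> t) (e1 t) v) (e2 t)"
proof -
  obtain c where c: "c \<in> A" "\<beta> t \<in> chart_dom c" by (rule chart_exists)
  define L :: "real^3 \<Rightarrow> real^3" where "L w = (let u = tvec_of A c (\<beta> t) w in
    vector [\<alpha> (\<beta> t) u, ext_deriv A \<alpha> (\<beta> t) u (e2 t), ext_deriv A \<alpha> (\<beta> t) (e1 t) u])" for w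
  note simps = form_tcomb ext_deriv_tcomb frame_tangent R_in tcomb_in tvec_of_in[OF c]
  have Lc: "L (a *\<^sub>R w + b *\<^sub>R z) = a *\<^sub>R L w + b *\<^sub>R L z" for a b w z
    by (simp add: L_def Let_def tvec_of_tcomb[OF c] simps vec_eq_iff forall_3)
  have lin: "linear L"
    using Lc[of 1 _ 1] Lc[of _ _ 0] by (intro linearI) simp_all
  have Lv: "L (u c) = vector [\<alpha> (\<beta> t) u, ext_deriv A \<alpha> (\<beta> t) u (e2 t), ext_deriv A \<alpha> (\<beta> t) (e1 t) u]"
    if "u \<in> tangent_space A (\<beta> t)" for u
    by (simp add: L_def Let_def tvec_of_chart[OF that c])
  have a: "\<alpha> (\<beta> t) (e1 t) = 0" "\<alpha> (\<beta> t) (e2 t) = 0" using frame_in[of t] by (simp_all add: contact_plane_def)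
  have R0: "ext_deriv A \<alpha> (\<beta> t) (R (\<beta> t)) u = 0" "ext_deriv A \<alpha> (\<beta> t) u (R (\<beta> t)) = 0"
    if "u \<in> tangent_space A (\<beta> t)" for u
    using ext_deriv_R[OF that] ext_deriv_swap[of "\<beta> t" u "R (\<beta> t)"] by simp_all
  have "surj L"
  proof (rule surjI)
    fix y :: "real^3"
    define u where "u = tcomb 1 (tcomb (y$1) (R (\<beta> t)) (y$2) (e1 t)) (y$3) (e2 t)"
    have "u \<in> tangent_space A (\<beta> t)" by (simp add: u_def simps)
    from Lv[OF this] show "L ((\<lambda>y. tcomb 1 (tcomb (y$1) (R (\<beta> t)) (y$2) (e1 t)) (y$3) (e2 t) c) y) = y"
      by (simp add: u_def simps a form_R R0 frame_pairing ext_deriv_self vec_eq_iff forall_3)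
  qed
  then have inj: "inj L" by (rule linear_surj_imp_inj[OF lin])
  let ?w = "tcomb (ext_deriv A \<alpha> (\<beta> t) v (e2 t)) (e1 t) (ext_deriv A \<alpha> (\<beta> t) (e1 t) v) (e2 t)"
  have w: "?w \<in> tangent_space A (\<beta> t)" by (simp add: simps)
  have "L (v c) = L (?w c)"
    using v Lv[OF w] Lv[OF plane_in[OF v]] by (simp add: simps a ext_deriv_frame contact_plane_def)
  then have "v c = ?w c" using inj by (simp add: inj_eq)
  then show ?thesis by (rule tangent_eqI[OF plane_in[OF v] w c])
qed

lemma flow_plane:
  assumes "v \<in> contact_plane A \<alpha> (\<beta> 0)"
  shows "tangent_map A (\<phi> t) (\<beta> 0) v \<in> contact_plane A \<alpha> (\<beta> t)"
  using assms tangent_map_in[OF flow_dmap, of v "\<beta> 0" t] form_invariant[of v "\<beta> 0" t] \<beta>_flow[of t]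
  by (simp add: contact_plane_def)

section \<open>The matrix of the linearized flow in the frame\<close>

abbreviation flow_e1 :: "real \<Rightarrow> 'y tvec" where "flow_e1 t \<equiv> tangent_map A (\<phi> t) (\<beta> 0) (e1 0)"
abbreviation flow_e2 :: "real \<Rightarrow> 'y tvec" where "flow_e2 t \<equiv> tangent_map A (\<phi> t) (\<beta> 0) (e2 0)"

abbreviation flow_matrix :: "real \<Rightarrow> real^2^2" where "flow_matrix \<equiv> linearized_flow A \<phi> \<beta> e1 e2"

lemma flow_e_in: "flow_e1 t \<in> contact_plane A \<alpha> (\<beta> t)" "flow_e2 t \<in> contact_plane A \<alpha> (\<beta> t)"
  by (intro flow_plane frame_in)+

text \<open>Pairing with the frame under d\<alpha> reads off the coefficients; besides resolving the
  \<open>THE\<close>, this form makes continuity in t accessible.\<close>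

lemma flow_matrix_eq: "flow_matrix t = mat2 (ext_deriv A \<alpha> (\<beta> t) (flow_e1 t) (e2 t)) (ext_deriv A \<alpha> (\<beta> t) (flow_e2 t) (e2 t))
    (ext_deriv A \<alpha> (\<beta> t) (e1 t) (flow_e1 t)) (ext_deriv A \<alpha> (\<beta> t) (e1 t) (flow_e2 t))"
  unfolding linearized_flow_def
proof (rule the_equality, goal_cases)
  case 1 show ?case unfolding mat2_nth by (intro conjI frame_expansion flow_e_in)
next
  case (2 M) then show ?case by (simp add: mat2_eq_iff ext_deriv_frame)
qed

lemma flow_matrix_columns: "flow_e1 t = tcomb (flow_matrix t$1$1) (e1 t) (flow_matrix t$2$1) (e2 t)" "flow_e2 t = tcomb (flow_matrix t$1$2) (e1 t) (flow_matrix t$2$2) (e2 t)"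
  unfolding flow_matrix_eq mat2_nth by (intro frame_expansion flow_e_in)+

lemma flow_matrix_unique:
  assumes "flow_e1 t = tcomb a (e1 t) b (e2 t)" "flow_e2 t = tcomb a' (e1 t) b' (e2 t)"
  shows "flow_matrix t = mat2 a a' b b'"
  by (simp add: flow_matrix_eq assms ext_deriv_frame)

lemma flow_matrix_apply:
  "tangent_map A (\<phi> t) (\<beta> 0) (tcomb x (e1 0) y (e2 0)) =
    tcomb (flow_matrix t$1$1 * x + flow_matrix t$1$2 * y) (e1 t) (flow_matrix t$2$1 * x + flow_matrix t$2$2 * y) (e2 t)"
  unfolding tangent_map_tcomb[OF flow_dmap frame_tangent] flow_matrix_columns
  by (simp add: tcomb_def fun_eq_iff algebra_simps)

lemma flow_matrix_at_0: "flow_matrix 0 = mat 1"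
proof -
  have "\<phi> 0 = id" using flow_0 by auto
  then have "flow_e1 0 = tcomb 1 (e1 0) 0 (e2 0)" "flow_e2 0 = tcomb 0 (e1 0) 1 (e2 0)"
    using tangent_map_id frame_tangent by (simp_all add: tcomb_def)
  from flow_matrix_unique[OF this] show ?thesis by (simp add: mat2_eq_iff)
qed

lemma flow_matrix_symplectic: "flow_matrix t \<in> Sp2"
proof -
  have "ext_deriv A \<alpha> (\<beta> t) (flow_e1 t) (flow_e2 t) = 1"
    using ext_deriv_invariant[OF frame_tangent[of 0], of t] \<beta>_flow[of t] frame_pairing[of 0] by simp
  then have "flow_matrix t$1$1 * flow_matrix t$2$2 - flow_matrix t$2$1 * flow_matrix t$1$2 = 1"
    using ext_deriv_swap[of "\<beta> t" "e2 t" "e1 t"] unfolding flow_matrix_columns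
    by (simp add: ext_deriv_tcomb tcomb_in frame_tangent ext_deriv_self frame_pairing algebra_simps)
  then show ?thesis by (simp add: Sp2_iff mult.commute)
qed

lemma flow_matrix_periodic: "flow_matrix (t + \<tau>) = flow_matrix t ** flow_matrix \<tau>"
proof -
  have \<beta>\<tau>: "\<phi> \<tau> (\<beta> 0) = \<beta> 0" using \<beta>_flow[of \<tau>] \<beta>_period[of 0] by simp
  have e: "e1 \<tau> = e1 0" "e2 \<tau> = e2 0" using frame_period[of 0] by simp_all
  have "\<phi> (t + \<tau>) = \<phi> t \<circ> \<phi> \<tau>" using flow_add by auto
  then have "tangent_map A (\<phi> (t + \<tau>)) (\<beta> 0) v = tangent_map A (\<phi> t) (\<beta> 0) (tangent_map A (\<phi> \<tau>) (\<beta> 0) v)"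
    if "v \<in> tangent_space A (\<beta> 0)" for v
    using tangent_map_compose[OF flow_dmap flow_dmap that, of t \<tau>] \<beta>\<tau> by simp
  then have "flow_e1 (t + \<tau>) = tangent_map A (\<phi> t) (\<beta> 0) (tcomb (flow_matrix \<tau>$1$1) (e1 0) (flow_matrix \<tau>$2$1) (e2 0))"
    "flow_e2 (t + \<tau>) = tangent_map A (\<phi> t) (\<beta> 0) (tcomb (flow_matrix \<tau>$1$2) (e1 0) (flow_matrix \<tau>$2$2) (e2 0))"
    using frame_tangent[of 0] flow_matrix_columns[of \<tau>] by (simp_all add: e)
  from flow_matrix_unique[OF this[unfolded flow_matrix_apply, folded frame_period[of t]]]
  show ?thesis by (simp add: mat2_eq_iff matrix_matrix_mult_def sum_2)
qed

text \<open>Differentiate N \<phi>(t) = \<phi>(-t) N at \<beta>(0), which N fixes, and expand both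
  sides in the frame at -t.\<close>

lemma flow_matrix_reflection: "flow_matrix (- t) = mat2 (flow_matrix t$1$1) (- flow_matrix t$1$2) (- flow_matrix t$2$1) (flow_matrix t$2$2)"
proof -
  have N\<beta>: "N (\<beta> 0) = \<beta> 0" using \<beta>_reflect[of 0] by simp
  have "N \<circ> \<phi> t = \<phi> (- t) \<circ> N" using N_flow by auto
  then have *: "tangent_map A (\<phi> (- t)) (\<beta> 0) (tangent_map A N (\<beta> 0) v) = tangent_map A N (\<beta> t) (tangent_map A (\<phi> t) (\<beta> 0) v)"
    if "v \<in> tangent_space A (\<beta> 0)" for v
    using tangent_map_compose[OF N_dmap flow_dmap that, of t] tangent_map_compose[OF flow_dmap N_dmap that, of "- t"] N\<beta> \<beta>_flow[of t]
    by simp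
  have Nf: "tangent_map A N (\<beta> t) (tcomb a (e1 t) b (e2 t)) = tcomb (- a) (e1 (- t)) b (e2 (- t))" for a b
    unfolding tangent_map_tcomb[OF N_dmap frame_tangent] frame_N by (simp add: tcomb_def)
  have "flow_e2 (- t) = tcomb (- flow_matrix t$1$2) (e1 (- t)) (flow_matrix t$2$2) (e2 (- t))"
    using *[OF frame_tangent(2)] frame_N(2)[of 0] by (simp add: flow_matrix_columns(2)[of t] Nf)
  moreover have "tangent_map A (\<phi> (- t)) (\<beta> 0) (tcomb (-1) (e1 0) 0 (e2 0)) = tcomb (- flow_matrix t$1$1) (e1 (- t)) (flow_matrix t$2$1) (e2 (- t))"
    using *[OF frame_tangent(1)] frame_N(1)[of 0] by (simp add: flow_matrix_columns(1)[of t] Nf)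
  then have "flow_matrix (- t)$1$1 = flow_matrix t$1$1 \<and> flow_matrix (- t)$2$1 = - flow_matrix t$2$1"
    unfolding flow_matrix_apply using frame_unique by fastforce
  ultimately show ?thesis
    using frame_unique[of "flow_matrix (- t)$1$2" "- t" "flow_matrix (- t)$2$2"] flow_matrix_columns(2)[of "- t"] by (simp add: mat2_eq_iff)
qed

lemma flow_matrix_nondegenerate:
  assumes k: "k \<ge> 1" and v: "flow_matrix (real k * \<tau>) *v v = v"
  shows "v = 0"
proof -
  have per: "\<beta> (t + real k * \<tau>) = \<beta> t \<and> e1 (t + real k * \<tau>) = e1 t \<and> e2 (t + real k * \<tau>) = e2 t" for t k
  proof (induction k)
    case (Suc k)
    have "t + real (Suc k) * \<tau> = (t + real k * \<tau>) + \<tau>" by (simp add: algebra_simps)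
    then show ?case using Suc by (simp only: \<beta>_period frame_period)
  qed simp
  have "periodic_orbit A R \<beta> (real k * \<tau>)"
    using k \<tau>_positive \<beta>_velocity per by (simp add: periodic_orbit_def)
  from nondegenerate[OF this] have nd: "u \<in> contact_plane A \<alpha> (\<beta> 0) \<Longrightarrow> tangent_map A (\<phi> (real k * \<tau>)) (\<beta> 0) u = u \<Longrightarrow> u = tzero" for u
    by (simp add: nondegenerate_orbit_def)
  define u where "u = tcomb (v$1) (e1 0) (v$2) (e2 0)"
  have "u = tzero"
  proof (rule nd)
    show "u \<in> contact_plane A \<alpha> (\<beta> 0)"
      using frame_in[of 0] by (simp add: u_def contact_plane_def tcomb_in form_tcomb)
    show "tangent_map A (\<phi> (real k * \<tau>)) (\<beta> 0) u = u"
      using v per[of 0 k] unfolding u_def flow_matrix_apply by (simp add: vec2_eq_iff)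
  qed
  then have "tcomb (v$1) (e1 0) (v$2) (e2 0) = tcomb 0 (e1 0) 0 (e2 0)" by (simp add: u_def tcomb_def tzero_def)
  from frame_unique[OF this] show ?thesis by (simp add: vec2_eq_iff)
qed

text \<open>Base point and both arguments vary together; expanding in a basis leaves finitely many
  coefficients that depend on the base point alone.\<close>

lemma dform_continuous:
  assumes c: "c \<in> A" and x: "continuous_on S x" "\<And>s. s \<in> S \<Longrightarrow> x s \<in> chart_img c"
    and u: "continuous_on S u" and v: "continuous_on S v"
  shows "continuous_on S (\<lambda>s. dform (form_coord A \<alpha> c) (x s) (u s) (v s))"
proof -
  have lin: "linear (\<lambda>w. fderiv (form_coord A \<alpha> c w) y z)" if "y \<in> chart_img c" for y z
    using form_coord_deriv_combination[OF c that, of 1 _ 1] form_coord_deriv_combination[OF c that, of _ _ 0]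
    by (intro linearI) simp_all
  have exp: "fderiv (form_coord A \<alpha> c w) y z = (\<Sum>j\<in>Basis. \<Sum>i\<in>Basis. (z \<bullet> j) * ((w \<bullet> i) * fderiv (form_coord A \<alpha> c i) y j))"
    if y: "y \<in> chart_img c" for w y z
  proof -
    have "fderiv (form_coord A \<alpha> c w) y z = fderiv (form_coord A \<alpha> c (\<Sum>i\<in>Basis. (w \<bullet> i) *\<^sub>R i)) y (\<Sum>j\<in>Basis. (z \<bullet> j) *\<^sub>R j)"
      by (simp add: euclidean_representation)
    then show ?thesis
      by (simp add: linear_sum[OF lin[OF y]] linear_cmul[OF lin[OF y]] linear_sum[OF fderiv_linear[OF form_coord_differentiable[OF c y]]]
          linear_cmul[OF fderiv_linear[OF form_coord_differentiable[OF c y]]] sum_distrib_left)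
  qed
  have "continuous_on S (\<lambda>s. \<Sum>j\<in>Basis. \<Sum>i\<in>Basis. (z s \<bullet> j) * ((w s \<bullet> i) * fderiv (form_coord A \<alpha> c i) (x s) j))"
    if "continuous_on S w" "continuous_on S z" for w z
    by (intro continuous_on_sum continuous_on_mult continuous_on_inner continuous_on_const that
        continuous_on_compose2[OF form_coord_deriv_cont[OF c] x(1)]) (use x(2) in auto)
  then have "continuous_on S (\<lambda>s. fderiv (form_coord A \<alpha> c (w s)) (x s) (z s))"
    if "continuous_on S w" "continuous_on S z" for w z
    using that x(2) by (subst continuous_on_cong[OF refl exp]) auto
  from continuous_on_diff[OF this[OF v u] this[OF u v]] show ?thesis unfolding dform_def .
qed

lemma pairing_continuous:
  assumes uv: "\<And>t. u t \<in> tangent_space A (\<beta> t)" "\<And>t. v t \<in> tangent_space A (\<beta> t)"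
    and cont: "\<And>c. c \<in> A \<Longrightarrow> continuous_on {t. \<beta> t \<in> chart_dom c} (\<lambda>t. u t c)"
      "\<And>c. c \<in> A \<Longrightarrow> continuous_on {t. \<beta> t \<in> chart_dom c} (\<lambda>t. v t c)"
  shows "continuous_on UNIV (\<lambda>t. ext_deriv A \<alpha> (\<beta> t) (u t) (v t))"
proof -
  have "isCont (\<lambda>t. ext_deriv A \<alpha> (\<beta> t) (u t) (v t)) t" for t
  proof -
    obtain c where c: "c \<in> A" "\<beta> t \<in> chart_dom c" by (rule chart_exists)
    let ?S = "{t. \<beta> t \<in> chart_dom c}"
    have S: "open ?S" using open_vimage[OF chart_open(1)[OF c(1)] \<beta>_cont] by (simp add: vimage_def)
    have "continuous_on (chart_dom c) (chart_map c)"
      using chart_homeo[OF c(1)] by (simp add: homeomorphism_def)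
    then have x: "continuous_on ?S (\<lambda>t. chart_map c (\<beta> t))"
      by (rule continuous_on_compose2[OF _ continuous_on_subset[OF \<beta>_cont subset_UNIV]]) auto
    have "continuous_on ?S (\<lambda>t. dform (form_coord A \<alpha> c) (chart_map c (\<beta> t)) (u t c) (v t c))"
      by (rule dform_continuous[OF c(1) x _ cont[OF c(1)]]) (simp add: chart_map_in)
    then have "continuous_on ?S (\<lambda>t. ext_deriv A \<alpha> (\<beta> t) (u t) (v t))"
      by (subst continuous_on_cong[OF refl]) (auto simp: ext_deriv_chart[OF c(1)] uv)
    then show ?thesis using S c by (simp add: continuous_on_eq_continuous_at)
  qed
  then show ?thesis by (simp add: continuous_on_eq_continuous_at)
qed

lemma flow_vector_continuous:
  assumes v: "v \<in> tangent_space A (\<beta> 0)" and d: "d \<in> A"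
  shows "continuous_on {t. \<beta> t \<in> chart_dom d} (\<lambda>t. tangent_map A (\<phi> t) (\<beta> 0) v d)"
proof -
  obtain c where c: "c \<in> A" "\<beta> 0 \<in> chart_dom c" by (rule chart_exists)
  have "Ck_on (Suc 0) (fdom c d) (fmap c d)" by (rule fmap_Ck[OF c(1) d])
  then have "continuous_on (fdom c d) (\<lambda>z. fderiv (fmap c d) z (0, v c))" by simp
  then have "continuous_on {t. \<beta> t \<in> chart_dom d} (\<lambda>t. fderiv (fmap c d) (t, chart_map c (\<beta> 0)) (0, v c))"
    by (rule continuous_on_compose2)
      (simp_all add: continuous_on_Pair continuous_on_const continuous_on_id image_subset_iff fdom_iff[OF c] \<beta>_flow)
  then show ?thesis
    by (subst continuous_on_cong[OF refl]) (use \<beta>_flow in \<open>auto simp: tangent_map_loc[OF flow_dmap v c d] fmap_deriv(2)[OF c d]\<close>)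
qed

lemma flow_matrix_continuous: "continuous_on UNIV flow_matrix"
proof -
  have "continuous_on UNIV (\<lambda>t. mat2 (ext_deriv A \<alpha> (\<beta> t) (flow_e1 t) (e2 t)) (ext_deriv A \<alpha> (\<beta> t) (flow_e2 t) (e2 t))
    (ext_deriv A \<alpha> (\<beta> t) (e1 t) (flow_e1 t)) (ext_deriv A \<alpha> (\<beta> t) (e1 t) (flow_e2 t)))"
    by (intro continuous_on_mat2 pairing_continuous flow_e_in[THEN plane_in] frame_tangent frame_cont
        flow_vector_continuous)
  then show ?thesis by (simp only: flow_matrix_eq[symmetric])
qed

lemma flow_matrix_brake_path: "brake_path flow_matrix \<tau>"
  by unfold_locales (fact \<tau>_positive flow_matrix_continuous flow_matrix_symplectic flow_matrix_at_0 flow_matrix_periodic flow_matrix_reflection flow_matrix_nondegenerate)+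

end

theorem theorem1p1:
  fixes A :: "'y::t2_space chart set"
    and \<alpha> :: "'y one_form"
    and R :: "'y \<Rightarrow> 'y tvec"
    and \<phi> :: "real \<Rightarrow> 'y \<Rightarrow> 'y"
    and N :: "'y \<Rightarrow> 'y"
    and J :: "'y \<Rightarrow> 'y tvec \<Rightarrow> 'y tvec"
    and \<beta> :: "real \<Rightarrow> 'y"
    and \<tau> :: real
    and e1 e2 :: "real \<Rightarrow> 'y tvec"
    and \<Psi> :: "real \<Rightarrow> real^2^2"
    and \<mu>CZ \<mu>1 \<mu>2 :: "nat \<Rightarrow> real"
  assumes "closed_3_manifold A"
    and "contact_form A \<alpha>"
    and "reeb_field A \<alpha> R"
    and "flow_of A R \<phi>"
    and "anticontact_involution A \<alpha> N"
    and "compatible_acs A \<alpha> R J"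
    and "anticommutes_with_involution A \<alpha> N J"
    and "\<And>\<gamma> T. periodic_orbit A R \<gamma> T \<Longrightarrow> nondegenerate_orbit A \<alpha> \<phi> \<gamma> T"
    and "brake_orbit A R N \<beta> \<tau>"
    and "brake_trivialization A \<alpha> N J \<beta> \<tau> e1 e2"
    and "\<Psi> = linearized_flow A \<phi> \<beta> e1 e2"
    and "\<mu>CZ = (\<lambda>k. mu_CZ \<Psi> (real k * \<tau>))"
    and "\<mu>1 = (\<lambda>k. mu_1 \<Psi> (real k * \<tau>))"
    and "\<mu>2 = (\<lambda>k. mu_2 \<Psi> (real k * \<tau>))"
  shows "(\<exists>!i::nat. i < 5 \<and>
            [elliptic (\<Psi> \<tau>),
             negative_hyperbolic (\<Psi> \<tau>) \<and> type_one \<Psi> \<tau>,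
             negative_hyperbolic (\<Psi> \<tau>) \<and> type_two \<Psi> \<tau>,
             positive_hyperbolic (\<Psi> \<tau>) \<and> type_one \<Psi> \<tau>,
             positive_hyperbolic (\<Psi> \<tau>) \<and> type_two \<Psi> \<tau>] ! i) \<and>
    (elliptic (\<Psi> \<tau>) \<longrightarrow>
       (\<exists>\<theta>. \<theta> \<notin> \<rat> \<and> rotation_number \<Psi> \<tau> \<theta> \<and>
          (\<exists>P\<in>Sp2. \<Psi> \<tau> = P ** rot (2 * pi * \<theta>) ** matrix_inv P) \<and>
          (\<forall>k\<ge>1. \<mu>1 k = of_int \<lfloor>real k * \<theta>\<rfloor> + 1 / 2 \<and>
                  \<mu>CZ k = 2 * of_int \<lfloor>real k * \<theta>\<rfloor> + 1))) \<and>
    (negative_hyperbolic (\<Psi> \<tau>) \<and> type_one \<Psi> \<tau> \<longrightarrow>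
       \<mu>1 2 - \<mu>2 2 = 1 \<and> \<mu>CZ 1 = 2 * \<mu>1 1 \<and>
       (\<forall>k\<ge>1. \<mu>1 k = (if odd k then real k * \<mu>1 1 else real k * \<mu>1 1 + 1 / 2) \<and>
               \<mu>CZ k = real k * \<mu>CZ 1 \<and> \<mu>CZ k = 2 * real k * \<mu>1 1)) \<and>
    (negative_hyperbolic (\<Psi> \<tau>) \<and> type_two \<Psi> \<tau> \<longrightarrow>
       \<mu>1 2 - \<mu>2 2 = -1 \<and> \<mu>CZ 1 = 2 * \<mu>1 1 \<and>
       (\<forall>k\<ge>1. \<mu>1 k = (if odd k then real k * \<mu>1 1 else real k * \<mu>1 1 - 1 / 2) \<and>
               \<mu>CZ k = real k * \<mu>CZ 1 \<and> \<mu>CZ k = 2 * real k * \<mu>1 1)) \<and>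
    (positive_hyperbolic (\<Psi> \<tau>) \<and> type_one \<Psi> \<tau> \<longrightarrow>
       \<mu>1 2 - \<mu>2 2 = 1 \<and> \<mu>CZ 1 = 2 * \<mu>1 1 - 1 \<and>
       (\<forall>k\<ge>1. \<mu>1 k = real k * \<mu>1 1 + (1 - real k) / 2 \<and>
               \<mu>CZ k = real k * \<mu>CZ 1 \<and> \<mu>CZ k = 2 * real k * \<mu>1 1 - real k)) \<and>
    (positive_hyperbolic (\<Psi> \<tau>) \<and> type_two \<Psi> \<tau> \<longrightarrow>
       \<mu>1 2 - \<mu>2 2 = -1 \<and> \<mu>CZ 1 = 2 * \<mu>1 1 + 1 \<and>
       (\<forall>k\<ge>1. \<mu>1 k = real k * \<mu>1 1 + (real k - 1) / 2 \<and>
               \<mu>CZ k = real k * \<mu>CZ 1 \<and> \<mu>CZ k = 2 * real k * \<mu>1 1 + real k))"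
proof -
  interpret S: brake_setting A \<alpha> R \<phi> J N \<beta> \<tau> e1 e2
    by unfold_locales (use assms(1-10) in \<open>simp_all add: closed_3_manifold_def contact_form_def\<close>)
  interpret P: brake_path "linearized_flow A \<phi> \<beta> e1 e2" \<tau>
    by (rule S.flow_matrix_brake_path)
  show ?thesis
    unfolding assms(11-14) by (rule P.brake_path_indices[unfolded P.\<mu>CZ_def P.\<mu>1_def P.\<mu>2_def])
qed

end
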